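(* Let $G$ be a proper termination graph for a logic program $\mathcal{P}$ (possibly with cuts) whose root is the abstract state $(p(T_1,\ldots,T_m); (\{T_{i_1},\ldots,T_{i_k}\},\varnothing))$. If the cut-free program $\mathcal{P}_G$ terminates for all queries in $\mathcal{Q}_G$, then all concretizations of $G$'s root state have only finite state-derivations. In other words, then all queries from the set $\{ p(t_1,\ldots,t_m) \mid t_{i_1},\ldots,t_{i_k} \text{ are ground}\}$ terminate w.r.t. $\mathcal{P}$.
   Context: A logic program $\mathcal{P}$ is a finite sequence of clauses $c_1,\ldots$, possibly containing the cut "!". Its operational semantics is given by inference rules (Suc, Fail, Cut, Case, Eval, Backtrack) on concrete states, which are sequences of goals, goals labeled by the clause to be applied next and a mark $m$, and scope markers $?_m$; a "state-derivation" is a sequence of applications of these rules. A query terminates w.r.t. $\mathcal{P}$ (universal termination) if every state-derivation from it is finite. Variables are split into ordinary variables $\mathcal{N}$ and abstract variables $\mathcal{A}$ (each standing for a fixed but arbitrary term). An abstract state $(S; (\mathcal{G},\mathcal{U}))$ consists of a state $S$ over $\mathcal{N}\cup\mathcal{A}$ and a knowledge base with $\mathcal{G}\subseteq\mathcal{A}$ (variables to be instantiated only by ground terms) and $\mathcal{U}$ a set of pairs $(s,s')$ that must not become unifiable. A concretization is a substitution $\gamma$ with domain $\mathcal{A}$ and range over $\mathcal{N}$, mapping variables of $\mathcal{G}$ to ground terms and with $s\gamma$, $s'\gamma$ non-unifiable for all $(s,s')\in\mathcal{U}$; the concretizations of an abstract state are the concrete states $S\gamma$. A termination graph is a finite graph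 built from an initial abstract state using the abstract inference rules Suc, Fail, Cut, Case, Backtrack, Eval, Instance, Parallel and Split, such that there is no cycle consisting only of Instance edges and all leaves are of the form $(\varepsilon; \mathit{KB}')$ (empty state) or $(X,Q \mid S; \mathit{KB}')$ with $X$ a variable. It is "proper" if there are no leaves of the latter form. $\mathcal{P}_G$ is the cut-free logic program consisting of one clause $\mathit{Clause}(\pi) = \mathit{Ren}(n_1)\sigma_{\pi,\infty} \leftarrow I_\pi, \mathit{Ren}(n_k)$ for every clause path $\pi = n_1\ldots n_k$ of $G$ (paths starting at the root, at the child of an Instance node, or at the left child of a Split node, and ending at a Suc node, an Instance node, or the left child of an Instance or Split node, without passing through Instance nodes or such left children in between). Here $\mathit{Ren}(n)$ is $p_n(\mathcal{V}(n))$ with a fresh predicate symbol $p_n$ for node $n$ (for Suc nodes it is the empty goal; for Instance nodes it is the renaming of the successor instantiated by the Instance substitution), $\sigma_{\pi,\infty}$ collects the substitutions along the path from Eval and Split edges (discarding substitutions of earlier backtracking alternatives of the same case analysis, identified via marks), and $I_\pi$ are the renamed left children of Split nodes on $\pi$. $\mathcal{Q}_G = \{ p_n(t_1,\ldots,t_m) \mid t_{i_1},\ldots,t_{i_k} \text{ are ground}\}$, where $p_n$ is the new predicate symbol for the root node $n$.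
   Formalization: Added: the root is not an Instance node (otherwise its new predicate has no clauses in the cut-free program and the claim can fail), and no Instance edge leads to a Suc node (otherwise a clause head would be the empty goal). *)

theory Defs
  imports Main "HOL-Library.Extended_Nat"
begin

section \<open>Terms, substitutions, unification\<close>

datatype var = NVar nat | AVar nat

definition ordinary :: "var set" where
  "ordinary = range NVar"

definition abstract :: "var set" where
  "abstract = range AVar"

text \<open>As in Prolog, predicate and function symbols are not distinguished, and a symbol is
  identified by its name together with the number of its arguments.\<close>

datatype 'f trm = Var var | Fun 'f "'f trm list"

type_synonym 'f subst = "var \<Rightarrow> 'f trm"

primrec subst_trm :: "'f subst \<Rightarrow> 'f trm \<Rightarrow> 'f trm" where
  "subst_trm \<sigma> (Var x) = \<sigma> x"
| "subst_trm \<sigma> (Fun f ts) = Fun f (map (subst_trm \<sigma>) ts)"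

text \<open>Variables are listed from left to right, because they become the argument lists of the
  new predicates of the cut-free program.\<close>

primrec var_list :: "'f trm \<Rightarrow> var list" where
  "var_list (Var x) = [x]"
| "var_list (Fun f ts) = concat (map var_list ts)"

definition vars_trm :: "'f trm \<Rightarrow> var set" where
  "vars_trm t = set (var_list t)"

definition ground :: "'f trm \<Rightarrow> bool" where
  "ground t \<longleftrightarrow> vars_trm t = {}"

definition subst_dom :: "'f subst \<Rightarrow> var set" where
  "subst_dom \<sigma> = {x. \<sigma> x \<noteq> Var x}"

definition subst_range :: "'f subst \<Rightarrow> 'f trm set" where
  "subst_range \<sigma> = \<sigma> ` subst_dom \<sigma>"

definition range_vars :: "'f subst \<Rightarrow> var set" where
  "range_vars \<sigma> = (\<Union>t\<in>subst_range \<sigma>. vars_trm t)"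

definition restrict_subst :: "'f subst \<Rightarrow> var set \<Rightarrow> 'f subst" where
  "restrict_subst \<sigma> X = (\<lambda>x. if x \<in> X then \<sigma> x else Var x)"

text \<open>First \<open>\<sigma>\<close>, then \<open>\<tau>\<close>.\<close>

definition subst_comp :: "'f subst \<Rightarrow> 'f subst \<Rightarrow> 'f subst" where
  "subst_comp \<sigma> \<tau> = (\<lambda>x. subst_trm \<tau> (\<sigma> x))"

definition unifiable :: "'f trm \<Rightarrow> 'f trm \<Rightarrow> bool" where
  "unifiable s t \<longleftrightarrow> (\<exists>\<sigma>. subst_trm \<sigma> s = subst_trm \<sigma> t)"

text \<open>A most general unifier is most general on all variables, not only on those of the two
  terms: in the evaluation rules it is also applied to the rest of the goal.\<close>

definition is_mgu :: "'f subst \<Rightarrow> 'f trm \<Rightarrow> 'f trm \<Rightarrow> bool" where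
  "is_mgu \<sigma> s t \<longleftrightarrow> subst_trm \<sigma> s = subst_trm \<sigma> t \<and>
     (\<forall>\<gamma>. subst_trm \<gamma> s = subst_trm \<gamma> t \<longrightarrow> (\<exists>\<delta>. \<gamma> = subst_comp \<sigma> \<delta>))"


section \<open>Programs and states\<close>

text \<open>Cuts are unlabelled in clause bodies (\<open>'c = unit\<close>) and carry their mark in the goals of a
  state (\<open>'c = nat\<close>). A body or goal element \<open>Atom (Var x)\<close> is a meta-call.\<close>

datatype ('c, 'f) lit = Cut 'c | Atom "'f trm"

datatype 'f clause = Clause (head: "'f trm") (body: "(unit, 'f) lit list")

type_synonym 'f goal = "(nat, 'f) lit list"

text \<open>\<open>Labeled Q c m\<close> is the goal \<open>Q\<close> to which clause \<open>c\<close> is to be applied next, and \<open>Scope m\<close>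
  is the scope marker \<open>?\<close> with mark \<open>m\<close>.\<close>

datatype 'f sgoal = Goal "'f goal" | Labeled "'f goal" "'f clause" nat | Scope nat

type_synonym 'f state = "'f sgoal list"

primrec subst_lit :: "'f subst \<Rightarrow> ('c, 'f) lit \<Rightarrow> ('c, 'f) lit" where
  "subst_lit \<sigma> (Cut m) = Cut m"
| "subst_lit \<sigma> (Atom t) = Atom (subst_trm \<sigma> t)"

definition subst_goal :: "'f subst \<Rightarrow> ('c, 'f) lit list \<Rightarrow> ('c, 'f) lit list" where
  "subst_goal \<sigma> Q = map (subst_lit \<sigma>) Q"

definition subst_clause :: "'f subst \<Rightarrow> 'f clause \<Rightarrow> 'f clause" where
  "subst_clause \<sigma> c = Clause (subst_trm \<sigma> (head c)) (subst_goal \<sigma> (body c))"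

primrec subst_sgoal :: "'f subst \<Rightarrow> 'f sgoal \<Rightarrow> 'f sgoal" where
  "subst_sgoal \<sigma> (Goal Q) = Goal (subst_goal \<sigma> Q)"
| "subst_sgoal \<sigma> (Labeled Q c m) = Labeled (subst_goal \<sigma> Q) c m"
| "subst_sgoal \<sigma> (Scope m) = Scope m"

definition subst_state :: "'f subst \<Rightarrow> 'f state \<Rightarrow> 'f state" where
  "subst_state \<sigma> S = map (subst_sgoal \<sigma>) S"

primrec lit_var_list :: "('c, 'f) lit \<Rightarrow> var list" where
  "lit_var_list (Cut m) = []"
| "lit_var_list (Atom t) = var_list t"

definition goal_var_list :: "('c, 'f) lit list \<Rightarrow> var list" where
  "goal_var_list Q = concat (map lit_var_list Q)"

primrec sgoal_var_list :: "'f sgoal \<Rightarrow> var list" where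
  "sgoal_var_list (Goal Q) = goal_var_list Q"
| "sgoal_var_list (Labeled Q c m) = goal_var_list Q"
| "sgoal_var_list (Scope m) = []"

definition state_var_list :: "'f state \<Rightarrow> var list" where
  "state_var_list S = remdups (concat (map sgoal_var_list S))"

definition vars_state :: "'f state \<Rightarrow> var set" where
  "vars_state S = set (state_var_list S)"

definition vars_clause :: "'f clause \<Rightarrow> var set" where
  "vars_clause c = vars_trm (head c) \<union> set (goal_var_list (body c))"

definition marks_goal :: "'f goal \<Rightarrow> nat set" where
  "marks_goal Q = {m. Cut m \<in> set Q}"

primrec marks_sgoal :: "'f sgoal \<Rightarrow> nat set" where
  "marks_sgoal (Goal Q) = marks_goal Q"
| "marks_sgoal (Labeled Q c m) = insert m (marks_goal Q)"
| "marks_sgoal (Scope m) = {m}"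

definition marks_state :: "'f state \<Rightarrow> nat set" where
  "marks_state S = (\<Union>g\<in>set S. marks_sgoal g)"

definition label_cuts :: "nat \<Rightarrow> (unit, 'f) lit list \<Rightarrow> 'f goal" where
  "label_cuts m B = map (map_lit (\<lambda>_. m) id) B"

definition slice :: "'f clause list \<Rightarrow> 'f \<Rightarrow> nat \<Rightarrow> 'f clause list" where
  "slice P p n = filter (\<lambda>c. \<exists>ts. head c = Fun p ts \<and> length ts = n) P"

definition case_goals :: "'f clause list \<Rightarrow> 'f \<Rightarrow> 'f trm list \<Rightarrow> 'f goal \<Rightarrow> nat \<Rightarrow> 'f state" where
  "case_goals P p ts Q m =
     map (\<lambda>c. Labeled (Atom (Fun p ts) # Q) c m) (slice P p (length ts)) @ [Scope m]"


section \<open>Concrete operational semantics\<close>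

text \<open>Clauses are renamed apart from the state before unification.\<close>

definition renamed_apart :: "'f clause \<Rightarrow> 'f state \<Rightarrow> 'f clause \<Rightarrow> bool" where
  "renamed_apart c S c' \<longleftrightarrow> (\<exists>\<rho>. inj_on \<rho> (vars_clause c) \<and>
     \<rho> ` vars_clause c \<subseteq> ordinary - vars_state S \<and> c' = subst_clause (Var \<circ> \<rho>) c)"

inductive step :: "'f clause list \<Rightarrow> 'f state \<Rightarrow> 'f state \<Rightarrow> bool" for P where
  Suc_step: "step P (Goal [] # S) S"
| Fail_step: "step P (Scope m # S) S"
| Cut_scope_step:
    "Scope m \<notin> set S \<Longrightarrow>
     step P (Goal (Cut m # Q) # S @ Scope m # S') (Goal Q # Scope m # S')"
| Cut_all_step:
    "Scope m \<notin> set S \<Longrightarrow> step P (Goal (Cut m # Q) # S) [Goal Q]"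
| Case_step:
    "m \<notin> marks_state (Goal (Atom (Fun p ts) # Q) # S) \<Longrightarrow>
     step P (Goal (Atom (Fun p ts) # Q) # S) (case_goals P p ts Q m @ S)"
| Eval_step:
    "\<lbrakk> renamed_apart c (Labeled (Atom t # Q) c m # S) c'; is_mgu \<sigma> t (head c');
       \<forall>x\<in>ordinary. vars_trm (\<sigma> x) \<subseteq> ordinary \<rbrakk> \<Longrightarrow>
     step P (Labeled (Atom t # Q) c m # S)
            (Goal (subst_goal \<sigma> (label_cuts m (body c') @ Q)) # S)"
| Backtrack_step:
    "\<lbrakk> renamed_apart c (Labeled (Atom t # Q) c m # S) c'; \<not> unifiable t (head c') \<rbrakk> \<Longrightarrow>
     step P (Labeled (Atom t # Q) c m # S) S"

definition terminates :: "'f clause list \<Rightarrow> 'f state \<Rightarrow> bool" where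
  "terminates P S \<longleftrightarrow> \<not> (\<exists>f. f 0 = S \<and> (\<forall>i::nat. step P (f i) (f (Suc i))))"

definition query_terminates :: "'f clause list \<Rightarrow> 'f trm \<Rightarrow> bool" where
  "query_terminates P t \<longleftrightarrow> terminates P [Goal [Atom t]]"

text \<open>States carry no answer substitutions. The answer instances \<open>us\<close> of the arguments of a query
  \<open>p(ts)\<close> are observed by appending an atom with the same arguments and a symbol
  (\<open>None\<close>) that does not occur in the program: this atom becomes the first one exactly
  when \<open>p(ts)\<close> has been solved, and it has then been instantiated by the answer substitution.\<close>

definition is_answer :: "'f clause list \<Rightarrow> 'f \<Rightarrow> 'f trm list \<Rightarrow> 'f trm list \<Rightarrow> bool" where
  "is_answer P p ts us \<longleftrightarrow> (\<exists>S.
     (step (map (map_clause Some) P))\<^sup>*\<^sup>*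
       [Goal [Atom (map_trm Some (Fun p ts)), Atom (Fun None (map (map_trm Some) ts))]]
       (Goal [Atom (Fun None (map (map_trm Some) us))] # S))"

text \<open>\<open>gnd p n I = J\<close> means: if the argument positions \<open>I\<close> of a query with predicate \<open>p\<close> of
  arity \<open>n\<close> are ground, then every answer substitution makes the positions \<open>J\<close> ground. Positions
  are counted from 0.\<close>

type_synonym 'f groundness = "'f \<Rightarrow> nat \<Rightarrow> nat set \<Rightarrow> nat set"

definition groundness_analysis :: "'f clause list \<Rightarrow> 'f groundness \<Rightarrow> bool" where
  "groundness_analysis P gnd \<longleftrightarrow> (\<forall>p ts us I.
     (\<forall>t\<in>set ts. vars_trm t \<subseteq> ordinary) \<and> (\<forall>i\<in>I. i < length ts \<and> ground (ts ! i)) \<and>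
     is_answer P p ts us \<longrightarrow> (\<forall>j\<in>gnd p (length ts) I. j < length us \<longrightarrow> ground (us ! j)))"


section \<open>Abstract states\<close>

type_synonym 'f kb = "var set \<times> ('f trm \<times> 'f trm) set"
type_synonym 'f astate = "'f state \<times> 'f kb"

definition subst_pairs :: "'f subst \<Rightarrow> ('f trm \<times> 'f trm) set \<Rightarrow> ('f trm \<times> 'f trm) set" where
  "subst_pairs \<sigma> U = (\<lambda>(s, s'). (subst_trm \<sigma> s, subst_trm \<sigma> s')) ` U"

fun vars_astate :: "'f astate \<Rightarrow> var set" where
  "vars_astate (S, (\<G>, U)) = vars_state S \<union> \<G> \<union> (\<Union>(s, s')\<in>U. vars_trm s \<union> vars_trm s')"

fun concretization :: "'f subst \<Rightarrow> 'f astate \<Rightarrow> bool" where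
  "concretization \<gamma> (S, (\<G>, U)) \<longleftrightarrow>
     subst_dom \<gamma> = abstract \<and> range_vars \<gamma> \<subseteq> ordinary \<and>
     range_vars (restrict_subst \<gamma> \<G>) = {} \<and>
     (\<forall>(s, s')\<in>U. \<not> unifiable (subst_trm \<gamma> s) (subst_trm \<gamma> s'))"

definition concretizations :: "'f astate \<Rightarrow> 'f state set" where
  "concretizations s = {subst_state \<gamma> (fst s) | \<gamma>. concretization \<gamma> s}"


section \<open>Abstract inference rules\<close>

text \<open>The rule applied to a node of a termination graph, with the substitution belonging to it.
  \<open>Open\<close> marks the nodes that have not been expanded, i.e. the leaves.\<close>

datatype 'f rule =
    Open | R_Suc | R_Fail | R_Cut | R_Case | R_Backtrack | R_Eval "'f subst"
  | R_Instance "'f subst" | R_Parallel | R_Split "'f subst"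

definition active_cuts :: "'f state \<Rightarrow> nat set" where
  "active_cuts S =
     {m. (\<exists>Q. Goal Q \<in> set S \<and> Cut m \<in> set Q) \<or>
         (\<exists>Q c d. Labeled Q c d \<in> set S \<and> (Cut m \<in> set Q \<or> d = m \<and> Cut () \<in> set (body c)))}"

definition active_marks :: "'f state \<Rightarrow> nat set" where
  "active_marks S = {m. \<exists>S1 S2. S = S1 @ Scope m # S2 \<and> S1 \<noteq> [] \<and> S2 \<noteq> []}"

fun approx_gnd :: "'f groundness \<Rightarrow> var set \<Rightarrow> (nat, 'f) lit \<Rightarrow> 'f subst \<Rightarrow> var set" where
  "approx_gnd gnd \<G> (Atom (Fun p ts)) \<mu> =
     abstract \<inter> (\<Union>j\<in>gnd p (length ts) {i. i < length ts \<and> vars_trm (ts ! i) \<subseteq> \<G>} \<inter> {..<length ts}.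
       vars_trm (subst_trm \<mu> (ts ! j)))"
| "approx_gnd gnd \<G> _ \<mu> = {}"

text \<open>\<open>expand P gnd W M s r ss\<close>: rule \<open>r\<close> (other than \<open>Instance\<close>) takes \<open>s\<close> to the list \<open>ss\<close> of its
  successors, where \<open>W\<close> and \<open>M\<close> are the variables and the marks used so far, on which freshness
  depends. The substitutions of \<open>R_Eval\<close> and \<open>R_Split\<close> have to act on all of \<open>W\<close> (except, for
  \<open>R_Split\<close>, on ground variables), since variables with different names may share variables in
  their concretizations and since these substitutions are composed along paths.\<close>

inductive expand :: "'f clause list \<Rightarrow> 'f groundness \<Rightarrow> var set \<Rightarrow> nat set \<Rightarrow>
    'f astate \<Rightarrow> 'f rule \<Rightarrow> 'f astate list \<Rightarrow> bool" for P gnd W M where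
  Suc_rule: "expand P gnd W M (Goal [] # S, KB) R_Suc [(S, KB)]"
| Fail_rule: "expand P gnd W M (Scope m # S, KB) R_Fail [(S, KB)]"
| Cut_scope_rule:
    "Scope m \<notin> set S \<Longrightarrow>
     expand P gnd W M (Goal (Cut m # Q) # S @ Scope m # S', KB) R_Cut
       [(Goal Q # Scope m # S', KB)]"
| Cut_all_rule:
    "Scope m \<notin> set S \<Longrightarrow> expand P gnd W M (Goal (Cut m # Q) # S, KB) R_Cut [([Goal Q], KB)]"
| Case_rule:
    "\<forall>k\<in>M. k < m \<Longrightarrow>
     expand P gnd W M (Goal (Atom (Fun p ts) # Q) # S, KB) R_Case
       [(case_goals P p ts Q m @ S, KB)]"
| Backtrack_rule:
    "\<not> (\<exists>\<gamma>. concretization \<gamma> (Labeled (Atom t # Q) c m # S, KB) \<and>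
             unifiable (subst_trm \<gamma> t) (head c)) \<Longrightarrow>
     expand P gnd W M (Labeled (Atom t # Q) c m # S, KB) R_Backtrack [(S, KB)]"
| Eval_rule:
    "\<lbrakk> is_mgu \<sigma> t (head c);
       \<forall>x\<in>W \<union> vars_clause c. vars_trm (\<sigma> x) \<subseteq> abstract - W;
       \<tau> = restrict_subst \<sigma> \<G> \<rbrakk> \<Longrightarrow>
     expand P gnd W M (Labeled (Atom t # Q) c m # S, (\<G>, U)) (R_Eval \<sigma>)
       [(Goal (subst_goal \<sigma> (label_cuts m (body c) @ Q)) # subst_state \<tau> S,
          (abstract \<inter> range_vars \<tau>, subst_pairs \<tau> U)),
        (S, (\<G>, insert (t, head c) U))]"
| Parallel_rule:
    "active_cuts S \<inter> active_marks S' = {} \<Longrightarrow>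
     expand P gnd W M (S @ S', KB) R_Parallel [(S, KB), (S', KB)]"
| Split_rule:
    "\<lbrakk> \<forall>x\<in>\<G>. \<mu> x = Var x; \<forall>x\<in>W - \<G>. \<exists>y\<in>abstract - W. \<mu> x = Var y; inj_on \<mu> W \<rbrakk> \<Longrightarrow>
     expand P gnd W M ([Goal (l # Q)], (\<G>, U)) (R_Split \<mu>)
       [([Goal [l]], (\<G>, U)),
        ([Goal (subst_goal \<mu> Q)], (\<G> \<union> approx_gnd gnd \<G> l \<mu>, subst_pairs \<mu> U))]"

fun instance_of :: "'f subst \<Rightarrow> 'f astate \<Rightarrow> 'f astate \<Rightarrow> bool" where
  "instance_of \<mu> (S, (\<G>, U)) (S', (\<G>', U')) \<longleftrightarrow>
     S = subst_state \<mu> S' \<and>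
     (\<forall>x\<in>ordinary. \<exists>y\<in>ordinary. \<mu> x = Var y) \<and> inj_on \<mu> ordinary \<and>
     \<G>' \<subseteq> abstract \<and> (\<forall>x\<in>\<G>'. vars_trm (\<mu> x) \<subseteq> \<G>) \<and> subst_pairs \<mu> U' \<subseteq> U"


section \<open>Termination graphs\<close>

text \<open>The nodes of a graph are the indices of the list, with 0 as the root; an entry consists of
  the abstract state of the node, the rule applied to it, and its successors in order.\<close>

type_synonym 'f graph = "('f astate \<times> 'f rule \<times> nat list) list"

definition astate_of :: "'f graph \<Rightarrow> nat \<Rightarrow> 'f astate" where
  "astate_of G n = fst (G ! n)"

definition rule_of :: "'f graph \<Rightarrow> nat \<Rightarrow> 'f rule" where
  "rule_of G n = fst (snd (G ! n))"

definition succs :: "'f graph \<Rightarrow> nat \<Rightarrow> nat list" where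
  "succs G n = snd (snd (G ! n))"

fun rule_vars :: "'f rule \<Rightarrow> var set" where
  "rule_vars (R_Eval \<sigma>) = subst_dom \<sigma> \<union> range_vars \<sigma>"
| "rule_vars (R_Split \<mu>) = subst_dom \<mu> \<union> range_vars \<mu>"
| "rule_vars _ = {}"

definition used_vars :: "'f graph \<Rightarrow> var set" where
  "used_vars G = (\<Union>n<length G. vars_astate (astate_of G n) \<union> rule_vars (rule_of G n))"

definition used_marks :: "'f graph \<Rightarrow> nat set" where
  "used_marks G = (\<Union>n<length G. marks_state (fst (astate_of G n)))"

inductive built :: "'f clause list \<Rightarrow> 'f groundness \<Rightarrow> 'f graph \<Rightarrow> bool" for P gnd where
  root: "built P gnd [(s, Open, [])]"
| expansion:
    "\<lbrakk> built P gnd G; n < length G; G ! n = (s, Open, []);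
       expand P gnd (used_vars G) (used_marks G) s r ss \<rbrakk> \<Longrightarrow>
     built P gnd (G[n := (s, r, [length G..<length G + length ss])] @
                  map (\<lambda>s'. (s', Open, [])) ss)"
| instance_old:
    "\<lbrakk> built P gnd G; n < length G; G ! n = (s, Open, []); n' < length G;
       instance_of \<mu> s (astate_of G n') \<rbrakk> \<Longrightarrow>
     built P gnd (G[n := (s, R_Instance \<mu>, [n'])])"
| instance_new:
    "\<lbrakk> built P gnd G; n < length G; G ! n = (s, Open, []); instance_of \<mu> s s' \<rbrakk> \<Longrightarrow>
     built P gnd (G[n := (s, R_Instance \<mu>, [length G])] @ [(s', Open, [])])"

definition suc_nodes :: "'f graph \<Rightarrow> nat set" where
  "suc_nodes G = {n. n < length G \<and> rule_of G n = R_Suc}"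

definition instance_nodes :: "'f graph \<Rightarrow> nat set" where
  "instance_nodes G = {n. n < length G \<and> (\<exists>\<mu>. rule_of G n = R_Instance \<mu>)}"

definition split_nodes :: "'f graph \<Rightarrow> nat set" where
  "split_nodes G = {n. n < length G \<and> (\<exists>\<mu>. rule_of G n = R_Split \<mu>)}"

definition leaf_nodes :: "'f graph \<Rightarrow> nat set" where
  "leaf_nodes G = {n. n < length G \<and> succs G n = []}"

fun variable_first :: "'f state \<Rightarrow> bool" where
  "variable_first (Goal (Atom (Var x) # Q) # S) = True"
| "variable_first _ = False"

definition termination_graph :: "'f clause list \<Rightarrow> 'f groundness \<Rightarrow> 'f graph \<Rightarrow> bool" where
  "termination_graph P gnd G \<longleftrightarrow>
     built P gnd G \<and>
     acyclic {(n, n'). n \<in> instance_nodes G \<and> n' \<in> set (succs G n)} \<and>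
     (\<forall>n\<in>leaf_nodes G. fst (astate_of G n) = [] \<or> variable_first (fst (astate_of G n)))"

definition proper :: "'f graph \<Rightarrow> bool" where
  "proper G \<longleftrightarrow> (\<forall>n\<in>leaf_nodes G. \<not> variable_first (fst (astate_of G n)))"


section \<open>The cut-free program of a termination graph\<close>

datatype 'f gsym = Orig 'f | Pred nat

definition emb_subst :: "'f subst \<Rightarrow> 'f gsym subst" where
  "emb_subst \<sigma> = map_trm Orig \<circ> \<sigma>"

text \<open>The renaming of a node, as a list of at most one atom. The recursion through \<open>Instance\<close>
  nodes ends because there are no cycles of \<open>Instance\<close> edges, so it is single-valued and total.\<close>

inductive is_ren :: "'f graph \<Rightarrow> nat \<Rightarrow> 'f gsym trm list \<Rightarrow> bool" for G where
  "n \<in> suc_nodes G \<Longrightarrow> is_ren G n []"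
| "\<lbrakk> n < length G; rule_of G n = R_Instance \<mu>; is_ren G (succs G n ! 0) ts \<rbrakk> \<Longrightarrow>
     is_ren G n (map (subst_trm (emb_subst \<mu>)) ts)"
| "\<lbrakk> n < length G; n \<notin> suc_nodes G; n \<notin> instance_nodes G \<rbrakk> \<Longrightarrow>
     is_ren G n [Fun (Pred n) (map Var (state_var_list (fst (astate_of G n))))]"

definition Ren :: "'f graph \<Rightarrow> nat \<Rightarrow> 'f gsym trm list" where
  "Ren G n = (THE ts. is_ren G n ts)"

text \<open>Start nodes other than the root: successors of \<open>Instance\<close> nodes and left successors of
  \<open>Split\<close> nodes.\<close>

definition first_succs :: "'f graph \<Rightarrow> nat set" where
  "first_succs G = (\<lambda>n. succs G n ! 0) ` (instance_nodes G \<union> split_nodes G)"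

definition clause_path :: "'f graph \<Rightarrow> nat list \<Rightarrow> bool" where
  "clause_path G \<pi> \<longleftrightarrow>
     1 < length \<pi> \<and>
     (\<forall>n\<in>set \<pi>. n < length G) \<and>
     (\<forall>j. Suc j < length \<pi> \<longrightarrow> \<pi> ! Suc j \<in> set (succs G (\<pi> ! j))) \<and>
     (hd \<pi> = 0 \<or> hd \<pi> \<in> first_succs G) \<and>
     last \<pi> \<in> suc_nodes G \<union> instance_nodes G \<union> first_succs G \<and>
     (\<forall>j. Suc j < length \<pi> \<longrightarrow> \<pi> ! j \<notin> instance_nodes G) \<and>
     (\<forall>j. 0 < j \<and> Suc j < length \<pi> \<longrightarrow> \<pi> ! j \<notin> first_succs G)"

text \<open>The mark of the first goal of an \<open>Eval\<close> node.\<close>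

definition node_mark :: "'f graph \<Rightarrow> nat \<Rightarrow> nat" where
  "node_mark G n = (THE m. \<exists>Q c. hd (fst (astate_of G n)) = Labeled Q c m)"

text \<open>The argument path is reversed, i.e. it is traversed from its end. An \<open>Eval\<close> step whose mark
  is not below the mark of the \<open>Eval\<close> step considered last belongs to an alternative that has been
  left by backtracking, and contributes only its effect on the ground variables.\<close>

fun rev_path_subst :: "'f graph \<Rightarrow> enat \<Rightarrow> nat list \<Rightarrow> 'f subst" where
  "rev_path_subst G m (n' # n # ns) =
     (case rule_of G n of
        R_Eval \<sigma> \<Rightarrow>
          if n' = succs G n ! 0 then
            if enat (node_mark G n) < m
            then subst_comp (rev_path_subst G (enat (node_mark G n)) (n # ns)) \<sigma>
            else subst_comp (rev_path_subst G m (n # ns))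
                   (restrict_subst \<sigma> (fst (snd (astate_of G n))))
          else rev_path_subst G m (n # ns)
      | R_Split \<mu> \<Rightarrow>
          if n' = succs G n ! 1 then subst_comp (rev_path_subst G m (n # ns)) \<mu>
          else rev_path_subst G m (n # ns)
      | _ \<Rightarrow> rev_path_subst G m (n # ns))"
| "rev_path_subst G m _ = Var"

definition path_subst :: "'f graph \<Rightarrow> nat list \<Rightarrow> 'f gsym subst" where
  "path_subst G \<pi> = emb_subst (rev_path_subst G \<infinity> (rev \<pi>))"

fun intermediate_goals :: "'f graph \<Rightarrow> nat list \<Rightarrow> 'f gsym trm list" where
  "intermediate_goals G (n # n' # ns) =
     (if n \<in> split_nodes G \<and> n' = succs G n ! 1
      then map (subst_trm (path_subst G (n # n' # ns))) (Ren G (succs G n ! 0)) else [])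
     @ intermediate_goals G (n' # ns)"
| "intermediate_goals G _ = []"

definition path_clause :: "'f graph \<Rightarrow> nat list \<Rightarrow> 'f gsym clause" where
  "path_clause G \<pi> = Clause (subst_trm (path_subst G \<pi>) (hd (Ren G (hd \<pi>))))
     (map Atom (intermediate_goals G \<pi> @ Ren G (last \<pi>)))"

definition P_G :: "'f graph \<Rightarrow> 'f gsym clause set" where
  "P_G G = {path_clause G \<pi> | \<pi>. clause_path G \<pi>}"

text \<open>The cut-free program is well defined if the heads of its clauses are atoms, and the query
  set refers to a predicate of the program only if the renaming of the root is an atom for its own
  new predicate. So \<open>Instance\<close> edges may not lead to \<open>Suc\<close> nodes, whose renaming is empty,
  and the root may not be an \<open>Instance\<close> node, whose renaming uses the predicate of another node.\<close>

definition renaming_well_defined :: "'f graph \<Rightarrow> bool" where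
  "renaming_well_defined G \<longleftrightarrow>
     0 \<notin> instance_nodes G \<and> (\<forall>n\<in>instance_nodes G. succs G n ! 0 \<notin> suc_nodes G)"

text \<open>The queries \<open>p\<^sub>0(t\<^sub>1,\<dots>,t\<^sub>m)\<close> for the root 0, where the arguments at the positions \<open>I\<close>
  (counted from 0) are ground.\<close>

definition ground_args :: "nat \<Rightarrow> nat set \<Rightarrow> 'f trm list set" where
  "ground_args m I = {ts. length ts = m \<and> (\<forall>t\<in>set ts. vars_trm t \<subseteq> ordinary) \<and>
     (\<forall>i\<in>I. ground (ts ! i))}"

definition Q_G :: "nat \<Rightarrow> nat set \<Rightarrow> 'f gsym trm set" where
  "Q_G m I = {Fun (Pred 0) (map (map_trm Orig) ts) | ts. ts \<in> ground_args m I}"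

end

theory Submission
 imports Defs
begin

text \<open>Suppose that a concretization of the root has an infinite computation and follow it through the
  graph with valuations of the abstract variables. Of a state only one goal matters: what stands
  before it is exhausted by the computation, what stands behind it is never reached. Along a clause
  path the substitutions of the edges factor through the valuations, so the traversed path yields an
  instance of its clause whose head is the renamed node at the start. A computation that is infinite
  at a \<open>Split\<close> node is infinite for the left child, where the path ends, or the left child has an
  answer after which the right child has an infinite computation. A computation with an answer is
  followed in the same way, and shows that the body atoms contributed by \<open>Split\<close> nodes are derivable
  in \<open>P_G\<close>. Both claims are proved together by induction on the calls of \<open>P_G\<close>, whose accessibility is
  what termination of \<open>P_G\<close> provides; an infinite computation would lead to infinitely many calls.

  The concrete valuation may be more special than the one on the path, since substitutions of
  earlier alternatives are discarded. Undetermined values are therefore represented by hazards,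
  reserved variables that make an atom fail, as if they were terms that no clause head matches.
  Interpreting them by such terms also keeps the pairs of the knowledge base non-unifiable.\<close>

text \<open>With cuts, failure is not inherited by instances: instantiating a goal may block an atom
  that stands before a cut, and alternatives that were pruned become reachable. An infinite
  computation can be followed with the values it has itself, but an atom contributed by a
  \<open>Split\<close> node has to be derived at the values of an answer, while the alternatives
  before the answering clause are known to be exhausted only for the more general goal being called.
  At the answer values the graph may still force the path into the body of such an alternative.
  There all fresh non-ground variables become hazards, and atoms that mention one are skipped.
  Exhaustion survives this, because hazards never enter clause bodies and so no local cut stands
  behind a skipped atom. A second difficulty is that renaming apart, fresh marks and mgu's make each
  step a choice. Resolution is therefore phrased without renaming and states are compared up to
  variants, so that any step of a non-terminating state is as good as any other.\<close>

abbreviation subst_app :: "'f trm => 'f subst => 'f trm" (infixl "$" 67) where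
 "t $ \<sigma> \<equiv> subst_trm \<sigma> t"

abbreviation subst_goal_app :: "('c, 'f) lit list => 'f subst => ('c, 'f) lit list" (infixl "$g" 67) where
 "Q $g \<sigma> \<equiv> subst_goal \<sigma> Q"

abbreviation subst_sgoal_app :: "'f sgoal => 'f subst => 'f sgoal" (infixl "$h" 67) where
 "g $h \<sigma> \<equiv> subst_sgoal \<sigma> g"

abbreviation subst_state_app :: "'f state => 'f subst => 'f state" (infixl "$s" 67) where
 "S $s \<sigma> \<equiv> subst_state \<sigma> S"

section \<open>Substitutions on terms\<close>

lemma vars_trm_Var [simp]: "vars_trm (Var x) = {x}"
 and vars_trm_Fun [simp]: "vars_trm (Fun f ts) = (UN t:set ts. vars_trm t)" by (auto simp: vars_trm_def)

lemma finite_vars_trm [simp]: "finite (vars_trm t)" by (simp add: vars_trm_def)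

lemma subst_trm_Var [simp]: "t $ Var = t" by (induction t) (auto simp: map_idI)

lemma subst_trm_cong: "(!!x. x : vars_trm t ==> \<sigma> x = \<tau> x) ==> t $ \<sigma> = t $ \<tau>" by (induction t) auto

lemma subst_trm_eqD: "t $ \<sigma> = t $ \<tau> ==> x : vars_trm t ==> \<sigma> x = \<tau> x" by (induction t) auto

lemma subst_trm_eq_iff: "t $ \<sigma> = t $ \<tau> \<longleftrightarrow> (ALL x:vars_trm t. \<sigma> x = \<tau> x)"
 using subst_trm_cong subst_trm_eqD by metis

lemma subst_trm_subst: "t $ \<sigma> $ \<tau> = t $ (%x. \<sigma> x $ \<tau>)" by (induction t) auto

lemma vars_trm_subst: "vars_trm (t $ \<sigma>) = (UN x:vars_trm t. vars_trm (\<sigma> x))" by (induction t) auto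

lemma subst_trm_ident: "(!!x. x : vars_trm t ==> \<sigma> x = Var x) ==> t $ \<sigma> = t" using subst_trm_cong[of t \<sigma> Var] by simp

lemma vars_trm_map_trm [simp]: "vars_trm (map_trm e t) = vars_trm t" by (induction t) auto

lemma map_trm_subst: "map_trm e (t $ \<sigma>) = map_trm e t $ (%x. map_trm e (\<sigma> x))" by (induction t) auto

lemma map_trm_inv: "inj e ==> map_trm (inv e) (map_trm e t) = t" by (simp add: trm.map_comp trm.map_id0 trm.map_ident comp_def inv_f_f)

section \<open>Unification of lists of equations\<close>

primrec trm_size :: "'f trm => nat" where
 "trm_size (Var x) = 1"
| "trm_size (Fun f ts) = Suc (sum_list (map trm_size ts))"

lemma trm_size_pos [simp]: "0 < trm_size t" by (cases t) auto

lemma trm_size_arg: "t : set ts ==> trm_size t < trm_size (Fun f ts)" by (simp add: member_le_sum_list less_Suc_eq_le)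

lemma trm_size_var_le: "x : vars_trm t ==> trm_size (\<sigma> x) <= trm_size (t $ \<sigma>)"
proof (induction t)
 case (Fun f ts)
 then obtain t where t: "t : set ts" "x : vars_trm t" by auto
 hence "trm_size (\<sigma> x) <= trm_size (t $ \<sigma>)" using Fun by auto
 also have "\<dots> < trm_size (Fun f ts $ \<sigma>)" using t(1) trm_size_arg[of "t $ \<sigma>" "map (%t. t $ \<sigma>) ts" f] by auto
 finally show ?case by simp
qed auto

text \<open>A proper occurrence of \<open>x\<close> would make the instance of \<open>t\<close>
  strictly larger than that of \<open>x\<close>.\<close>

lemma occurs_check: "x : vars_trm t ==> \<sigma> x = t $ \<sigma> ==> t = Var x"
proof (cases t)
 case (Fun f ts)
 assume a: "x : vars_trm t" "\<sigma> x = t $ \<sigma>"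
 obtain u where u: "u : set ts" "x : vars_trm u" using a Fun by auto
 have "trm_size (\<sigma> x) <= trm_size (u $ \<sigma>)" using u trm_size_var_le by blast
 also have "\<dots> < trm_size (t $ \<sigma>)" using u Fun trm_size_arg[of "u $ \<sigma>" "map (%t. t $ \<sigma>) ts" f] by auto
 finally show ?thesis using a by simp
qed auto

definition eqs_vars :: "('f trm \<times> 'f trm) list => var set" where
 "eqs_vars E = (UN (s, t):set E. vars_trm s Un vars_trm t)"

definition eqs_size :: "('f trm \<times> 'f trm) list => nat" where
 "eqs_size E = sum_list (map (%(s, t). trm_size s + trm_size t) E)"

definition unifies :: "'f subst => ('f trm \<times> 'f trm) list => bool" where
 "unifies \<sigma> E \<longleftrightarrow> (ALL (s, t):set E. s $ \<sigma> = t $ \<sigma>)"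

definition emb_eqs :: "('f => 'g) => ('f trm \<times> 'f trm) list => ('g trm \<times> 'g trm) list" where
 "emb_eqs e E = map (%(s, t). (map_trm e s, map_trm e t)) E"

lemma eqs_vars_simps [simp]: "eqs_vars [] = {}"
 "eqs_vars ((s, t) # E) = vars_trm s Un vars_trm t Un eqs_vars E" by (auto simp: eqs_vars_def)

lemma eqs_size_simps [simp]: "eqs_size [] = 0"
 "eqs_size ((s, t) # E) = trm_size s + trm_size t + eqs_size E"
 "eqs_size (E @ E') = eqs_size E + eqs_size E'" by (auto simp: eqs_size_def)

lemma unifies_simps [simp]: "unifies \<sigma> []"
 "unifies \<sigma> ((s, t) # E) \<longleftrightarrow> s $ \<sigma> = t $ \<sigma> & unifies \<sigma> E"
 "unifies \<sigma> (E @ E') \<longleftrightarrow> unifies \<sigma> E & unifies \<sigma> E'" by (auto simp: unifies_def)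

lemma emb_eqs_simps [simp]: "emb_eqs e [] = []"
 "emb_eqs e ((s, t) # E) = (map_trm e s, map_trm e t) # emb_eqs e E"
 "emb_eqs e (E @ E') = emb_eqs e E @ emb_eqs e E'" by (auto simp: emb_eqs_def)

lemma finite_eqs_vars [simp]: "finite (eqs_vars E)" by (auto simp: eqs_vars_def)

lemma eqs_size_zip: "length ss = length ts ==>
  eqs_size (zip ss ts) = sum_list (map trm_size ss) + sum_list (map trm_size ts)" by (induction ss ts rule: list_induct2) auto

lemma eqs_vars_zip: "length ss = length ts ==>
  eqs_vars (zip ss ts) = (UN t:set ss Un set ts. vars_trm t)" by (induction ss ts rule: list_induct2) auto

lemma eqs_vars_append [simp]: "eqs_vars (E @ E') = eqs_vars E Un eqs_vars E'" by (auto simp: eqs_vars_def)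

lemma unifies_zip: "length ss = length ts ==>
  unifies \<sigma> (zip ss ts) \<longleftrightarrow> map (%t. t $ \<sigma>) ss = map (%t. t $ \<sigma>) ts"
 by (induction ss ts rule: list_induct2) auto

lemma emb_eqs_zip: "length ss = length ts ==>
  emb_eqs e (zip ss ts) = zip (map (map_trm e) ss) (map (map_trm e) ts)" by (induction ss ts rule: list_induct2) auto

definition elim_var :: "var => 'f trm => ('f trm \<times> 'f trm) list => ('f trm \<times> 'f trm) list" where
 "elim_var x t E = map (%(u, v). (u $ Var(x := t), v $ Var(x := t))) E"

lemma subst_upd_absorb: "\<gamma> x = t $ \<gamma> ==> u $ Var(x := t) $ \<gamma> = u $ \<gamma>"
 by (auto simp: subst_trm_subst intro: subst_trm_cong)

lemma unifies_elim_var: "\<gamma> x = t $ \<gamma> ==> unifies \<gamma> (elim_var x t E) \<longleftrightarrow> unifies \<gamma> E"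
 by (auto simp: unifies_def elim_var_def subst_upd_absorb split_beta)

lemma emb_elim_var: "emb_eqs e (elim_var x t E) = elim_var x (map_trm e t) (emb_eqs e E)"
 by (auto simp: emb_eqs_def elim_var_def map_trm_subst split_beta intro!: subst_trm_cong)

lemma vars_elim_var: "eqs_vars (elim_var x t E) <= (eqs_vars E - {x}) Un vars_trm t"
 by (force simp: eqs_vars_def elim_var_def vars_trm_subst split: if_splits)

lemma unifies_elim_var_compose:
 "unifies \<sigma> (elim_var x t E) ==> unifies (%y. (Var(x := t)) y $ \<sigma>) E"
 by (auto simp: unifies_def elim_var_def subst_trm_subst split_beta)

text \<open>The solution is most general also for the image of the equations under an embedding of the
  symbols into a larger set of symbols.\<close>

definition solved_by :: "('f => 'g) => ('f trm \<times> 'f trm) list => 'f subst => bool" where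
 "solved_by e E \<sigma> \<longleftrightarrow> unifies \<sigma> E &
   (ALL \<gamma>. unifies \<gamma> (emb_eqs e E) --> (ALL x. map_trm e (\<sigma> x) $ \<gamma> = \<gamma> x)) &
   (ALL x. x ~: eqs_vars E --> \<sigma> x = Var x) &
   (ALL x:eqs_vars E. vars_trm (\<sigma> x) <= eqs_vars E)"

text \<open>The solution binds \<open>x\<close> first and then applies \<sigma>, which leaves
  \<open>x\<close> alone because \<open>x\<close> has been eliminated.\<close>

lemma solved_by_elim:
 assumes "solved_by e (elim_var x t E) \<sigma>" "x ~: vars_trm t"
 shows "solved_by e ((Var x, t) # E) (%y. (Var(x := t)) y $ \<sigma>)"
proof -
 let ?s = "%y. (Var(x := t)) y $ \<sigma>"
 have v: "eqs_vars (elim_var x t E) <= (eqs_vars E - {x}) Un vars_trm t" by (rule vars_elim_var)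
 have sx: "\<sigma> x = Var x" using assms v by (auto simp: solved_by_def)
 have vs: "vars_trm (\<sigma> y) <= insert y (eqs_vars E Un vars_trm t)" for y
  using assms(1) v by (cases "y : eqs_vars (elim_var x t E)") (force simp: solved_by_def)+
 have "t $ ?s = t $ \<sigma>" using assms(2) by (auto intro!: subst_trm_cong)
 hence u: "unifies ?s ((Var x, t) # E)" using assms(1) unifies_elim_var_compose[of \<sigma> x t E] by (simp add: solved_by_def)
 have m: "map_trm e (?s y) $ \<gamma> = \<gamma> y" if "unifies \<gamma> (emb_eqs e ((Var x, t) # E))" for \<gamma> y
 proof -
  from that have a: "\<gamma> x = map_trm e t $ \<gamma>" "unifies \<gamma> (emb_eqs e (elim_var x t E))"
   by (auto simp: emb_elim_var unifies_elim_var)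
  hence b: "map_trm e (\<sigma> z) $ \<gamma> = \<gamma> z" for z using assms(1) by (auto simp: solved_by_def)
  show ?thesis by (auto simp: map_trm_subst subst_trm_subst b a)
 qed
 have n: "?s y = Var y" if "y ~: eqs_vars ((Var x, t) # E)" for y using that v assms(1) by (auto simp: solved_by_def)
 have r: "vars_trm (?s y) <= eqs_vars ((Var x, t) # E)" if "y : eqs_vars ((Var x, t) # E)" for y
  using that vs by (auto simp: vars_trm_subst)
 show ?thesis unfolding solved_by_def using u m n r by blast
qed

text \<open>Eliminating a variable lowers the number of variables; decomposing two applications or
  dropping a trivial equation lowers the size without adding variables. The given unifier rules out
  symbol clashes and failing occurs checks.\<close>

lemma solved_by_exists:
 assumes "unifies \<theta> E"
 shows "EX \<sigma>. solved_by e E \<sigma>" using assms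
proof (induction E arbitrary: \<theta> rule: wf_induct[OF wf_measures[of "[%E. card (eqs_vars E), eqs_size, %E. case E of (Fun _ _, Var _) # _ => 1 | _ => 0]"]])
 case (1 E)
 have IH: "EX \<sigma>. solved_by e E' \<sigma>"
  if "card (eqs_vars E') < card (eqs_vars E) \<or> card (eqs_vars E') <= card (eqs_vars E) & eqs_size E' < eqs_size E" "unifies \<theta>' E'" for E' \<theta>'
 proof -
  have "(E', E) : measures [%E. card (eqs_vars E), eqs_size, %E. case E of (Fun _ _, Var _) # _ => 1 | _ => 0]"
   using that(1) by (auto simp: measures_def)
  thus ?thesis using 1 that(2) by blast
 qed
 have elim: "EX \<sigma>. solved_by e ((Var x, t) # E') \<sigma>"
  if "x ~: vars_trm t" "unifies \<theta> ((Var x, t) # E')" "eqs_vars E = insert x (vars_trm t Un eqs_vars E')" for x t E'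
 proof -
  have "x ~: eqs_vars (elim_var x t E')" using vars_elim_var[of x t E'] that(1) by auto
  moreover have "eqs_vars (elim_var x t E') <= eqs_vars E" using vars_elim_var[of x t E'] that(3) by auto
  ultimately have "eqs_vars (elim_var x t E') \<subset> eqs_vars E" using that(3) by blast
  hence "card (eqs_vars (elim_var x t E')) < card (eqs_vars E)" by (simp add: psubset_card_mono)
  moreover have "unifies \<theta> (elim_var x t E')" using that(2) by (simp add: unifies_elim_var)
  ultimately obtain \<sigma> where "solved_by e (elim_var x t E') \<sigma>" using IH by blast
  thus ?thesis using solved_by_elim that(1) by blast
 qed
 have swap: "solved_by e ((s, t) # E') \<sigma>" if "solved_by e ((t, s) # E') \<sigma>" for s t E' \<sigma>
  using that by (simp add: solved_by_def Un_commute)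
 show ?case
 proof (cases E)
  case Nil
  thus ?thesis by (intro exI[of _ Var]) (auto simp: solved_by_def)
 next
  case (Cons p E')
  obtain s t where p: "p = (s, t)" by force
  have same: "EX \<sigma>. solved_by e E \<sigma>" if "s = t"
  proof -
   have "card (eqs_vars E') <= card (eqs_vars E)" using Cons p by (auto intro!: card_mono)
   then obtain \<sigma> where s: "solved_by e E' \<sigma>" using IH[of E' \<theta>] 1(2) Cons p by auto
   have "vars_trm (\<sigma> x) <= eqs_vars E" if "x : eqs_vars E" for x
    using that s Cons p by (cases "x : eqs_vars E'") (auto simp: solved_by_def)
   hence "solved_by e E \<sigma>" using s Cons p that by (auto simp: solved_by_def)
   thus ?thesis by blast
  qed
  show ?thesis
  proof (cases s)
   case (Var x)
   show ?thesis
   proof (cases "x : vars_trm t")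
    case True
    hence "t = Var x" using occurs_check[of x t \<theta>] 1(2) Cons p Var by auto
    thus ?thesis using same Var by simp
   next
    case False
    thus ?thesis using elim[of x t E'] 1(2) Cons p Var by auto
   qed
  next
   case s: (Fun f ss)
   show ?thesis
   proof (cases t)
    case (Var x)
    show ?thesis
    proof (cases "x : vars_trm s")
     case True
     hence "s = Var x" using occurs_check[of x s \<theta>] 1(2) Cons p Var by auto
     thus ?thesis using same Var by simp
    next
     case False
     hence "EX \<sigma>. solved_by e ((Var x, s) # E') \<sigma>" using elim[of x s E'] 1(2) Cons p Var by auto
     thus ?thesis using swap Cons p Var by blast
    qed
   next
    case (Fun g ts)
    from 1(2) Cons p s Fun have fg: "f = g" and m: "map (%t. t $ \<theta>) ss = map (%t. t $ \<theta>) ts"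
     and u: "unifies \<theta> E'" by auto
    hence l: "length ss = length ts" using map_eq_imp_length_eq by blast
    let ?E = "zip ss ts @ E'"
    have v: "eqs_vars ?E = eqs_vars E" using l Cons p s Fun by (auto simp: eqs_vars_zip)
    moreover have "eqs_size ?E < eqs_size E" using l Cons p s Fun by (simp add: eqs_size_zip)
    moreover have "unifies \<theta> ?E" using l m u by (simp add: unifies_zip)
    ultimately obtain \<sigma> where sg: "solved_by e ?E \<sigma>" using IH by (metis order_refl)
    have "unifies \<gamma> (emb_eqs e E) \<longleftrightarrow> unifies \<gamma> (emb_eqs e ?E)" for \<gamma>
     using l Cons p s Fun fg by (simp add: emb_eqs_zip unifies_zip comp_def)
    moreover have "unifies \<gamma> E \<longleftrightarrow> unifies \<gamma> ?E" for \<gamma>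
     using l Cons p s Fun fg by (simp add: unifies_zip)
    ultimately have "solved_by e E \<sigma>" using sg unfolding solved_by_def v by blast
    thus ?thesis by blast
   qed
  qed
 qed
qed

text \<open>Relevance (no new variables) later confines mgu's to a reserved class of variables;
  generality over a larger signature lets the same mgu be used in the program extended by the symbol
  that observes answers.\<close>

lemma relevant_mgu_exists:
 assumes "s $ \<theta> = t $ \<theta>"
 obtains \<sigma> where "s $ \<sigma> = t $ \<sigma>"
  "!!\<gamma> x. map_trm e s $ \<gamma> = map_trm e t $ \<gamma> ==> map_trm e (\<sigma> x) $ \<gamma> = \<gamma> x"
  "!!x. x ~: vars_trm s Un vars_trm t ==> \<sigma> x = Var x"
  "!!x. x : vars_trm s Un vars_trm t ==> vars_trm (\<sigma> x) <= vars_trm s Un vars_trm t"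
proof -
 have "unifies \<theta> [(s, t)]" using assms by simp
 then obtain \<sigma> where "solved_by e [(s, t)] \<sigma>" using solved_by_exists by blast
 thus thesis using that[of \<sigma>] by (auto simp: solved_by_def)
qed

section \<open>Variables and marks of goals and states\<close>

abbreviation vars_goal :: "('c, 'f) lit list => var set" where
 "vars_goal Q \<equiv> set (goal_var_list Q)"

lemma goal_var_list_simps [simp]: "goal_var_list [] = []"
 "goal_var_list (l # Q) = lit_var_list l @ goal_var_list Q"
 "goal_var_list (Q @ Q') = goal_var_list Q @ goal_var_list Q'" by (auto simp: goal_var_list_def)

lemma set_var_list [simp]: "set (var_list t) = vars_trm t" by (simp add: vars_trm_def)

lemma subst_goal_simps [simp]: "[] $g \<sigma> = []"
 "(l # Q) $g \<sigma> = subst_lit \<sigma> l # Q $g \<sigma>"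
 "(Q @ Q') $g \<sigma> = Q $g \<sigma> @ Q' $g \<sigma>" by (auto simp: subst_goal_def)

lemma subst_lit_subst: "subst_lit \<tau> (subst_lit \<sigma> l) = subst_lit (%x. \<sigma> x $ \<tau>) l"
 by (cases l) (auto simp: subst_trm_subst)

lemma subst_goal_subst: "Q $g \<sigma> $g \<tau> = Q $g (%x. \<sigma> x $ \<tau>)" by (induction Q) (auto simp: subst_lit_subst)

lemma subst_lit_eq_iff: "subst_lit \<sigma> l = subst_lit \<tau> l \<longleftrightarrow> (ALL x:set (lit_var_list l). \<sigma> x = \<tau> x)"
 by (cases l) (auto simp: subst_trm_eq_iff)

lemma subst_goal_eq_iff: "Q $g \<sigma> = Q $g \<tau> \<longleftrightarrow> (ALL x:vars_goal Q. \<sigma> x = \<tau> x)"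
 by (induction Q) (auto simp: subst_lit_eq_iff)

lemma subst_lit_Var [simp]: "subst_lit Var l = l" by (cases l) auto

lemma subst_goal_Var [simp]: "Q $g Var = Q" by (induction Q) auto

lemma subst_goal_ident: "(!!x. x : vars_goal Q ==> \<sigma> x = Var x) ==> Q $g \<sigma> = Q"
 using subst_goal_eq_iff[of \<sigma> Q Var] by simp

lemma lit_vars_subst: "set (lit_var_list (subst_lit \<sigma> l)) = (UN x:set (lit_var_list l). vars_trm (\<sigma> x))"
 by (cases l) (auto simp: vars_trm_subst)

lemma vars_goal_subst: "vars_goal (Q $g \<sigma>) = (UN x:vars_goal Q. vars_trm (\<sigma> x))" by (induction Q) (auto simp: lit_vars_subst)

lemma label_cuts_simps [simp]: "label_cuts m [] = []"
 "label_cuts m (l # B) = map_lit (%_. m) id l # label_cuts m B"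
 "label_cuts m (B @ B') = label_cuts m B @ label_cuts m B'" by (auto simp: label_cuts_def)

lemma map_lit_subst: "subst_lit \<sigma> (map_lit f id l) = map_lit f id (subst_lit \<sigma> l)" by (cases l) (auto simp: trm.map_id)

lemma subst_goal_label_cuts: "label_cuts m B $g \<sigma> = label_cuts m (B $g \<sigma>)" by (induction B) (auto simp: map_lit_subst)

lemma lit_var_list_map_lit [simp]: "lit_var_list (map_lit f id l) = lit_var_list l" by (cases l) (auto simp: trm.map_id)

lemma goal_var_list_label_cuts [simp]: "goal_var_list (label_cuts m B) = goal_var_list B" by (induction B) auto

lemma marks_goal_simps [simp]: "marks_goal [] = {}"
 "marks_goal (Cut m # Q) = insert m (marks_goal Q)"
 "marks_goal (Atom t # Q) = marks_goal Q"
 "marks_goal (Q @ Q') = marks_goal Q Un marks_goal Q'" by (auto simp: marks_goal_def)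

lemma marks_goal_subst [simp]: "marks_goal (Q $g \<sigma>) = marks_goal Q"
proof (induction Q)
 case (Cons l Q) thus ?case by (cases l) auto
qed simp

lemma marks_goal_label_cuts: "marks_goal (label_cuts m B) = (if Cut () : set B then {m} else {})"
proof (induction B)
 case (Cons l B) thus ?case by (cases l) auto
qed simp

lemma finite_marks_goal [simp]: "finite (marks_goal Q)"
proof (induction Q)
 case (Cons l Q) thus ?case by (cases l) auto
qed simp

lemma marks_state_simps [simp]: "marks_state [] = {}"
 "marks_state (s # S) = marks_sgoal s Un marks_state S"
 "marks_state (S @ S') = marks_state S Un marks_state S'" by (auto simp: marks_state_def)

lemma finite_marks_sgoal [simp]: "finite (marks_sgoal s)" by (cases s) auto

lemma finite_marks_state [simp]: "finite (marks_state S)" by (induction S) auto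

lemma Scope_in_marks: "Scope m : set S ==> m : marks_state S" by (force simp: marks_state_def)

lemma case_goals_Nil_simp: "slice P p (length ts) = [] ==> case_goals P p ts Q m = [Scope m]" by (simp add: case_goals_def)

lemma marks_case_goals: "marks_state (case_goals P p ts Q m) <= insert m (marks_goal Q)" by (auto simp: case_goals_def marks_state_def)

subsection \<open>Hazardous variables and two-sided most general unifiers\<close>

text \<open>Concrete states never contain abstract variables, so the abstract variables are free to encode
  the three kinds of values occurring below: hazards, final values of answers, and variables local
  to a computation. An atom containing a hazard is resolved with no clause.\<close>

definition hazards :: "var set" where
 "hazards = range (%i. AVar (3 * i))"

definition hazardous :: "'f trm => bool" where
 "hazardous t \<longleftrightarrow> vars_trm t Int hazards ~= {}"

definition admissible :: "'f subst => bool" where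
 "admissible \<sigma> \<longleftrightarrow> (ALL x:hazards. \<sigma> x = Var x) & (ALL x. x ~: hazards --> vars_trm (\<sigma> x) Int hazards = {})"

lemma admissible_Var [simp]: "admissible Var" by (auto simp: admissible_def)

lemma admissible_comp: "admissible \<sigma> ==> admissible \<tau> ==> admissible (%x. \<sigma> x $ \<tau>)"
proof -
 assume a: "admissible \<sigma>" and b: "admissible \<tau>"
 have "y ~: hazards" if "x ~: hazards" "y : vars_trm (\<sigma> x)" for x y using a that by (auto simp: admissible_def)
 moreover have "vars_trm (\<tau> y) Int hazards = {}" if "y ~: hazards" for y using b that by (simp add: admissible_def)
 ultimately have "vars_trm (\<sigma> x $ \<tau>) Int hazards = {}" if "x ~: hazards" for x using that unfolding vars_trm_subst by blast
 thus ?thesis using a b by (simp add: admissible_def)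
qed

lemma hazardous_subst: "admissible \<sigma> ==> hazardous (t $ \<sigma>) \<longleftrightarrow> hazardous t"
proof
 assume a: "admissible \<sigma>" "hazardous (t $ \<sigma>)"
 then obtain x h where "x : vars_trm t" "h : vars_trm (\<sigma> x)" "h : hazards" by (auto simp: hazardous_def vars_trm_subst)
 hence "x : hazards" using a by (auto simp: admissible_def)
 thus "hazardous t" using \<open>x : vars_trm t\<close> by (auto simp: hazardous_def)
next
 assume a: "admissible \<sigma>" "hazardous t"
 then obtain h where "h : vars_trm t" "h : hazards" by (auto simp: hazardous_def)
 thus "hazardous (t $ \<sigma>)" using a(1) by (force simp: hazardous_def vars_trm_subst admissible_def)
qed

text \<open>Two independent substitutions express unifiability after renaming the clause
  apart.\<close>

definition matchable :: "'f trm => 'f clause => bool" where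
 "matchable t c \<longleftrightarrow> (EX \<alpha> \<beta>. t $ \<alpha> = head c $ \<beta>)"

lemma matchable_subst: "matchable (t $ \<sigma>) c ==> matchable t c" by (force simp: matchable_def subst_trm_subst)

text \<open>Applying one substitution to the goal and another one to the clause makes renaming apart
  unnecessary.\<close>

definition two_mgu :: "var set => 'f trm => 'f clause => 'f subst => 'f subst => bool" where
 "two_mgu V t c \<alpha> \<beta> \<longleftrightarrow> t $ \<alpha> = head c $ \<beta> &
   (ALL \<alpha>' \<beta>'. t $ \<alpha>' = head c $ \<beta>' -->
    (EX \<delta>. (ALL x:V. \<alpha>' x = \<alpha> x $ \<delta>) & (ALL y:vars_clause c. \<beta>' y = \<beta> y $ \<delta>))) &
   admissible \<alpha> & (ALL y. vars_trm (\<beta> y) Int hazards = {})"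

lemma two_mguD:
 assumes "two_mgu V t c \<alpha> \<beta>"
 shows "t $ \<alpha> = head c $ \<beta>" "admissible \<alpha>" "vars_trm (\<beta> y) Int hazards = {}"
 using assms by (auto simp: two_mgu_def)

lemma two_mgu_factor:
 assumes "two_mgu V t c \<alpha> \<beta>" "t $ \<alpha>' = head c $ \<beta>'"
 obtains \<delta> where "!!x. x : V ==> \<alpha>' x = \<alpha> x $ \<delta>" "!!y. y : vars_clause c ==> \<beta>' y = \<beta> y $ \<delta>"
proof -
 have "EX \<delta>. (ALL x:V. \<alpha>' x = \<alpha> x $ \<delta>) & (ALL y:vars_clause c. \<beta>' y = \<beta> y $ \<delta>)"
  using assms by (simp add: two_mgu_def)
 thus thesis using that by blast
qed

lemma finite_vars_clause [simp]: "finite (vars_clause c)" by (auto simp: vars_clause_def)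

lemma var_list_map_trm [simp]: "var_list (map_trm e t) = var_list t"
proof (induction t)
 case (Fun f ts)
 hence "map (%x. var_list (map_trm e x)) ts = map var_list ts" by simp
 thus ?case by (simp only: trm.map map_map comp_def var_list.simps)
qed simp

lemma lit_var_list_map_lit2 [simp]: "lit_var_list (map_lit f e l) = lit_var_list l" by (cases l) auto

lemma goal_var_list_map_lit [simp]: "goal_var_list (map (map_lit f e) Q) = goal_var_list Q" by (induction Q) auto

lemma vars_clause_map_clause [simp]: "vars_clause (map_clause e c) = vars_clause c" by (cases c) (simp add: vars_clause_def)

text \<open>The clause variables are moved into a finite part \<open>C\<close> of \<open>B\<close>
  that avoids \<open>V\<close> and \<open>t\<close>; an ordinary mgu is taken there and read off as
  two halves \<alpha> and \<beta>. The set \<open>B\<close> keeps all new variables in one class,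
  and the embedding \<open>e\<close> makes the same pair available for a program with more
  symbols.\<close>

lemma two_mgu_exists:
 fixes t :: "'f trm" and e :: "'f => 'g"
 assumes "inj e" and "matchable t c" and "~ hazardous t" and "finite V"
  and B: "infinite B" "B Int hazards = {}" "vars_trm t <= B"
 shows "EX \<alpha> \<beta>. two_mgu V t c \<alpha> \<beta> &
  two_mgu V (map_trm e t) (map_clause e c) (%x. map_trm e (\<alpha> x)) (%x. map_trm e (\<beta> x)) &
  (ALL x. x ~: vars_trm t --> \<alpha> x = Var x) & (ALL x:B. vars_trm (\<alpha> x) <= B) & (ALL y. vars_trm (\<beta> y) <= B)"
proof -
 obtain \<theta> \<eta> where un: "t $ \<theta> = head c $ \<eta>" using assms(2) by (auto simp: matchable_def)
 have "infinite (B - (V Un vars_trm t))" using B(1) assms(4) by (simp add: Diff_infinite_finite)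
 then obtain C where C: "C <= B - (V Un vars_trm t)" "finite C" "card C = card (vars_clause c)"
  using infinite_arbitrarily_large[of "B - (V Un vars_trm t)" "card (vars_clause c)"] by auto
 then obtain \<rho> where \<rho>: "bij_betw \<rho> (vars_clause c) C" by (metis finite_same_card_bij finite_vars_clause)
 define inv where "inv = inv_into (vars_clause c) \<rho>"
 have inv: "inv (\<rho> y) = y" if "y : vars_clause c" for y using that \<rho> by (auto simp: inv_def bij_betw_def inv_into_f_f)
 have \<rho>C: "\<rho> y : C" if "y : vars_clause c" for y using that \<rho> by (auto simp: bij_betw_def)
 have CV: "x ~: C" if "x : V Un vars_trm t" for x using that C by auto
 let ?s = "head c $ (%y. Var (\<rho> y))"
 have hv: "vars_trm (head c) <= vars_clause c" by (auto simp: vars_clause_def)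
 have vs: "vars_trm ?s <= C" using hv \<rho>C by (auto simp: vars_trm_subst)
 \<comment> \<open>Merges a pair of substitutions into one: moved clause variables use
   \<open>b\<close>, all other variables use \<open>a\<close>.\<close>
 define glue :: "'f subst => 'f subst => 'f subst"
  where "glue a b = (%x. if x : C then b (inv x) else a x)" for a b
 have g1: "t $ glue a b = t $ a" for a b using CV by (auto simp: glue_def intro!: subst_trm_cong)
 have g2: "?s $ glue a b = head c $ b" for a b using hv \<rho>C inv by (auto simp: glue_def subst_trm_subst intro!: subst_trm_cong)
 have "t $ glue \<theta> \<eta> = ?s $ glue \<theta> \<eta>" by (simp only: g1 g2 un)
 then obtain \<sigma> where s1: "t $ \<sigma> = ?s $ \<sigma>"
  and s2: "!!\<gamma> x. map_trm e t $ \<gamma> = map_trm e ?s $ \<gamma> ==> map_trm e (\<sigma> x) $ \<gamma> = \<gamma> x"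
  and s3: "!!x. x ~: vars_trm t Un vars_trm ?s ==> \<sigma> x = Var x"
  and s4: "!!x. x : vars_trm t Un vars_trm ?s ==> vars_trm (\<sigma> x) <= vars_trm t Un vars_trm ?s"
  by (rule relevant_mgu_exists[where e = e]) blast
 \<comment> \<open>A default value for variables outside the clause, so that \<beta> stays in
   \<open>B\<close> everywhere.\<close>
 obtain b where b: "b : B" using B(1) by (metis finite.emptyI ex_in_conv)
 define \<alpha> where "\<alpha> = (%x. if x : vars_trm t then \<sigma> x else Var x)"
 define \<beta> where "\<beta> = (%y. if y : vars_clause c then \<sigma> (\<rho> y) else Var b)"
 have CB: "C <= B" using C by auto
 have \<sigma>B: "vars_trm (\<sigma> x) <= B" if "x : B" for x
 proof (cases "x : vars_trm t Un vars_trm ?s")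
  case True
  thus ?thesis using s4[OF True] vs CB B(3) by blast
 next
  case False
  thus ?thesis using s3[OF False] that by simp
 qed
 have aB: "vars_trm (\<alpha> x) <= B" if "x : B" for x using \<sigma>B that by (auto simp: \<alpha>_def)
 have bB: "vars_trm (\<beta> y) <= B" for y using \<sigma>B \<rho>C CB b by (auto simp: \<beta>_def)
 have eq: "t $ \<alpha> = head c $ \<beta>"
 proof -
  have "t $ \<alpha> = t $ \<sigma>" by (auto simp: \<alpha>_def intro!: subst_trm_cong)
  also have "\<dots> = head c $ \<beta>" using s1 hv by (auto simp: subst_trm_subst \<beta>_def intro!: subst_trm_cong)
  finally show ?thesis .
 qed
 have adm: "admissible \<alpha>" unfolding admissible_def
 proof (intro conjI ballI allI impI)
  fix x assume "x : hazards" thus "\<alpha> x = Var x" using assms(3) by (auto simp: \<alpha>_def hazardous_def)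
 next
  fix x assume "x ~: hazards"
  thus "vars_trm (\<alpha> x) Int hazards = {}" using aB[of x] B(2,3) by (cases "x : vars_trm t") (auto simp: \<alpha>_def)
 qed
 have bH: "vars_trm (\<beta> y) Int hazards = {}" for y using bB[of y] B(2) by auto
 have hd: "head (map_clause e c) = map_trm e (head c)" by (cases c) auto
 have gen: "EX \<delta>. (ALL x:V. \<alpha>' x = map_trm e (\<alpha> x) $ \<delta>) & (ALL y:vars_clause c. \<beta>' y = map_trm e (\<beta> y) $ \<delta>)"
  if u: "map_trm e t $ \<alpha>' = map_trm e (head c) $ \<beta>'" for \<alpha>' \<beta>' :: "'g subst"
 proof -
  define \<gamma> where "\<gamma> = (%x. if x : C then \<beta>' (inv x) else \<alpha>' x)"
  have "map_trm e t $ \<gamma> = map_trm e t $ \<alpha>'" using CV by (auto simp: \<gamma>_def intro!: subst_trm_cong)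
  moreover have "map_trm e ?s $ \<gamma> = map_trm e (head c) $ \<beta>'"
   using hv \<rho>C inv by (auto simp: \<gamma>_def map_trm_subst subst_trm_subst intro!: subst_trm_cong)
  ultimately have "map_trm e (\<sigma> x) $ \<gamma> = \<gamma> x" for x using s2 u by simp
  hence "ALL x. map_trm e (\<sigma> x) $ \<gamma> = \<gamma> x" by blast
  hence "(ALL x:V. \<alpha>' x = map_trm e (\<alpha> x) $ \<gamma>) & (ALL y:vars_clause c. \<beta>' y = map_trm e (\<beta> y) $ \<gamma>)"
   using CV \<rho>C inv by (auto simp: \<alpha>_def \<beta>_def \<gamma>_def)
  thus ?thesis by blast
 qed
 have t1: "two_mgu V (map_trm e t) (map_clause e c) (%x. map_trm e (\<alpha> x)) (%x. map_trm e (\<beta> x))"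
  unfolding two_mgu_def vars_clause_map_clause hd using gen adm bH eq by (auto simp: admissible_def map_trm_subst[symmetric])
 have "EX \<delta>. (ALL x:V. \<alpha>' x = \<alpha> x $ \<delta>) & (ALL y:vars_clause c. \<beta>' y = \<beta> y $ \<delta>)"
  if u: "t $ \<alpha>' = head c $ \<beta>'" for \<alpha>' \<beta>' :: "'f subst"
 proof -
  have "map_trm e t $ (%x. map_trm e (\<alpha>' x)) = map_trm e (head c) $ (%x. map_trm e (\<beta>' x))"
   using u by (simp add: map_trm_subst[symmetric])
  from gen[OF this] obtain \<delta> where d: "!!x. x : V ==> map_trm e (\<alpha>' x) = map_trm e (\<alpha> x) $ \<delta>"
   "!!y. y : vars_clause c ==> map_trm e (\<beta>' y) = map_trm e (\<beta> y) $ \<delta>" by blast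
  \<comment> \<open>The factor exists over the larger signature; the inverse of \<open>e\<close>
    pulls it back to the original symbols.\<close>
  define \<delta>' where "\<delta>' = (%x. map_trm (inv_into UNIV e) (\<delta> x))"
  have bk: "u = w $ \<delta>'" if "map_trm e u = map_trm e w $ \<delta>" for u w
  proof -
   have "u = map_trm (inv_into UNIV e) (map_trm e w $ \<delta>)" using that assms(1) by (metis map_trm_inv)
   thus ?thesis using assms(1) by (simp add: map_trm_subst \<delta>'_def map_trm_inv)
  qed
  show ?thesis using d bk by (intro exI[of _ \<delta>']) blast
 qed
 hence t2: "two_mgu V t c \<alpha> \<beta>" unfolding two_mgu_def using adm bH eq by auto
 have "ALL x. x ~: vars_trm t --> \<alpha> x = Var x" by (simp add: \<alpha>_def)
 thus ?thesis using t1 t2 aB bB by (intro exI[of _ \<alpha>] exI[of _ \<beta>]) blast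
qed

definition resolvent :: "nat => 'f clause => 'f goal => 'f subst => 'f subst => 'f goal" where
 "resolvent m c Q \<alpha> \<beta> = label_cuts m (body c $g \<beta>) @ Q $g \<alpha>"

text \<open>Resolving an instance gives an instance of the resolvent, by generality of the first
  pair. The factor is cut down to the variables of the resolvent, since only there is it known to
  respect hazards.\<close>

lemma two_mgu_variant:
 assumes m1: "two_mgu V t c \<alpha> \<beta>" and m2: "two_mgu V' t' c \<alpha>' \<beta>'"
  and sub: "admissible \<phi>" "t' = t $ \<phi>" "Q' = Q $g \<phi>"
  and V: "vars_trm t Un vars_goal Q <= V"
 obtains \<delta> where "admissible \<delta>" "resolvent m c Q' \<alpha>' \<beta>' = resolvent m c Q \<alpha> \<beta> $g \<delta>"
proof -
 have "t $ (%x. \<phi> x $ \<alpha>') = head c $ \<beta>'" using two_mguD(1)[OF m2] sub by (simp add: subst_trm_subst)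
 then obtain \<delta> where d1: "!!x. x : V ==> \<phi> x $ \<alpha>' = \<alpha> x $ \<delta>"
  and d2: "!!y. y : vars_clause c ==> \<beta>' y = \<beta> y $ \<delta>" using two_mgu_factor[OF m1] by metis
 let ?R = "resolvent m c Q \<alpha> \<beta>"
 define \<delta>' where "\<delta>' = (%x. if x : vars_goal ?R then \<delta> x else Var x)"
 have vR: "vars_goal ?R = (UN y:vars_goal (body c). vars_trm (\<beta> y)) Un (UN x:vars_goal Q. vars_trm (\<alpha> x))"
  by (auto simp: resolvent_def vars_goal_subst)
 have bc: "vars_goal (body c) <= vars_clause c" by (auto simp: vars_clause_def)
 have adm: "admissible \<delta>'" unfolding admissible_def
 proof (intro conjI ballI allI impI)
  fix h assume h: "h : hazards"
  show "\<delta>' h = Var h"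
  proof (cases "h : vars_goal ?R")
   case True
   then obtain x where x: "x : vars_goal Q" "h : vars_trm (\<alpha> x)" using vR two_mguD(3)[OF m1] h by auto
   hence "x : hazards" using two_mguD(2)[OF m1] h by (auto simp: admissible_def)
   hence "x = h" "\<alpha> h = Var h" using x two_mguD(2)[OF m1] by (auto simp: admissible_def)
   hence "\<delta> h = \<phi> h $ \<alpha>'" using d1[of h] x V by auto
   hence "\<delta> h = Var h" using h sub(1) two_mguD(2)[OF m2] by (simp add: admissible_def)
   thus ?thesis by (simp add: \<delta>'_def)
  qed (simp add: \<delta>'_def)
 next
  fix x assume x: "x ~: hazards"
  show "vars_trm (\<delta>' x) Int hazards = {}"
  proof (cases "x : vars_goal ?R")
   case True
   then consider y where "y : vars_clause c" "x : vars_trm (\<beta> y)"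
    | z where "z : vars_goal Q" "x : vars_trm (\<alpha> z)" using vR bc by auto
   hence "vars_trm (\<delta> x) Int hazards = {}"
   proof cases
    case 1
    hence "vars_trm (\<delta> x) <= vars_trm (\<beta>' y)" using d2[of y] by (auto simp: vars_trm_subst)
    thus ?thesis using two_mguD(3)[OF m2] by blast
   next
    case 2
    hence "z ~: hazards" using x two_mguD(2)[OF m1] by (auto simp: admissible_def)
    hence "vars_trm (\<phi> z $ \<alpha>') Int hazards = {}"
     using admissible_comp[OF sub(1) two_mguD(2)[OF m2]] by (auto simp: admissible_def)
    moreover have "vars_trm (\<delta> x) <= vars_trm (\<alpha> z $ \<delta>)" using 2 by (auto simp: vars_trm_subst)
    moreover have "\<phi> z $ \<alpha>' = \<alpha> z $ \<delta>" using d1[of z] 2 V by blast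
    ultimately show ?thesis by auto
   qed
   thus ?thesis using True by (simp add: \<delta>'_def)
  qed (use x in \<open>simp add: \<delta>'_def\<close>)
 qed
 have "?R $g \<delta>' = ?R $g \<delta>" by (auto simp: subst_goal_eq_iff \<delta>'_def)
 also have "\<dots> = resolvent m c Q' \<alpha>' \<beta>'"
 proof -
  have "(body c $g \<beta>) $g \<delta> = body c $g \<beta>'" using d2 bc by (auto simp: subst_goal_subst subst_goal_eq_iff)
  moreover have "Q $g \<alpha> $g \<delta> = Q' $g \<alpha>'" using d1 V sub(3) by (auto simp: subst_goal_subst subst_goal_eq_iff)
  ultimately show ?thesis by (simp add: resolvent_def subst_goal_label_cuts)
 qed
 finally show thesis using that adm by simp
qed

subsection \<open>Renaming-free operational semantics\<close>

text \<open>Both cut rules become one, because dropping up to an absent marker leaves nothing. A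
  bare hazard disappears at once, and a labelled hazardous atom falls through to the next
  alternative. A goal headed by any other variable is stuck.\<close>

inductive rstep :: "'f clause list => 'f state => 'f state => bool" for P where
 r_suc: "rstep P (Goal [] # S) S"
| r_fail: "rstep P (Scope m # S) S"
| r_cut: "rstep P (Goal (Cut m # Q) # S) (Goal Q # dropWhile (%g. g ~= Scope m) S)"
| r_case: "m ~: marks_state (Goal (Atom (Fun p ts) # Q) # S) ==>
   rstep P (Goal (Atom (Fun p ts) # Q) # S) (case_goals P p ts Q m @ S)"
| r_hvar: "x : hazards ==> rstep P (Goal (Atom (Var x) # Q) # S) S"
| r_drop: "hazardous t \<or> ~ matchable t c ==> rstep P (Labeled (Atom t # Q) c m # S) S"
| r_res: "~ hazardous t ==> two_mgu (vars_trm t Un vars_goal Q) t c \<alpha> \<beta> ==>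
   rstep P (Labeled (Atom t # Q) c m # S) (Goal (resolvent m c Q \<alpha> \<beta>) # S)"

text \<open>A local step does not cut beyond the end of the state.\<close>

fun local :: "'f state => bool" where
 "local (Goal (Cut m # Q) # S) \<longleftrightarrow> Scope m : set S"
| "local _ \<longleftrightarrow> True"

definition lstep :: "'f clause list => 'f state => 'f state => bool" where
 "lstep P S T \<longleftrightarrow> rstep P S T & local S"

section \<open>Determinism up to renaming of marks and variables\<close>

primrec mark_lit :: "(nat => nat) => (nat, 'f) lit => (nat, 'f) lit" where
 "mark_lit \<nu> (Cut m) = Cut (\<nu> m)"
| "mark_lit \<nu> (Atom t) = Atom t"

primrec mark_sgoal :: "(nat => nat) => 'f sgoal => 'f sgoal" where
 "mark_sgoal \<nu> (Goal Q) = Goal (map (mark_lit \<nu>) Q)"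
| "mark_sgoal \<nu> (Labeled Q c m) = Labeled (map (mark_lit \<nu>) Q) c (\<nu> m)"
| "mark_sgoal \<nu> (Scope m) = Scope (\<nu> m)"

definition variant :: "'f sgoal => 'f sgoal => bool" where
 "variant s t \<longleftrightarrow> (EX \<phi>. admissible \<phi> & s $h \<phi> = t) & (EX \<psi>. admissible \<psi> & t $h \<psi> = s)"

text \<open>Marks link the goals of a state and are renamed globally; variables are renamed in each
  goal separately, since a step substitutes in one goal only.\<close>

definition sim_by :: "(nat => nat) => 'f state => 'f state => bool" where
 "sim_by \<nu> S T \<longleftrightarrow> inj_on \<nu> (marks_state S) & list_all2 (%s t. variant (mark_sgoal \<nu> s) t) S T"

definition sim :: "'f state => 'f state => bool" where
 "sim S T \<longleftrightarrow> (EX \<nu>. sim_by \<nu> S T)"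

lemma subst_sgoal_subst: "s $h \<sigma> $h \<tau> = s $h (%x. \<sigma> x $ \<tau>)" by (cases s) (auto simp: subst_goal_subst)

lemma subst_sgoal_Var [simp]: "s $h Var = s" by (cases s) auto

lemma variant_refl [simp]: "variant s s" unfolding variant_def by (metis admissible_Var subst_sgoal_Var)

lemma variant_sym: "variant s t ==> variant t s" by (auto simp: variant_def)

lemma mark_lit_subst: "subst_lit \<sigma> (mark_lit \<nu> l) = mark_lit \<nu> (subst_lit \<sigma> l)" by (cases l) auto

lemma mark_goal_subst: "map (mark_lit \<nu>) Q $g \<sigma> = map (mark_lit \<nu>) (Q $g \<sigma>)"
 by (induction Q) (auto simp: mark_lit_subst)

lemma mark_sgoal_subst: "mark_sgoal \<nu> s $h \<sigma> = mark_sgoal \<nu> (s $h \<sigma>)" by (cases s) (auto simp: mark_goal_subst)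

lemma goal_var_list_mark [simp]: "goal_var_list (map (mark_lit \<nu>) Q) = goal_var_list Q"
proof (induction Q)
 case (Cons l Q) thus ?case by (cases l) auto
qed simp

lemma marks_goal_mark: "marks_goal (map (mark_lit \<nu>) Q) = \<nu> ` marks_goal Q"
proof (induction Q)
 case (Cons l Q) thus ?case by (cases l) auto
qed simp

lemma marks_sgoal_mark: "marks_sgoal (mark_sgoal \<nu> s) = \<nu> ` marks_sgoal s" by (cases s) (auto simp: marks_goal_mark)

lemma marks_sgoal_subst [simp]: "marks_sgoal (s $h \<sigma>) = marks_sgoal s" by (cases s) auto

lemma marks_variant: "variant s t ==> marks_sgoal t = marks_sgoal s" by (auto simp: variant_def)

lemma mark_lit_cong: "(!!m. l = Cut m ==> f m = g m) ==> mark_lit f l = mark_lit g l" by (cases l) auto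

lemma mark_goal_cong: "(!!m. m : marks_goal Q ==> f m = g m) ==> map (mark_lit f) Q = map (mark_lit g) Q"
 unfolding map_eq_conv by (intro ballI mark_lit_cong) (auto simp: marks_goal_def)

lemma mark_sgoal_cong: "(!!m. m : marks_sgoal s ==> f m = g m) ==> mark_sgoal f s = mark_sgoal g s"
proof (cases s)
 case (Goal Q) thus "(!!m. m : marks_sgoal s ==> f m = g m) ==> ?thesis" using mark_goal_cong[of Q f g] by simp
next
 case (Labeled Q c m) thus "(!!m. m : marks_sgoal s ==> f m = g m) ==> ?thesis" using mark_goal_cong[of Q f g] by simp
qed simp

lemma mark_lit_comp: "mark_lit f \<circ> mark_lit g = mark_lit (f \<circ> g)"
proof
 fix l show "(mark_lit f \<circ> mark_lit g) l = mark_lit (f \<circ> g) l" by (cases l) simp_all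
qed

lemma mark_sgoal_comp: "mark_sgoal f (mark_sgoal g s) = mark_sgoal (f \<circ> g) s" by (cases s) (simp_all add: mark_lit_comp)

lemma mark_lit_id: "mark_lit id = id"
proof
 fix l show "mark_lit id l = id l" by (cases l) simp_all
qed

lemma mark_sgoal_id: "mark_sgoal id s = s" by (cases s) (simp_all add: mark_lit_id)

lemma mark_sgoal_ident: "(!!m. m : marks_sgoal s ==> f m = m) ==> mark_sgoal f s = s"
 using mark_sgoal_cong[of s f id] by (simp add: mark_sgoal_id)

lemma variant_mark: "variant s t ==> variant (mark_sgoal \<nu> s) (mark_sgoal \<nu> t)" unfolding variant_def by (metis mark_sgoal_subst)

lemma sim_by_marks: "sim_by \<nu> S T ==> marks_state T = \<nu> ` marks_state S"
proof -
 assume "sim_by \<nu> S T"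
 hence "list_all2 (%s t. variant (mark_sgoal \<nu> s) t) S T" by (simp add: sim_by_def)
 thus ?thesis by (induction rule: list_all2_induct) (auto simp: image_Un dest!: marks_variant simp: marks_sgoal_mark)
qed

lemma sim_refl [simp]: "sim S S" by (auto simp: sim_def sim_by_def mark_sgoal_id intro!: exI[of _ id] list.rel_refl)

lemma variants_sim: "list_all2 variant S T ==> sim S T" by (auto simp: sim_def sim_by_def mark_sgoal_id intro!: exI[of _ id])

lemma sim_sym: "sim S T ==> sim T S"
proof -
 assume "sim S T"
 then obtain \<nu> where n: "sim_by \<nu> S T" by (auto simp: sim_def)
 define \<mu> where "\<mu> = inv_into (marks_state S) \<nu>"
 have i: "\<mu> (\<nu> m) = m" if "m : marks_state S" for m using n that by (simp add: \<mu>_def sim_by_def)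
 have inj: "inj_on \<mu> (marks_state T)" using n sim_by_marks[OF n] by (auto simp: inj_on_def i)
 have "list_all2 (%s t. variant (mark_sgoal \<nu> s) t) S T" using n by (simp add: sim_by_def)
 hence "list_all2 (%t s. variant (mark_sgoal \<mu> t) s) T S" unfolding list_all2_conv_all_nth
 proof (intro conjI allI impI; (elim conjE)?)
  fix k assume l: "length S = length T" and a: "ALL i<length S. variant (mark_sgoal \<nu> (S ! i)) (T ! i)" and k: "k < length T"
  hence "variant (mark_sgoal \<nu> (S ! k)) (T ! k)" by simp
  from variant_mark[OF this, of \<mu>]
  have "variant (mark_sgoal (\<mu> \<circ> \<nu>) (S ! k)) (mark_sgoal \<mu> (T ! k))" by (simp add: mark_sgoal_comp)
  moreover have "mark_sgoal (\<mu> \<circ> \<nu>) (S ! k) = S ! k" using i k l by (intro mark_sgoal_ident) (force simp: marks_state_def)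
  ultimately show "variant (mark_sgoal \<mu> (T ! k)) (S ! k)" by (simp add: variant_sym)
 qed simp
 thus ?thesis using inj by (auto simp: sim_def sim_by_def)
qed

lemma variant_Scope: "variant (Scope m) t \<longleftrightarrow> t = Scope m" by (auto simp: variant_def intro: exI[of _ Var])

lemma variant_GoalD: "variant (Goal Q) t ==> EX \<phi> \<psi>. admissible \<phi> & admissible \<psi> & t = Goal (Q $g \<phi>) & Q $g \<phi> $g \<psi> = Q"
 unfolding variant_def by (metis subst_sgoal.simps(1) sgoal.inject(1))

lemma variant_LabeledD: "variant (Labeled Q c m) t ==> EX \<phi> \<psi>. admissible \<phi> & admissible \<psi> & t = Labeled (Q $g \<phi>) c m & Q $g \<phi> $g \<psi> = Q"
 unfolding variant_def by (metis subst_sgoal.simps(2) sgoal.inject(2))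

lemma variant_GoalI: "admissible \<phi> ==> admissible \<psi> ==> Q' = Q $g \<phi> ==> Q' $g \<psi> = Q ==> variant (Goal Q) (Goal Q')"
 by (auto simp: variant_def)

lemma variant_LabeledI: "admissible \<phi> ==> admissible \<psi> ==> Q' = Q $g \<phi> ==> Q' $g \<psi> = Q ==> variant (Labeled Q c m) (Labeled Q' c m)"
 by (auto simp: variant_def)

lemma variant_resolvent:
 assumes "two_mgu V t c \<alpha> \<beta>" "two_mgu V' t' c \<alpha>' \<beta>'"
  and "admissible \<phi>" "admissible \<psi>" "t' = t $ \<phi>" "Q' = Q $g \<phi>" "t = t' $ \<psi>" "Q = Q' $g \<psi>"
  and "vars_trm t Un vars_goal Q <= V" "vars_trm t' Un vars_goal Q' <= V'"
 shows "variant (Goal (resolvent m c Q \<alpha> \<beta>)) (Goal (resolvent m c Q' \<alpha>' \<beta>'))"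
proof -
 obtain \<delta> where "admissible \<delta>" "resolvent m c Q' \<alpha>' \<beta>' = resolvent m c Q \<alpha> \<beta> $g \<delta>"
  by (rule two_mgu_variant[OF assms(1,2,3,5,6,9)])
 moreover obtain \<delta>' where "admissible \<delta>'" "resolvent m c Q \<alpha> \<beta> = resolvent m c Q' \<alpha>' \<beta>' $g \<delta>'"
  by (rule two_mgu_variant[OF assms(2,1,4,7,8,10)])
 ultimately show ?thesis by (intro variant_GoalI[of \<delta> \<delta>']) auto
qed

lemma mark_resolvent: "map (mark_lit \<nu>) (resolvent m c Q \<alpha> \<beta>) = resolvent (\<nu> m) c (map (mark_lit \<nu>) Q) \<alpha> \<beta>"
proof -
 have "mark_lit \<nu> (map_lit (%_. m) id l) = map_lit (%_. \<nu> m) id l" for l :: "(unit, 'a) lit" by (cases l) auto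
 thus ?thesis by (simp add: resolvent_def label_cuts_def mark_goal_subst)
qed

lemma list_all2_dropWhile:
 "list_all2 R S T ==> (!!s t. s : set S ==> R s t ==> p s \<longleftrightarrow> q t) ==> list_all2 R (dropWhile p S) (dropWhile q T)"
 by (induction rule: list_all2_induct) auto

lemma marks_dropWhile: "marks_state (dropWhile p S) <= marks_state S" by (auto simp: marks_state_def dest: set_dropWhileD)

lemma infinite_ordinary: "infinite (ordinary :: var set)"
 unfolding ordinary_def by (metis finite_imageD infinite_UNIV_nat injI var.inject(1))

lemma ordinary_hazards [simp]: "ordinary Int hazards = {}" by (auto simp: ordinary_def hazards_def)

lemma infinite_nonhazards: "infinite (- hazards)"
proof -
 have "ordinary <= - hazards" by (auto simp: ordinary_def hazards_def)
 thus ?thesis using infinite_ordinary by (metis finite_subset)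
qed

lemma two_mgu_ex:
 assumes "matchable t c" "~ hazardous t" "finite V"
 obtains \<alpha> \<beta> where "two_mgu V t c \<alpha> \<beta>"
proof -
 have "vars_trm t <= - hazards" using assms(2) by (auto simp: hazardous_def)
 moreover have "- hazards Int hazards = {}" by simp
 ultimately have "EX \<alpha> \<beta>. two_mgu V t c \<alpha> \<beta>"
  using two_mgu_exists[OF inj_on_id[of UNIV] assms infinite_nonhazards] by blast
 thus thesis using that by blast
qed

lemma two_mgu_matchable: "two_mgu V t c \<alpha> \<beta> ==> matchable t c" by (auto simp: two_mgu_def matchable_def)

lemma sim_by_Cons: "sim_by \<nu> (s # S) T' \<longleftrightarrow> (EX t T. T' = t # T & variant (mark_sgoal \<nu> s) t &
  list_all2 (%s t. variant (mark_sgoal \<nu> s) t) S T & inj_on \<nu> (marks_state (s # S)))" by (auto simp: sim_by_def list_all2_Cons1)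

inductive_cases rstep_NilE: "rstep P [] T"
inductive_cases rstep_sucE: "rstep P (Goal [] # S) T"
inductive_cases rstep_failE: "rstep P (Scope m # S) T"
inductive_cases rstep_cutE: "rstep P (Goal (Cut m # Q) # S) T"
inductive_cases rstep_caseE: "rstep P (Goal (Atom t # Q) # S) T"
inductive_cases rstep_labE: "rstep P (Labeled Q c m # S) T"

lemma sim_scope_iff:
 assumes "inj_on \<nu> (marks_state S)" "s : set S" "variant (mark_sgoal \<nu> s) t" "m : M" "M \<supseteq> marks_state S" "inj_on \<nu> M"
 shows "s = Scope m \<longleftrightarrow> t = Scope (\<nu> m)"
proof
 assume "s = Scope m" thus "t = Scope (\<nu> m)" using assms by (simp add: variant_Scope)
next
 assume a: "t = Scope (\<nu> m)"
 hence "mark_sgoal \<nu> s = Scope (\<nu> m)" using assms(3) variant_sym[of "mark_sgoal \<nu> s" t] by (simp add: variant_Scope)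
 then obtain k where k: "s = Scope k" "\<nu> k = \<nu> m" by (cases s) auto
 hence "k : M" using assms(2,5) by (force simp: marks_state_def)
 thus "s = Scope m" using k assms(4,6) by (auto simp: inj_on_def)
qed

lemma sim_case_goals:
 assumes "list_all2 (%s t. variant (mark_sgoal \<nu> s) t) S T"
  and "variant (mark_sgoal \<nu> (Goal (Atom (Fun p ts) # Q))) (Goal (Atom (Fun p ts') # Q'))"
  and "inj_on \<nu> (marks_state (Goal (Atom (Fun p ts) # Q) # S))"
  and "m ~: marks_state (Goal (Atom (Fun p ts) # Q) # S)"
  and "m' ~: \<nu> ` marks_state (Goal (Atom (Fun p ts) # Q) # S)"
 shows "sim_by (\<nu>(m := m')) (case_goals P p ts Q m @ S) (case_goals P p ts' Q' m' @ T)"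
proof -
 let ?M = "marks_state (Goal (Atom (Fun p ts) # Q) # S)"
 let ?\<nu> = "\<nu>(m := m')"
 have inj: "inj_on ?\<nu> (insert m ?M)" using assms(3,4,5) by (auto simp: inj_on_def)
 have mk: "mark_sgoal ?\<nu> s = mark_sgoal \<nu> s" if "s : set (Goal (Atom (Fun p ts) # Q) # S)" for s
  using that assms(4) by (intro mark_sgoal_cong) (auto simp: marks_state_def)
 have l: "length ts = length ts'" using assms(2) by (auto simp: variant_def dest!: map_eq_imp_length_eq arg_cong[where f=length])
 have Q: "map (mark_lit ?\<nu>) Q = map (mark_lit \<nu>) Q" using mk[of "Goal (Atom (Fun p ts) # Q)"] by simp
 have lab: "variant (mark_sgoal ?\<nu> (Labeled (Atom (Fun p ts) # Q) c m)) (Labeled (Atom (Fun p ts') # Q') c m')" for c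
 proof -
  obtain \<phi> \<psi> where "admissible \<phi>" "admissible \<psi>"
   "Atom (Fun p ts') # Q' = (Atom (Fun p ts) # map (mark_lit \<nu>) Q) $g \<phi>"
   "(Atom (Fun p ts') # Q') $g \<psi> = Atom (Fun p ts) # map (mark_lit \<nu>) Q"
   using variant_GoalD[of _ "Goal (Atom (Fun p ts') # Q')"] assms(2) by fastforce
  hence "variant (Labeled (Atom (Fun p ts) # map (mark_lit ?\<nu>) Q) c m') (Labeled (Atom (Fun p ts') # Q') c m')"
   unfolding Q by (intro variant_LabeledI[of \<phi> \<psi>])
  thus ?thesis by simp
 qed
 have "list_all2 (%s t. variant (mark_sgoal ?\<nu> s) t) (case_goals P p ts Q m) (case_goals P p ts' Q' m')"
  unfolding case_goals_def using l lab
  by (auto simp: variant_Scope list_all2_map1 list_all2_map2 intro!: list_all2_appendI list.rel_refl_strong)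
 moreover have "list_all2 (%s t. variant (mark_sgoal ?\<nu> s) t) S T" using assms(1) by (rule list.rel_mono_strong) (simp add: mk)
 moreover have "inj_on ?\<nu> (marks_state (case_goals P p ts Q m @ S))"
  using marks_case_goals[of P p ts Q m] by (intro inj_on_subset[OF inj]) auto
 ultimately show ?thesis by (simp add: sim_by_def list_all2_appendI)
qed

text \<open>The only choices in a step are the fresh mark and the mgu. A new mark extends the
  renaming of marks, and two mgu's for variants of a goal give resolvents that are variants
  again.\<close>

lemma sim_step:
 assumes "sim S T" "rstep P S S'" "rstep P T T'"
 shows "sim S' T'"
proof -
 obtain \<nu> where n: "sim_by \<nu> S T" using assms(1) by (auto simp: sim_def)
 have inj: "inj_on \<nu> (marks_state S)" using n by (simp add: sim_by_def)
 have tl: "sim S1 T1" if "list_all2 (%s t. variant (mark_sgoal \<nu> s) t) S1 T1" "marks_state S1 <= marks_state S" for S1 T1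
  using that inj_on_subset[OF inj] by (auto simp: sim_def sim_by_def)
 from assms(2) show ?thesis
 proof cases
  case r_suc
  then obtain T1 where "T = Goal [] # T1" "list_all2 (%s t. variant (mark_sgoal \<nu> s) t) S' T1"
   using n by (auto simp: sim_by_Cons dest!: variant_GoalD)
  thus ?thesis using assms(3) tl r_suc by (auto elim: rstep_sucE)
 next
  case (r_fail m)
  then obtain T1 where "T = Scope (\<nu> m) # T1" "list_all2 (%s t. variant (mark_sgoal \<nu> s) t) S' T1"
   using n by (auto simp: sim_by_Cons variant_Scope)
  thus ?thesis using assms(3) tl r_fail by (auto elim: rstep_failE)
 next
  case (r_cut m Q S1)
  then obtain t T1 where T: "T = t # T1" "variant (mark_sgoal \<nu> (Goal (Cut m # Q))) t"
   "list_all2 (%s t. variant (mark_sgoal \<nu> s) t) S1 T1" using n by (auto simp: sim_by_Cons)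
  then obtain \<phi> \<psi> where p: "admissible \<phi>" "admissible \<psi>" "t = Goal (Cut (\<nu> m) # map (mark_lit \<nu>) Q $g \<phi>)"
   "(map (mark_lit \<nu>) Q $g \<phi>) $g \<psi> = map (mark_lit \<nu>) Q" by (auto dest!: variant_GoalD)
  have T': "T' = Goal (map (mark_lit \<nu>) Q $g \<phi>) # dropWhile (%g. g ~= Scope (\<nu> m)) T1"
   using assms(3) T p by (auto elim: rstep_cutE)
  have "list_all2 (%s t. variant (mark_sgoal \<nu> s) t) (dropWhile (%g. g ~= Scope m) S1) (dropWhile (%g. g ~= Scope (\<nu> m)) T1)"
  proof (rule list_all2_dropWhile[OF T(3)])
   fix s t assume "s : set S1" "variant (mark_sgoal \<nu> s) t"
   thus "(s ~= Scope m) = (t ~= Scope (\<nu> m))"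
    using sim_scope_iff[of \<nu> S1 s t m "marks_state S"] inj r_cut(1) by (auto simp: inj_on_def)
  qed
  hence "list_all2 (%s t. variant (mark_sgoal \<nu> s) t) S' T'" using r_cut(2) T' p by (auto intro!: variant_GoalI[of \<phi> \<psi>])
  moreover have "marks_state S' <= marks_state S" using r_cut marks_dropWhile[of "%g. g ~= Scope m" S1] by auto
  ultimately show ?thesis using tl by blast
 next
  case (r_case m p ts Q S1)
  then obtain t T1 where T: "T = t # T1" "variant (mark_sgoal \<nu> (Goal (Atom (Fun p ts) # Q))) t"
   "list_all2 (%s t. variant (mark_sgoal \<nu> s) t) S1 T1" using n by (auto simp: sim_by_Cons)
  obtain ts' Q' where t: "t = Goal (Atom (Fun p ts') # Q')" using T(2) by (auto dest!: variant_GoalD)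
  obtain m' where T': "T' = case_goals P p ts' Q' m' @ T1" "m' ~: marks_state T" using assms(3) T(1) t by (auto elim: rstep_caseE)
  have "sim_by (\<nu>(m := m')) (case_goals P p ts Q m @ S1) (case_goals P p ts' Q' m' @ T1)"
   using sim_case_goals[OF T(3), of p ts Q ts' Q' m m'] T t T'(2) r_case(1,3) inj sim_by_marks[OF n] by auto
  thus ?thesis using r_case T' by (auto simp: sim_def)
 next
  case (r_hvar x Q)
  then obtain t T1 where T: "T = t # T1" "variant (mark_sgoal \<nu> (Goal (Atom (Var x) # Q))) t"
   "list_all2 (%s t. variant (mark_sgoal \<nu> s) t) S' T1" using n by (auto simp: sim_by_Cons)
  then obtain \<phi> Q' where "admissible \<phi>" "t = Goal (Atom (\<phi> x) # Q')" by (auto dest!: variant_GoalD)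
  hence "t = Goal (Atom (Var x) # Q')" using r_hvar by (simp add: admissible_def)
  hence "T' = T1" using assms(3) T(1) by (auto elim: rstep_caseE)
  thus ?thesis using T(3) tl r_hvar by auto
 next
  case (r_drop t c Q m)
  then obtain u T1 where T: "T = u # T1" "variant (mark_sgoal \<nu> (Labeled (Atom t # Q) c m)) u"
   "list_all2 (%s t. variant (mark_sgoal \<nu> s) t) S' T1" using n by (auto simp: sim_by_Cons)
  then obtain \<phi> \<psi> where p: "admissible \<phi>" "admissible \<psi>" "u = Labeled (Atom (t $ \<phi>) # map (mark_lit \<nu>) Q $g \<phi>) c (\<nu> m)"
   "t $ \<phi> $ \<psi> = t" by (auto dest!: variant_LabeledD)
  have "~ (~ hazardous (t $ \<phi>) & matchable (t $ \<phi>) c)"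
   using r_drop p(1,4) hazardous_subst[OF p(1)] matchable_subst[where \<sigma> = \<psi> and t = "t $ \<phi>" and c = c] matchable_subst[where \<sigma> = \<phi> and t = t and c = c] by metis
  hence "T' = T1" using assms(3) T p by (auto elim!: rstep_labE dest: two_mgu_matchable)
  thus ?thesis using T(3) tl r_drop by auto
 next
  case (r_res t Q c \<alpha> \<beta> m S1)
  then obtain u T1 where T: "T = u # T1" "variant (mark_sgoal \<nu> (Labeled (Atom t # Q) c m)) u"
   "list_all2 (%s t. variant (mark_sgoal \<nu> s) t) S1 T1" using n by (auto simp: sim_by_Cons)
  let ?Q = "map (mark_lit \<nu>) Q"
  from T obtain \<phi> \<psi> where p: "admissible \<phi>" "admissible \<psi>" "u = Labeled (Atom (t $ \<phi>) # ?Q $g \<phi>) c (\<nu> m)"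
   "t $ \<phi> $ \<psi> = t" "?Q $g \<phi> $g \<psi> = ?Q" by (auto dest!: variant_LabeledD)
  have "~ hazardous (t $ \<phi>)" using r_res p(1) hazardous_subst by blast
  moreover have "matchable (t $ \<phi>) c"
   using r_res(4) p(4) matchable_subst[where \<sigma> = \<psi> and t = "t $ \<phi>" and c = c] by (simp add: two_mgu_matchable)
  ultimately obtain \<alpha>' \<beta>' where a: "two_mgu (vars_trm (t $ \<phi>) Un vars_goal (?Q $g \<phi>)) (t $ \<phi>) c \<alpha>' \<beta>'"
   and T': "T' = Goal (resolvent (\<nu> m) c (?Q $g \<phi>) \<alpha>' \<beta>') # T1" using assms(3) T p by (auto elim!: rstep_labE)
  have vQ: "vars_goal ?Q = vars_goal Q" by simp
  have "variant (Goal (resolvent (\<nu> m) c ?Q \<alpha> \<beta>)) (Goal (resolvent (\<nu> m) c (?Q $g \<phi>) \<alpha>' \<beta>'))"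
   by (rule variant_resolvent[OF r_res(4) a p(1,2)]) (use p vQ in auto)
  hence "list_all2 (%s t. variant (mark_sgoal \<nu> s) t) S' T'" using r_res T' T(3) by (simp add: mark_resolvent)
  moreover have "marks_state S' <= marks_state S" using r_res by (auto simp: resolvent_def marks_goal_label_cuts)
  ultimately show ?thesis using tl by blast
 qed
qed

lemma sim_local: "sim S T ==> local S ==> local T"
proof -
 assume "sim S T" and l: "local S"
 then obtain \<nu> where n: "sim_by \<nu> S T" by (auto simp: sim_def)
 show ?thesis
 proof (cases "EX m Q T1. T = Goal (Cut m # Q) # T1")
  case True
  then obtain m' Q' T1 where T: "T = Goal (Cut m' # Q') # T1" by blast
  obtain s S1 where S: "S = s # S1" "variant (mark_sgoal \<nu> s) (Goal (Cut m' # Q'))"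
   "list_all2 (%s t. variant (mark_sgoal \<nu> s) t) S1 T1" using n T by (auto simp: sim_by_def list_all2_Cons2)
  obtain \<phi> where "mark_sgoal \<nu> s = Goal (Cut m' # Q' $g \<phi>)"
   using S(2) unfolding variant_def by (metis subst_goal_simps(2) subst_lit.simps(1) subst_sgoal.simps(1))
  then obtain m Q where s: "s = Goal (Cut m # Q)" "m' = \<nu> m"
  proof (cases s)
   case (Goal Q)
   then obtain l Q1 where "Q = l # Q1" "mark_lit \<nu> l = Cut m'" using \<open>mark_sgoal \<nu> s = _\<close> by auto
   thus thesis using that Goal by (cases l) auto
  qed auto
  hence "Scope m : set S1" using l S by simp
  then obtain k where k: "k < length S1" "S1 ! k = Scope m" by (auto simp: in_set_conv_nth)
  hence "T1 ! k = Scope (\<nu> m)" "k < length T1" using S(3) by (auto simp: list_all2_conv_all_nth variant_Scope dest!: spec[of _ k])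
  thus ?thesis using T s by (auto simp: in_set_conv_nth)
 next
  case False
  thus ?thesis by (cases T rule: local.cases) auto
 qed
qed

lemma sim_progress:
 assumes "sim S T" "rstep P S S'"
 shows "EX T'. rstep P T T'"
proof -
 obtain \<nu> where n: "sim_by \<nu> S T" using assms(1) by (auto simp: sim_def)
 from assms(2) show ?thesis
 proof cases
  case r_suc
  then obtain T1 where "T = Goal [] # T1" using n by (auto simp: sim_by_Cons dest!: variant_GoalD)
  thus ?thesis using rstep.r_suc by blast
 next
  case (r_fail m)
  then obtain T1 where "T = Scope (\<nu> m) # T1" using n by (auto simp: sim_by_Cons variant_Scope)
  thus ?thesis using rstep.r_fail by blast
 next
  case (r_cut m Q S1)
  then obtain Q' T1 where "T = Goal (Cut (\<nu> m) # Q') # T1" using n by (auto simp: sim_by_Cons dest!: variant_GoalD)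
  thus ?thesis using rstep.r_cut by blast
 next
  case (r_case m p ts Q S1)
  then obtain ts' Q' T1 where T: "T = Goal (Atom (Fun p ts') # Q') # T1" using n by (auto simp: sim_by_Cons dest!: variant_GoalD)
  obtain m' where "m' ~: marks_state T" using ex_new_if_finite[OF infinite_UNIV_nat finite_marks_state] by blast
  hence "rstep P T (case_goals P p ts' Q' m' @ T1)" unfolding T by (rule rstep.r_case)
  thus ?thesis by blast
 next
  case (r_hvar x Q)
  then obtain \<phi> Q' T1 where "admissible \<phi>" "T = Goal (Atom (\<phi> x) # Q') # T1"
   using n by (auto simp: sim_by_Cons dest!: variant_GoalD)
  hence "T = Goal (Atom (Var x) # Q') # T1" using r_hvar by (simp add: admissible_def)
  thus ?thesis using rstep.r_hvar r_hvar by blast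
 next
  case (r_drop t c Q m)
  then obtain t' Q' m' T1 where T: "T = Labeled (Atom t' # Q') c m' # T1" using n by (auto simp: sim_by_Cons dest!: variant_LabeledD)
  show ?thesis
  proof (cases "hazardous t' \<or> ~ matchable t' c")
   case False
   then obtain \<alpha>' \<beta>' where "two_mgu (vars_trm t' Un vars_goal Q') t' c \<alpha>' \<beta>'"
    using two_mgu_ex[of t' c "vars_trm t' Un vars_goal Q'"] by auto
   hence "rstep P T (Goal (resolvent m' c Q' \<alpha>' \<beta>') # T1)" using False unfolding T by (auto intro: rstep.r_res)
   thus ?thesis by blast
  next
   case True
   hence "rstep P T T1" unfolding T by (rule rstep.r_drop)
   thus ?thesis by blast
  qed
 next
  case (r_res t Q c \<alpha> \<beta> m S1)
  then obtain t' Q' m' T1 where T: "T = Labeled (Atom t' # Q') c m' # T1" using n by (auto simp: sim_by_Cons dest!: variant_LabeledD)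
  show ?thesis
  proof (cases "hazardous t' \<or> ~ matchable t' c")
   case False
   then obtain \<alpha>' \<beta>' where "two_mgu (vars_trm t' Un vars_goal Q') t' c \<alpha>' \<beta>'"
    using two_mgu_ex[of t' c "vars_trm t' Un vars_goal Q'"] by auto
   hence "rstep P T (Goal (resolvent m' c Q' \<alpha>' \<beta>') # T1)" using False unfolding T by (auto intro: rstep.r_res)
   thus ?thesis by blast
  next
   case True
   hence "rstep P T T1" unfolding T by (rule rstep.r_drop)
   thus ?thesis by blast
  qed
 qed
qed

lemma two_mgu_subset: "two_mgu V t c \<alpha> \<beta> ==> W <= V ==> two_mgu W t c \<alpha> \<beta>"
 unfolding two_mgu_def by (meson subsetD)

section \<open>Finite computations and exhausted states\<close>

definition fin :: "'f clause list => 'f state => bool" where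
 "fin P S \<longleftrightarrow> Wellfounded.accp (%T S. rstep P S T) S"

lemma finI: "(!!T. rstep P S T ==> fin P T) ==> fin P S" unfolding fin_def by (rule accp.intros)

lemma fin_step: "fin P S ==> rstep P S T ==> fin P T" unfolding fin_def by (rule accp_downward)

lemma fin_induct [consumes 1, case_names step]:
 assumes "fin P S" "!!S. fin P S ==> (!!T. rstep P S T ==> R T) ==> R S"
 shows "R S" using assms(1) unfolding fin_def
proof (induction rule: accp.induct)
 case (accI S)
 have "fin P S" by (rule finI) (use accI in \<open>simp add: fin_def\<close>)
 thus ?case using assms(2) accI(2) by blast
qed

text \<open>For arguments that have to pass over several steps at once, such as the complete work on
  exhausted siblings.\<close>

lemma fin_strong_induct [consumes 1, case_names step]:
 assumes "fin P S" "!!S. fin P S ==> (!!T. (rstep P)\<^sup>+\<^sup>+ S T ==> R T) ==> R S"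
 shows "R S"
proof -
 have "ALL T. (rstep P)\<^sup>*\<^sup>* S T --> R T" using assms(1)
 proof (induction rule: fin_induct)
  case (step S)
  have plus: "R T" if "(rstep P)\<^sup>+\<^sup>+ S T" for T using tranclpD[OF that] step(2) by blast
  have "R S" by (rule assms(2)[OF step(1) plus])
  thus ?case using plus by (auto dest: rtranclpD)
 qed
 thus ?thesis by blast
qed

lemma fin_sim: "fin P S ==> sim S T ==> fin P T"
proof (induction arbitrary: T rule: fin_induct)
 case (step S)
 show ?case
 proof (rule finI)
  fix T' assume T': "rstep P T T'"
  then obtain S' where "rstep P S S'" using sim_progress sim_sym step(3) by blast
  thus "fin P T'" using step(2) sim_step[OF step(3) _ T'] by blast
 qed
qed

lemma not_fin_ex: "~ fin P S ==> EX T. rstep P S T & ~ fin P T"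
proof (rule ccontr)
 assume "~ fin P S" "\<nexists>T. rstep P S T & ~ fin P T"
 moreover from this(2) have "fin P S" by (rule_tac finI) simp
 ultimately show False by simp
qed

text \<open>All successors of a state are similar, so if one of them is infinite then every one
  is.\<close>

lemma not_fin_step:
 assumes "~ fin P S" "rstep P S T"
 shows "~ fin P T"
proof
 assume "fin P T"
 obtain T' where "rstep P S T'" "~ fin P T'" using not_fin_ex[OF assms(1)] by blast
 thus False using fin_sim[OF \<open>fin P T\<close> sim_step[OF sim_refl assms(2)]] by blast
qed

lemma fin_Nil [simp]: "fin P []" by (rule finI) (auto elim: rstep_NilE)

text \<open>Demanding a successor excludes stuck states, and local steps exclude cuts to markers
  outside. Such a state is consumed completely, so whatever follows it is reached.\<close>

inductive exh :: "'f clause list => 'f state => bool" for P where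
 exh_Nil: "exh P []"
| exh_step: "lstep P X X' ==> (!!X'. lstep P X X' ==> exh P X') ==> exh P X"

lemma lstep_Nil [simp]: "~ lstep P [] X" by (auto simp: lstep_def elim: rstep_NilE)

lemma exh_lstep: "exh P X ==> lstep P X X' ==> exh P X'" by (auto elim: exh.cases)

lemma exh_progress: "exh P X ==> X ~= [] ==> EX X'. lstep P X X'" by (auto elim: exh.cases)

lemma exh_sim: "exh P S ==> sim S T ==> exh P T"
proof (induction arbitrary: T rule: exh.induct)
 case exh_Nil
 thus ?case by (auto simp: sim_def sim_by_def intro: exh.exh_Nil)
next
 case (exh_step X X')
 obtain T' where T': "lstep P T T'" using exh_step(1,4) sim_progress[of X T P X'] sim_local[of X T] unfolding lstep_def by blast
 have "exh P T'" if "lstep P T T'" for T' using exh_step(1,3,4) that sim_step[of X T P X' T'] unfolding lstep_def by blast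
 with T' show ?case by (rule exh.exh_step)
qed

lemma exh_ex: "lstep P X X' ==> exh P X' ==> exh P X" by (rule exh.exh_step) (auto simp: lstep_def intro: exh_sim sim_step[OF sim_refl])

lemma dropWhile_Scope_append: "dropWhile (%g. g ~= Scope m) (X @ Z) =
  (if Scope m : set X then dropWhile (%g. g ~= Scope m) X @ Z else dropWhile (%g. g ~= Scope m) Z)" by (induction X) auto

lemma dropWhile_Scope_notin: "Scope m ~: set X ==> dropWhile (%g. g ~= Scope m) X = []" by (induction X) auto

lemma rstep_append:
 assumes "rstep P (X @ Z) T" "X ~= []"
 obtains X' where "lstep P X X'" "T = X' @ Z"
 | m Q X1 where "X = Goal (Cut m # Q) # X1" "Scope m ~: set X1" "T = Goal Q # dropWhile (%g. g ~= Scope m) Z"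
proof -
 obtain s X1 where X: "X = s # X1" using assms(2) by (cases X) auto
 from assms(1) show thesis
 proof cases
  case r_suc
  hence e: "X = Goal [] # X1" "T = X1 @ Z" using X by auto
  show thesis by (rule that(1)[of X1]) (simp_all add: e lstep_def rstep.r_suc)
 next
  case (r_fail m)
  hence e: "X = Scope m # X1" "T = X1 @ Z" using X by auto
  show thesis by (rule that(1)[of X1]) (simp_all add: e lstep_def rstep.r_fail)
 next
  case (r_cut m Q S)
  hence e: "X = Goal (Cut m # Q) # X1" "S = X1 @ Z" using X by auto
  show thesis
  proof (cases "Scope m : set X1")
   case True
   show thesis by (rule that(1)[of "Goal Q # dropWhile (%g. g ~= Scope m) X1"])
     (use r_cut(2) True in \<open>simp_all add: e lstep_def rstep.r_cut dropWhile_Scope_append\<close>)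
  next
   case False
   show thesis by (rule that(2)[of m Q X1])
     (use r_cut(2) False in \<open>simp_all add: e dropWhile_Scope_append\<close>)
  qed
 next
  case (r_case m p ts Q S)
  hence e: "X = Goal (Atom (Fun p ts) # Q) # X1" "S = X1 @ Z" using X by auto
  show thesis by (rule that(1)[of "case_goals P p ts Q m @ X1"])
    (use r_case in \<open>simp_all add: e lstep_def rstep.r_case\<close>)
 next
  case (r_hvar x Q)
  hence e: "X = Goal (Atom (Var x) # Q) # X1" "T = X1 @ Z" using X by auto
  show thesis by (rule that(1)[of X1]) (use r_hvar in \<open>simp_all add: e lstep_def rstep.r_hvar\<close>)
 next
  case (r_drop t c Q m)
  hence e: "X = Labeled (Atom t # Q) c m # X1" "T = X1 @ Z" using X by auto
  show thesis by (rule that(1)[of X1]) (use r_drop(2) in \<open>simp_all add: e lstep_def rstep.r_drop\<close>)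
 next
  case (r_res t Q c \<alpha> \<beta> m S)
  hence e: "X = Labeled (Atom t # Q) c m # X1" "S = X1 @ Z" using X by auto
  show thesis by (rule that(1)[of "Goal (resolvent m c Q \<alpha> \<beta>) # X1"])
    (use r_res in \<open>simp_all add: e lstep_def rstep.r_res\<close>)
 qed
qed

text \<open>A trailing marker offers no alternative; it only decides whether a cut leaves that
  marker behind.\<close>

lemma fin_scope: "fin P S ==> fin P (S @ [Scope m])"
proof (induction rule: fin_induct)
 case (step S)
 show ?case
 proof (rule finI)
  fix T assume T: "rstep P (S @ [Scope m]) T"
  show "fin P T"
  proof (cases "S = []")
   case True
   thus ?thesis using T by (auto elim: rstep_failE)
  next
   case False
   from T False show ?thesis
   proof (cases rule: rstep_append)
    case (1 X')
    thus ?thesis using step(2) by (auto simp: lstep_def)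
   next
    case (2 k Q X1)
    hence "rstep P S [Goal Q]" using rstep.r_cut[of P k Q X1] by (simp add: dropWhile_Scope_notin)
    hence "fin P [Goal Q]" "fin P ([Goal Q] @ [Scope m])" using step fin_step by blast+
    thus ?thesis using 2(3) by auto
   qed
  qed
 qed
qed

text \<open>As \<open>X\<close> is finite, the infinite part has to begin at \<open>g\<close>. A cut
  escaping from \<open>X\<close> cannot occur on the way: it would leave a finite goal reached from
  \<open>X\<close> and at most a marker.\<close>

lemma not_fin_snoc: "fin P X ==> ~ fin P (X @ [g]) ==> exh P X & ~ fin P [g]"
proof (induction rule: fin_induct)
 case (step X)
 show ?case
 proof (cases "X = []")
  case True
  thus ?thesis using step(3) by (auto intro: exh_Nil)
 next
  case False
  obtain T where T: "rstep P (X @ [g]) T" "~ fin P T" using not_fin_ex[OF step(3)] by blast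
  from T(1) False show ?thesis
  proof (cases rule: rstep_append)
   case (1 X')
   hence "exh P X' & ~ fin P [g]" using step(2)[of X'] T(2) by (auto simp: lstep_def)
   thus ?thesis using 1 exh_ex by blast
  next
   case (2 m Q X1)
   hence "rstep P X [Goal Q]" using rstep.r_cut[of P m Q X1] by (simp add: dropWhile_Scope_notin)
   hence "fin P [Goal Q]" using step fin_step by blast
   hence "fin P T" using 2(3) fin_scope[of P "[Goal Q]" m] by (auto split: if_splits)
   thus ?thesis using T(2) by blast
  qed
 qed
qed

text \<open>Looking at the shortest infinite prefix isolates the single goal that is responsible;
  what stands behind it does not matter.\<close>

lemma not_fin_split: "~ fin P S ==> EX X g Y. S = X @ g # Y & exh P X & ~ fin P [g]"
proof (induction S rule: rev_induct)
 case (snoc g S)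
 show ?case
 proof (cases "fin P S")
  case True
  thus ?thesis using not_fin_snoc[OF True snoc(2)] by blast
 next
  case False
  thus ?thesis using snoc(1) by (metis append_Cons append_assoc)
 qed
qed simp

lemma lstepI: "rstep P S T ==> local S ==> lstep P S T" by (simp add: lstep_def)

lemma fin_Scope [simp]: "fin P [Scope m]" by (rule finI) (auto elim: rstep_failE)

lemma fin_Goal_Nil [simp]: "fin P [Goal []]" by (rule finI) (auto elim: rstep_sucE)

lemma not_fin_Cut: "~ fin P [Goal (Cut m # Q)] ==> ~ fin P [Goal Q]" using not_fin_step[OF _ rstep.r_cut[of P m Q "[]"]] by simp

lemma not_fin_Atom: "~ fin P [Goal (Atom t # Q)] ==> EX p ts. t = Fun p ts"
proof (rule ccontr)
 assume a: "~ fin P [Goal (Atom t # Q)]" "\<nexists>p ts. t = Fun p ts"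
 then obtain T where "rstep P [Goal (Atom t # Q)] T" "~ fin P T" using not_fin_ex by blast
 thus False using a(2) by (auto elim!: rstep_caseE)
qed

lemma not_fin_Labeled:
 assumes "~ fin P [Labeled Q c m]"
 obtains t Q' where "Q = Atom t # Q'" "~ hazardous t" "matchable t c"
  "!!V \<alpha> \<beta>. two_mgu V t c \<alpha> \<beta> ==> vars_trm t Un vars_goal Q' <= V ==> ~ fin P [Goal (resolvent m c Q' \<alpha> \<beta>)]"
proof -
 obtain T where T: "rstep P [Labeled Q c m] T" using not_fin_ex[OF assms] by blast
 have nf: "~ fin P T" by (rule not_fin_step[OF assms T])
 from T obtain t Q' \<alpha> \<beta> where q: "Q = Atom t # Q'" and h: "~ hazardous t"
  and mg: "two_mgu (vars_trm t Un vars_goal Q') t c \<alpha> \<beta>"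
 proof cases
  case (r_drop t Q')
  thus thesis using nf by simp
 next
  case (r_res t Q' \<alpha> \<beta>)
  thus thesis using that by simp
 qed
 have "~ fin P [Goal (resolvent m c Q' \<alpha>' \<beta>')]"
  if "two_mgu V t c \<alpha>' \<beta>'" "vars_trm t Un vars_goal Q' <= V" for V \<alpha>' \<beta>'
 proof -
  have "two_mgu (vars_trm t Un vars_goal Q') t c \<alpha>' \<beta>'" by (rule two_mgu_subset[OF that])
  hence "rstep P [Labeled Q c m] [Goal (resolvent m c Q' \<alpha>' \<beta>')]" unfolding q by (rule rstep.r_res[OF h])
  thus ?thesis by (rule not_fin_step[OF assms])
 qed
 thus thesis using that[OF q h two_mgu_matchable[OF mg]] by blast
qed

text \<open>Isolates the responsible goal among the alternatives of a case analysis; the marker at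
  their end is finite and hence excluded.\<close>

lemma not_fin_case:
 assumes "~ fin P [Goal (Atom (Fun p ts) # Q)]" "m ~: marks_goal Q"
 obtains cs1 c cs2 where "slice P p (length ts) = cs1 @ c # cs2"
  "exh P (map (%c. Labeled (Atom (Fun p ts) # Q) c m) cs1)" "~ fin P [Labeled (Atom (Fun p ts) # Q) c m]"
proof -
 have "~ fin P (case_goals P p ts Q m)" using not_fin_step[OF assms(1) rstep.r_case[of m p ts Q "[]"]] assms(2) by simp
 then obtain X g Y where X: "case_goals P p ts Q m = X @ g # Y" "exh P X" "~ fin P [g]" using not_fin_split by blast
 let ?L = "%c. Labeled (Atom (Fun p ts) # Q) c m"
 have "Y ~= []"
 proof
  assume "Y = []" hence "g = Scope m" using X(1) by (simp add: case_goals_def)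
  thus False using X(3) by simp
 qed
 then obtain Y' where "map ?L (slice P p (length ts)) = X @ g # Y'" using X(1) unfolding case_goals_def by (cases Y rule: rev_cases) auto
 then obtain cs1 c cs2 where "slice P p (length ts) = cs1 @ c # cs2" "X = map ?L cs1" "g = ?L c"
  by (auto simp: map_eq_append_conv map_eq_Cons_conv)
 thus thesis using that X by blast
qed

subsection \<open>Parts of exhausted states\<close>

primrec cuts_sgoal :: "'f sgoal => nat set" where
 "cuts_sgoal (Goal Q) = marks_goal Q"
| "cuts_sgoal (Labeled Q c m) = marks_goal Q Un (if Cut () : set (body c) then {m} else {})"
| "cuts_sgoal (Scope m) = {}"

lemma active_cuts_eq: "active_cuts S = (UN s:set S. cuts_sgoal s)"
proof -
 have "m : active_cuts S \<longleftrightarrow> (EX s:set S. m : cuts_sgoal s)" for m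
 proof
  assume "m : active_cuts S"
  thus "EX s:set S. m : cuts_sgoal s"
  proof -
   from \<open>m : active_cuts S\<close> consider Q where "Goal Q : set S" "Cut m : set Q"
    | Q c d where "Labeled Q c d : set S" "Cut m : set Q \<or> d = m & Cut () : set (body c)" unfolding active_cuts_def by blast
   thus ?thesis
   proof cases
    case 1
    thus ?thesis by (intro bexI[of _ "Goal Q"]) (auto simp: marks_goal_def)
   next
    case 2
    thus ?thesis by (intro bexI[of _ "Labeled Q c d"]) (auto simp: marks_goal_def)
   qed
  qed
 next
  assume "EX s:set S. m : cuts_sgoal s"
  then obtain s where s: "s : set S" "m : cuts_sgoal s" by blast
  show "m : active_cuts S"
  proof (cases s)
   case (Goal Q)
   hence "Cut m : set Q" using s by (simp add: marks_goal_def)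
   thus ?thesis using s Goal unfolding active_cuts_def by blast
  next
   case (Labeled Q c k)
   hence "Cut m : set Q \<or> k = m & Cut () : set (body c)" using s by (auto simp: marks_goal_def split: if_splits)
   thus ?thesis using s Labeled unfolding active_cuts_def by blast
  qed (use s in simp)
 qed
 thus ?thesis by blast
qed

lemma active_cuts_simps [simp]: "active_cuts [] = {}"
 "active_cuts (s # S) = cuts_sgoal s Un active_cuts S"
 "active_cuts (S @ S') = active_cuts S Un active_cuts S'" by (auto simp: active_cuts_eq)

definition scopes :: "'f state => nat set" where
 "scopes S = {m. Scope m : set S}"

lemma scopes_simps [simp]: "scopes [] = {}" "scopes (Goal Q # S) = scopes S"
 "scopes (Labeled Q c m # S) = scopes S" "scopes (Scope m # S) = insert m (scopes S)"
 "scopes (S @ S') = scopes S Un scopes S'" by (auto simp: scopes_def)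

lemma scopes_marks: "scopes S <= marks_state S" by (auto simp: scopes_def Scope_in_marks)

lemma active_cuts_dropWhile: "active_cuts (dropWhile p S) <= active_cuts S" by (auto simp: active_cuts_eq dest: set_dropWhileD)

lemma active_cuts_resolvent: "marks_goal (resolvent m c Q \<alpha> \<beta>) = cuts_sgoal (Labeled (Atom t # Q) c m)"
proof -
 have "Cut () : set (B $g \<beta>) \<longleftrightarrow> Cut () : set B" for B
 proof (induction B)
  case (Cons l B) thus ?case by (cases l) auto
 qed simp
 thus ?thesis by (auto simp: resolvent_def marks_goal_label_cuts)
qed

lemma active_cuts_case_goals: "active_cuts (case_goals P p ts Q m) <= insert m (marks_goal Q)"
 by (auto simp: active_cuts_eq case_goals_def split: if_splits)

text \<open>A cut to a scope marker at the very beginning of the rest is like backtracking to the rest.\<close>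

lemma lstep_prefix:
 assumes "lstep P (X @ Z) T" "X ~= []" "active_cuts X Int scopes (tl Z) = {}"
 obtains X' where "T = X' @ Z" "active_cuts X' Int scopes (tl Z) = {}"
  "active_cuts X Int scopes Z = {} ==> lstep P X X' & active_cuts X' Int scopes Z = {}"
proof -
 obtain s X1 where X: "X = s # X1" using assms(2) by (cases X) auto
 have tl: "scopes (tl Z) <= scopes Z" by (cases Z) (auto simp: scopes_def)
 from assms(1) have r: "rstep P (X @ Z) T" and l: "local (X @ Z)" by (auto simp: lstep_def)
 from r show thesis
 proof cases
  case r_suc
  hence e: "X = Goal [] # X1" "T = X1 @ Z" using X by auto
  show thesis by (rule that[of X1]) (use assms(3) in \<open>simp_all add: e lstep_def rstep.r_suc\<close>)
 next
  case (r_fail m)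
  hence e: "X = Scope m # X1" "T = X1 @ Z" using X by auto
  show thesis by (rule that[of X1]) (use assms(3) in \<open>simp_all add: e lstep_def rstep.r_fail\<close>)
 next
  case (r_cut m Q S)
  hence e: "X = Goal (Cut m # Q) # X1" "S = X1 @ Z" using X by auto
  show thesis
  proof (cases "Scope m : set X1")
   case True
   let ?X = "Goal Q # dropWhile (%g. g ~= Scope m) X1"
   have sub: "active_cuts ?X <= active_cuts X" using active_cuts_dropWhile[of "%g. g ~= Scope m" X1] by (auto simp: e)
   show thesis
   proof (rule that[of ?X])
    show "T = ?X @ Z" using r_cut(2) True by (simp add: e dropWhile_Scope_append)
    show "active_cuts ?X Int scopes (tl Z) = {}" using sub assms(3) by blast
    have "lstep P X ?X" using True by (simp add: e lstep_def rstep.r_cut)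
    thus "lstep P X ?X & active_cuts ?X Int scopes Z = {}" if "active_cuts X Int scopes Z = {}" using sub that by blast
   qed
  next
   case False
   hence "Scope m : set Z" using l by (simp add: e)
   moreover have "Scope m ~: set (tl Z)" using assms(3) by (auto simp: e scopes_def)
   ultimately obtain Z1 where Z: "Z = Scope m # Z1" by (cases Z) auto
   show thesis
   proof (rule that[of "[Goal Q]"])
    show "T = [Goal Q] @ Z" using r_cut(2) False Z by (simp add: e dropWhile_Scope_append)
    show "active_cuts [Goal Q] Int scopes (tl Z) = {}" using assms(3) by (auto simp: e)
    show "lstep P X [Goal Q] & active_cuts [Goal Q] Int scopes Z = {}" if "active_cuts X Int scopes Z = {}"
     using that by (simp add: e Z)
   qed
  qed
 next
  case (r_case m p ts Q S)
  hence e: "X = Goal (Atom (Fun p ts) # Q) # X1" "S = X1 @ Z" using X by auto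
  let ?X = "case_goals P p ts Q m @ X1"
  have "m ~: scopes Z" using r_case(3) scopes_marks[of Z] by (auto simp: e)
  moreover have "active_cuts ?X <= insert m (active_cuts X)" using active_cuts_case_goals[of P p ts Q m] by (auto simp: e)
  ultimately have sub: "active_cuts ?X Int scopes Z <= active_cuts X Int scopes Z" by blast
  show thesis
  proof (rule that[of ?X])
   show "T = ?X @ Z" using r_case(2) by (simp add: e)
   show "active_cuts ?X Int scopes (tl Z) = {}" using sub assms(3) tl by blast
   have "lstep P X ?X" using r_case(3) by (simp add: e lstep_def rstep.r_case)
   thus "lstep P X ?X & active_cuts ?X Int scopes Z = {}" if "active_cuts X Int scopes Z = {}" using sub that by blast
  qed
 next
  case (r_hvar x Q)
  hence e: "X = Goal (Atom (Var x) # Q) # X1" "T = X1 @ Z" using X by auto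
  show thesis by (rule that[of X1]) (use assms(3) r_hvar(2) in \<open>auto simp: e lstep_def rstep.r_hvar\<close>)
 next
  case (r_drop t c Q m)
  hence e: "X = Labeled (Atom t # Q) c m # X1" "T = X1 @ Z" using X by auto
  show thesis by (rule that[of X1]) (use assms(3) r_drop(2) in \<open>auto simp: e lstep_def rstep.r_drop\<close>)
 next
  case (r_res t Q c \<alpha> \<beta> m S)
  hence e: "X = Labeled (Atom t # Q) c m # X1" "S = X1 @ Z" using X by auto
  let ?X = "Goal (resolvent m c Q \<alpha> \<beta>) # X1"
  have c: "active_cuts ?X = active_cuts X" using active_cuts_resolvent[of m c Q \<alpha> \<beta> t] by (simp add: e)
  show thesis
  proof (rule that[of ?X])
   show "T = ?X @ Z" using r_res(2) by (simp add: e)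
   show "active_cuts ?X Int scopes (tl Z) = {}" using c assms(3) by simp
   have "lstep P X ?X" using r_res(3,4) by (simp add: e lstep_def rstep.r_res)
   thus "lstep P X ?X & active_cuts ?X Int scopes Z = {}" if "active_cuts X Int scopes Z = {}" using c that by blast
  qed
 qed
qed

text \<open>Whether or not goals in \<open>X\<close> are solved, the cuts of \<open>X\<close> stop
  at \<open>Z\<close> at the latest, so the computation of \<open>X @ Z\<close> passes through
  \<open>Z\<close>.\<close>

lemma exh_suffix:
 assumes "exh P (X @ Z)" "active_cuts X Int scopes (tl Z) = {}"
 shows "exh P Z"
proof -
 have "exh P Y ==> Y = X @ Z ==> active_cuts X Int scopes (tl Z) = {} ==> exh P Z" for Y
 proof (induction arbitrary: X rule: exh.induct)
  case exh_Nil
  thus ?case by (simp add: exh.exh_Nil)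
 next
  case (exh_step Y Y')
  show ?case
  proof (cases "X = []")
   case True
   thus ?thesis using exh_step by (auto intro: exh.exh_step)
  next
   case False
   have "lstep P (X @ Z) Y'" using exh_step(1,4) by simp
   then obtain X' where "Y' = X' @ Z" "active_cuts X' Int scopes (tl Z) = {}" using False exh_step(5) by (rule lstep_prefix) blast
   thus ?thesis using exh_step by blast
  qed
 qed
 thus ?thesis using assms by blast
qed

text \<open>Without cuts from \<open>X\<close> to markers of \<open>Z\<close>, each step before
  \<open>Z\<close> is reached is a local step of the part in front of it.\<close>

lemma exh_prefix:
 assumes "exh P (X @ Z)" "active_cuts X Int scopes Z = {}"
 shows "exh P X"
proof -
 have tl: "scopes (tl Z) <= scopes Z" by (cases Z) (auto simp: scopes_def)
 have "exh P Y ==> Y = X @ Z ==> active_cuts X Int scopes Z = {} ==> exh P X" for Y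
 proof (induction arbitrary: X rule: exh.induct)
  case exh_Nil
  thus ?case by (simp add: exh.exh_Nil)
 next
  case (exh_step Y Y')
  show ?case
  proof (cases "X = []")
   case False
   then obtain X' where "Y' = X' @ Z" "lstep P X X'" "active_cuts X' Int scopes Z = {}"
    proof -
    have "lstep P (X @ Z) Y'" using exh_step(1,4) by simp
    moreover have "active_cuts X Int scopes (tl Z) = {}" using exh_step(5) tl by blast
    ultimately show thesis using that False exh_step(5) by (rule_tac lstep_prefix[of P X Z Y']) blast+
   qed
   thus ?thesis using exh_step exh_ex by blast
  qed (simp add: exh.exh_Nil)
 qed
 thus ?thesis using assms by blast
qed

lemma exh_context: "exh P X ==> (rstep P)\<^sup>*\<^sup>* (X @ Z) Z"
proof (induction rule: exh.induct)
 case (exh_step X X')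
 have "EX X''. lstep P X X'' & rstep P (X @ Z) (X'' @ Z)" using exh_step(1) unfolding lstep_def
 proof (elim conjE)
  assume r: "rstep P X X'" and l: "local X"
  from r show "EX X''. (rstep P X X'' & local X) & rstep P (X @ Z) (X'' @ Z)"
  proof cases
   case (r_cut m Q S)
   thus ?thesis using l r rstep.r_cut[of P m Q "S @ Z"] by (intro exI[of _ X']) (auto simp: dropWhile_Scope_append)
  next
   case (r_case m p ts Q S)
   \<comment> \<open>The mark of the given step may occur in \<open>Z\<close>; the step is repeated
     with a mark that is fresh for the context too.\<close>
   obtain k where "k ~: marks_state (X @ Z)" using ex_new_if_finite[OF infinite_UNIV_nat finite_marks_state] by blast
   thus ?thesis using l r_case rstep.r_case[of k p ts Q "S @ Z" P] rstep.r_case[of k p ts Q S P]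
    by (intro exI[of _ "case_goals P p ts Q k @ S"]) auto
  qed (use l r in \<open>auto intro!: exI[of _ X'] intro: rstep.intros\<close>)
 qed
 thus ?case using exh_step by (meson converse_rtranclp_into_rtranclp)
qed simp

subsection \<open>Skipping hazardous atoms\<close>

text \<open>The real goal \<open>Qr\<close> is obtained from \<open>Q\<close> by instantiating hazards and appending a tail. Cuts behind
  the first hazardous atom and in the tail lead out of the current state.\<close>

definition skip_goal :: "nat set => 'f goal => 'f goal => bool" where
 "skip_goal M Qr Q \<longleftrightarrow> (EX \<alpha> K. Qr = Q $g \<alpha> @ K & marks_goal K Int M = {} &
   (ALL x. x ~: hazards --> \<alpha> x = Var x)) &
   (ALL Q1 t Q2. Q = Q1 @ Atom t # Q2 & hazardous t --> marks_goal Q2 Int M = {})"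

fun skip_sgoal :: "nat set => 'f sgoal => 'f sgoal => bool" where
 "skip_sgoal M (Goal Qr) (Goal Q) \<longleftrightarrow> skip_goal M Qr Q"
| "skip_sgoal M (Labeled Qr c m) (Labeled Q c' m') \<longleftrightarrow> c = c' & m = m' & skip_goal M Qr Q &
   (EX t Q'. Q = Atom t # Q' & ~ hazardous t)"
| "skip_sgoal M (Scope m) (Scope m') \<longleftrightarrow> m = m'"
| "skip_sgoal M _ _ \<longleftrightarrow> False"

lemma skip_goal_mono: "skip_goal M Qr Q ==> N <= M ==> skip_goal N Qr Q" unfolding skip_goal_def by blast

lemma skip_sgoal_mono: "skip_sgoal M s t ==> N <= M ==> skip_sgoal N s t"
 by (cases "(M, s, t)" rule: skip_sgoal.cases) (auto intro: skip_goal_mono)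

lemma skip_goal_fresh: "skip_goal M Qr Q ==> m ~: marks_goal Qr ==> skip_goal (insert m M) Qr Q"
proof -
 assume a: "skip_goal M Qr Q" "m ~: marks_goal Qr"
 hence "m ~: marks_goal Q" by (auto simp: skip_goal_def)
 hence "m ~: marks_goal Q2" if "Q = Q1 @ Atom t # Q2" for Q1 t Q2 using that by auto
 moreover obtain \<alpha> K where "Qr = Q $g \<alpha> @ K" "marks_goal K Int M = {}" "ALL x. x ~: hazards --> \<alpha> x = Var x"
  using a(1) by (auto simp: skip_goal_def)
 moreover from this have "marks_goal K Int insert m M = {}" using a(2) by auto
 ultimately show ?thesis using a(1) unfolding skip_goal_def by blast
qed

lemma skip_sgoal_fresh: "skip_sgoal M s t ==> m ~: marks_sgoal s ==> skip_sgoal (insert m M) s t"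
 by (cases "(M, s, t)" rule: skip_sgoal.cases) (auto intro: skip_goal_fresh)

lemma skip_scopes: "list_all2 (skip_sgoal M) Sr S ==> scopes S = scopes Sr"
proof (induction rule: list_all2_induct)
 case (Cons s Sr t S)
 thus ?case by (cases "(M, s, t)" rule: skip_sgoal.cases) auto
qed simp

lemma skip_Scope_iff: "skip_sgoal M s t ==> s = Scope m \<longleftrightarrow> t = Scope m"
 by (cases "(M, s, t)" rule: skip_sgoal.cases) auto

text \<open>No clause is applied to a hazardous atom: its alternatives fall through one by one, then
  the marker fails and \<open>S\<close> is reached.\<close>

lemma exh_hazardous:
 assumes "hazardous t" "exh P S"
 shows "exh P (Goal (Atom t # Q) # S)"
proof (cases t)
 case (Var x)
 thus ?thesis using assms exh_ex[of P "Goal (Atom t # Q) # S" S] by (auto simp: lstep_def hazardous_def intro: rstep.r_hvar)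
next
 case (Fun p ts)
 obtain m where m: "m ~: marks_state (Goal (Atom t # Q) # S)" using ex_new_if_finite[OF infinite_UNIV_nat finite_marks_state] by blast
 have "exh P (map (%c. Labeled (Atom t # Q) c m) cs @ Scope m # S)" for cs
 proof (induction cs)
  case Nil
  show ?case using assms(2) exh_ex[of P "Scope m # S" S] by (auto simp: lstep_def intro: rstep.r_fail)
 next
  case (Cons c cs)
  let ?S = "map (%c. Labeled (Atom t # Q) c m) cs @ Scope m # S"
  have "lstep P (Labeled (Atom t # Q) c m # ?S) ?S" using assms(1) rstep.r_drop[of t c P Q m ?S] by (simp add: lstep_def)
  thus ?case using Cons exh_ex by fastforce
 qed
 hence "exh P (case_goals P p ts Q m @ S)" by (simp add: case_goals_def Fun)
 moreover have "lstep P (Goal (Atom t # Q) # S) (case_goals P p ts Q m @ S)"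
  using rstep.r_case[of m p ts Q S P] m by (simp add: lstep_def Fun)
 ultimately show ?thesis using exh_ex by blast
qed

lemma two_mgu_mem:
 assumes "two_mgu V t c \<alpha> \<beta>"
 shows "x : vars_goal (label_cuts m (B $g \<beta>)) ==> x ~: hazards"
proof
 assume "x : vars_goal (label_cuts m (B $g \<beta>))" "x : hazards"
 then obtain y where "x : vars_trm (\<beta> y)" by (auto simp: vars_goal_subst)
 thus False using two_mguD(3)[OF assms, of y] \<open>x : hazards\<close> by blast
qed

lemma append_eq_append_Atom:
 assumes "A @ B = Q1 @ Atom t # Q2" "~ (EX A1 A2. A = A1 @ Atom t # A2)"
 obtains Q1' where "B = Q1' @ Atom t # Q2"
proof -
 from assms(1) obtain us where "A = Q1 @ us & us @ B = Atom t # Q2 \<or> A @ us = Q1 & B = us @ Atom t # Q2"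
  unfolding append_eq_append_conv2 by blast
 thus thesis
 proof
  assume a: "A = Q1 @ us & us @ B = Atom t # Q2"
  hence "us = []" using assms(2) by (cases us) auto
  thus thesis using a that[of "[]"] by simp
 next
  assume "A @ us = Q1 & B = us @ Atom t # Q2"
  thus thesis using that by blast
 qed
qed

lemma subst_goal_decomp:
 assumes "Q $g \<alpha> = Q1 @ Atom u # Q2"
 obtains Q1' t Q2' where "Q = Q1' @ Atom t # Q2'" "u = t $ \<alpha>" "marks_goal Q2 = marks_goal Q2'"
proof -
 from assms obtain Q1' l Q2' where "Q = Q1' @ l # Q2'" "subst_lit \<alpha> l = Atom u" "Q2 = Q2' $g \<alpha>"
  unfolding subst_goal_def by (auto simp: map_eq_append_conv map_eq_Cons_conv)
 thus thesis using that by (cases l) auto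
qed

text \<open>Only hazard-free atoms are resolved, so instances of clause bodies contain no hazards.
  The cuts of the body thus stand before every hazardous atom, and the condition on cuts behind
  hazards survives.\<close>

lemma skip_goal_resolvent:
 assumes "skip_goal M (Atom t # Qr) (Atom t' # Q)" "~ hazardous t'"
  and mg: "two_mgu V t c \<alpha> \<beta>" and V: "vars_goal Q <= V"
 shows "t = t'" "skip_goal M (resolvent m c Qr \<alpha> \<beta>) (resolvent m c Q \<alpha> \<beta>)"
proof -
 from assms(1) obtain \<eta> K where a: "t = t' $ \<eta>" "Qr = Q $g \<eta> @ K" "marks_goal K Int M = {}"
  "!!x. x ~: hazards ==> \<eta> x = Var x"
  and tc: "!!Q1 u Q2. Atom t' # Q = Q1 @ Atom u # Q2 ==> hazardous u ==> marks_goal Q2 Int M = {}" by (auto simp: skip_goal_def)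
 show tt: "t = t'" using a(1,4) assms(2) subst_trm_ident[of t' \<eta>] by (auto simp: hazardous_def)
 have ad: "admissible \<alpha>" by (rule two_mguD(2)[OF mg])
 \<comment> \<open>The real values of the hazards after the step. On all other variables the two
   resolvents agree.\<close>
 define \<zeta> where "\<zeta> = (%x. if x : hazards then \<eta> x $ \<alpha> else Var x)"
 have "label_cuts m (body c $g \<beta>) $g \<zeta> = label_cuts m (body c $g \<beta>)"
  using two_mgu_mem[OF mg] by (intro subst_goal_ident) (simp add: \<zeta>_def)
 moreover have "\<alpha> x $ \<zeta> = \<eta> x $ \<alpha>" for x
 proof (cases "x : hazards")
  case True
  thus ?thesis using ad by (simp add: admissible_def \<zeta>_def)
 next
  case False
  hence "\<alpha> x $ \<zeta> = \<alpha> x" using ad by (intro subst_trm_ident) (auto simp: admissible_def \<zeta>_def)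
  thus ?thesis using a(4)[OF False] by simp
 qed
 ultimately have "resolvent m c Qr \<alpha> \<beta> = resolvent m c Q \<alpha> \<beta> $g \<zeta> @ K $g \<alpha>"
  by (simp add: resolvent_def a(2) subst_goal_subst)
 moreover have "marks_goal Q2 Int M = {}"
  if res: "resolvent m c Q \<alpha> \<beta> = Q1 @ Atom u # Q2" and hu: "hazardous u" for Q1 u Q2
 proof -
  let ?A = "label_cuts m (body c $g \<beta>)"
  have "~ (EX A1 A2. ?A = A1 @ Atom u # A2)"
  proof
   assume "EX A1 A2. ?A = A1 @ Atom u # A2"
   hence "vars_trm u <= vars_goal ?A" by fastforce
   thus False using two_mgu_mem[OF mg, of _ m "body c"] hu unfolding hazardous_def by blast
  qed
  then obtain Q1' where q: "Q $g \<alpha> = Q1' @ Atom u # Q2" by (rule append_eq_append_Atom[OF res[unfolded resolvent_def]])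
  obtain R1 v R2 where r: "Q = R1 @ Atom v # R2" "u = v $ \<alpha>" "marks_goal Q2 = marks_goal R2" using q by (rule subst_goal_decomp)
  have "hazardous v" using hu r(2) hazardous_subst[OF ad] by simp
  hence "marks_goal R2 Int M = {}" using tc[of "Atom t' # R1" v R2] r(1) by simp
  thus ?thesis using r(3) by simp
 qed
 ultimately show "skip_goal M (resolvent m c Qr \<alpha> \<beta>) (resolvent m c Q \<alpha> \<beta>)" unfolding skip_goal_def using a(3)
  by (intro conjI exI[of _ \<zeta>] exI[of _ "K $g \<alpha>"] allI impI) (simp_all add: \<zeta>_def)
qed

text \<open>The induction follows the exhaustion of the real state. \<open>X\<close> is the work
  still spent there on goals that have already been skipped or solved on the other side; its cuts
  lead out of the present scopes, or at most to the beginning of \<open>Sr\<close>, so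
  \<open>Sr\<close> is reached.\<close>

lemma exh_skip:
 assumes "exh P (X @ Sr)" "active_cuts X Int scopes (tl Sr) = {}" "list_all2 (skip_sgoal (scopes S)) Sr S"
 shows "exh P S"
proof -
 have "exh P Y ==> Y = X @ Sr ==> active_cuts X Int scopes (tl Sr) = {} ==>
  list_all2 (skip_sgoal (scopes S)) Sr S ==> exh P S" for Y
 proof (induction arbitrary: X Sr S rule: exh.induct)
  case exh_Nil
  thus ?case by (simp add: exh.exh_Nil)
 next
  case (exh_step Y Y')
  have IH: "exh P S'" if "lstep P Y (X' @ Sr')" "active_cuts X' Int scopes (tl Sr') = {}"
   "list_all2 (skip_sgoal (scopes S')) Sr' S'" for X' Sr' S' using exh_step.IH[OF that(1) refl that(2,3)] .
  \<comment> \<open>While the prefix is nonempty only the real computation moves.\<close>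
  have via_prefix: "exh P S'" if Y': "Y = X' @ Sr'" and ne: "X' ~= []" and cond: "active_cuts X' Int scopes (tl Sr') = {}"
   and sk: "list_all2 (skip_sgoal (scopes S')) Sr' S'" for X' Sr' S'
  proof -
   have l: "lstep P (X' @ Sr') Y'" using exh_step(1) Y' by simp
   obtain X'' where x: "Y' = X'' @ Sr'" "active_cuts X'' Int scopes (tl Sr') = {}" using l ne cond by (rule lstep_prefix)
   have "lstep P Y (X'' @ Sr')" using exh_step(1) x(1) by simp
   thus ?thesis using x(2) sk by (rule IH)
  qed
  show ?case
  proof (cases "X = []")
   case False
   thus ?thesis using via_prefix exh_step by blast
  next
   case X: True
   show ?thesis
   proof (cases S)
    case Nil
    thus ?thesis by (simp add: exh.exh_Nil)
   next
    case (Cons s S1)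
    then obtain sr S1r where Sr: "Sr = sr # S1r" "skip_sgoal (scopes S) sr s"
     "list_all2 (skip_sgoal (scopes S)) S1r S1" using exh_step(6) by (auto simp: list_all2_Cons2)
    have Y: "Y = sr # S1r" using exh_step(4) X Sr by simp
    have sc: "scopes S1 <= scopes S" using Cons by (cases s) auto
    have scr: "scopes S1 = scopes S1r" using skip_scopes[OF Sr(3)] .
    have mono: "list_all2 (skip_sgoal M) S1r S1" if "M <= scopes S" for M
     using Sr(3) by (rule list_all2_mono) (rule skip_sgoal_mono[OF _ that])
    have tls: "scopes (tl S1r) <= scopes S" using scr sc by (cases S1r) (auto simp: scopes_def)
    have lY: "rstep P Y Y'" "local Y" using exh_step(1) by (auto simp: lstep_def)
    show ?thesis
    proof (cases s)
     case (Scope m)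
     hence "sr = Scope m" using Sr(2) by (cases sr) auto
     hence "lstep P Y ([] @ S1r)" unfolding Y by (auto simp: lstep_def intro: rstep.r_fail)
     hence "exh P S1" using IH[of "[]" S1r S1] mono sc by simp
     thus ?thesis using Cons Scope exh_ex[of P S S1] by (auto simp: lstep_def intro: rstep.r_fail)
    next
     case (Labeled Q c m)
     then obtain Qr t Q' where sr: "sr = Labeled Qr c m" "skip_goal (scopes S) Qr Q" "Q = Atom t # Q'" "~ hazardous t"
      using Sr(2) by (cases sr) auto
     then obtain \<eta> K where "Qr = Q $g \<eta> @ K" "!!x. x ~: hazards ==> \<eta> x = Var x" by (auto simp: skip_goal_def)
     moreover from this(2) have "t $ \<eta> = t" using sr(4) by (intro subst_trm_ident) (auto simp: hazardous_def)
     ultimately obtain Qr' where Qr: "Qr = Atom t # Qr'" using sr(3) by simp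
     show ?thesis
     proof (cases "matchable t c")
      case False
      hence "lstep P Y ([] @ S1r)" unfolding Y sr Qr by (auto simp: lstep_def intro: rstep.r_drop)
      hence "exh P S1" using IH[of "[]" S1r S1] mono sc by simp
      moreover have "lstep P S S1" using False Cons Labeled sr by (auto simp: lstep_def intro: rstep.r_drop)
      ultimately show ?thesis using exh_ex by blast
     next
      case True
      let ?V = "vars_trm t Un (vars_goal Qr' Un vars_goal Q')"
      obtain \<alpha> \<beta> where mg: "two_mgu ?V t c \<alpha> \<beta>" using two_mgu_ex[OF True sr(4), of ?V] by auto
      have "two_mgu (vars_trm t Un vars_goal Qr') t c \<alpha> \<beta>" "two_mgu (vars_trm t Un vars_goal Q') t c \<alpha> \<beta>"
       by (rule two_mgu_subset[OF mg]; blast)+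
      hence l1: "lstep P Y ([] @ Goal (resolvent m c Qr' \<alpha> \<beta>) # S1r)"
       and l2: "lstep P S (Goal (resolvent m c Q' \<alpha> \<beta>) # S1)"
       unfolding Y sr Qr Cons Labeled using sr(4) by (auto simp: lstep_def intro: rstep.r_res)
      have "skip_goal (scopes S) (resolvent m c Qr' \<alpha> \<beta>) (resolvent m c Q' \<alpha> \<beta>)"
       by (rule skip_goal_resolvent(2)[OF _ sr(4) mg]) (use sr Qr in auto)
      hence "exh P (Goal (resolvent m c Q' \<alpha> \<beta>) # S1)"
       using IH[OF l1, of "Goal (resolvent m c Q' \<alpha> \<beta>) # S1"] Sr(3) Cons Labeled by simp
      thus ?thesis using l2 exh_ex by blast
     qed
    next
     case (Goal Q)
     then obtain Qr where sr: "sr = Goal Qr" "skip_goal (scopes S) Qr Q" using Sr(2) by (cases sr) auto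
     then obtain \<eta> K where Qr: "Qr = Q $g \<eta> @ K" "marks_goal K Int scopes S = {}" "!!x. x ~: hazards ==> \<eta> x = Var x"
      and tc: "!!Q1 t Q2. Q = Q1 @ Atom t # Q2 ==> hazardous t ==> marks_goal Q2 Int scopes S = {}" unfolding skip_goal_def by blast
     \<comment> \<open>When the goal of \<open>S\<close> is solved or begins with a hazard, the rest
       of the real goal becomes the new prefix.\<close>
     have skip1: "exh P S1" if "marks_goal Qr Int scopes S = {}"
      by (rule via_prefix[of "[Goal Qr]" S1r S1]) (use Y sr that tls mono sc in auto)
     show ?thesis
     proof (cases Q)
      case Nil
      hence "exh P S1" using skip1 Qr by simp
      thus ?thesis using Cons Goal Nil exh_ex[of P S S1] by (auto simp: lstep_def intro: rstep.r_suc)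
     next
      case Q: (Cons l Q')
      show ?thesis
      proof (cases l)
       case (Cut m)
       have Yc: "Y = Goal (Cut m # Q' $g \<eta> @ K) # S1r" using Y sr Qr Q Cut by simp
       have sm: "Scope m : set S1r" using lY(2) Yc by simp
       hence sm': "Scope m : set S1" using scr by (auto simp: scopes_def)
       let ?D = "dropWhile (%g. g ~= Scope m) S1" and ?Dr = "dropWhile (%g. g ~= Scope m) S1r"
       have l1: "lstep P Y ([] @ Goal (Q' $g \<eta> @ K) # ?Dr)" unfolding Yc using sm by (simp add: lstep_def rstep.r_cut)
       have l2: "lstep P S (Goal Q' # ?D)" unfolding Cons Goal Q Cut using sm' by (simp add: lstep_def rstep.r_cut)
       have "scopes ?D <= scopes S1" by (auto simp: scopes_def dest: set_dropWhileD)
       hence ms: "scopes (Goal Q' # ?D) <= scopes S" using sc by auto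
       have "list_all2 (skip_sgoal (scopes S)) ?Dr ?D" by (rule list_all2_dropWhile[OF Sr(3)]) (simp add: skip_Scope_iff)
       moreover have "skip_goal (scopes S) (Q' $g \<eta> @ K) Q'"
        unfolding skip_goal_def using Qr tc[of "Cut m # Q1" for Q1] Q Cut by auto
       ultimately have "list_all2 (skip_sgoal (scopes S)) (Goal (Q' $g \<eta> @ K) # ?Dr) (Goal Q' # ?D)" by simp
       hence "list_all2 (skip_sgoal (scopes (Goal Q' # ?D))) (Goal (Q' $g \<eta> @ K) # ?Dr) (Goal Q' # ?D)"
        by (rule list_all2_mono) (rule skip_sgoal_mono[OF _ ms])
       hence "exh P (Goal Q' # ?D)" using IH[OF l1] by simp
       thus ?thesis using l2 exh_ex by blast
      next
       case (Atom t)
       show ?thesis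
       proof (cases "hazardous t")
        case True
        hence "exh P S1" using skip1 Qr tc[of "[]" t Q'] Q Atom by auto
        thus ?thesis using exh_hazardous[OF True] Cons Goal Q Atom by simp
       next
        case nh: False
        hence t: "t $ \<eta> = t" using Qr(3) by (intro subst_trm_ident) (auto simp: hazardous_def)
        let ?Kr = "Q' $g \<eta> @ K"
        have Ya: "Y = Goal (Atom t # ?Kr) # S1r" using Y sr Qr Q Atom t by simp
        from lY(1) obtain p ts where pt: "t = Fun p ts" unfolding Ya using nh by cases (auto simp: hazardous_def)
        \<comment> \<open>One mark that is fresh for both states keeps the two case analyses
          synchronized.\<close>
        obtain m where m: "m ~: marks_state (Y @ S)" using ex_new_if_finite[OF infinite_UNIV_nat finite_marks_state] by blast
        let ?C = "case_goals P p ts Q' m" and ?Cr = "case_goals P p ts ?Kr m"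
        have l1: "lstep P Y ([] @ ?Cr @ S1r)" using m rstep.r_case[of m p ts ?Kr S1r P] by (simp add: Ya pt lstep_def)
        have l2: "lstep P S (?C @ S1)" using m rstep.r_case[of m p ts Q' S1 P] by (simp add: Cons Goal Q Atom pt lstep_def)
        have "scopes (?C @ S1) = insert m (scopes S1)" by (auto simp: scopes_def case_goals_def)
        also have "\<dots> = insert m (scopes S)" using Cons Goal by simp
        finally have sc': "scopes (?C @ S1) = insert m (scopes S)" .
        have g: "skip_goal (insert m (scopes S)) (Atom t # ?Kr) (Atom t # Q')"
        proof (rule skip_goal_fresh)
         show "skip_goal (scopes S) (Atom t # ?Kr) (Atom t # Q')" using sr(2) Qr(1) Q Atom t by simp
        qed (use m Ya in auto)
        have "list_all2 (skip_sgoal (insert m (scopes S))) S1r S1"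
        proof (rule list.rel_mono_strong[OF Sr(3)])
         fix a b assume "a : set S1r" "skip_sgoal (scopes S) a b"
         thus "skip_sgoal (insert m (scopes S)) a b" using m Ya by (intro skip_sgoal_fresh) (auto simp: marks_state_def)
        qed
        moreover have "list_all2 (skip_sgoal (insert m (scopes S))) ?Cr ?C" unfolding case_goals_def using g nh pt
         by (auto simp: list_all2_map1 list_all2_map2 intro!: list_all2_appendI list.rel_refl_strong)
        ultimately have "list_all2 (skip_sgoal (scopes (?C @ S1))) (?Cr @ S1r) (?C @ S1)"
         unfolding sc' by (simp add: list_all2_appendI)
        hence "exh P (?C @ S1)" using IH[OF l1] by simp
        thus ?thesis using l2 exh_ex by blast
       qed
      qed
     qed
    qed
   qed
  qed
 qed
 thus ?thesis using assms by blast
qed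

subsection \<open>Answers\<close>

text \<open>Stated for the resolvent instead of the labelled goal, hence vacuous for a clause that
  does not match.\<close>

definition sibling_exh :: "'f clause list => 'f trm => 'f goal => nat => 'f clause => bool" where
 "sibling_exh P t Q m c \<longleftrightarrow> (ALL V \<alpha> \<beta>. two_mgu V t c \<alpha> \<beta> & vars_trm t Un vars_goal Q <= V -->
   exh P [Goal (resolvent m c Q \<alpha> \<beta>)])"

lemma exh_siblings:
 assumes "exh P (map (%c. Labeled (Atom t # Q) c m) cs)" "c : set cs" "~ hazardous t"
 shows "sibling_exh P t Q m c" unfolding sibling_exh_def
proof (intro allI impI, elim conjE)
 fix V \<alpha> \<beta> assume mg: "two_mgu V t c \<alpha> \<beta>" and V: "vars_trm t Un vars_goal Q <= V"
 let ?L = "%c. Labeled (Atom t # Q) c m"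
 obtain cs1 cs2 where cs: "cs = cs1 @ c # cs2" using assms(2) by (meson split_list)
 have sc: "scopes (map ?L cs) = {}" for cs by (auto simp: scopes_def)
 have "exh P (map ?L cs1 @ ?L c # map ?L cs2)" using assms(1) cs by simp
 hence "exh P (?L c # map ?L cs2)" by (rule exh_suffix) (simp add: sc)
 moreover have "lstep P (?L c # map ?L cs2) (Goal (resolvent m c Q \<alpha> \<beta>) # map ?L cs2)"
  using rstep.r_res[OF assms(3) two_mgu_subset[OF mg V]] by (simp add: lstep_def)
 ultimately have "exh P ([Goal (resolvent m c Q \<alpha> \<beta>)] @ map ?L cs2)" using exh_lstep by fastforce
 thus "exh P [Goal (resolvent m c Q \<alpha> \<beta>)]" by (rule exh_prefix) (simp add: sc)
qed

text \<open>\<open>ans P Q \<delta>\<close>: the goal \<open>Q\<close> has an answer of which \<open>\<delta>\<close> is an instance.\<close>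

inductive ans :: "'f clause list => 'f goal => 'f subst => bool" for P where
 ans_Nil: "ans P [] \<delta>"
| ans_Cut: "ans P Q \<delta> ==> ans P (Cut m # Q) \<delta>"
| ans_Atom: "[| slice P p (length ts) = cs1 @ c # cs2; m ~: marks_goal Q; ~ hazardous (Fun p ts);
   !!c'. c' : set cs1 ==> sibling_exh P (Fun p ts) Q m c';
   two_mgu (vars_trm (Fun p ts) Un vars_goal Q) (Fun p ts) c \<alpha> \<beta>; ans P (resolvent m c Q \<alpha> \<beta>) \<delta>';
   !!x. x : vars_trm (Fun p ts) Un vars_goal Q ==> \<delta> x = \<alpha> x $ \<delta>' |] ==>
   ans P (Atom (Fun p ts) # Q) \<delta>"

lemma ans_inst: "ans P Q \<delta> ==> ans P Q (%x. \<delta> x $ \<eta>)"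
proof (induction rule: ans.induct)
 case (ans_Atom p ts cs1 c cs2 m Q \<alpha> \<beta> \<delta>' \<delta>)
 show ?case by (rule ans.ans_Atom[OF ans_Atom.hyps(1,2,3,4,5) ans_Atom.IH]) (simp_all add: ans_Atom.hyps(7) subst_trm_subst)
qed (auto intro: ans.ans_Nil ans.ans_Cut)

lemma sim_mark: "inj_on \<nu> (marks_goal Q) ==> sim [Goal Q] [Goal (map (mark_lit \<nu>) Q)]"
 by (auto simp: sim_def sim_by_def intro!: exI[of _ \<nu>])

lemma sibling_exh_mark:
 assumes "sibling_exh P t Q m c" "inj_on \<nu> (insert m (marks_goal Q))"
 shows "sibling_exh P t (map (mark_lit \<nu>) Q) (\<nu> m) c" unfolding sibling_exh_def
proof (intro allI impI, elim conjE)
 fix V \<alpha> \<beta> assume "two_mgu V t c \<alpha> \<beta>" "vars_trm t Un vars_goal (map (mark_lit \<nu>) Q) <= V"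
 hence "exh P [Goal (resolvent m c Q \<alpha> \<beta>)]" using assms(1) unfolding sibling_exh_def by simp
 moreover have "marks_goal (resolvent m c Q \<alpha> \<beta>) <= insert m (marks_goal Q)"
  by (auto simp: resolvent_def marks_goal_label_cuts)
 ultimately have "exh P [Goal (map (mark_lit \<nu>) (resolvent m c Q \<alpha> \<beta>))]"
  using exh_sim sim_mark inj_on_subset[OF assms(2)] by blast
 thus "exh P [Goal (resolvent (\<nu> m) c (map (mark_lit \<nu>) Q) \<alpha> \<beta>)]" by (simp only: mark_resolvent)
qed

text \<open>Marks only have to be kept distinct, and the mark chosen for a case analysis can be
  renamed along.\<close>

lemma ans_mark: "ans P Q \<delta> ==> inj_on \<nu> (marks_goal Q) ==> ans P (map (mark_lit \<nu>) Q) \<delta>"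
proof (induction arbitrary: \<nu> rule: ans.induct)
 case (ans_Cut Q \<delta> m)
 thus ?case by (auto intro!: ans.ans_Cut)
next
 case (ans_Atom p ts cs1 c cs2 m Q \<alpha> \<beta> \<delta>' \<delta>)
 obtain m' where m': "m' ~: \<nu> ` marks_goal Q" using ex_new_if_finite[OF infinite_UNIV_nat, of "\<nu> ` marks_goal Q"] by auto
 let ?\<nu> = "\<nu>(m := m')"
 have inj: "inj_on ?\<nu> (insert m (marks_goal Q))" using ans_Atom.hyps(2) ans_Atom.prems m' by (auto simp: inj_on_def)
 have Q: "map (mark_lit ?\<nu>) Q = map (mark_lit \<nu>) Q" using ans_Atom.hyps(2) by (intro mark_goal_cong) auto
 have "sibling_exh P (Fun p ts) (map (mark_lit \<nu>) Q) m' c'" if "c' : set cs1" for c'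
  using sibling_exh_mark[OF ans_Atom.hyps(4)[OF that] inj] by (simp add: Q)
 moreover have "marks_goal (resolvent m c Q \<alpha> \<beta>) <= insert m (marks_goal Q)"
  by (auto simp: resolvent_def marks_goal_label_cuts)
 hence "ans P (map (mark_lit ?\<nu>) (resolvent m c Q \<alpha> \<beta>)) \<delta>'" using ans_Atom.IH inj_on_subset[OF inj] by blast
 hence "ans P (resolvent m' c (map (mark_lit \<nu>) Q) \<alpha> \<beta>) \<delta>'" by (simp only: mark_resolvent Q fun_upd_same)
 ultimately have "ans P (Atom (Fun p ts) # map (mark_lit \<nu>) Q) \<delta>"
  by (intro ans.ans_Atom[of P p ts cs1 c cs2 m' "map (mark_lit \<nu>) Q" \<alpha> \<beta> \<delta>' \<delta>])
   (use ans_Atom.hyps m' in \<open>simp_all add: marks_goal_mark\<close>)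
 thus ?case by simp
qed (auto intro: ans.ans_Nil)

text \<open>Inversion with any prescribed fresh mark; it is applied with the mark that the graph has
  chosen at a \<open>Case\<close> node.\<close>

lemma ans_AtomE:
 assumes "ans P (Atom t # Q) \<delta>" "m ~: marks_goal Q"
 obtains p ts cs1 c cs2 \<alpha> \<beta> \<delta>' where "t = Fun p ts" "slice P p (length ts) = cs1 @ c # cs2"
  "~ hazardous t" "!!c'. c' : set cs1 ==> sibling_exh P t Q m c'"
  "two_mgu (vars_trm t Un vars_goal Q) t c \<alpha> \<beta>" "ans P (resolvent m c Q \<alpha> \<beta>) \<delta>'"
  "!!x. x : vars_trm t Un vars_goal Q ==> \<delta> x = \<alpha> x $ \<delta>'" using assms(1)
proof cases
 case (ans_Atom p ts cs1 c cs2 k \<alpha> \<beta> \<delta>')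
 let ?\<nu> = "id(k := m)"
 have inj: "inj_on ?\<nu> (insert k (marks_goal Q))" using assms(2) ans_Atom(3) by (auto simp: inj_on_def)
 have Q: "map (mark_lit ?\<nu>) Q = Q"
 proof -
  have "map (mark_lit ?\<nu>) Q = map (mark_lit id) Q" using ans_Atom(3) by (intro mark_goal_cong) auto
  thus ?thesis by (simp add: mark_lit_id)
 qed
 have s: "sibling_exh P t Q m c'" if "c' : set cs1" for c' using sibling_exh_mark[OF ans_Atom(5)[OF that] inj] ans_Atom(1) by (simp add: Q)
 have "marks_goal (resolvent k c Q \<alpha> \<beta>) <= insert k (marks_goal Q)" by (auto simp: resolvent_def marks_goal_label_cuts)
 hence "ans P (map (mark_lit ?\<nu>) (resolvent k c Q \<alpha> \<beta>)) \<delta>'"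
  using ans_mark[OF ans_Atom(7)] inj_on_subset[OF inj] by blast
 hence "ans P (resolvent m c Q \<alpha> \<beta>) \<delta>'" by (simp only: mark_resolvent Q fun_upd_same)
 thus thesis using that[OF ans_Atom(1,2) _ s _ _ ans_Atom(8)] ans_Atom(1,4,6) by simp
qed

lemma resolvent_append: "resolvent m c (A @ Q) \<alpha> \<beta> = resolvent m c A \<alpha> \<beta> @ Q $g \<alpha>"
 by (simp add: resolvent_def)

text \<open>A goal with an infinite computation fails to have one only because of what follows one of its
  answers.\<close>

lemma not_fin_append:
 assumes "fin P (Goal A # Z)" "~ fin P [Goal (A @ Q)]"
 shows "EX \<delta>. admissible \<delta> & ans P A \<delta> & ~ fin P [Goal (Q $g \<delta>)]"
proof -
 have "fin P S ==> S = Goal A # Z ==> ~ fin P [Goal (A @ Q)] ==>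
  EX \<delta>. admissible \<delta> & ans P A \<delta> & ~ fin P [Goal (Q $g \<delta>)]" for S
 proof (induction arbitrary: A Z Q rule: fin_strong_induct)
  case (step S)
  show ?case
  proof (cases A)
   case Nil
   thus ?thesis using step(4) by (intro exI[of _ Var]) (auto intro: ans_Nil)
  next
   case (Cons l A')
   show ?thesis
   proof (cases l)
    case (Cut m)
    have "rstep P S (Goal A' # dropWhile (%g. g ~= Scope m) Z)" unfolding step(3) Cons Cut by (rule rstep.r_cut)
    moreover have "~ fin P [Goal (A' @ Q)]" using step(4) Cons Cut not_fin_Cut by simp
    ultimately obtain \<delta> where "admissible \<delta>" "ans P A' \<delta>" "~ fin P [Goal (Q $g \<delta>)]"
     using step(2)[OF tranclp.r_into_trancl refl] by blast
    thus ?thesis using Cons Cut ans_Cut by blast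
   next
    case (Atom t)
    have nf: "~ fin P [Goal (Atom t # A' @ Q)]" using step(4) Cons Atom by simp
    then obtain p ts where t: "t = Fun p ts" using not_fin_Atom by blast
    obtain m where m: "m ~: marks_state (Goal (A @ Q) # Z)" using ex_new_if_finite[OF infinite_UNIV_nat finite_marks_state] by blast
    have mm: "m ~: marks_goal (A' @ Q)" using m Cons Atom by simp
    obtain cs1 c cs2 where sl: "slice P p (length ts) = cs1 @ c # cs2"
     and ex: "exh P (map (%c. Labeled (Atom t # A' @ Q) c m) cs1)"
     and nl: "~ fin P [Labeled (Atom t # A' @ Q) c m]" using not_fin_case[OF nf[unfolded t] mm] t by blast
    let ?V = "vars_trm t Un vars_goal (A' @ Q)"
    obtain nh: "~ hazardous t" and ma: "matchable t c"
     and nr: "!!V \<alpha> \<beta>. two_mgu V t c \<alpha> \<beta> ==> ?V <= V ==> ~ fin P [Goal (resolvent m c (A' @ Q) \<alpha> \<beta>)]"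
     using nl by (rule not_fin_Labeled) auto
    obtain \<alpha> \<beta> where mg: "two_mgu ?V t c \<alpha> \<beta>" using two_mgu_ex[OF ma nh, of ?V] by auto
    let ?R = "resolvent m c A' \<alpha> \<beta>"
    have nR: "~ fin P [Goal (?R @ Q $g \<alpha>)]" using nr[OF mg] by (simp add: resolvent_append)
    let ?L = "%c. Labeled (Atom t # A') c m"
    \<comment> \<open>The siblings are exhausted in front of \<open>A' @ Q\<close>; skipping the
      tail \<open>Q\<close> shows that they are exhausted in front of \<open>A'\<close>
      alone.\<close>
    have "list_all2 (skip_sgoal {}) (map (%c. Labeled (Atom t # A' @ Q) c m) cs1) (map ?L cs1)"
     using nh by (auto simp: list_all2_map1 list_all2_map2 skip_goal_def intro!: list.rel_refl_strong
       exI[of _ Var] exI[of _ Q])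
    moreover have "scopes (map ?L cs1) = {}" by (auto simp: scopes_def)
    ultimately have exA: "exh P (map ?L cs1)" using exh_skip[of P "[]"] ex by simp
    have mg': "two_mgu (vars_trm t Un vars_goal A') t c \<alpha> \<beta>" by (rule two_mgu_subset[OF mg]) auto
    \<comment> \<open>The untried alternatives join \<open>Z\<close>. It is finiteness of the whole
      state that carries the induction, since the goal itself may grow.\<close>
    let ?Z = "map ?L cs2 @ Scope m # Z"
    have "rstep P S (case_goals P p ts A' m @ Z)" unfolding step(3) Cons Atom t using m Cons Atom by (intro rstep.r_case) auto
    moreover have "case_goals P p ts A' m @ Z = map ?L cs1 @ ?L c # ?Z" using sl t by (simp add: case_goals_def)
    ultimately have "rstep P S (map ?L cs1 @ ?L c # ?Z)" by simp
    moreover have "(rstep P)\<^sup>*\<^sup>* (map ?L cs1 @ ?L c # ?Z) (?L c # ?Z)" by (rule exh_context[OF exA])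
    moreover have "rstep P (?L c # ?Z) (Goal ?R # ?Z)" by (rule rstep.r_res[OF nh mg'])
    ultimately have "(rstep P)\<^sup>+\<^sup>+ S (Goal ?R # ?Z)"
     by (meson rtranclp_into_tranclp2 tranclp.trancl_into_trancl tranclp_rtranclp_tranclp tranclp.r_into_trancl)
    from step(2)[OF this refl nR] obtain \<delta>' where d: "admissible \<delta>'" "ans P ?R \<delta>'"
     "~ fin P [Goal (Q $g \<alpha> $g \<delta>')]" by blast
    let ?\<delta> = "%x. \<alpha> x $ \<delta>'"
    have "ans P (Atom (Fun p ts) # A') ?\<delta>" by (rule ans_Atom[of P p ts cs1 c cs2 m A' \<alpha> \<beta> \<delta>'])
      (use sl mm nh t mg' d(2) exh_siblings[OF exA _ nh] in auto)
    moreover have "admissible ?\<delta>" using admissible_comp[OF two_mguD(2)[OF mg] d(1)] .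
    ultimately show ?thesis using d(3) Cons Atom t by (auto simp: subst_goal_subst)
   qed
  qed
 qed
 thus ?thesis using assms by blast
qed

subsection \<open>Concrete computations\<close>

lemma vars_state_simps [simp]: "vars_state [] = {}"
 "vars_state (s # S) = set (sgoal_var_list s) Un vars_state S"
 "vars_state (S @ S') = vars_state S Un vars_state S'" by (auto simp: vars_state_def state_var_list_def)

lemma finite_vars_state [simp]: "finite (vars_state S)" by (simp add: vars_state_def)

definition glue :: "(var => var) => var set => 'f subst => 'f subst => 'f subst" where
 "glue \<rho> Y \<alpha> \<beta> = (%x. if x : \<rho> ` Y then \<beta> (inv_into Y \<rho> x) else \<alpha> x)"

lemma glue_left: "vars_trm t Int \<rho> ` Y = {} ==> t $ glue \<rho> Y \<alpha> \<beta> = t $ \<alpha>"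
 by (rule subst_trm_cong) (auto simp: glue_def)

lemma glue_right: "inj_on \<rho> Y ==> vars_trm t <= Y ==> t $ (Var \<circ> \<rho>) $ glue \<rho> Y \<alpha> \<beta> = t $ \<beta>"
 by (auto simp: subst_trm_subst glue_def subset_iff intro!: subst_trm_cong)

lemma head_vars: "vars_trm (head c) <= vars_clause c" and body_vars: "vars_goal (body c) <= vars_clause c" by (auto simp: vars_clause_def)

lemma renamed_apart_unifiable:
 assumes "renamed_apart c (Labeled (Atom t # Q) c m # S) c'"
 shows "unifiable t (head c') \<longleftrightarrow> matchable t c"
proof -
 from assms obtain \<rho> where r: "inj_on \<rho> (vars_clause c)"
  "\<rho> ` vars_clause c <= ordinary - vars_state (Labeled (Atom t # Q) c m # S)" "c' = subst_clause (Var \<circ> \<rho>) c"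
  by (auto simp: renamed_apart_def)
 have h: "head c' = head c $ (Var \<circ> \<rho>)" using r(3) by (simp add: subst_clause_def)
 show ?thesis
 proof
  assume "unifiable t (head c')"
  thus "matchable t c" unfolding unifiable_def matchable_def h subst_trm_subst by blast
 next
  assume "matchable t c"
  then obtain \<alpha> \<beta> where "t $ \<alpha> = head c $ \<beta>" by (auto simp: matchable_def)
  hence "t $ glue \<rho> (vars_clause c) \<alpha> \<beta> = head c' $ glue \<rho> (vars_clause c) \<alpha> \<beta>"
   unfolding h using r glue_right[OF r(1) head_vars] glue_left[of t \<rho> "vars_clause c" \<alpha> \<beta>] by (simp add: disjoint_iff subset_iff) blast
  thus "unifiable t (head c')" unfolding unifiable_def by blast
 qed
qed

lemma ordinary_not_hazard: "x : ordinary ==> x ~: hazards" using ordinary_hazards by blast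

text \<open>The concrete mgu is split into its action on the goal and its action on the renamed
  clause. Cutting \<alpha> down to ordinary variables makes it admissible, as nothing is known about
  \<sigma> on abstract ones.\<close>

lemma concrete_resolvent:
 assumes ra: "renamed_apart c (Labeled (Atom t # Q) c m # S) c'" and mg: "is_mgu \<sigma> t (head c')"
  and ord: "ALL x:ordinary. vars_trm (\<sigma> x) <= ordinary" "vars_trm t Un vars_goal Q <= ordinary"
 obtains \<alpha> \<beta> where "two_mgu (vars_trm t Un vars_goal Q) t c \<alpha> \<beta>"
  "(label_cuts m (body c') @ Q) $g \<sigma> = resolvent m c Q \<alpha> \<beta>"
  "vars_goal (resolvent m c Q \<alpha> \<beta>) <= ordinary"
proof -
 let ?Y = "vars_clause c"
 from ra obtain \<rho> where r: "inj_on \<rho> ?Y"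
  "\<rho> ` ?Y <= ordinary - vars_state (Labeled (Atom t # Q) c m # S)" "c' = subst_clause (Var \<circ> \<rho>) c"
  by (auto simp: renamed_apart_def)
 have h: "head c' = head c $ (Var \<circ> \<rho>)" "body c' = body c $g (Var \<circ> \<rho>)"
  using r(3) by (simp_all add: subst_clause_def)
 define \<alpha> where "\<alpha> = (%x. if x : ordinary then \<sigma> x else Var x)"
 define \<beta> where "\<beta> = (%y. if y : ?Y then \<sigma> (\<rho> y) else Var (NVar 0))"
 have ap: "x ~: \<rho> ` ?Y" if "x : vars_trm t Un vars_goal Q" for x using r(2) that by auto
 have bo: "vars_trm (\<beta> y) <= ordinary" for y
 proof (cases "y : ?Y")
  case True
  hence "\<rho> y : ordinary" using r(2) by auto
  thus ?thesis using ord(1) True by (simp add: \<beta>_def)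
 qed (simp add: \<beta>_def ordinary_def)
 have ad: "admissible \<alpha>" using ord(1) ordinary_not_hazard by (fastforce simp: admissible_def \<alpha>_def)
 have hb: "u $ (Var \<circ> \<rho>) $ \<sigma> = u $ \<beta>" if "vars_trm u <= ?Y" for u
  using that by (auto simp: subst_trm_subst \<beta>_def intro!: subst_trm_cong)
 have "t $ \<alpha> = t $ \<sigma>" using ord(2) by (auto simp: \<alpha>_def intro!: subst_trm_cong)
 also have "\<dots> = head c $ \<beta>" using mg hb[OF head_vars] by (simp add: is_mgu_def h)
 finally have eq: "t $ \<alpha> = head c $ \<beta>" .
 have gen: "EX \<delta>. (ALL x:vars_trm t Un vars_goal Q. \<alpha>' x = \<alpha> x $ \<delta>) & (ALL y:?Y. \<beta>' y = \<beta> y $ \<delta>)"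
  if u: "t $ \<alpha>' = head c $ \<beta>'" for \<alpha>' \<beta>'
 proof -
  have "t $ glue \<rho> ?Y \<alpha>' \<beta>' = head c' $ glue \<rho> ?Y \<alpha>' \<beta>'"
   unfolding h using u glue_right[OF r(1) head_vars] glue_left[of t \<rho> ?Y \<alpha>' \<beta>'] ap by (simp add: disjoint_iff)
  then obtain \<delta> where d: "glue \<rho> ?Y \<alpha>' \<beta>' = subst_comp \<sigma> \<delta>" using mg by (auto simp: is_mgu_def)
  have "\<alpha>' x = \<alpha> x $ \<delta>" if "x : vars_trm t Un vars_goal Q" for x
  proof -
   have "\<alpha>' x = glue \<rho> ?Y \<alpha>' \<beta>' x" using ap[OF that] by (simp add: glue_def)
   thus ?thesis using d that ord(2) by (auto simp: subst_comp_def \<alpha>_def)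
  qed
  moreover have "\<beta>' y = \<beta> y $ \<delta>" if "y : ?Y" for y
  proof -
   have "\<beta>' y = glue \<rho> ?Y \<alpha>' \<beta>' (\<rho> y)" using that r(1) by (simp add: glue_def)
   thus ?thesis using d that by (simp add: subst_comp_def \<beta>_def)
  qed
  ultimately show ?thesis by blast
 qed
 have bh: "vars_trm (\<beta> y) Int hazards = {}" for y using bo[of y] ordinary_not_hazard by blast
 have t1: "two_mgu (vars_trm t Un vars_goal Q) t c \<alpha> \<beta>" unfolding two_mgu_def using eq gen ad bh by blast
 have b: "body c' $g \<sigma> = body c $g \<beta>" using body_vars[of c] by (auto simp: h subst_goal_subst subst_goal_eq_iff \<beta>_def)
 moreover have q: "Q $g \<sigma> = Q $g \<alpha>" using ord(2) by (auto simp: subst_goal_eq_iff \<alpha>_def)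
 ultimately have t2: "(label_cuts m (body c') @ Q) $g \<sigma> = resolvent m c Q \<alpha> \<beta>"
  by (simp add: resolvent_def subst_goal_label_cuts)
 have "vars_goal (resolvent m c Q \<alpha> \<beta>) <= ordinary"
 proof -
  have "vars_trm (\<alpha> x) <= ordinary" if "x : vars_goal Q" for x
  proof -
   have "x : ordinary" using that ord(2) by blast
   thus ?thesis using ord(1) by (simp add: \<alpha>_def)
  qed
  thus ?thesis using bo by (auto simp: resolvent_def vars_goal_subst)
 qed
 thus thesis using that t1 t2 by blast
qed

lemma Scope_split: "Scope m ~: set S1 ==> dropWhile (%g. g ~= Scope m) (S1 @ Scope m # S2) = Scope m # S2"
 by (simp add: dropWhile_Scope_append)

lemma step_rstep:
 assumes "step P S S'" "vars_state S <= ordinary"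
 shows "rstep P S S' & vars_state S' <= ordinary" using assms
proof (induction rule: step.induct)
 case (Suc_step S)
 thus ?case by (auto intro: rstep.r_suc)
next
 case (Fail_step m S)
 thus ?case by (auto intro: rstep.r_fail)
next
 case (Cut_scope_step m S Q S')
 thus ?case using rstep.r_cut[of P m Q "S @ Scope m # S'"] by (simp add: Scope_split)
next
 case (Cut_all_step m S Q)
 thus ?case using rstep.r_cut[of P m Q S] by (simp add: dropWhile_Scope_notin)
next
 case (Case_step m p ts Q S)
 have "vars_state (case_goals P p ts Q m) <= vars_trm (Fun p ts) Un vars_goal Q"
  by (auto simp: case_goals_def vars_state_def state_var_list_def)
 thus ?case using Case_step by (auto intro: rstep.r_case)
next
 case (Eval_step c t Q m S c' \<sigma>)
 have "vars_trm t Un vars_goal Q <= ordinary" using Eval_step(4) by auto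
 then obtain \<alpha> \<beta> where *: "two_mgu (vars_trm t Un vars_goal Q) t c \<alpha> \<beta>"
  "(label_cuts m (body c') @ Q) $g \<sigma> = resolvent m c Q \<alpha> \<beta>"
  "vars_goal (resolvent m c Q \<alpha> \<beta>) <= ordinary" using concrete_resolvent[OF Eval_step(1-3)] by blast
 have "~ hazardous t" using Eval_step(4) ordinary_not_hazard by (auto simp: hazardous_def)
 thus ?case unfolding *(2) using rstep.r_res * Eval_step(4) by auto
next
 case (Backtrack_step c t Q m S c')
 hence "~ matchable t c" using renamed_apart_unifiable by blast
 thus ?case using Backtrack_step by (auto intro: rstep.r_drop)
qed

lemma renamed_apart_ex: "EX c'. renamed_apart c S c'"
proof -
 have "infinite (ordinary - vars_state S)" using infinite_ordinary by (simp add: Diff_infinite_finite)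
 then obtain C where C: "C <= ordinary - vars_state S" "finite C" "card C = card (vars_clause c)"
  using infinite_arbitrarily_large[of "ordinary - vars_state S" "card (vars_clause c)"] by auto
 then obtain \<rho> where "bij_betw \<rho> (vars_clause c) C" using finite_same_card_bij[of "vars_clause c" C] by auto
 thus ?thesis using C(1) unfolding renamed_apart_def bij_betw_def by blast
qed

text \<open>Existence of some concrete step is enough: that step is itself a renaming-free one, and
  all of these are similar.\<close>

lemma rstep_step:
 fixes P :: "'f clause list"
 assumes "rstep P S S'" "vars_state S <= ordinary"
 shows "EX S''. step P S S''" using assms
proof (induction rule: rstep.induct)
 case (r_cut m Q S)
 show ?case
 proof (cases "Scope m : set S")
  case True
  then obtain S1 S2 where "S = S1 @ Scope m # S2" "Scope m ~: set S1" by (meson split_list_first)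
  thus ?thesis using Cut_scope_step by blast
 next
  case False
  thus ?thesis using Cut_all_step by blast
 qed
next
 case (r_hvar x Q S)
 thus ?case using ordinary_not_hazard by auto
next
 case (r_drop t c Q m S)
 obtain c' where c': "renamed_apart c (Labeled (Atom t # Q) c m # S) c'" using renamed_apart_ex by blast
 have "~ hazardous t" using r_drop(2) ordinary_not_hazard by (auto simp: hazardous_def)
 hence "~ unifiable t (head c')" using r_drop(1) renamed_apart_unifiable[OF c'] by blast
 thus ?case using Backtrack_step c' by blast
next
 case (r_res t Q c \<alpha> \<beta> m S)
 obtain c' where c': "renamed_apart c (Labeled (Atom t # Q) c m # S) c'" using renamed_apart_ex by blast
 hence "vars_trm (head c') <= ordinary" using head_vars[of c] by (fastforce simp: renamed_apart_def subst_clause_def vars_trm_subst)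
 moreover have "vars_trm t <= ordinary" using r_res(3) by auto
 moreover have "unifiable t (head c')" using renamed_apart_unifiable[OF c'] two_mgu_matchable[OF r_res(2)] by blast
 then obtain \<theta> where "t $ \<theta> = head c' $ \<theta>" by (auto simp: unifiable_def)
 then obtain \<sigma> where s: "t $ \<sigma> = head c' $ \<sigma>"
  "!!\<gamma> x. map_trm id t $ \<gamma> = map_trm id (head c') $ \<gamma> ==> map_trm id (\<sigma> x) $ \<gamma> = \<gamma> x"
  "!!x. x ~: vars_trm t Un vars_trm (head c') ==> \<sigma> x = Var x"
  "!!x. x : vars_trm t Un vars_trm (head c') ==> vars_trm (\<sigma> x) <= vars_trm t Un vars_trm (head c')"
  by (rule relevant_mgu_exists[where e = id]) blast
 have "is_mgu \<sigma> t (head c')" unfolding is_mgu_def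
 proof (intro conjI allI impI)
  fix \<gamma> :: "'f subst" assume "t $ \<gamma> = head c' $ \<gamma>"
  hence "\<gamma> = subst_comp \<sigma> \<gamma>" using s(2)[of \<gamma>] by (simp add: trm.map_id subst_comp_def fun_eq_iff)
  thus "EX \<delta>. \<gamma> = subst_comp \<sigma> \<delta>" by blast
 qed (rule s(1))
 moreover have "ALL x:ordinary. vars_trm (\<sigma> x) <= ordinary"
 proof
  fix x :: var assume "x : ordinary"
  thus "vars_trm (\<sigma> x) <= ordinary" using s(3,4)[of x] calculation(1,2) by (cases "x : vars_trm t Un vars_trm (head c')") auto
 qed
 ultimately show ?case using Eval_step c' by blast
next
 case (r_case m p ts Q S)
 thus ?case using Case_step[OF r_case(1)] by blast
qed (auto intro: step.intros)

lemma terminates_iff_fin: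
 assumes "vars_state S <= ordinary"
 shows "terminates P S \<longleftrightarrow> fin P S"
proof
 assume "fin P S"
 thus "terminates P S" using assms
 proof (induction rule: fin_induct)
  case (step S)
  show ?case unfolding terminates_def
  proof
   assume "EX f. f 0 = S & (ALL i. Defs.step P (f i) (f (Suc i)))"
   then obtain f where f: "f 0 = S" "!!i. Defs.step P (f i) (f (Suc i))" by blast
   hence "rstep P S (f 1)" "vars_state (f 1) <= ordinary" using step_rstep[of P S "f 1"] step(3) f(2)[of 0] by auto
   hence "terminates P (f 1)" using step(2) by blast
   moreover have "EX g. g 0 = f 1 & (ALL i. Defs.step P (g i) (g (Suc i)))" using f(2) by (intro exI[of _ "%i. f (Suc i)"]) simp
   ultimately show False unfolding terminates_def by blast
  qed
 qed
next
 assume t: "terminates P S"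
 show "fin P S"
 proof (rule ccontr)
  assume nf: "~ fin P S"
  let ?I = "%S. ~ fin P S & vars_state S <= ordinary"
  have "EX S'. step P S S' & ?I S'" if "?I S" for S
  proof -
   from that have nf: "~ fin P S" and vo: "vars_state S <= ordinary" by blast+
   obtain T where "rstep P S T" using not_fin_ex[OF nf] by blast
   then obtain S' where S': "step P S S'" using rstep_step vo by blast
   hence "rstep P S S'" "vars_state S' <= ordinary" using step_rstep[OF _ vo] by blast+
   thus ?thesis using S' not_fin_step[OF nf] by blast
  qed
  then obtain F where F: "!!S. ?I S ==> step P S (F S) & ?I (F S)" by metis
  define f where "f = rec_nat S (%_. F)"
  have I: "?I (f i)" for i by (induction i) (use nf assms F in \<open>auto simp: f_def\<close>)
  hence "!!i. step P (f i) (f (Suc i))" using F by (simp add: f_def)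
  moreover have "f 0 = S" by (simp add: f_def)
  ultimately show False using t by (auto simp: terminates_def)
 qed
qed

subsection \<open>Definite programs\<close>

definition definite :: "'f clause list => bool" where
 "definite C \<longleftrightarrow> (ALL c:set C. (EX f us. head c = Fun f us) & (ALL l:set (body c). EX f us. l = Atom (Fun f us)))"

text \<open>Proof trees whose atoms need not be ground: the atom itself, not merely some instance,
  is derivable.\<close>

inductive tree :: "'f clause list => 'f trm => bool" for C where
 "c : set C ==> (!!t. Atom t : set (body c) ==> tree C (t $ \<theta>)) ==> tree C (head c $ \<theta>)"

lemma tree_inst: "tree C A ==> tree C (A $ \<eta>)"
proof (induction rule: tree.induct)
 case (1 c \<theta>)
 hence "tree C (head c $ (%x. \<theta> x $ \<eta>))" by (intro tree.intros) (auto simp: subst_trm_subst)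
 thus ?case by (simp add: subst_trm_subst)
qed

text \<open>The caller may be instantiated arbitrarily and no mgu is required, so that calls can be
  read off from any instance of a clause with derivable earlier body atoms.\<close>

definition calls :: "'f clause list => 'f trm => 'f trm => bool" where
 "calls C A B \<longleftrightarrow> (EX c:set C. EX \<theta> \<eta> bs1 b bs2. A $ \<eta> = head c $ \<theta> & body c = map Atom (bs1 @ b # bs2) &
   (ALL b':set bs1. tree C (b' $ \<theta>)) & B = b $ \<theta>)"

definition accessible :: "'f clause list => 'f trm => bool" where
 "accessible C A \<longleftrightarrow> Wellfounded.accp (%B A. calls C A B) A"

lemma accessibleI: "(!!B. calls C A B ==> accessible C B) ==> accessible C A" unfolding accessible_def by (rule accp.intros)

lemma accessible_calls: "accessible C A ==> calls C A B ==> accessible C B" unfolding accessible_def by (rule accp_downward)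

lemma calls_inst: "calls C (A $ \<eta>) B ==> calls C A B" unfolding calls_def subst_trm_subst by blast

lemma accessible_inst: "accessible C A ==> accessible C (A $ \<eta>)" by (rule accessibleI) (blast intro: accessible_calls calls_inst)

lemma accessible_induct [consumes 1, case_names step]:
 assumes "accessible C A" "!!A. accessible C A ==> (!!B. calls C A B ==> R B) ==> R A"
 shows "R A" using assms(1) unfolding accessible_def
proof (induction rule: accp.induct)
 case (accI A)
 have "accessible C A" by (rule accessibleI) (use accI in \<open>simp add: accessible_def\<close>)
 thus ?case using assms(2) accI(2) by blast
qed

text \<open>The invariant of an infinite computation: the atoms before \<open>b\<close> can be
  solved, and from \<open>b\<close> an endless chain of calls starts.\<close>

definition bad_atoms :: "'f clause list => 'f trm list => bool" where
 "bad_atoms C us \<longleftrightarrow> (EX us1 b us2. us = us1 @ b # us2 & (ALL u:set us1. tree C u) & ~ accessible C b)"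

fun bad_sgoal :: "'f clause list => 'f sgoal => bool" where
 "bad_sgoal C (Goal Q) \<longleftrightarrow> (EX \<theta> us. Q = map Atom us & bad_atoms C (map (subst_trm \<theta>) us))"
| "bad_sgoal C (Labeled Q c m) \<longleftrightarrow> (EX \<theta> \<eta> t us bs. Q = Atom t # map Atom us & body c = map Atom bs &
   t $ \<theta> = head c $ \<eta> & bad_atoms C (map (subst_trm \<eta>) bs @ map (subst_trm \<theta>) us))"
| "bad_sgoal C (Scope m) \<longleftrightarrow> False"

definition pure_goal :: "'f goal => bool" where
 "pure_goal Q \<longleftrightarrow> (ALL l:set Q. EX f us. l = Atom (Fun f us)) & vars_goal Q Int hazards = {}"

fun pure_sgoal :: "'f clause list => 'f sgoal => bool" where
 "pure_sgoal C (Goal Q) \<longleftrightarrow> pure_goal Q"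
| "pure_sgoal C (Labeled Q c m) \<longleftrightarrow> pure_goal Q & Q ~= [] & c : set C"
| "pure_sgoal C (Scope m) \<longleftrightarrow> True"

lemma pure_goal_Cons: "pure_goal (l # Q) \<longleftrightarrow> (EX f us. l = Atom (Fun f us) & ~ hazardous (Fun f us)) & pure_goal Q"
 unfolding pure_goal_def hazardous_def by (auto simp: Int_Un_distrib2 simp del: vars_trm_Fun var_list.simps)

text \<open>If the first atom is the inaccessible one, one of its inaccessible callees names the
  clause; otherwise the root of its proof tree does.\<close>

lemma bad_goal_labeled:
 assumes "bad_sgoal C (Goal (Atom t # Q))" "definite C"
 obtains c where "c : set C" "bad_sgoal C (Labeled (Atom t # Q) c m)"
proof -
 from assms(1) obtain \<theta> us where Q: "Q = map Atom us" and b: "bad_atoms C (t $ \<theta> # map (subst_trm \<theta>) us)"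
  by (auto simp: Cons_eq_map_conv)
 from b obtain us1 b us2 where u: "t $ \<theta> # map (subst_trm \<theta>) us = us1 @ b # us2" "ALL u:set us1. tree C u" "~ accessible C b"
  by (auto simp: bad_atoms_def)
 show thesis
 proof (cases us1)
  case Nil
  hence "~ accessible C (t $ \<theta>)" using u by simp
  then obtain B where B: "calls C (t $ \<theta>) B" "~ accessible C B" using accessibleI by blast
  from B(1) obtain c \<theta>' \<eta> bs1 d bs2 where c: "c : set C" "t $ \<theta> $ \<eta> = head c $ \<theta>'" "body c = map Atom (bs1 @ d # bs2)"
   "ALL b':set bs1. tree C (b' $ \<theta>')" "B = d $ \<theta>'" by (auto simp: calls_def)
  have "bad_atoms C (map (subst_trm \<theta>') (bs1 @ d # bs2) @ map (subst_trm (%x. \<theta> x $ \<eta>)) us)" unfolding bad_atoms_def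
   by (intro exI[of _ "map (subst_trm \<theta>') bs1"] exI[of _ B]
     exI[of _ "map (subst_trm \<theta>') bs2 @ map (subst_trm (%x. \<theta> x $ \<eta>)) us"]) (use c B in auto)
  moreover have "t $ (%x. \<theta> x $ \<eta>) = head c $ \<theta>'" using c(2) by (simp add: subst_trm_subst)
  ultimately have "bad_sgoal C (Labeled (Atom t # Q) c m)" unfolding bad_sgoal.simps using Q c(3)
   by (intro exI[of _ "%x. \<theta> x $ \<eta>"] exI[of _ \<theta>'] exI[of _ t] exI[of _ us] exI[of _ "bs1 @ d # bs2"]) simp
  thus thesis using that c(1) by blast
 next
  case (Cons a us1')
  hence "tree C (t $ \<theta>)" and us: "map (subst_trm \<theta>) us = us1' @ b # us2" using u by auto
  then obtain c \<theta>' where c: "c : set C" "t $ \<theta> = head c $ \<theta>'" "!!t. Atom t : set (body c) ==> tree C (t $ \<theta>')"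
   by (auto elim: tree.cases)
  have "EX bs. body c = map Atom bs" using assms(2) c(1) unfolding definite_def by (metis ex_map_conv)
  then obtain bs where bs: "body c = map Atom bs" by blast
  have "bad_atoms C (map (subst_trm \<theta>') bs @ map (subst_trm \<theta>) us)" unfolding bad_atoms_def us
   by (intro exI[of _ "map (subst_trm \<theta>') bs @ us1'"] exI[of _ b] exI[of _ us2]) (use c(3) bs u Cons in auto)
  hence "bad_sgoal C (Labeled (Atom t # Q) c m)" using Q c(2) bs by auto
  thus thesis using that c(1) by blast
 qed
qed

text \<open>Lifting: the substitutions witnessing badness unify the atom with the clause head and
  hence factor through the mgu.\<close>

lemma bad_labeled_resolvent:
 assumes "bad_sgoal C (Labeled (Atom t # Q) c m)" "two_mgu (vars_trm t Un vars_goal Q) t c \<alpha> \<beta>"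
 shows "bad_sgoal C (Goal (resolvent m c Q \<alpha> \<beta>))"
proof -
 from assms(1) obtain \<theta> \<eta> us bs where a: "Q = map Atom us" "body c = map Atom bs"
  "t $ \<theta> = head c $ \<eta>" "bad_atoms C (map (subst_trm \<eta>) bs @ map (subst_trm \<theta>) us)" by auto
 obtain \<delta> where d: "!!x. x : vars_trm t Un vars_goal Q ==> \<theta> x = \<alpha> x $ \<delta>"
  "!!y. y : vars_clause c ==> \<eta> y = \<beta> y $ \<delta>" using two_mgu_factor[OF assms(2) a(3)] by blast
 have vu: "vars_trm u <= vars_goal Q" if "u : set us" for u using that unfolding a(1) by (induction us) auto
 have vb: "vars_trm u <= vars_clause c" if "u : set bs" for u
 proof -
  have "vars_trm u <= vars_goal (map Atom bs :: (unit, _) lit list)" using that by (induction bs) auto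
  thus ?thesis using body_vars[of c] a(2) by auto
 qed
 have "map (subst_trm \<eta>) bs = map (subst_trm \<delta>) (map (subst_trm \<beta>) bs)"
  using d(2) vb by (auto simp: subst_trm_subst intro!: subst_trm_cong)
 moreover have "map (subst_trm \<theta>) us = map (subst_trm \<delta>) (map (subst_trm \<alpha>) us)"
  using d(1) vu by (auto simp: subst_trm_subst intro!: subst_trm_cong)
 moreover have "resolvent m c Q \<alpha> \<beta> = map Atom (map (subst_trm \<beta>) bs @ map (subst_trm \<alpha>) us)"
  by (simp add: resolvent_def a(1,2) subst_goal_def label_cuts_def trm.map_id)
 ultimately show ?thesis using a(4) unfolding bad_sgoal.simps by (metis map_append)
qed

lemma pure_resolvent:
 assumes "pure_goal (Atom t # Q)" "c : set C" "definite C" "two_mgu V t c \<alpha> \<beta>"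
 shows "pure_goal (resolvent m c Q \<alpha> \<beta>)"
proof -
 have ad: "admissible \<alpha>" "!!y. vars_trm (\<beta> y) Int hazards = {}" using two_mguD[OF assms(4)] by auto
 have "vars_trm (\<alpha> x) Int hazards = {}" if "x : vars_goal Q" for x
  using that assms(1) ad(1) by (auto simp: pure_goal_def admissible_def)
 hence "vars_goal (resolvent m c Q \<alpha> \<beta>) Int hazards = {}" using ad(2) by (auto simp: resolvent_def vars_goal_subst)
 moreover have "ALL l:set (resolvent m c Q \<alpha> \<beta>). EX f us. l = Atom (Fun f us)"
  using assms(1,2,3) by (fastforce simp: resolvent_def pure_goal_def definite_def subst_goal_def label_cuts_def)
 ultimately show ?thesis by (simp add: pure_goal_def)
qed

text \<open>The bad goal need not come first. Without cuts nothing is pruned, so a step either turns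
  a bad goal into a bad goal or leaves it in the state until its turn comes.\<close>

lemma bad_state_step:
 assumes "definite C" "ALL s:set S. pure_sgoal C s" "EX s:set S. bad_sgoal C s"
 shows "EX T. rstep C S T & (ALL s:set T. pure_sgoal C s) & (EX s:set T. bad_sgoal C s)"
proof -
 from assms(3) obtain s S1 where S: "S = s # S1" by (cases S) auto
 have pS1: "ALL s:set S1. pure_sgoal C s" using assms(2) S by simp
 show ?thesis
 proof (cases s)
  case (Scope m)
  thus ?thesis using assms S by (intro exI[of _ S1]) (auto intro: rstep.r_fail)
 next
  case (Labeled Q c m)
  then obtain t Q' where Q: "Q = Atom t # Q'" "~ hazardous t" and c: "c : set C" using assms(2) S by (cases Q) (auto simp: pure_goal_Cons)
  show ?thesis
  proof (cases "matchable t c")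
   case True
   let ?V = "vars_trm t Un vars_goal Q'"
   obtain \<alpha> \<beta> where mg: "two_mgu ?V t c \<alpha> \<beta>" using two_mgu_ex[OF True Q(2), of ?V] by auto
   have "bad_sgoal C (Goal (resolvent m c Q' \<alpha> \<beta>)) \<or> (EX s:set S1. bad_sgoal C s)"
    using assms(3) bad_labeled_resolvent[OF _ mg, of C m] unfolding S Labeled Q by (auto simp del: bad_sgoal.simps)
   moreover have "pure_goal (resolvent m c Q' \<alpha> \<beta>)" using pure_resolvent[OF _ c assms(1) mg] assms(2) S Labeled Q by simp
   moreover have "rstep C S (Goal (resolvent m c Q' \<alpha> \<beta>) # S1)" unfolding S Labeled Q using Q(2) mg by (rule rstep.r_res)
   ultimately show ?thesis using pS1 by (intro exI[of _ "Goal (resolvent m c Q' \<alpha> \<beta>) # S1"]) auto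
  next
   case False
   hence "~ bad_sgoal C s" unfolding Labeled Q by (auto simp: matchable_def)
   moreover have "rstep C S S1" unfolding S Labeled Q using False by (intro rstep.r_drop) simp
   ultimately show ?thesis using assms(3) pS1 S by auto
  qed
 next
  case (Goal Q)
  show ?thesis
  proof (cases Q)
   case Nil
   hence "~ bad_sgoal C s" unfolding Goal by (auto simp: bad_atoms_def)
   moreover have "rstep C S S1" unfolding S Goal Nil by (rule rstep.r_suc)
   ultimately show ?thesis using assms(3) pS1 S by auto
  next
   case (Cons l Q')
   then obtain p ts where l: "l = Atom (Fun p ts)" "~ hazardous (Fun p ts)" "pure_goal Q'"
    using assms(2) S Goal by (auto simp: pure_goal_Cons)
   obtain m where m: "m ~: marks_state S" using ex_new_if_finite[OF infinite_UNIV_nat finite_marks_state] by blast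
   let ?T = "case_goals C p ts Q' m @ S1"
   have st: "rstep C S ?T" unfolding S Goal Cons l(1) by (rule rstep.r_case) (use m S Goal Cons l in simp)
   have pq: "pure_goal (Atom (Fun p ts) # Q')" using l by (simp add: pure_goal_Cons)
   have pu: "ALL s:set ?T. pure_sgoal C s" using pS1 pq by (auto simp: case_goals_def slice_def)
   have "EX s:set ?T. bad_sgoal C s"
   proof (cases "bad_sgoal C s")
    case True
    then obtain c where c: "c : set C" "bad_sgoal C (Labeled (Atom (Fun p ts) # Q') c m)"
     using bad_goal_labeled[OF _ assms(1)] Goal Cons l(1) by blast
    obtain f us where h: "head c = Fun f us" using assms(1) c(1) by (auto simp: definite_def)
    moreover obtain \<theta> \<eta> where "Fun p ts $ \<theta> = head c $ \<eta>" using c(2) by auto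
    ultimately have "f = p" "length us = length ts" by (auto dest: map_eq_imp_length_eq)
    hence "c : set (slice C p (length ts))" using c(1) h by (auto simp: slice_def)
    thus ?thesis using c(2) by (intro bexI[of _ "Labeled (Atom (Fun p ts) # Q') c m"]) (auto simp: case_goals_def)
   next
    case False
    thus ?thesis using assms(3) S by auto
   qed
   thus ?thesis using st pu by blast
  qed
 qed
qed

text \<open>Converts termination into well-founded calls: a query with an endless chain of calls is
  a bad goal, and a state with a bad goal can always be continued by another one.\<close>

lemma accessible_query:
 assumes "definite C" "query_terminates C (Fun f us)" "vars_trm (Fun f us) <= ordinary"
 shows "accessible C (Fun f us)"
proof (rule ccontr)
 assume na: "~ accessible C (Fun f us)"
 have "fin C S ==> ~ ((ALL s:set S. pure_sgoal C s) & (EX s:set S. bad_sgoal C s))" for S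
  by (induction rule: fin_induct) (use bad_state_step[OF assms(1)] in blast)
 moreover have "fin C [Goal [Atom (Fun f us)]]"
  using assms(2,3) terminates_iff_fin[of "[Goal [Atom (Fun f us)]]" C] by (simp add: query_terminates_def)
 moreover have "pure_sgoal C (Goal [Atom (Fun f us)])" using assms(3) ordinary_not_hazard by (auto simp: pure_goal_def)
 moreover have "bad_sgoal C (Goal [Atom (Fun f us)])" unfolding bad_sgoal.simps using na by (intro exI[of _ Var] exI[of _ "[Fun f us]"])
   (auto simp: bad_atoms_def map_idI intro!: exI[of _ "[]"] exI[of _ "Fun f us"])
 ultimately show False by fastforce
qed

subsection \<open>Answers and groundness\<close>

abbreviation emb_trm :: "'f trm => 'f option trm" where
 "emb_trm \<equiv> map_trm Some"

primrec emb_lit :: "('c, 'f) lit => ('c, 'f option) lit" where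
 "emb_lit (Cut m) = Cut m"
| "emb_lit (Atom t) = Atom (emb_trm t)"

abbreviation emb_goal :: "('c, 'f) lit list => ('c, 'f option) lit list" where
 "emb_goal \<equiv> map emb_lit"

abbreviation emb_clause :: "'f clause => 'f option clause" where
 "emb_clause \<equiv> map_clause Some"

abbreviation marker :: "'f option trm list => (nat, 'f option) lit" where
 "marker us \<equiv> Atom (Fun None us)"

lemma emb_lit_subst: "emb_lit (subst_lit \<sigma> l) = subst_lit (%x. emb_trm (\<sigma> x)) (emb_lit l)"
 by (cases l) (auto simp: map_trm_subst)

lemma emb_goal_subst: "emb_goal (Q $g \<sigma>) = emb_goal Q $g (%x. emb_trm (\<sigma> x))" by (induction Q) (auto simp: emb_lit_subst)

lemma emb_label_cuts: "emb_goal (label_cuts m B) = label_cuts m (emb_goal B)"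
proof -
 have "emb_lit (map_lit (%_. m) id l) = map_lit (%_. m) id (emb_lit l)" for l :: "(unit, 'a) lit" by (cases l) (auto simp: trm.map_id)
 thus ?thesis unfolding label_cuts_def by (simp only: map_map comp_def)
qed

lemma emb_clause_sel: "head (emb_clause c) = emb_trm (head c)" "body (emb_clause c) = emb_goal (body c)"
proof -
 have "map_lit id Some l = emb_lit l" for l :: "(unit, 'a) lit" by (cases l) auto
 thus "head (emb_clause c) = emb_trm (head c)" "body (emb_clause c) = emb_goal (body c)" by (cases c; simp)+
qed

lemma goal_var_list_emb [simp]: "goal_var_list (emb_goal Q) = goal_var_list Q"
proof (induction Q)
 case (Cons l Q) thus ?case by (cases l) (auto simp del: var_list.simps)
qed simp

lemma emb_resolvent:
 "resolvent m (emb_clause c) (emb_goal Q @ K) (%x. emb_trm (\<alpha> x)) (%x. emb_trm (\<beta> x)) =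
  emb_goal (resolvent m c Q \<alpha> \<beta>) @ K $g (%x. emb_trm (\<alpha> x))"
 by (simp add: resolvent_def emb_clause_sel emb_goal_subst emb_label_cuts)

lemma marks_emb_goal [simp]: "marks_goal (emb_goal Q) = marks_goal Q"
proof (induction Q)
 case (Cons l Q) thus ?case by (cases l) auto
qed simp

lemma matchable_emb: "matchable (emb_trm t) (emb_clause c) \<longleftrightarrow> matchable t c"
proof
 assume "matchable (emb_trm t) (emb_clause c)"
 then obtain \<alpha> \<beta> where "emb_trm t $ \<alpha> = emb_trm (head c) $ \<beta>" by (auto simp: matchable_def emb_clause_sel)
 from arg_cong[OF this, of "map_trm (inv Some)"]
 have "t $ (%x. map_trm (inv Some) (\<alpha> x)) = head c $ (%x. map_trm (inv Some) (\<beta> x))" by (simp add: map_trm_subst map_trm_inv)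
 thus "matchable t c" unfolding matchable_def by blast
next
 assume "matchable t c"
 then obtain \<alpha> \<beta> where "t $ \<alpha> = head c $ \<beta>" by (auto simp: matchable_def)
 from arg_cong[OF this, of emb_trm]
 have "emb_trm t $ (%x. emb_trm (\<alpha> x)) = head (emb_clause c) $ (%x. emb_trm (\<beta> x))"
  by (simp add: map_trm_subst emb_clause_sel)
 thus "matchable (emb_trm t) (emb_clause c)" unfolding matchable_def by blast
qed

lemma hazardous_emb [simp]: "hazardous (emb_trm t) \<longleftrightarrow> hazardous t" by (simp add: hazardous_def)

lemma slice_emb: "slice (map emb_clause P) (Some p) n = map emb_clause (slice P p n)"
proof -
 have "(EX ts. emb_trm h = Fun (Some p) ts & length ts = n) \<longleftrightarrow> (EX ts. h = Fun p ts & length ts = n)" for h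
  by (cases h) auto
 thus ?thesis by (induction P) (auto simp: slice_def emb_clause_sel)
qed

lemma slice_None: "slice (map emb_clause P) None n = []"
proof -
 have "emb_trm h ~= Fun None ts" for h ts by (cases h) auto
 thus ?thesis unfolding slice_def filter_empty_conv by (auto simp: emb_clause_sel)
qed

lemma two_mgu_emb_ex:
 fixes t :: "'f trm"
 assumes "matchable t c" "~ hazardous t" "finite V"
 obtains \<alpha> \<beta> where "two_mgu V t c \<alpha> \<beta>"
  "two_mgu V (emb_trm t) (emb_clause c) (%x. emb_trm (\<alpha> x)) (%x. emb_trm (\<beta> x))"
proof -
 have "vars_trm t <= - hazards" using assms(2) by (auto simp: hazardous_def)
 moreover have "- hazards Int hazards = {}" by simp
 moreover have "inj (Some :: 'f => _)" by simp
 ultimately have "EX \<alpha> \<beta>. two_mgu V t c \<alpha> \<beta> &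
   two_mgu V (emb_trm t) (emb_clause c) (%x. emb_trm (\<alpha> x)) (%x. emb_trm (\<beta> x))"
  using two_mgu_exists[OF _ assms infinite_nonhazards, of Some] by blast
 thus thesis using that by blast
qed

text \<open>Appending a marker to every goal: no clause applies to the marker.\<close>

fun marked :: "'f option sgoal => 'f sgoal => bool" where
 "marked (Goal Q1) (Goal Q) \<longleftrightarrow> (EX A us. Q1 = emb_goal A @ [marker us] & variant (Goal A) (Goal Q))"
| "marked (Labeled Q1 c1 m1) (Labeled Q c m) \<longleftrightarrow> (EX A us. Q1 = emb_goal A @ [marker us] &
   variant (Goal A) (Goal Q)) & c1 = emb_clause c & m1 = m"
| "marked (Scope m1) (Scope m) \<longleftrightarrow> m1 = m"
| "marked _ _ \<longleftrightarrow> False"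

lemma marked_Scope_iff: "marked s t ==> s = Scope m \<longleftrightarrow> t = Scope m" by (cases "(s, t)" rule: marked.cases) auto

text \<open>The case analysis of the marker has no alternatives and consists of a scope marker
  only.\<close>

lemma exh_marker:
 assumes "exh (map emb_clause P) X"
 shows "exh (map emb_clause P) (Goal [marker us] # X)"
proof -
 let ?P = "map emb_clause P"
 obtain m where m: "m ~: marks_state (Goal [marker us] # X)" using ex_new_if_finite[OF infinite_UNIV_nat finite_marks_state] by blast
 have "lstep ?P (Goal [marker us] # X) (case_goals ?P None us [] m @ X)" using rstep.r_case[OF m] by (simp add: lstep_def)
 hence "lstep ?P (Goal [marker us] # X) (Scope m # X)" by (simp add: case_goals_Nil_simp slice_None)
 moreover have "lstep ?P (Scope m # X) X" by (simp add: lstep_def rstep.r_fail)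
 ultimately show ?thesis using assms exh_ex by blast
qed

lemma variant_Goal_Cons:
 assumes "variant (Goal A) (Goal (Atom t # Q))"
 obtains t' A' \<phi> \<psi> where "A = Atom t' # A'" "admissible \<phi>" "admissible \<psi>" "t = t' $ \<phi>" "Q = A' $g \<phi>"
  "t' = t $ \<psi>" "A' = Q $g \<psi>"
proof -
 obtain \<phi> \<psi> where p: "admissible \<phi>" "admissible \<psi>" "Atom t # Q = A $g \<phi>" "A $g \<phi> $g \<psi> = A"
  using variant_GoalD[OF assms] by auto
 hence A: "A = (Atom t # Q) $g \<psi>" by simp
 have e: "A = Atom (t $ \<psi>) # Q $g \<psi>" using A by simp
 hence "Atom t # Q = (Atom (t $ \<psi>) # Q $g \<psi>) $g \<phi>" using p(3) by simp
 hence "t = t $ \<psi> $ \<phi>" "Q = Q $g \<psi> $g \<phi>" by simp_all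
 thus thesis using that[of "t $ \<psi>" "Q $g \<psi>" \<phi> \<psi>] e p by blast
qed

lemma variant_Cut_Cons:
 assumes "variant (Goal A) (Goal (Cut m # Q))"
 obtains A' where "A = Cut m # A'" "variant (Goal A') (Goal Q)"
proof -
 obtain \<phi> \<psi> where p: "admissible \<phi>" "admissible \<psi>" "Cut m # Q = A $g \<phi>" "A $g \<phi> $g \<psi> = A"
  using variant_GoalD[OF assms] by auto
 hence A: "A = Cut m # Q $g \<psi>" by (metis subst_goal_simps(2) subst_lit.simps(1))
 hence "Q = Q $g \<psi> $g \<phi>" using p(3) by simp
 hence "variant (Goal (Q $g \<psi>)) (Goal Q)" by (intro variant_GoalI[OF p(1,2)]) auto
 thus thesis using that A by blast
qed

text \<open>A goal that is solved in \<open>P\<close> leaves just the marker, which fails. The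
  correspondence is up to variants, because the mgu's of the marked computation have to be most
  general on the variables of the marker as well.\<close>

lemma exh_marked:
 assumes "exh P X" "list_all2 marked X1 X"
 shows "exh (map emb_clause P) X1" using assms
proof (induction arbitrary: X1 rule: exh.induct)
 case exh_Nil
 thus ?case by (simp add: exh.exh_Nil)
next
 case (exh_step X X')
 let ?P = "map emb_clause P"
 have IH: "exh ?P X1'" if "lstep P X X''" "list_all2 marked X1' X''" for X1' X'' using exh_step that by blast
 from exh_step(1) obtain s S where X: "X = s # S" by (cases X) auto
 then obtain s1 S1 where X1: "X1 = s1 # S1" "marked s1 s" "list_all2 marked S1 S" using exh_step(4) by (auto simp: list_all2_Cons2)
 have r: "rstep P X X'" "local X" using exh_step(1) by (auto simp: lstep_def)
 from r(1) show ?case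
 proof cases
  case r_suc
  then obtain us where s1: "s1 = Goal [marker us]" using X X1 by (cases s1) (auto dest!: variant_sym variant_GoalD)
  have "exh ?P S1" using IH exh_step(1) r_suc X X1 by auto
  thus ?thesis unfolding X1 s1 by (rule exh_marker)
 next
  case (r_fail m)
  hence s1: "s1 = Scope m" using X X1 by (cases s1) auto
  have "exh ?P S1" using IH exh_step(1) r_fail X X1 by auto
  thus ?thesis unfolding X1 s1 using exh_ex[of ?P "Scope m # S1" S1] by (simp add: lstep_def rstep.r_fail)
 next
  case (r_cut m Q S')
  hence S': "S' = S" "s = Goal (Cut m # Q)" using X by auto
  then obtain A us where A: "s1 = Goal (emb_goal A @ [marker us])" "variant (Goal A) (Goal (Cut m # Q))" using X1 by (cases s1) auto
  obtain A' where A': "A = Cut m # A'" "variant (Goal A') (Goal Q)" using variant_Cut_Cons[OF A(2)] .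
  have sc: "Scope m : set S1"
  proof -
   have "Scope m : set S" using r(2) X S' by simp
   then obtain k where "k < length S" "S ! k = Scope m" by (auto simp: in_set_conv_nth)
   hence "k < length S1" "S1 ! k = Scope m" using X1(3) marked_Scope_iff[of "S1 ! k" "S ! k" m] by (auto simp: list_all2_conv_all_nth)
   thus ?thesis by (auto simp: in_set_conv_nth)
  qed
  let ?d = "dropWhile (%g. g ~= Scope m)"
  have "list_all2 marked (?d S1) (?d S)" by (rule list_all2_dropWhile[OF X1(3)]) (simp add: marked_Scope_iff)
  hence "list_all2 marked (Goal (emb_goal A' @ [marker us]) # ?d S1) X'" using r_cut(2) S' A'(2) by auto
  hence "exh ?P (Goal (emb_goal A' @ [marker us]) # ?d S1)" using IH exh_step(1) by blast
  moreover have "lstep ?P X1 (Goal (emb_goal A' @ [marker us]) # ?d S1)"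
   using sc rstep.r_cut[of ?P m "emb_goal A' @ [marker us]" S1] unfolding X1 A A' by (simp add: lstep_def)
  ultimately show ?thesis using exh_ex by blast
 next
  case (r_case k p ts Q S')
  hence S': "S' = S" "s = Goal (Atom (Fun p ts) # Q)" using X by auto
  then obtain A us where A: "s1 = Goal (emb_goal A @ [marker us])" "variant (Goal A) (Goal (Atom (Fun p ts) # Q))"
   using X1 by (cases s1) auto
  obtain t' A' \<phi> \<psi> where A': "A = Atom t' # A'" "t' = Fun p ts $ \<psi>" using variant_Goal_Cons[OF A(2)] by metis
  define ts' where "ts' = map (subst_trm \<psi>) ts"
  have t': "t' = Fun p ts'" using A'(2) by (simp add: ts'_def)
  obtain m where m: "m ~: marks_state X Un marks_state X1"
   using ex_new_if_finite[OF infinite_UNIV_nat, of "marks_state X Un marks_state X1"] by auto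
  have l: "lstep P X (case_goals P p ts Q m @ S)" using rstep.r_case[of m p ts Q S P] m X S' by (simp add: lstep_def)
  let ?Q1 = "emb_goal A' @ [marker us]"
  have l1: "lstep ?P X1 (case_goals ?P (Some p) (map emb_trm ts') ?Q1 m @ S1)"
   using rstep.r_case[of m "Some p" "map emb_trm ts'" ?Q1 S1 ?P] m X1(1) A(1) A' t' by (simp add: lstep_def)
  have "list_all2 marked (case_goals ?P (Some p) (map emb_trm ts') ?Q1 m) (case_goals P p ts Q m)"
  proof -
   have "marked (Labeled (Atom (Fun (Some p) (map emb_trm ts')) # ?Q1) (emb_clause c) m) (Labeled (Atom (Fun p ts) # Q) c m)" for c
    using A(2) A'(1) t' unfolding marked.simps by (intro conjI exI[of _ A] exI[of _ us]) simp_all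
   moreover have "length ts' = length ts" by (simp add: ts'_def)
   ultimately show ?thesis unfolding case_goals_def by (auto simp: slice_emb list_all2_map1 list_all2_map2 simp del: marked.simps(2)
      intro!: list_all2_appendI list.rel_refl_strong)
  qed
  hence "exh ?P (case_goals ?P (Some p) (map emb_trm ts') ?Q1 m @ S1)" using IH[OF l] X1(3) by (simp add: list_all2_appendI)
  thus ?thesis using l1 exh_ex by blast
 next
  case (r_hvar x Q)
  hence s: "s = Goal (Atom (Var x) # Q)" using X by auto
  then obtain A us where A: "s1 = Goal (emb_goal A @ [marker us])" "variant (Goal A) (Goal (Atom (Var x) # Q))"
   using X1 by (cases s1) auto
  obtain t' A' \<phi> \<psi> where A': "A = Atom t' # A'" "t' = Var x $ \<psi>" "admissible \<psi>" using variant_Goal_Cons[OF A(2)] by metis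
  hence t': "t' = Var x" using r_hvar by (simp add: admissible_def)
  have "exh ?P S1" using IH exh_step(1) r_hvar X X1 by auto
  moreover have "hazardous (emb_trm t')" using r_hvar by (simp add: t' hazardous_def)
  ultimately show ?thesis unfolding X1 A A'(1) using exh_hazardous[of "emb_trm t'"] by simp
 next
  case (r_drop t c Q m)
  hence s: "s = Labeled (Atom t # Q) c m" using X by auto
  then obtain A us where A: "s1 = Labeled (emb_goal A @ [marker us]) (emb_clause c) m" "variant (Goal A) (Goal (Atom t # Q))"
   using X1 by (cases s1) auto
  obtain t' A' \<phi> \<psi> where A': "A = Atom t' # A'" "t' = t $ \<psi>" "admissible \<psi>" using variant_Goal_Cons[OF A(2)] by metis
  have h: "hazardous (emb_trm t') \<or> ~ matchable (emb_trm t') (emb_clause c)"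
   using r_drop(2) hazardous_subst[OF A'(3), of t] matchable_subst[of \<psi> t c] unfolding A'(2) hazardous_emb matchable_emb by blast
  have "lstep ?P X1 S1" unfolding X1 A A'(1) using rstep.r_drop[OF h, of ?P "emb_goal A' @ [marker us]" m S1] by (simp add: lstep_def)
  moreover have "exh ?P S1" using IH exh_step(1) r_drop X X1 by auto
  ultimately show ?thesis using exh_ex by blast
 next
  case (r_res t Q c \<alpha> \<beta> m S')
  hence S': "S' = S" "s = Labeled (Atom t # Q) c m" using X by auto
  then obtain A us where A: "s1 = Labeled (emb_goal A @ [marker us]) (emb_clause c) m" "variant (Goal A) (Goal (Atom t # Q))"
   using X1 by (cases s1) auto
  obtain t' A' \<phi> \<psi> where A': "A = Atom t' # A'" "admissible \<phi>" "admissible \<psi>" "t = t' $ \<phi>" "Q = A' $g \<phi>"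
   "t' = t $ \<psi>" "A' = Q $g \<psi>" using variant_Goal_Cons[OF A(2)] .
  have nh: "~ hazardous t'" using r_res(3) A'(6) hazardous_subst[OF A'(3)] by simp
  have ma: "matchable t' c" using two_mgu_matchable[OF r_res(4)] matchable_subst[of \<phi> t' c] A'(4) by simp
  let ?V = "vars_trm t' Un (vars_goal A' Un vars_goal [marker us])"
  obtain \<alpha>' \<beta>' where mg: "two_mgu ?V t' c \<alpha>' \<beta>'"
   and mge: "two_mgu ?V (emb_trm t') (emb_clause c) (%x. emb_trm (\<alpha>' x)) (%x. emb_trm (\<beta>' x))"
   by (rule two_mgu_emb_ex[OF ma nh, of ?V]) auto
  let ?R = "emb_goal (resolvent m c A' \<alpha>' \<beta>') @ [marker (map (subst_trm (%x. emb_trm (\<alpha>' x))) us)]"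
  have "resolvent m (emb_clause c) (emb_goal A' @ [marker us]) (%x. emb_trm (\<alpha>' x)) (%x. emb_trm (\<beta>' x)) = ?R"
   by (simp add: emb_resolvent)
  moreover have "rstep ?P (Labeled (Atom (emb_trm t') # emb_goal A' @ [marker us]) (emb_clause c) m # S1)
    (Goal (resolvent m (emb_clause c) (emb_goal A' @ [marker us]) (%x. emb_trm (\<alpha>' x)) (%x. emb_trm (\<beta>' x))) # S1)"
   by (rule rstep.r_res[OF _ two_mgu_subset[OF mge]]) (use nh in auto)
  ultimately have l1: "lstep ?P X1 (Goal ?R # S1)" unfolding X1 A A'(1) by (simp add: lstep_def)
  have "variant (Goal (resolvent m c A' \<alpha>' \<beta>')) (Goal (resolvent m c Q \<alpha> \<beta>))"
   by (rule variant_resolvent[OF mg r_res(4) A'(2,3) A'(4,5,6,7)]) auto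
  hence "list_all2 marked (Goal ?R # S1) X'" using r_res(2) S' X1(3) by auto
  thus ?thesis using IH[OF exh_step(1)] l1 exh_ex by blast
 qed
qed

lemma lstep_context:
 assumes "lstep P X X'" "finite M"
 shows "EX X''. lstep P X X'' & (ALL Z. marks_state Z <= M --> lstep P (X @ Z) (X'' @ Z))"
proof -
 from assms(1) have "rstep P X X'" and l: "local X" by (auto simp: lstep_def)
 from this(1) show ?thesis
 proof cases
  case (r_cut m Q S)
  hence "lstep P (X @ Z) (X' @ Z)" for Z using l rstep.r_cut[of P m Q "S @ Z"] by (simp add: lstep_def dropWhile_Scope_append)
  thus ?thesis using assms(1) by blast
 next
  case (r_case k p ts Q S)
  obtain m where m: "m ~: marks_state X Un M" using ex_new_if_finite[OF infinite_UNIV_nat, of "marks_state X Un M"] assms(2) by auto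
  have "lstep P X (case_goals P p ts Q m @ S)" using m r_case rstep.r_case[of m p ts Q S P] by (simp add: lstep_def)
  moreover have "lstep P (X @ Z) ((case_goals P p ts Q m @ S) @ Z)" if "marks_state Z <= M" for Z
   using m that r_case rstep.r_case[of m p ts Q "S @ Z" P] by (auto simp: lstep_def)
  ultimately show ?thesis by blast
 qed (use assms(1) l in \<open>auto intro!: exI[of _ X'] simp: lstep_def intro: rstep.intros\<close>)
qed

lemma exh_append: "exh P X ==> exh P Y ==> exh P (X @ Y)"
proof (induction rule: exh.induct)
 case (exh_step X X')
 obtain X'' where "lstep P X X''" "lstep P (X @ Y) (X'' @ Y)" using lstep_context[OF exh_step(1), of "marks_state Y"] by auto
 thus ?case using exh_step exh_ex by blast
qed simp

lemma exh_siblings_marked: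
 assumes "!!c. c : set cs ==> sibling_exh P t Q m c" "~ hazardous t"
  and var: "admissible \<phi>" "admissible \<psi>" "t = t' $ \<phi>" "Q = A' $g \<phi>" "t' = t $ \<psi>" "A' = Q $g \<psi>"
 shows "exh (map emb_clause P) (map (%c. Labeled (Atom (emb_trm t') # emb_goal A' @ [marker us]) c m) (map emb_clause cs))" using assms(1)
proof (induction cs)
 case Nil
 thus ?case by (simp add: exh.exh_Nil)
next
 case (Cons c cs)
 let ?P = "map emb_clause P"
 let ?L = "Labeled (Atom (emb_trm t') # emb_goal A' @ [marker us]) (emb_clause c) m"
 have nh: "~ hazardous t'" using assms(2) var(5) hazardous_subst[OF var(2)] by simp
 have "exh ?P [?L]"
 proof (cases "matchable t' c")
  case False
  hence "lstep ?P [?L] []" by (auto simp: lstep_def matchable_emb intro: rstep.r_drop)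
  thus ?thesis using exh_ex exh.exh_Nil by blast
 next
  case True
  hence ma: "matchable t c" using matchable_subst[of \<psi> t c] var(5) by simp
  let ?V = "vars_trm t' Un (vars_goal A' Un vars_goal [marker us])"
  obtain \<alpha>' \<beta>' where mg: "two_mgu ?V t' c \<alpha>' \<beta>'"
   and mge: "two_mgu ?V (emb_trm t') (emb_clause c) (%x. emb_trm (\<alpha>' x)) (%x. emb_trm (\<beta>' x))"
   by (rule two_mgu_emb_ex[OF True nh, of ?V]) auto
  obtain \<alpha> \<beta> where mg0: "two_mgu (vars_trm t Un vars_goal Q) t c \<alpha> \<beta>"
   by (rule two_mgu_ex[OF ma assms(2), of "vars_trm t Un vars_goal Q"]) auto
  let ?R = "emb_goal (resolvent m c A' \<alpha>' \<beta>') @ [marker (map (subst_trm (%x. emb_trm (\<alpha>' x))) us)]"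
  have "resolvent m (emb_clause c) (emb_goal A' @ [marker us]) (%x. emb_trm (\<alpha>' x)) (%x. emb_trm (\<beta>' x)) = ?R"
   by (simp add: emb_resolvent)
  moreover have "rstep ?P [?L]
    [Goal (resolvent m (emb_clause c) (emb_goal A' @ [marker us]) (%x. emb_trm (\<alpha>' x)) (%x. emb_trm (\<beta>' x)))]"
   by (rule rstep.r_res[OF _ two_mgu_subset[OF mge]]) (use nh in auto)
  ultimately have l1: "lstep ?P [?L] [Goal ?R]" by (simp add: lstep_def)
  have "variant (Goal (resolvent m c A' \<alpha>' \<beta>')) (Goal (resolvent m c Q \<alpha> \<beta>))"
   by (rule variant_resolvent[OF mg mg0 var]) auto
  moreover have "exh P [Goal (resolvent m c Q \<alpha> \<beta>)]" using Cons(2)[of c] mg0 unfolding sibling_exh_def by auto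
  ultimately have "exh ?P [Goal ?R]" by (intro exh_marked) auto
  thus ?thesis using l1 exh_ex by blast
 qed
 moreover have "exh ?P (map (%c. Labeled (Atom (emb_trm t') # emb_goal A' @ [marker us]) c m) (map emb_clause cs))" using Cons by simp
 ultimately show ?case using exh_append[of ?P "[?L]"] by simp
qed

text \<open>Turns an answer into an actual computation whose marker collects the bindings.
  \<open>A1\<close> differs from \<open>A\<close> in marks and variables because fresh marks depend
  on the context \<open>Z\<close>; \<theta> relates its variables to the answer \<delta>.\<close>

lemma ans_run:
 assumes "ans P A \<delta>" "inj_on \<nu> (marks_goal A1)" "variant (Goal (map (mark_lit \<nu>) A1)) (Goal A)"
  and "(emb_goal (map (mark_lit \<nu>) A1)) $g \<theta> = emb_goal (A $g \<delta>)"
 shows "EX us' \<eta> Z'. (rstep (map emb_clause P))\<^sup>*\<^sup>* (Goal (emb_goal A1 @ [marker us]) # Z) (Goal [marker us'] # Z') &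
   map (subst_trm \<eta>) us' = map (subst_trm \<theta>) us" using assms
proof (induction arbitrary: \<nu> A1 \<theta> us Z rule: ans.induct)
 case (ans_Nil \<delta>)
 hence "A1 = []" by (auto dest!: variant_sym variant_GoalD)
 thus ?case by auto
next
 case (ans_Cut Q \<delta> m)
 then obtain A' where A': "map (mark_lit \<nu>) A1 = Cut m # A'" "variant (Goal A') (Goal Q)" using variant_Cut_Cons by metis
 then obtain k A1' where A1: "A1 = Cut k # A1'" "A' = map (mark_lit \<nu>) A1'"
 proof -
  obtain l A1' where "A1 = l # A1'" "mark_lit \<nu> l = Cut m" "A' = map (mark_lit \<nu>) A1'" using A'(1) by auto
  thus thesis using that by (cases l) auto
 qed
 have "rstep (map emb_clause P) (Goal (emb_goal A1 @ [marker us]) # Z)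
   (Goal (emb_goal A1' @ [marker us]) # dropWhile (%g. g ~= Scope k) Z)"
  using rstep.r_cut[of "map emb_clause P" k "emb_goal A1' @ [marker us]" Z] by (simp add: A1)
 moreover have "EX us' \<eta> Z'. (rstep (map emb_clause P))\<^sup>*\<^sup>* (Goal (emb_goal A1' @ [marker us]) # dropWhile (%g. g ~= Scope k) Z) (Goal [marker us'] # Z') &
   map (subst_trm \<eta>) us' = map (subst_trm \<theta>) us" by (rule ans_Cut.IH[of \<nu>]) (use ans_Cut.prems A' A1 in auto)
 ultimately show ?case by (meson converse_rtranclp_into_rtranclp)
next
 case (ans_Atom p ts cs1 c cs2 m Q \<alpha> \<beta> \<delta>' \<delta>)
 let ?t = "Fun p ts" and ?P = "map emb_clause P"
 obtain t' A' \<phi> \<psi> where A': "map (mark_lit \<nu>) A1 = Atom t' # A'" "admissible \<phi>" "admissible \<psi>" "?t = t' $ \<phi>" "Q = A' $g \<phi>"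
   "t' = ?t $ \<psi>" "A' = Q $g \<psi>" using variant_Goal_Cons[OF ans_Atom.prems(2)] .
 then obtain A1' where A1: "A1 = Atom t' # A1'" "A' = map (mark_lit \<nu>) A1'"
 proof -
  obtain l A1' where "A1 = l # A1'" "mark_lit \<nu> l = Atom t'" "A' = map (mark_lit \<nu>) A1'" using A'(1) by auto
  thus thesis using that by (cases l) auto
 qed
 define ts' where "ts' = map (subst_trm \<psi>) ts"
 have t': "t' = Fun p ts'" "length ts' = length ts" using A'(6) by (simp_all add: ts'_def)
 let ?S = "Goal (emb_goal A1 @ [marker us]) # Z"
 obtain k where k: "k ~: marks_state ?S" using ex_new_if_finite[OF infinite_UNIV_nat finite_marks_state] by blast
 hence kA: "k ~: marks_goal A1'" using A1 by auto
 \<comment> \<open>The fresh mark \<open>k\<close> of the computation plays the part of the mark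
   \<open>m\<close> in the answer.\<close>
 let ?\<nu> = "\<nu>(k := m)"
 have mQ: "marks_goal Q = \<nu> ` marks_goal A1'" using A'(7) A1(2) by (metis A'(5) marks_goal_mark marks_goal_subst)
 have inj: "inj_on ?\<nu> (insert k (marks_goal A1'))" using ans_Atom.prems(1) A1 kA ans_Atom.hyps(2) mQ by (auto simp: inj_on_def)
 have "map (mark_lit ?\<nu>) A1' = map (mark_lit \<nu>) A1'" using kA by (intro mark_goal_cong) auto
 hence eqA: "map (mark_lit ?\<nu>) A1' = A'" using A1(2) by simp
 have nh: "~ hazardous t'" using ans_Atom.hyps(3) A'(6) hazardous_subst[OF A'(3)] by metis
 have ma: "matchable t' c" using two_mgu_matchable[OF ans_Atom.hyps(5)] matchable_subst[of \<phi> t' c] A'(4) by simp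
 let ?V = "vars_trm t' Un (vars_goal A' Un vars_goal [marker us])"
 obtain \<alpha>' \<beta>' where mg: "two_mgu ?V t' c \<alpha>' \<beta>'"
  and mge: "two_mgu ?V (emb_trm t') (emb_clause c) (%x. emb_trm (\<alpha>' x)) (%x. emb_trm (\<beta>' x))"
  by (rule two_mgu_emb_ex[OF ma nh, of ?V]) auto
 let ?ea = "%x. emb_trm (\<alpha>' x)" and ?eb = "%x. emb_trm (\<beta>' x)"
 let ?R1 = "resolvent k c A1' \<alpha>' \<beta>'"
 have mR: "map (mark_lit ?\<nu>) ?R1 = resolvent m c A' \<alpha>' \<beta>'" by (simp only: mark_resolvent eqA fun_upd_same)
 have var: "variant (Goal (map (mark_lit ?\<nu>) ?R1)) (Goal (resolvent m c Q \<alpha> \<beta>))"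
  unfolding mR by (rule variant_resolvent[OF mg ans_Atom.hyps(5) A'(2,3,4,5,6,7)]) auto
 have th: "emb_trm t' $ \<theta> = emb_trm (?t $ \<delta>)" "emb_goal A' $g \<theta> = emb_goal (Q $g \<delta>)"
  using ans_Atom.prems(3) unfolding A'(1) by auto
 have td: "?t $ \<delta> = head c $ (%y. \<beta> y $ \<delta>')"
 proof -
  have "?t $ \<delta> = ?t $ (%x. \<alpha> x $ \<delta>')" using ans_Atom.hyps(7) by (intro subst_trm_cong) blast
  also have "\<dots> = ?t $ \<alpha> $ \<delta>'" by (simp only: subst_trm_subst)
  also have "\<dots> = head c $ \<beta> $ \<delta>'" by (simp only: two_mguD(1)[OF ans_Atom.hyps(5)])
  finally show ?thesis by (simp only: subst_trm_subst)
 qed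
 have "emb_trm t' $ \<theta> = head (emb_clause c) $ (%y. emb_trm (\<beta> y $ \<delta>'))"
  unfolding th(1) td by (simp add: map_trm_subst emb_clause_sel)
 \<comment> \<open>At \<theta> the called atom is the instance of the head that the answer
   prescribes, so \<theta> and the answer bindings factor jointly through the mgu of this
   computation.\<close>
 then obtain \<zeta> where z0: "!!x. x : ?V ==> \<theta> x = ?ea x $ \<zeta>" "!!y. y : vars_clause (emb_clause c) ==> emb_trm (\<beta> y $ \<delta>') = ?eb y $ \<zeta>"
  using two_mgu_factor[OF mge, of \<theta> "%y. emb_trm (\<beta> y $ \<delta>')"] by auto
 have z: "!!x. x : ?V ==> \<theta> x = ?ea x $ \<zeta>" "!!y. y : vars_clause c ==> emb_trm (\<beta> y $ \<delta>') = ?eb y $ \<zeta>"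
  using z0 by (simp_all only: vars_clause_map_clause)
 have "emb_goal (resolvent m c A' \<alpha>' \<beta>') $g \<zeta> = emb_goal (resolvent m c Q \<alpha> \<beta> $g \<delta>')"
 proof -
  have "emb_goal (A' $g \<alpha>') $g \<zeta> = emb_goal A' $g \<theta>"
   using z(1) by (auto simp: emb_goal_subst subst_goal_subst subst_goal_eq_iff)
  also have "\<dots> = emb_goal (Q $g \<alpha> $g \<delta>')"
   using ans_Atom.hyps(7) by (auto simp: th(2) subst_goal_subst subst_goal_eq_iff intro!: arg_cong[where f=emb_goal])
  finally have 1: "emb_goal (A' $g \<alpha>') $g \<zeta> = emb_goal (Q $g \<alpha> $g \<delta>')" .
  have 2: "emb_goal (body c $g \<beta>') $g \<zeta> = emb_goal ((body c $g \<beta>) $g \<delta>')"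
  proof -
   have "emb_goal (body c $g \<beta>') $g \<zeta> = emb_goal (body c) $g (%y. emb_trm (\<beta> y $ \<delta>'))"
    using z(2) body_vars[of c] by (auto simp: emb_goal_subst subst_goal_subst subst_goal_eq_iff)
   thus ?thesis by (simp add: emb_goal_subst subst_goal_subst map_trm_subst)
  qed
  show ?thesis using 1 2 by (simp add: resolvent_def emb_label_cuts subst_goal_label_cuts)
 qed
 hence th': "(emb_goal (map (mark_lit ?\<nu>) ?R1)) $g \<zeta> = emb_goal (resolvent m c Q \<alpha> \<beta> $g \<delta>')"
  by (simp only: mR)
 have injR: "inj_on ?\<nu> (marks_goal ?R1)" by (rule inj_on_subset[OF inj]) (auto simp: resolvent_def marks_goal_label_cuts)
 let ?L = "%c. Labeled (Atom (emb_trm t') # emb_goal A1' @ [marker us]) c k"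
 let ?Z = "map ?L (map emb_clause cs2) @ Scope k # Z"
 let ?us = "map (subst_trm ?ea) us"
 obtain us' \<eta> Z' where run: "(rstep ?P)\<^sup>*\<^sup>* (Goal (emb_goal ?R1 @ [marker ?us]) # ?Z) (Goal [marker us'] # Z')"
  "map (subst_trm \<eta>) us' = map (subst_trm \<zeta>) ?us" using ans_Atom.IH[OF injR var th'] by blast
 have ueq: "map (subst_trm \<zeta>) ?us = map (subst_trm \<theta>) us"
 proof -
  have "u $ ?ea $ \<zeta> = u $ \<theta>" if "u : set us" for u
  proof -
   have sub: "vars_trm u <= ?V" using that by auto
   show ?thesis unfolding subst_trm_subst by (rule subst_trm_cong, rule z(1)[symmetric]) (rule subsetD[OF sub])
  qed
  thus ?thesis unfolding map_map comp_def by (rule map_cong[OF refl])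
 qed
 have "rstep ?P ?S (case_goals ?P (Some p) (map emb_trm ts') (emb_goal A1' @ [marker us]) k @ Z)"
  using rstep.r_case[of k "Some p" "map emb_trm ts'" "emb_goal A1' @ [marker us]" Z ?P] k by (simp add: A1 t')
 also have "case_goals ?P (Some p) (map emb_trm ts') (emb_goal A1' @ [marker us]) k @ Z
   = map ?L (map emb_clause cs1) @ ?L (emb_clause c) # ?Z" using ans_Atom.hyps(1) t' by (simp add: case_goals_def slice_emb)
 finally have s1: "rstep ?P ?S (map ?L (map emb_clause cs1) @ ?L (emb_clause c) # ?Z)" .
 have ex: "exh ?P (map ?L (map emb_clause cs1))"
 proof -
  \<comment> \<open>transfer the siblings to the mark \<open>k\<close> by the inverse renaming of marks\<close>
  define \<mu> where "\<mu> = inv_into (insert k (marks_goal A1')) ?\<nu>"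
  have i: "\<mu> (?\<nu> j) = j" if "j : insert k (marks_goal A1')" for j using inj that unfolding \<mu>_def by (rule inv_into_f_f)
  have "?\<nu> ` insert k (marks_goal A1') = insert m (marks_goal Q)" using mQ kA by auto
  hence injm: "inj_on \<mu> (insert m (marks_goal Q))" unfolding \<mu>_def by (metis inj_on_inv_into order_refl)
  have mk: "\<mu> m = k" using i[of k] by simp
  have mA: "map (mark_lit \<mu>) A' = A1'"
  proof -
   have "map (mark_lit \<mu>) A' = map (mark_lit \<mu>) (map (mark_lit ?\<nu>) A1')" by (simp only: eqA)
   also have "\<dots> = map (mark_lit (\<mu> \<circ> ?\<nu>)) A1'" by (simp add: mark_lit_comp)
   also have "\<dots> = map (mark_lit id) A1'" using i by (intro mark_goal_cong) auto
   finally show ?thesis by (simp add: mark_lit_id)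
  qed
  have "sibling_exh P ?t (map (mark_lit \<mu>) Q) k c'" if "c' : set cs1" for c'
   using sibling_exh_mark[OF ans_Atom.hyps(4)[OF that] injm] mk by simp
  thus ?thesis
  proof (rule exh_siblings_marked[OF _ ans_Atom.hyps(3) A'(2,3,4) _ A'(6)])
   show "map (mark_lit \<mu>) Q = A1' $g \<phi>" using A'(5) mA by (metis mark_goal_subst)
   show "A1' = map (mark_lit \<mu>) Q $g \<psi>" using A'(7) mA by (metis mark_goal_subst)
  qed
 qed
 have s2: "(rstep ?P)\<^sup>*\<^sup>* (map ?L (map emb_clause cs1) @ ?L (emb_clause c) # ?Z) (?L (emb_clause c) # ?Z)"
  by (rule exh_context[OF ex])
 have vA: "vars_goal A' = vars_goal A1'" using A1(2) by simp
 have "two_mgu (vars_trm (emb_trm t') Un vars_goal (emb_goal A1' @ [marker us])) (emb_trm t') (emb_clause c) ?ea ?eb"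
  by (rule two_mgu_subset[OF mge]) (use vA in auto)
 hence "rstep ?P (?L (emb_clause c) # ?Z) (Goal (resolvent k (emb_clause c) (emb_goal A1' @ [marker us]) ?ea ?eb) # ?Z)"
  by (rule rstep.r_res[rotated]) (use nh in simp)
 hence s3: "rstep ?P (?L (emb_clause c) # ?Z) (Goal (emb_goal ?R1 @ [marker ?us]) # ?Z)" by (simp add: emb_resolvent)
 have "(rstep ?P)\<^sup>*\<^sup>* ?S (Goal [marker us'] # Z')"
  using s1 s2 s3 run(1) by (meson converse_rtranclp_into_rtranclp rtranclp_trans)
 thus ?case using run(2) ueq by metis
qed

lemma rsteps_steps:
 assumes "(rstep P)\<^sup>*\<^sup>* S T" "vars_state S <= ordinary"
 shows "EX T'. (step P)\<^sup>*\<^sup>* S T' & sim T T' & vars_state T' <= ordinary" using assms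
proof (induction rule: rtranclp_induct)
 case base
 thus ?case by (intro exI[of _ S]) simp
next
 case (step T U)
 then obtain T' where T': "(Defs.step P)\<^sup>*\<^sup>* S T'" "sim T T'" "vars_state T' <= ordinary" by blast
 obtain V where "rstep P T' V" using sim_progress[OF T'(2) step(2)] by blast
 then obtain U' where U': "Defs.step P T' U'" using rstep_step[OF _ T'(3)] by blast
 hence "rstep P T' U'" "vars_state U' <= ordinary" using step_rstep[OF _ T'(3)] by blast+
 thus ?case using T' U' sim_step[OF T'(2) step(2)] by (meson rtranclp.rtrancl_into_rtrancl)
qed

section \<open>Renaming variables into a reserved class\<close>

definition code :: "var => nat" where
 "code x = (case x of NVar n => 2 * n | AVar n => 2 * n + 1)"

lemma code_inj: "code x = code y \<longleftrightarrow> x = y" by (cases x; cases y; simp add: code_def) presburger+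

definition decode :: "nat => var" where
 "decode = inv_into UNIV code"

lemma decode_code [simp]: "decode (code x) = x" unfolding decode_def by (rule inv_into_f_f) (auto intro: injI simp: code_inj)

text \<open>With \<open>K\<close> enumerating a class of variables this moves a goal into the class.
  Hazards have to stay, since variants are related by admissible substitutions.\<close>

definition ren :: "(nat => var) => 'f subst" where
 "ren K x = (if x : hazards then Var x else Var (K (code x)))"

text \<open>The default values outside the image of the renaming keep the inverse
  admissible.\<close>

definition unren :: "(nat => var) => 'f subst" where
 "unren K x = (if x : range K & decode (inv_into UNIV K x) ~: hazards then Var (decode (inv_into UNIV K x)) else
   if x : hazards then Var x else Var (NVar 0))"

lemma ren_admissible: "range K Int hazards = {} ==> admissible (ren K)" by (auto simp: ren_def admissible_def)

lemma unren_admissible: "range K Int hazards = {} ==> admissible (unren K)" by (auto simp: unren_def admissible_def hazards_def)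

lemma ren_unren: "inj K ==> range K Int hazards = {} ==> ren K x $ unren K = Var x" by (auto simp: ren_def unren_def)

lemma variant_ren:
 assumes "inj K" "range K Int hazards = {}"
 shows "variant s (s $h (ren K))"
proof -
 have "s $h (ren K) $h (unren K) = s"
 proof -
  have "(%x. ren K x $ unren K) = (Var :: 'a subst)" using ren_unren[OF assms] by blast
  thus ?thesis by (simp add: subst_sgoal_subst)
 qed
 thus ?thesis unfolding variant_def using ren_admissible[OF assms(2)] unren_admissible[OF assms(2)] by blast
qed

text \<open>Instantiation preserves function symbols, so the added symbol cannot occur in
  \<open>u\<close>.\<close>

lemma emb_trm_factor: "u $ \<psi> = emb_trm v ==> EX w. u = emb_trm w"
proof (induction u arbitrary: v)
 case (Var x)
 show ?case by (rule exI[of _ "Var x"]) simp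
next
 case (Fun f us)
 then obtain g vs where v: "v = Fun g vs" "f = Some g" "map (subst_trm \<psi>) us = map emb_trm vs" by (cases v) auto
 have "EX w. u = emb_trm w" if u: "u : set us" for u
 proof -
  have "u $ \<psi> : set (map (subst_trm \<psi>) us)" using u by simp
  hence "u $ \<psi> : set (map emb_trm vs)" unfolding v(3) .
  then obtain v' where "u $ \<psi> = emb_trm v'" by auto
  thus ?thesis by (rule Fun.IH[OF u])
 qed
 then obtain w where "!!u. u : set us ==> u = emb_trm (w u)" by metis
 hence "us = map emb_trm (map w us)" by (simp add: map_idI)
 thus ?case using v(2) by (intro exI[of _ "Fun g (map w us)"]) simp
qed

lemma emb_trms_factor:
 assumes "map (subst_trm \<psi>) us = map emb_trm vs"
 shows "EX ws. us = map emb_trm ws"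
proof -
 have "EX w. u = emb_trm w" if u: "u : set us" for u
 proof -
  have "u $ \<psi> : set (map (subst_trm \<psi>) us)" using u by simp
  hence "u $ \<psi> : set (map emb_trm vs)" unfolding assms .
  then obtain v' where "u $ \<psi> = emb_trm v'" by auto
  thus ?thesis by (rule emb_trm_factor)
 qed
 then obtain w where "!!u. u : set us ==> u = emb_trm (w u)" by metis
 hence "us = map emb_trm (map w us)" by (simp add: map_idI)
 thus ?thesis by blast
qed

lemma ground_subst_id: "ground t ==> t $ \<sigma> = t" by (auto simp: ground_def intro: subst_trm_ident)

lemma ground_emb: "ground (emb_trm t) \<longleftrightarrow> ground t" by (simp add: ground_def)

text \<open>The analysis is about queries with ordinary variables and about actual answers. The
  query is renamed and run with a marker; the answer of this run has the instantiated arguments of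
  \<open>ts\<close> as an instance, up to the embedding of symbols. A position that is ground in the
  run is therefore the same term in both.\<close>

lemma answer_ground:
 assumes ga: "groundness_analysis P gnd" and an: "ans P [Atom (Fun p ts)] \<delta>" and nh: "~ hazardous (Fun p ts)"
  and I: "ALL i:I. i < length ts & ground (ts ! i)" and j: "j : gnd p (length ts) I" "j < length ts"
 shows "ground (ts ! j $ \<delta>)"
proof -
 have K: "inj NVar" "range NVar Int hazards = {}" by (auto intro: injI simp: hazards_def)
 define ts' where "ts' = map (subst_trm (ren NVar)) ts"
 have ord: "vars_trm (t $ ren NVar) <= ordinary" if "t : set ts" for t
  using that nh by (auto simp: vars_trm_subst ren_def ordinary_def hazardous_def split: if_splits)
 have "variant (Goal [Atom (Fun p ts)]) (Goal [Atom (Fun p ts')])"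
  using variant_ren[OF K, of "Goal [Atom (Fun p ts)]"] by (simp add: ts'_def)
 hence var: "variant (Goal (map (mark_lit id) [Atom (Fun p ts')])) (Goal [Atom (Fun p ts)])" by (simp add: variant_sym)
 let ?\<theta> = "%x. emb_trm (unren NVar x $ \<delta>)"
 have undo: "t $ ren NVar $ (%x. unren NVar x $ \<delta>) = t $ \<delta>" for t :: "'a trm"
 proof -
  have "ren NVar x $ (%x. unren NVar x $ \<delta>) = (Var x :: 'a trm) $ \<delta>" for x
  proof -
   have "ren NVar x $ (%x. unren NVar x $ \<delta>) = ren NVar x $ unren NVar $ \<delta>" by (simp only: subst_trm_subst)
   thus ?thesis by (simp only: ren_unren[OF K])
  qed
  thus ?thesis by (simp add: subst_trm_subst)
 qed
 have th: "(emb_goal (map (mark_lit id) [Atom (Fun p ts')])) $g ?\<theta> = emb_goal ([Atom (Fun p ts)] $g \<delta>)"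
  using undo by (simp add: ts'_def map_trm_subst[symmetric])
 let ?P = "map emb_clause P"
 let ?us = "map emb_trm ts'"
 obtain us' \<eta> Z' where run: "(rstep ?P)\<^sup>*\<^sup>* [Goal (emb_goal [Atom (Fun p ts')] @ [marker ?us])] (Goal [marker us'] # Z')"
  and us': "map (subst_trm \<eta>) us' = map (subst_trm ?\<theta>) ?us" using ans_run[OF an inj_on_id var th, of ?us "[]"] by blast
 let ?S = "[Goal [Atom (emb_trm (Fun p ts')), marker ?us]]"
 have "vars_state ?S <= ordinary" using ord by (auto simp: ts'_def)
 moreover have "(rstep ?P)\<^sup>*\<^sup>* ?S (Goal [marker us'] # Z')" using run by simp
 ultimately obtain T' where T': "(step ?P)\<^sup>*\<^sup>* ?S T'" "sim (Goal [marker us'] # Z') T'" using rsteps_steps by blast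
 from T'(2) obtain \<nu> t T1 where T1: "T' = t # T1" "variant (mark_sgoal \<nu> (Goal [marker us'])) t"
  by (auto simp: sim_def sim_by_Cons)
 then obtain \<phi> \<psi> where t: "t = Goal [marker (map (subst_trm \<phi>) us')]" "map (subst_trm \<psi>) (map (subst_trm \<phi>) us') = us'"
  by (fastforce dest!: variant_GoalD)
 define us where "us = map (subst_trm \<phi>) us'"
 have us: "map (subst_trm \<psi>) us = us'" using t(2) by (simp add: us_def)
 have "map (subst_trm ?\<theta>) ?us = map emb_trm (map (subst_trm \<delta>) ts)"
  using undo by (simp add: ts'_def map_trm_subst[symmetric])
 hence us'': "map (subst_trm \<eta>) us' = map emb_trm (map (subst_trm \<delta>) ts)" using us' by simp
 then obtain vs' where vs': "us' = map emb_trm vs'" using emb_trms_factor[OF us''] by blast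
 obtain vs where vs: "us = map emb_trm vs" using emb_trms_factor[OF trans[OF us vs']] by blast
 have len: "length us' = length ts" using map_eq_imp_length_eq[OF us''] by simp
 hence lvs: "length vs = length ts" using arg_cong[OF vs, of length] by (simp add: us_def)
 have "is_answer P p ts' vs"
 proof -
  have "T' = Goal [marker (map emb_trm vs)] # T1" using t(1) T1(1) vs by (simp only: us_def)
  moreover have "[Goal [Atom (emb_trm (Fun p ts')), Atom (Fun None (map emb_trm ts'))]] = ?S" by simp
  ultimately show ?thesis unfolding is_answer_def using T'(1) by metis
 qed
 moreover have "ALL t:set ts'. vars_trm t <= ordinary" using ord by (auto simp: ts'_def)
 moreover have "ALL i:I. i < length ts' & ground (ts' ! i)" using I by (auto simp: ts'_def ground_subst_id)
 moreover have "length ts' = length ts" by (simp add: ts'_def)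
 ultimately have "ground (vs ! j)" using ga j lvs unfolding groundness_analysis_def by metis
 hence g: "ground (us ! j)" using vs lvs j by (simp add: ground_emb)
 have "us' ! j = us ! j $ \<psi>" using us len j by (metis length_map nth_map)
 hence "us' ! j = us ! j" using g by (simp add: ground_subst_id)
 moreover have "us' ! j $ \<eta> = emb_trm (ts ! j $ \<delta>)" using us'' len j by (metis length_map nth_map)
 ultimately have "us ! j = emb_trm (ts ! j $ \<delta>)" using g by (simp add: ground_subst_id)
 thus ?thesis using g by (simp add: ground_emb)
qed

section \<open>Valuations and non-unifiability\<close>

text \<open>Indices modulo 3 separate hazards, finals and locals and leave each class
  infinite.\<close>

definition finals :: "var set" where
 "finals = range (%i. AVar (3 * i + 1))"

definition locals :: "var set" where
 "locals = range (%i. AVar (3 * i + 2))"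

lemma codes_disjoint: "hazards Int finals = {}" "hazards Int locals = {}" "finals Int locals = {}"
 "ordinary Int hazards = {}" "ordinary Int finals = {}" "ordinary Int locals = {}"
 by (auto simp: hazards_def finals_def locals_def ordinary_def) presburger+

lemma infinite_finals: "infinite finals" and infinite_locals: "infinite locals"
 unfolding finals_def locals_def by (auto intro!: range_inj_infinite injI)

primrec max_arity :: "'f trm => nat" where
 "max_arity (Var x) = 0"
| "max_arity (Fun f ts) = foldr max (map max_arity ts) (length ts)"

lemma foldr_max_le: "foldr max xs (k::nat) <= n \<longleftrightarrow> k <= n & (ALL x:set xs. x <= n)" by (induction xs) auto

lemma max_arity_Fun_le: "max_arity (Fun f ts) <= n \<longleftrightarrow> length ts <= n & (ALL t:set ts. max_arity t <= n)"
 by (simp add: foldr_max_le)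

declare max_arity.simps(2) [simp del]

primrec subterms :: "'f trm => 'f trm set" where
 "subterms (Var x) = {Var x}"
| "subterms (Fun f ts) = insert (Fun f ts) (\<Union>(set (map subterms ts)))"

lemma subterms_refl: "t : subterms t" by (cases t) auto

lemma size_subterms: "s : subterms t ==> size s <= size t"
proof (induction t)
 case (Fun f ts)
 show ?case
 proof (cases "s = Fun f ts")
  case False
  then obtain t where t: "t : set ts" "s : subterms t" using Fun.prems by auto
  hence "size s <= size t" using Fun.IH by blast
  also have "size t <= size_list size ts" using t(1) by (simp add: size_list_estimation')
  finally show ?thesis by simp
 qed simp
qed simp

lemma subterms_subst_var: "x : vars_trm t ==> \<theta> x : subterms (t $ \<theta>)"
proof (induction t)
 case (Var y)
 thus ?case by (simp add: subterms_refl)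
qed auto

text \<open>An application with more arguments than any symbol of \<open>h\<close> cannot come from
  \<open>h\<close>, so it was inserted by the substitution.\<close>

lemma big_subterm:
 assumes "Fun f us : subterms (h $ \<theta>)" "max_arity h <= K" "K < length us"
 shows "EX y:vars_trm h. Fun f us : subterms (\<theta> y)" using assms(1,2)
proof (induction h)
 case (Fun g ts)
 hence "length ts <= K" by (simp add: max_arity_Fun_le)
 hence "Fun f us ~= Fun g ts $ \<theta>" using assms(3) by auto
 then obtain t where t: "t : set ts" "Fun f us : subterms (t $ \<theta>)" using Fun.prems(1) by auto
 hence "max_arity t <= K" using Fun.prems(2) by (simp add: max_arity_Fun_le)
 thus ?case using Fun.IH[OF t] t(1) by auto
qed simp

text \<open>The pairs in a knowledge base are kept non-unifiable for all valuations of the following kind.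
  Hazards stand for a term that unifies with no clause head: its arity is larger than every arity
  in a head, and it contains all variables to which the (not renamed) variables of the heads may be
  mapped. Finals stand for distinct ground terms that are opaque for the heads.\<close>

definition zeta :: "nat => var list => 'f trm" where
 "zeta K N = Fun undefined (map Var N @ replicate K (Var (hd N)))"

definition opq :: "nat => 'f trm" where
 "opq j = Fun undefined (replicate (Suc j) (Fun undefined []))"

text \<open>Raising \<open>L\<close> makes the values of finals opaque for any finite number of
  given terms. Locals are left unconstrained.\<close>

definition chi_ok :: "nat => var list => nat => 'f subst => bool" where
 "chi_ok K N L \<chi> \<longleftrightarrow> (ALL x:hazards. \<chi> x = zeta K N) & (ALL i. \<chi> (AVar (3 * i + 1)) = opq (L + i)) &
   (ALL x:ordinary. EX n:set N. \<chi> x = Var n)"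

lemma ground_opq: "ground (opq j)" by (auto simp: ground_def opq_def)

text \<open>Because of its arity the value of the hazard must lie inside the instance of some head
  variable. That variable is mapped to a member \<open>n\<close> of \<open>N\<close>, but
  \<open>n\<close> also occurs properly inside the value of the hazard, which contradicts the
  sizes.\<close>

lemma hazard_apart:
 assumes "hazardous t" "chi_ok K N L \<chi>" "max_arity h <= K" "vars_trm h <= ordinary" "N ~= []"
 shows "~ unifiable (t $ \<chi>) (h $ \<chi>)"
proof
 assume "unifiable (t $ \<chi>) (h $ \<chi>)"
 then obtain \<sigma> where eq: "t $ \<chi> $ \<sigma> = h $ \<chi> $ \<sigma>" by (auto simp: unifiable_def)
 obtain x where x: "x : vars_trm t" "x : hazards" using assms(1) by (auto simp: hazardous_def)
 let ?us = "map (subst_trm \<sigma>) (map Var N @ replicate K (Var (hd N)))"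
 have "\<chi> x $ \<sigma> : subterms (t $ (%x. \<chi> x $ \<sigma>))" using subterms_subst_var[OF x(1), of "%x. \<chi> x $ \<sigma>"] .
 hence "\<chi> x $ \<sigma> : subterms (h $ (%x. \<chi> x $ \<sigma>))" using eq by (simp add: subst_trm_subst)
 moreover have z: "\<chi> x $ \<sigma> = Fun undefined ?us" using assms(2) x(2) by (simp add: chi_ok_def zeta_def)
 ultimately have "Fun undefined ?us : subterms (h $ (%x. \<chi> x $ \<sigma>))" by simp
 moreover have "K < length ?us" using assms(5) by simp
 ultimately obtain y where y: "y : vars_trm h" "Fun undefined ?us : subterms (\<chi> y $ \<sigma>)"
  using big_subterm[OF _ assms(3)] by blast
 then obtain n where n: "n : set N" "\<chi> y = Var n" using assms(2,4) unfolding chi_ok_def by blast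
 hence "size (Fun undefined ?us) <= size (\<sigma> n)" using size_subterms[OF y(2)] by simp
 moreover have "size (\<sigma> n) <= size_list size ?us" using n(1) by (intro size_list_estimation'[of "\<sigma> n"]) auto
 ultimately show False by simp
qed

text \<open>The value of the final with index i has L + i + 1 arguments, whence the subtraction of
  \<open>Suc L\<close>.\<close>

primrec unopq :: "nat => 'f trm => 'f trm" where
 "unopq L (Var x) = Var x"
| "unopq L (Fun f us) = (if f = undefined & L < length us & set us = {Fun undefined []}
   then Var (AVar (3 * (length us - Suc L) + 1)) else Fun f (map (unopq L) us))"

lemma unopq_opq: "unopq L (opq (L + i)) = Var (AVar (3 * i + 1))" by (auto simp: opq_def)

lemma unopq_subst: "max_arity t <= L ==> unopq L (t $ \<theta>) = t $ (%x. unopq L (\<theta> x))"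
proof (induction t)
 case (Fun f ts)
 hence "length ts <= L" "ALL t:set ts. max_arity t <= L" by (simp_all add: max_arity_Fun_le)
 thus ?case using Fun.IH by simp
qed simp

text \<open>Turning opaque terms back into finals undoes \<chi> on \<open>t\<close> and commutes
  with instantiating \<open>h\<close>, because neither contains an arity above \<open>L\<close>. A
  unifier thus becomes a matcher: finals behave like constants.\<close>

lemma final_instance:
 assumes "vars_trm t <= finals" "chi_ok K N L \<chi>" "max_arity t <= L" "max_arity h <= L"
  and "unifiable (t $ \<chi>) (h $ \<chi>)"
 shows "EX \<beta>. t = h $ \<beta>"
proof -
 obtain \<sigma> where eq: "t $ \<chi> $ \<sigma> = h $ \<chi> $ \<sigma>" using assms(5) by (auto simp: unifiable_def)
 have val: "EX i. x = AVar (3 * i + 1) & \<chi> x = opq (L + i)" if "x : vars_trm t" for x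
  using that assms(1,2) unfolding finals_def chi_ok_def by blast
 have "unopq L (\<chi> x $ \<sigma>) = Var x" if xt: "x : vars_trm t" for x
 proof -
  obtain i where i: "x = AVar (3 * i + 1)" "\<chi> x = opq (L + i)" using val[OF xt] by blast
  hence "\<chi> x $ \<sigma> = opq (L + i)" by (simp add: ground_subst_id ground_opq)
  thus ?thesis using i unopq_opq by simp
 qed
 hence "t $ (%x. unopq L (\<chi> x $ \<sigma>)) = t" by (intro subst_trm_ident) auto
 hence "t = unopq L (t $ \<chi> $ \<sigma>)" using assms(3) by (simp add: subst_trm_subst unopq_subst)
 also have "\<dots> = h $ (%x. unopq L (\<chi> x $ \<sigma>))" unfolding eq using assms(4) by (simp add: subst_trm_subst unopq_subst)
 finally show ?thesis by blast
qed

text \<open>The threshold depends on the arities in the pairs and may have to grow with each new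
  pair; hence non-unifiability is demanded only from some \<open>L0\<close> on.\<close>

definition apart :: "nat => var list => 'f subst => ('f trm \<times> 'f trm) set => bool" where
 "apart K N \<psi> U \<longleftrightarrow> (EX L0. ALL L>=L0. ALL \<chi>. chi_ok K N L \<chi> -->
   (ALL (s, s'):U. ~ unifiable (s $ \<psi> $ \<chi>) (s' $ \<psi> $ \<chi>)))"

text \<open>Substitutions that may precede \<chi> without leaving the valuations under
  consideration; locals may be instantiated freely.\<close>

definition harmless :: "'f subst => bool" where
 "harmless \<theta> \<longleftrightarrow> (ALL x:hazards Un finals. \<theta> x = Var x) & (ALL x:ordinary. EX y:ordinary. \<theta> x = Var y)"

lemma harmless_Var [simp]: "harmless Var" by (simp add: harmless_def)

lemma harmless_chi: "harmless \<theta> ==> chi_ok K N L \<chi> ==> chi_ok K N L (%x. \<theta> x $ \<chi>)"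
 unfolding harmless_def chi_ok_def finals_def by fastforce

lemma apart_subst:
 assumes "apart K N \<psi> U" "harmless \<theta>"
  and "!!s s'. (s, s') : U' ==> EX q q'. (q, q') : U & s $ \<psi>' = q $ \<psi> $ \<theta> & s' $ \<psi>' = q' $ \<psi> $ \<theta>"
 shows "apart K N \<psi>' U'"
proof -
 obtain L0 where L0: "!!L \<chi> q q'. L >= L0 ==> chi_ok K N L \<chi> ==> (q, q') : U ==> ~ unifiable (q $ \<psi> $ \<chi>) (q' $ \<psi> $ \<chi>)"
  using assms(1) unfolding apart_def by fast
 have "~ unifiable (s $ \<psi>' $ \<chi>) (s' $ \<psi>' $ \<chi>)" if "L >= L0" "chi_ok K N L \<chi>" "(s, s') : U'" for L \<chi> s s'
 proof -
  obtain q q' where q: "(q, q') : U" "s $ \<psi>' = q $ \<psi> $ \<theta>" "s' $ \<psi>' = q' $ \<psi> $ \<theta>" using assms(3)[OF \<open>(s, s') : U'\<close>] by blast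
  have "~ unifiable (q $ \<psi> $ (%x. \<theta> x $ \<chi>)) (q' $ \<psi> $ (%x. \<theta> x $ \<chi>))"
   using L0[OF that(1) harmless_chi[OF assms(2) that(2)] q(1)] .
  thus ?thesis unfolding q(2,3) by (simp only: subst_trm_subst not_False_eq_True)
 qed
 thus ?thesis unfolding apart_def by blast
qed

lemma apart_insert:
 fixes \<psi> :: "'f subst"
 assumes "apart K N \<psi> U" and new: "!!L \<chi>. L >= L1 ==> chi_ok K N L \<chi> ==> ~ unifiable (s $ \<psi> $ \<chi>) (s' $ \<psi> $ \<chi>)"
 shows "apart K N \<psi> (insert (s, s') U)"
proof -
 obtain L0 where L0: "!!L \<chi> q q'. L >= L0 ==> chi_ok K N L \<chi> ==> (q, q') : U ==> ~ unifiable (q $ \<psi> $ \<chi>) (q' $ \<psi> $ \<chi>)"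
  using assms(1) unfolding apart_def by fast
 show ?thesis unfolding apart_def
 proof (intro exI[of _ "max L0 L1"] allI impI ballI)
  fix L p and \<chi> :: "'f subst" assume "L >= max L0 L1" "chi_ok K N L \<chi>" "p : insert (s, s') U"
  thus "case p of (s, s') => ~ unifiable (s $ \<psi> $ \<chi>) (s' $ \<psi> $ \<chi>)" using L0 new by (cases p) auto
 qed
qed

text \<open>The three reasons for leaving an alternative: a hazard in the atom, no unifier at all,
  or an atom with final values that is not an instance of the head.\<close>

lemma apart_no_match:
 fixes \<psi> :: "'f subst"
 assumes "apart K N \<psi> U" "ALL x:ordinary. \<psi> x = Var x" "vars_trm h <= ordinary" "max_arity h <= K" "N ~= []"
  and "hazardous (t $ \<psi>) \<or> ~ (EX \<alpha> \<beta>. t $ \<psi> $ \<alpha> = h $ \<beta>) \<or> vars_trm (t $ \<psi>) <= finals & ~ (EX \<beta>. t $ \<psi> = h $ \<beta>)"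
 shows "apart K N \<psi> (insert (t, h) U)"
proof (rule apart_insert[OF assms(1)])
 fix L and \<chi> :: "'f subst" assume L: "L >= max K (max_arity (t $ \<psi>))" and \<chi>: "chi_ok K N L \<chi>"
 have h: "h $ \<psi> = h" using assms(2,3) by (intro subst_trm_ident) auto
 show "~ unifiable (t $ \<psi> $ \<chi>) (h $ \<psi> $ \<chi>)"
 proof
  assume un: "unifiable (t $ \<psi> $ \<chi>) (h $ \<psi> $ \<chi>)"
  hence "~ hazardous (t $ \<psi>)" using hazard_apart[OF _ \<chi> assms(4,3,5)] h by auto
  moreover have "EX \<alpha> \<beta>. t $ \<psi> $ \<alpha> = h $ \<beta>" using un unfolding h unifiable_def by (metis subst_trm_subst)
  moreover have "vars_trm (t $ \<psi>) <= finals ==> EX \<beta>. t $ \<psi> = h $ \<beta>"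
   using final_instance[OF _ \<chi>] un L assms(4) unfolding h by simp
  ultimately show False using assms(6) by blast
 qed
qed

text \<open>If the atom matches at \<psi>, some concretization exhibits the match. Locals become
  ordinary variables with indices from \<open>F\<close> on, beyond those of the head, so that a
  unifier can treat the two sides independently.\<close>

lemma concretization_exists:
 assumes ap: "apart K N \<psi> U" and ord: "ALL x:ordinary. \<psi> x = Var x" and gr: "ALL x:\<G>. ground (\<psi> x)" and G: "\<G> <= abstract"
  and N: "N ~= []" "set N <= ordinary" "(UN (s, s'):U. vars_trm s Un vars_trm s') Int ordinary <= set N"
  and t: "vars_trm t <= abstract" "vars_trm (t $ \<psi>) <= locals & t $ \<psi> $ \<alpha> = h $ \<beta> \<or> vars_trm (t $ \<psi>) <= finals & t $ \<psi> = h $ \<beta>"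
  and h: "vars_trm h <= ordinary"
 shows "EX \<gamma>. concretization \<gamma> (S, (\<G>, U)) & unifiable (t $ \<gamma>) h"
proof -
 obtain L where L: "!!\<chi> q q'. chi_ok K N L \<chi> ==> (q, q') : U ==> ~ unifiable (q $ \<psi> $ \<chi>) (q' $ \<psi> $ \<chi>)"
  using ap unfolding apart_def by fast
 have "finite {n. NVar n : vars_trm h}" using finite_vimageI[of "vars_trm h" NVar] by (simp add: vimage_def inj_def flip: set_var_list)
 then obtain F where F: "!!n. NVar n : vars_trm h ==> n < F" using finite_nat_set_iff_bounded by auto
 define \<chi> :: "'a subst" where "\<chi> x = (case x of NVar n => if x : set N then Var x else Var (hd N)
   | AVar n => if n mod 3 = 0 then zeta K N else if n mod 3 = 1 then opq (L + n div 3) else Var (NVar (F + n div 3)))" for x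
 have div3: "Suc (3 * i) div 3 = i" for i :: nat by presburger
 have ok: "chi_ok K N L \<chi>" using N(1) div3 by (auto simp: chi_ok_def hazards_def ordinary_def \<chi>_def)
 have chi_ord: "vars_trm (\<chi> x) <= ordinary" for x
  using N(1,2) ground_opq[of "L + _"] by (cases x) (auto simp: \<chi>_def zeta_def ordinary_def ground_def split: if_splits)
 define \<gamma> where "\<gamma> x = (if x : abstract then \<psi> x $ \<chi> else Var x)" for x
 have abs: "x : abstract \<longleftrightarrow> x ~: ordinary" for x by (cases x) (auto simp: abstract_def ordinary_def)
 have gord: "vars_trm (\<gamma> x) <= ordinary" for x using chi_ord abs by (auto simp: \<gamma>_def vars_trm_subst)
 have "\<gamma> x ~= Var x" if "x : abstract" for x using gord[of x] that abs by auto
 hence dom: "subst_dom \<gamma> = abstract" by (auto simp: subst_dom_def \<gamma>_def)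
 have "range_vars \<gamma> <= ordinary" using gord by (auto simp: range_vars_def subst_range_def)
 moreover have "range_vars (restrict_subst \<gamma> \<G>) = {}"
  using gr G by (auto simp: range_vars_def subst_range_def subst_dom_def restrict_subst_def \<gamma>_def ground_def vars_trm_subst)
 moreover have "~ unifiable (s $ \<gamma>) (s' $ \<gamma>)" if U: "(s, s') : U" for s s'
 proof -
  have "\<gamma> x = \<psi> x $ \<chi>" if "x : vars_trm s Un vars_trm s'" for x
  proof (cases "x : abstract")
   case False
   hence "x : ordinary" "x : set N" using abs that N(3) U by auto
   thus ?thesis using ord by (auto simp: \<gamma>_def \<chi>_def abs ordinary_def)
  qed (simp add: \<gamma>_def)
  hence "s $ \<gamma> = s $ \<psi> $ \<chi>" "s' $ \<gamma> = s' $ \<psi> $ \<chi>" by (auto simp: subst_trm_subst intro!: subst_trm_cong)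
  thus ?thesis using L[OF ok U] by simp
 qed
 ultimately have con: "concretization \<gamma> (S, (\<G>, U))" using dom by auto
 have tg: "t $ \<gamma> = t $ \<psi> $ \<chi>" using t(1) by (auto simp: subst_trm_subst \<gamma>_def intro!: subst_trm_cong)
 \<comment> \<open>Variables below \<open>F\<close> belong to the head and are bound by \<beta>;
   those from \<open>F\<close> on are images of locals and are bound by \<alpha>.\<close>
 define \<sigma> where "\<sigma> x = (case x of NVar n => if n < F then \<beta> x $ \<chi> else \<alpha> (AVar (3 * (n - F) + 2)) $ \<chi> | AVar n => Var x)" for x
 have hs: "h $ \<sigma> = h $ \<beta> $ \<chi>"
  unfolding subst_trm_subst using h F by (intro subst_trm_cong) (auto simp: \<sigma>_def ordinary_def)
 from t(2) have "t $ \<psi> $ \<chi> $ \<sigma> = h $ \<sigma>"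
 proof (elim disjE conjE)
  assume l: "vars_trm (t $ \<psi>) <= locals" "t $ \<psi> $ \<alpha> = h $ \<beta>"
  have "\<chi> x $ \<sigma> = \<alpha> x $ \<chi>" if xl: "x : locals" for x
  proof -
   obtain i where x: "x = AVar (3 * i + 2)" using xl unfolding locals_def by blast
   have md: "(3 * i + 2) mod 3 = 2" "(3 * i + 2) div 3 = i" by presburger+
   have "\<chi> x = Var (NVar (F + i))" unfolding x \<chi>_def by (simp only: var.case md) simp
   moreover have "\<sigma> (NVar (F + i)) = \<alpha> x $ \<chi>" by (simp add: \<sigma>_def x)
   ultimately show ?thesis by simp
  qed
  hence "t $ \<psi> $ \<chi> $ \<sigma> = t $ \<psi> $ \<alpha> $ \<chi>" using l(1) unfolding subst_trm_subst[where t = "t $ \<psi>"]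
   by (intro subst_trm_cong) blast
  thus ?thesis using hs l(2) by simp
 next
  assume l: "vars_trm (t $ \<psi>) <= finals" "t $ \<psi> = h $ \<beta>"
  have "\<chi> x $ \<sigma> = \<chi> x" if xl: "x : finals" for x
  proof -
   obtain i where x: "x = AVar (3 * i + 1)" using xl unfolding finals_def by blast
   have md: "(3 * i + 1) mod 3 = 1" "(3 * i + 1) div 3 = i" by presburger+
   have "\<chi> x = opq (L + i)" unfolding x \<chi>_def by (simp only: var.case md) simp
   thus ?thesis by (simp add: ground_subst_id ground_opq)
  qed
  hence "t $ \<psi> $ \<chi> $ \<sigma> = t $ \<psi> $ \<chi>" using l(1) unfolding subst_trm_subst[where t = "t $ \<psi>"]
   by (intro subst_trm_cong) blast
  thus ?thesis using hs l(2) by simp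
 qed
 hence "unifiable (t $ \<gamma>) h" unfolding unifiable_def tg by blast
 thus ?thesis using con by blast
qed

section \<open>Termination graphs\<close>

definition expanded :: "'f graph => nat => bool" where
 "expanded G n \<longleftrightarrow> n < length G & rule_of G n ~= Open & n ~: instance_nodes G"

text \<open>\<open>W\<close> and \<open>M\<close> are the variables and marks that had been used when the nodes were expanded.\<close>

definition structured :: "'f clause list => 'f groundness => 'f graph => (nat => var set) => (nat => nat set) => bool" where
 "structured P gnd G W M \<longleftrightarrow> (ALL n<length G.
   (rule_of G n = Open --> succs G n = [] & W n = UNIV) &
   (ALL \<mu>. rule_of G n = R_Instance \<mu> --> W n = UNIV &
    (EX n'<length G. succs G n = [n'] & instance_of \<mu> (astate_of G n) (astate_of G n'))) &
   (expanded G n -->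
    expand P gnd (W n) (M n) (astate_of G n) (rule_of G n) (map (astate_of G) (succs G n)) &
    distinct (succs G n) &
    (ALL n':set (succs G n). n < n' & n' < length G & W n Un rule_vars (rule_of G n) <= W n') &
    vars_astate (astate_of G n) <= W n & marks_state (fst (astate_of G n)) <= M n & W n <= used_vars G))"

lemma structured_Open: "structured P gnd G W M ==> n < length G ==> rule_of G n = Open ==> succs G n = [] & W n = UNIV"
 unfolding structured_def by (drule spec, drule mp, assumption, elim conjE) (drule mp, assumption+)

lemma structured_Instance:
 assumes "structured P gnd G W M" "n < length G" "rule_of G n = R_Instance \<mu>"
 shows "W n = UNIV & (EX n'<length G. succs G n = [n'] & instance_of \<mu> (astate_of G n) (astate_of G n'))"
proof -
 note * = mp[OF spec[OF assms(1)[unfolded structured_def]] assms(2)]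
 have "ALL \<mu>. rule_of G n = R_Instance \<mu> --> W n = UNIV &
    (EX n'<length G. succs G n = [n'] & instance_of \<mu> (astate_of G n) (astate_of G n'))" using * by blast
 thus ?thesis using assms(3) by blast
qed

lemma structured_expanded:
 assumes "structured P gnd G W M" "expanded G n"
 shows "expand P gnd (W n) (M n) (astate_of G n) (rule_of G n) (map (astate_of G) (succs G n))"
  "distinct (succs G n)"
  "ALL n':set (succs G n). n < n' & n' < length G & W n Un rule_vars (rule_of G n) <= W n'"
  "vars_astate (astate_of G n) <= W n" "marks_state (fst (astate_of G n)) <= M n" "W n <= used_vars G"
proof -
 have "n < length G" using assms(2) by (simp add: expanded_def)
 note * = mp[OF conjunct2[OF conjunct2[OF mp[OF spec[OF assms(1)[unfolded structured_def]] this]]] assms(2)]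
 show "expand P gnd (W n) (M n) (astate_of G n) (rule_of G n) (map (astate_of G) (succs G n))"
  "distinct (succs G n)"
  "ALL n':set (succs G n). n < n' & n' < length G & W n Un rule_vars (rule_of G n) <= W n'"
  "vars_astate (astate_of G n) <= W n" "marks_state (fst (astate_of G n)) <= M n" "W n <= used_vars G"
  using * by - (elim conjE, assumption)+
qed

lemma expand_not_Open: "expand P gnd W M s r ss ==> r ~= Open & (ALL \<mu>. r ~= R_Instance \<mu>) & ss ~= []" by (auto elim: expand.cases)

context
 fixes G G' :: "'f graph" and n :: nat and s r l new
 assumes n: "n < length G" "G ! n = (s, Open, [])" and G': "G' = G[n := (s, r, l)] @ map (%s'. (s', Open, [])) new"
begin

lemma update_old:
 assumes "k < length G"
 shows "astate_of G' k = astate_of G k" "rule_of G' k = (if k = n then r else rule_of G k)"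
  "succs G' k = (if k = n then l else succs G k)"
proof -
 have "G' ! k = (if k = n then (s, r, l) else G ! k)" using assms n by (simp add: G' nth_append)
 thus "astate_of G' k = astate_of G k" "rule_of G' k = (if k = n then r else rule_of G k)"
  "succs G' k = (if k = n then l else succs G k)" using n by (auto simp: astate_of_def rule_of_def succs_def)
qed

lemma update_new:
 assumes "length G <= k" "k < length G'"
 shows "astate_of G' k = new ! (k - length G)" "rule_of G' k = Open" "succs G' k = []"
proof -
 have "G' ! k = (new ! (k - length G), Open, [])" using assms by (simp add: G' nth_append)
 thus "astate_of G' k = new ! (k - length G)" "rule_of G' k = Open" "succs G' k = []"
  by (simp_all add: astate_of_def rule_of_def succs_def)
qed

lemma update_length: "length G' = length G + length new" by (simp add: G')

lemma update_used: "used_vars G <= used_vars G'"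
proof
 fix x assume "x : used_vars G"
 then obtain k where k: "k < length G" "x : vars_astate (astate_of G k) Un rule_vars (rule_of G k)" by (auto simp: used_vars_def)
 have "rule_vars (rule_of G n) = {}" using n by (simp add: rule_of_def)
 hence "x : vars_astate (astate_of G' k) Un rule_vars (rule_of G' k)" using k update_old[OF k(1)] by auto
 thus "x : used_vars G'" using k(1) update_length unfolding used_vars_def by auto
qed

lemma update_structured:
 assumes st: "structured P gnd G W M" and
  new: "(EX \<mu> n'. r = R_Instance \<mu> & l = [n'] & n' < length G' & instance_of \<mu> s (astate_of G' n')) \<or>
   expand P gnd (used_vars G) (used_marks G) s r new & l = [length G..<length G + length new]"
 shows "EX W' M'. structured P gnd G' W' M'"
proof -
 have sn: "astate_of G n = s" using n by (simp add: astate_of_def)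
 \<comment> \<open>For open and \<open>Instance\<close> nodes the value \<open>UNIV\<close> makes
   the inclusion demanded from their predecessors trivial; an expansion fixes the set used at that
   moment.\<close>
 define W' where "W' k = (if length G <= k then UNIV else if k = n & (ALL \<mu>. r ~= R_Instance \<mu>) then used_vars G else W k)" for k
 define M' where "M' k = (if k = n then used_marks G else M k)" for k
 have ro: "rule_of G n = Open" using n by (simp add: rule_of_def)
 have rno: "r ~= Open" using new expand_not_Open by blast
 have Wn: "W n = UNIV" using structured_Open[OF st n(1) ro] by simp
 have used: "W k Un rule_vars (rule_of G k) <= used_vars G" if "expanded G k" for k
 proof -
  have "k < length G" using that by (simp add: expanded_def)
  hence "W k <= used_vars G" "rule_vars (rule_of G k) <= used_vars G" using structured_expanded(6)[OF st that]
   by (auto simp: used_vars_def)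
  thus ?thesis by blast
 qed
 have ex: "expanded G' k \<longleftrightarrow> expanded G k \<or> k = n & (ALL \<mu>. r ~= R_Instance \<mu>)" for k
 proof (cases "k < length G")
  case True
  have "r ~= Open" using new expand_not_Open by blast
  thus ?thesis using update_old[OF True] True ro update_length by (auto simp: expanded_def instance_nodes_def)
 next
  case False
  thus ?thesis using update_new[of k] n(1) by (auto simp: expanded_def)
 qed
 have "structured P gnd G' W' M'" unfolding structured_def
 proof (intro allI impI conjI)
  fix k assume k: "k < length G'" "rule_of G' k = Open"
  show "succs G' k = []"
  proof (cases "k < length G")
   case True
   hence "k ~= n" using k(2) update_old(2)[OF True] rno by auto
   hence "rule_of G k = Open" using k(2) update_old(2)[OF True] by simp
   hence "succs G k = []" using structured_Open[OF st True] by simp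
   thus ?thesis using \<open>k ~= n\<close> update_old(3)[OF True] by simp
  next
   case False
   thus ?thesis using update_new k(1) by simp
  qed
  show "W' k = UNIV"
  proof (cases "k < length G")
   case True
   hence "k ~= n" using k(2) update_old(2)[OF True] rno by auto
   hence "rule_of G k = Open" using k(2) update_old(2)[OF True] by simp
   hence "W k = UNIV" using structured_Open[OF st True] by simp
   thus ?thesis using \<open>k ~= n\<close> True by (simp add: W'_def)
  qed (simp add: W'_def)
 next
  fix k \<mu> assume k: "k < length G'" "rule_of G' k = R_Instance \<mu>"
  have kG: "k < length G" using k update_new(2)[of k] by (cases "k < length G") auto
  show "W' k = UNIV"
  proof (cases "k = n")
   case True
   hence rI: "r = R_Instance \<mu>" using k(2) update_old(2)[OF kG] by simp
   show ?thesis using True kG Wn by (simp add: W'_def rI)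
  next
   case False
   hence "rule_of G k = R_Instance \<mu>" using k(2) update_old(2)[OF kG] by simp
   hence "W k = UNIV" using structured_Instance[OF st kG] by simp
   thus ?thesis using False kG by (simp add: W'_def)
  qed
  show "EX n'<length G'. succs G' k = [n'] & instance_of \<mu> (astate_of G' k) (astate_of G' n')"
  proof (cases "k = n")
   case True
   hence "r = R_Instance \<mu>" using k(2) update_old(2)[OF kG] by simp
   then obtain n' where "l = [n']" "n' < length G'" "instance_of \<mu> s (astate_of G' n')" using new expand_not_Open by blast
   thus ?thesis using True update_old[OF n(1)] sn by simp
  next
   case False
   hence "rule_of G k = R_Instance \<mu>" using k(2) update_old(2)[OF kG] by simp
   then obtain n' where n': "n' < length G" "succs G k = [n']" "instance_of \<mu> (astate_of G k) (astate_of G n')"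
    using structured_Instance[OF st kG] by blast
   moreover have "astate_of G' k = astate_of G k" "succs G' k = succs G k" "astate_of G' n' = astate_of G n'" "n' < length G'"
    using False update_old[OF kG] update_old[OF n'(1)] update_length n'(1) by simp_all
   ultimately show ?thesis by metis
  qed
 next
  fix k assume k: "k < length G'" "expanded G' k"
  have kG: "k < length G" using k update_new(2)[of k] by (cases "k < length G") (auto simp: expanded_def)
  let ?C = "expand P gnd (W' k) (M' k) (astate_of G' k) (rule_of G' k) (map (astate_of G') (succs G' k)) &
    distinct (succs G' k) &
    (ALL n':set (succs G' k). k < n' & n' < length G' & W' k Un rule_vars (rule_of G' k) <= W' n') &
    vars_astate (astate_of G' k) <= W' k & marks_state (fst (astate_of G' k)) <= M' k & W' k <= used_vars G'"
  have ?C
  proof (cases "k = n")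
   case True
   hence r: "ALL \<mu>. r ~= R_Instance \<mu>" using k(2) ex ro by (auto simp: expanded_def)
   hence e: "expand P gnd (used_vars G) (used_marks G) s r new" and l: "l = [length G..<length G + length new]" using new by auto
   have W: "W' k = used_vars G" "M' k = used_marks G" using True r n(1) by (auto simp: W'_def M'_def)
   have ss: "map (astate_of G') l = new" using update_new(1) by (intro nth_equalityI) (auto simp: l update_length)
   have "vars_astate s <= used_vars G" "marks_state (fst s) <= used_marks G" using n sn by (auto simp: used_vars_def used_marks_def)
   thus ?thesis using True W e ss sn update_old[OF n(1)] update_used n(1) update_length by (auto simp: l W'_def)
  next
   case False
   hence old: "expanded G k" using k(2) ex by blast
   have W: "W' k = W k" "M' k = M k" using False kG by (auto simp: W'_def M'_def)
   have o: "expand P gnd (W k) (M k) (astate_of G k) (rule_of G k) (map (astate_of G) (succs G k))"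
    "distinct (succs G k)"
    "!!n'. n':set (succs G k) ==> k < n' & n' < length G & W k Un rule_vars (rule_of G k) <= W n'"
    "vars_astate (astate_of G k) <= W k" "marks_state (fst (astate_of G k)) <= M k" "W k <= used_vars G"
    using structured_expanded[OF st old] by blast+
   have "map (astate_of G') (succs G k) = map (astate_of G) (succs G k)" using o(3) update_old(1) by (intro map_cong) auto
   moreover have "W k Un rule_vars (rule_of G k) <= W' n'" if "n':set (succs G k)" for n'
    using used[OF old] o(3)[OF that] by (auto simp: W'_def)
   moreover have "n' < length G'" if "n':set (succs G k)" for n' using o(3)[OF that] update_length by simp
   moreover have "astate_of G' k = astate_of G k" "rule_of G' k = rule_of G k" "succs G' k = succs G k"
    using False update_old[OF kG] by simp_all
   ultimately show ?thesis using W o update_used by (simp only:) blast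
  qed
  thus "expand P gnd (W' k) (M' k) (astate_of G' k) (rule_of G' k) (map (astate_of G') (succs G' k))"
   "distinct (succs G' k)"
   "ALL n':set (succs G' k). k < n' & n' < length G' & W' k Un rule_vars (rule_of G' k) <= W' n'"
   "vars_astate (astate_of G' k) <= W' k" "marks_state (fst (astate_of G' k)) <= M' k" "W' k <= used_vars G'" by blast+
 qed
 thus ?thesis by blast
qed

end

lemma built_structured: "built P gnd G ==> EX W M. structured P gnd G W M"
proof (induction rule: built.induct)
 case (root s)
 show ?case by (rule exI[of _ "%n. UNIV"]) (auto simp: structured_def rule_of_def succs_def expanded_def)
next
 case (expansion G n s r ss)
 then obtain W M where "structured P gnd G W M" by blast
 thus ?case by (rule update_structured[OF expansion.hyps(2,3) refl]) (use expansion.hyps(4) in auto)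
next
 case (instance_old G n s n' \<mu>)
 let ?G = "G[n := (s, R_Instance \<mu>, [n'])] @ map (%s'. (s', Open, [])) []"
 obtain W M where st: "structured P gnd G W M" using instance_old.IH by blast
 have "astate_of ?G n' = astate_of G n'" using update_old(1)[OF instance_old.hyps(2,3) refl] instance_old.hyps(4) by blast
 hence "EX W' M'. structured P gnd ?G W' M'" using instance_old.hyps by (intro update_structured[OF instance_old.hyps(2,3) refl st]) auto
 thus ?case by simp
next
 case (instance_new G n s \<mu> s')
 let ?G = "G[n := (s, R_Instance \<mu>, [length G])] @ map (%s'. (s', Open, [])) [s']"
 obtain W M where st: "structured P gnd G W M" using instance_new.IH by blast
 have "astate_of ?G (length G) = s'" by (simp add: astate_of_def nth_append)
 hence "EX W' M'. structured P gnd ?G W' M'" using instance_new.hyps by (intro update_structured[OF instance_new.hyps(2,3) refl st]) auto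
 thus ?case by simp
qed

section \<open>Where ordinary variables can occur in a graph\<close>

definition labels :: "'f state => 'f clause set" where
 "labels S = {c. EX Q m. Labeled Q c m : set S}"

lemma labels_simps [simp]: "labels [] = {}" "labels (Goal Q # S) = labels S" "labels (Scope m # S) = labels S"
 "labels (Labeled Q c m # S) = insert c (labels S)" "labels (S @ S') = labels S Un labels S'" by (auto simp: labels_def)

lemma labels_subst [simp]: "labels (S $s \<sigma>) = labels S"
proof -
 have "Labeled Q c m = g $h \<sigma> \<longleftrightarrow> (EX Q'. g = Labeled Q' c m & Q = Q' $g \<sigma>)" for Q c m g by (cases g) auto
 thus ?thesis by (force simp: labels_def subst_state_def image_iff)
qed

lemma labels_case_goals: "labels (case_goals P p ts Q m) <= set P" by (auto simp: labels_def case_goals_def slice_def)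

lemma vars_case_goals: "vars_state (case_goals P p ts Q m) <= vars_trm (Fun p ts) Un vars_goal Q"
proof -
 have "vars_state (map (%c. Labeled (Atom (Fun p ts) # Q) c m) cs) <= vars_trm (Fun p ts) Un vars_goal Q" for cs by (induction cs) auto
 thus ?thesis by (simp add: case_goals_def)
qed

definition kb_vars :: "('f trm \<times> 'f trm) set => var set" where
 "kb_vars U = (UN (s, s'):U. vars_trm s Un vars_trm s')"

text \<open>Goals contain abstract variables only, whereas the pairs may contain ordinary ones, such
  as those of recorded clause heads. Finiteness makes it possible to collect them in the list
  \<open>N\<close>.\<close>

definition sane :: "'f clause list => 'f astate => bool" where
 "sane P s \<longleftrightarrow> vars_state (fst s) <= abstract & fst (snd s) <= abstract & labels (fst s) <= set P &
   finite (kb_vars (snd (snd s)) Int ordinary)"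

lemma vars_sgoal_subst: "set (sgoal_var_list (g $h \<sigma>)) = (UN x:set (sgoal_var_list g). vars_trm (\<sigma> x))"
 by (cases g) (auto simp: vars_goal_subst)

lemma subst_state_simps [simp]: "[] $s \<sigma> = []" "(g # S) $s \<sigma> = g $h \<sigma> # S $s \<sigma>"
 "(S @ S') $s \<sigma> = S $s \<sigma> @ S' $s \<sigma>" by (simp_all add: subst_state_def)

lemma vars_state_subst: "vars_state (S $s \<sigma>) = (UN x:vars_state S. vars_trm (\<sigma> x))"
 by (induction S) (auto simp: vars_sgoal_subst)

lemma kb_vars_subst_pairs: "kb_vars (subst_pairs \<sigma> U) = (UN x:kb_vars U. vars_trm (\<sigma> x))"
 unfolding kb_vars_def subst_pairs_def by (auto simp: split_def vars_trm_subst)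

lemma not_abstract: "x : ordinary \<longleftrightarrow> x ~: abstract" by (cases x) (auto simp: ordinary_def abstract_def)

lemma approx_gnd_abstract: "approx_gnd gnd \<G> l \<mu> <= abstract"
proof (cases l)
 case (Atom t)
 thus ?thesis by (cases t) auto
qed simp

lemma sane_insert:
 assumes "sane P (S, \<G>, U)"
 shows "sane P (S, \<G>, insert (t, h) U)"
proof -
 have kbi: "kb_vars (insert (t, h) U) = set (var_list t) Un set (var_list h) Un kb_vars U" by (simp add: kb_vars_def)
 show ?thesis using assms by (simp add: sane_def kbi Int_Un_distrib2 del: set_var_list)
qed

lemma expand_sane:
 assumes "expand P gnd W M s r ss" "sane P s" "vars_astate s <= W" "s' : set ss"
 shows "sane P s'" using assms
proof (induction rule: expand.induct)
 case (Case_rule m p ts Q S KB)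
 have "vars_trm (Fun p ts) Un vars_goal Q <= abstract" using Case_rule.prems(1) by (simp add: sane_def)
 hence "vars_state (case_goals P p ts Q m) <= abstract" using vars_case_goals by (rule order_trans[rotated])
 thus ?case using Case_rule.prems labels_case_goals[of P p ts Q m] by (simp add: sane_def)
next
 case (Eval_rule \<sigma> t c \<tau> \<G> Q m S U)
 let ?s1 = "(Goal ((label_cuts m (body c) @ Q) $g \<sigma>) # S $s \<tau>, abstract Int range_vars \<tau>, subst_pairs \<tau> U)"
 have W: "vars_goal Q <= W" "vars_state S <= W" "\<G> <= W" using Eval_rule.prems(2) by auto
 have sig: "vars_trm (\<sigma> x) <= abstract" if "x : W Un vars_clause c" for x using Eval_rule.hyps(2) that by blast
 have tau: "\<tau> x = (if x : \<G> then \<sigma> x else Var x)" for x by (simp add: Eval_rule.hyps(3) restrict_subst_def)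
 have s1: "sane P ?s1"
 proof -
  have "vars_goal ((label_cuts m (body c) @ Q) $g \<sigma>) <= abstract"
  proof
   fix y assume "y : vars_goal ((label_cuts m (body c) @ Q) $g \<sigma>)"
   then obtain x where x: "x : vars_goal (body c) Un vars_goal Q" "y : vars_trm (\<sigma> x)" by (auto simp: vars_goal_subst)
   thus "y : abstract" using sig[of x] W(1) body_vars[of c] by blast
  qed
  moreover have "vars_state (S $s \<tau>) <= abstract"
  proof
   fix y assume "y : vars_state (S $s \<tau>)"
   then obtain x where x: "x : vars_state S" "y : vars_trm (\<tau> x)" by (auto simp: vars_state_subst)
   have "x : abstract" using x(1) Eval_rule.prems(1) by (auto simp: sane_def)
   thus "y : abstract" using x W(2) sig[of x] by (cases "x : \<G>") (auto simp: tau)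
  qed
  moreover have sub: "kb_vars (subst_pairs \<tau> U) Int ordinary <= kb_vars U Int ordinary"
  proof
   fix y assume "y : kb_vars (subst_pairs \<tau> U) Int ordinary"
   then obtain x where x: "x : kb_vars U" "y : vars_trm (\<tau> x)" "y ~: abstract" by (auto simp: kb_vars_subst_pairs not_abstract)
   have "x ~: \<G>"
   proof
    assume "x : \<G>"
    hence "vars_trm (\<tau> x) <= abstract" using sig[of x] W(3) by (simp add: tau subset_iff)
    thus False using x(2,3) by blast
   qed
   thus "y : kb_vars U Int ordinary" using x by (simp add: tau not_abstract)
  qed
  moreover have "finite (kb_vars (subst_pairs \<tau> U) Int ordinary)" "labels S <= set P"
   using finite_subset[OF sub] Eval_rule.prems(1) by (simp_all add: sane_def)
  ultimately show ?thesis by (simp add: sane_def)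
 qed
 have "sane P (S, \<G>, insert (t, head c) U)" by (rule sane_insert) (use Eval_rule.prems(1) in \<open>simp add: sane_def\<close>)
 moreover have "s' = ?s1 \<or> s' = (S, \<G>, insert (t, head c) U)" using Eval_rule.prems(3) by (simp only: set_simps insert_iff empty_iff simp_thms)
 ultimately show ?case using s1 by metis
next
 case (Split_rule \<G> \<mu> l Q U)
 have W: "vars_goal Q <= W" "kb_vars U <= W" using Split_rule.prems(2) by (auto simp: kb_vars_def)
 have G: "\<G> <= abstract" using Split_rule.prems(1) by (simp add: sane_def)
 have mu: "vars_trm (\<mu> x) <= abstract" if "x : W" for x
 proof (cases "x : \<G>")
  case True
  thus ?thesis using Split_rule.hyps(1) G by auto
 next
  case False
  hence "x : W - \<G>" using \<open>x : W\<close> by simp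
  then obtain y where "y : abstract - W" "\<mu> x = Var y" by (rule bexE[OF bspec[OF Split_rule.hyps(2)]])
  thus ?thesis by simp
 qed
 have "approx_gnd gnd \<G> l \<mu> <= abstract" by (rule approx_gnd_abstract)
 moreover have "vars_goal (Q $g \<mu>) <= abstract" using W mu by (auto simp: vars_goal_subst)
 moreover have "kb_vars (subst_pairs \<mu> U) Int ordinary = {}"
 proof -
  have "x : abstract" if "x : kb_vars (subst_pairs \<mu> U)" for x using that W mu by (auto simp: kb_vars_subst_pairs)
  thus ?thesis using not_abstract by blast
 qed
 ultimately show ?case using Split_rule.prems(1,3) G by (auto simp: sane_def)
next
 case (Backtrack_rule t c m S Q KB)
 show ?case using Backtrack_rule.prems by (simp add: sane_def)
next
 case (Parallel_rule S S' KB)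
 thus ?case using Parallel_rule.prems by (auto simp: sane_def)
qed (simp_all add: sane_def)

text \<open>The \<open>Instance\<close> substitution maps ordinary variables injectively to ordinary
  ones, so abstractness of goals and finiteness can be pulled back along it.\<close>

lemma instance_sane:
 assumes "instance_of \<mu> s s'" "sane P s"
 shows "sane P s'"
proof -
 obtain S \<G> U where s: "s = (S, \<G>, U)" by (cases s) auto
 obtain S' \<G>' U' where s': "s' = (S', \<G>', U')" by (cases s') auto
 have i: "S = S' $s \<mu>" "!!x. x : ordinary ==> EX y:ordinary. \<mu> x = Var y" "inj_on \<mu> ordinary" "\<G>' <= abstract"
  "subst_pairs \<mu> U' <= U" using assms(1) by (auto simp: s s')
 have "vars_state S' <= abstract"
 proof
  fix x assume x: "x : vars_state S'"
  show "x : abstract"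
  proof (rule ccontr)
   assume "x ~: abstract"
   then obtain y where "y : ordinary" "\<mu> x = Var y" using i(2)[of x] not_abstract by blast
   hence "y : vars_state S" using x by (auto simp: i(1) vars_state_subst intro!: bexI[of _ x])
   thus False using \<open>y : ordinary\<close> assms(2) not_abstract by (auto simp: sane_def s)
  qed
 qed
 moreover have "finite (kb_vars U' Int ordinary)"
 proof (rule finite_imageD)
  have "\<mu> ` (kb_vars U' Int ordinary) <= Var ` (kb_vars U Int ordinary)"
  proof
   fix t assume "t : \<mu> ` (kb_vars U' Int ordinary)"
   then obtain x where x: "t = \<mu> x" "x : kb_vars U'" "x : ordinary" by blast
   then obtain y where y: "y : ordinary" "\<mu> x = Var y" using i(2) by blast
   have "kb_vars (subst_pairs \<mu> U') <= kb_vars U" using i(5) by (auto simp: kb_vars_def)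
   thus "t : Var ` (kb_vars U Int ordinary)" using x y by (force simp: kb_vars_subst_pairs)
  qed
  thus "finite (\<mu> ` (kb_vars U' Int ordinary))" by (rule finite_subset) (use assms(2) in \<open>simp add: sane_def s\<close>)
  show "inj_on \<mu> (kb_vars U' Int ordinary)" using i(3) by (rule inj_on_subset) simp
 qed
 moreover have "labels S' = labels S" by (simp add: i(1))
 ultimately show ?thesis using assms(2) i(4) by (simp add: sane_def s s')
qed

lemma built_sane:
 assumes "built P gnd G" "sane P (astate_of G 0)"
 shows "n < length G ==> sane P (astate_of G n)" using assms
proof (induction arbitrary: n rule: built.induct)
 case (root s)
 thus ?case by (simp add: astate_of_def)
next
 case (expansion G k s r ss)
 let ?G = "G[k := (s, r, [length G..<length G + length ss])] @ map (%s'. (s', Open, [])) ss"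
 note old = update_old[OF expansion.hyps(2,3), of ?G] and new = update_new[OF expansion.hyps(2,3), of ?G]
 have "0 < length G" using expansion.hyps(2) by (rule le_less_trans[OF le0])
 hence s: "sane P (astate_of G i)" if "i < length G" for i using expansion.IH[OF that] expansion.prems(2) old(1)[OF refl, of 0] by simp
 show ?case
 proof (cases "n < length G")
  case True
  thus ?thesis using s old(1)[OF refl True] by simp
 next
  case False
  hence n: "n - length G < length ss" "astate_of ?G n = ss ! (n - length G)" using expansion.prems(1) new(1)[OF refl] by auto
  have k: "astate_of G k = s" using expansion.hyps(3) by (simp add: astate_of_def)
  have "vars_astate s <= used_vars G" using expansion.hyps(2) k by (auto simp: used_vars_def)
  moreover have "sane P s" using s[OF expansion.hyps(2)] k by simp
  ultimately have "sane P (ss ! (n - length G))" by (rule expand_sane[OF expansion.hyps(4) _ _ nth_mem[OF n(1)], rotated])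
  thus ?thesis using n(2) by simp
 qed
next
 case (instance_old G k s n' \<mu>)
 let ?G = "G[k := (s, R_Instance \<mu>, [n'])] @ map (%s'. (s', Open, [])) []"
 note old = update_old[OF instance_old.hyps(2,3), of ?G]
 have "0 < length G" using instance_old.hyps(2) by (rule le_less_trans[OF le0])
 have G: "?G = G[k := (s, R_Instance \<mu>, [n'])]" by simp
 have n: "n < length G" using instance_old.prems(1) by simp
 have "astate_of G 0 = astate_of (G[k := (s, R_Instance \<mu>, [n'])]) 0" using old(1)[OF refl \<open>0 < length G\<close>] unfolding G by (rule sym)
 hence "sane P (astate_of G n)" using instance_old.IH[OF n] instance_old.prems(2) by simp
 moreover have "astate_of (G[k := (s, R_Instance \<mu>, [n'])]) n = astate_of G n" using old(1)[OF refl n] unfolding G .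
 ultimately show ?case by simp
next
 case (instance_new G k s \<mu> s')
 let ?G = "G[k := (s, R_Instance \<mu>, [length G])] @ map (%s'. (s', Open, [])) [s']"
 note old = update_old[OF instance_new.hyps(2,3), of ?G] and new = update_new[OF instance_new.hyps(2,3), of ?G]
 have "0 < length G" using instance_new.hyps(2) by (rule le_less_trans[OF le0])
 hence s: "sane P (astate_of G i)" if "i < length G" for i
  using instance_new.IH[OF that] instance_new.prems(2) old(1)[OF refl, of 0] by simp
 have k: "astate_of G k = s" using instance_new.hyps(3) by (simp add: astate_of_def)
 show ?case
 proof (cases "n < length G")
  case True
  thus ?thesis using s old(1)[OF refl True] by simp
 next
  case False
  hence "n = length G" using instance_new.prems(1) by simp
  hence "astate_of ?G n = s'" by (simp add: astate_of_def nth_append)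
  moreover have "sane P s" using s[OF instance_new.hyps(2)] k by simp
  ultimately show ?thesis using instance_sane[OF instance_new.hyps(4)] by simp
 qed
qed

section \<open>Clause paths\<close>

lemma emb_subst_apply [simp]: "emb_subst \<sigma> x = map_trm Orig (\<sigma> x)" by (simp add: emb_subst_def)

lemma emb_subst_subst: "B $ emb_subst \<sigma> $ emb_subst \<tau> = B $ emb_subst (%x. \<sigma> x $ \<tau>)"
proof -
 have "emb_subst \<sigma> x $ emb_subst \<tau> = emb_subst (%x. \<sigma> x $ \<tau>) x" for x
  by (simp add: map_trm_subst emb_subst_def comp_def)
 thus ?thesis unfolding subst_trm_subst by (rule subst_trm_cong)
qed

lemma emb_subst_cong: "(!!x. x : vars_trm B ==> \<sigma> x = \<tau> x) ==> B $ emb_subst \<sigma> = B $ emb_subst \<tau>"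
 by (rule subst_trm_cong) simp

text \<open>Which substitution an \<open>Eval\<close> edge contributes depends on marks occurring
  later on the path; collecting both candidates removes this dependence.\<close>

definition edge_substs :: "'f graph => nat => nat => 'f subst set" where
 "edge_substs G n n' = (case rule_of G n of
   R_Eval \<sigma> => if n' = succs G n ! 0 then {\<sigma>, restrict_subst \<sigma> (fst (snd (astate_of G n)))} else {Var}
  | R_Split \<mu> => if n' = succs G n ! 1 then {\<mu>} else {Var}
  | _ => {Var})"

lemma subst_comp_Var [simp]: "subst_comp \<sigma> Var = \<sigma>" by (simp add: subst_comp_def)

text \<open>The factor of the last edge and the new bound on marks do not depend on the beginning of
  the path, so paths can be treated one edge at a time.\<close>

lemma rev_path_edge:
 "EX \<sigma>:edge_substs G n n'. EX m'. ALL ns. rev_path_subst G m (n' # n # ns) = subst_comp (rev_path_subst G m' (n # ns)) \<sigma>"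
proof -
 have skip: ?thesis if "edge_substs G n n' = {Var}" "ALL ns. rev_path_subst G m (n' # n # ns) = rev_path_subst G m (n # ns)"
 proof (rule bexI[of _ Var], rule exI[of _ m])
  show "ALL ns. rev_path_subst G m (n' # n # ns) = subst_comp (rev_path_subst G m (n # ns)) Var"
   using that(2) by (simp only: subst_comp_Var simp_thms)
  show "Var : edge_substs G n n'" using that(1) by simp
 qed
 show ?thesis
proof (cases "rule_of G n")
 case (R_Eval \<sigma>)
 consider "n' = succs G n ! 0" "enat (node_mark G n) < m" | "n' = succs G n ! 0" "~ enat (node_mark G n) < m" | "n' ~= succs G n ! 0" by blast
 thus ?thesis
 proof cases
  case 1
  thus ?thesis by (intro bexI[of _ \<sigma>] exI[of _ "enat (node_mark G n)"]) (simp_all add: R_Eval edge_substs_def)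
 next
  case 2
  thus ?thesis
   by (intro bexI[of _ "restrict_subst \<sigma> (fst (snd (astate_of G n)))"] exI[of _ m]) (simp_all add: R_Eval edge_substs_def)
 next
  case 3
  thus ?thesis by (intro bexI[of _ Var] exI[of _ m]) (simp_all add: R_Eval edge_substs_def)
 qed
next
 case (R_Split \<mu>)
 show ?thesis
 proof (cases "n' = succs G n ! 1")
  case True
  thus ?thesis by (intro bexI[of _ \<mu>] exI[of _ m]) (simp_all add: R_Split edge_substs_def)
 next
  case False
  thus ?thesis by (intro bexI[of _ Var] exI[of _ m]) (simp_all add: R_Split edge_substs_def)
 qed
qed (rule skip; simp add: edge_substs_def)+
qed

declare rev_path_subst.simps(1) [simp del]

section \<open>Renamed nodes and instances of path clauses\<close>

locale graph =
 fixes P :: "'f clause list" and gnd :: "'f groundness" and G :: "'f graph"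
  and W :: "nat => var set" and M :: "nat => nat set" and PG :: "'f gsym clause list"
 assumes clauses: "!!c. c : set P ==> vars_clause c <= ordinary"
  and ga: "groundness_analysis P gnd"
  and st: "structured P gnd G W M"
  and sane: "!!n. n < length G ==> sane P (astate_of G n)"
  and acyc: "acyclic {(n, n'). n : instance_nodes G & n' : set (succs G n)}"
  and leaves: "!!n. n < length G ==> rule_of G n = Open ==> fst (astate_of G n) = []"
  and rwd: "renaming_well_defined G"
  and PG: "set PG = P_G G"
  and root: "0 < length G" "EX t. fst (astate_of G 0) = [Goal [Atom t]]"
begin

abbreviation S :: "nat => 'f state" where "S n \<equiv> fst (astate_of G n)"
abbreviation Gr :: "nat => var set" where "Gr n \<equiv> fst (snd (astate_of G n))"
abbreviation U :: "nat => ('f trm \<times> 'f trm) set" where "U n \<equiv> snd (snd (astate_of G n))"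

text \<open>A finite acyclic relation is well-founded in both directions. Hence chains of
  \<open>Instance\<close> edges end and renamings are total.\<close>

lemma wf_instances: "wf ({(n, n'). n : instance_nodes G & n' : set (succs G n)}\<inverse>)"
proof (rule finite_acyclic_wf_converse[OF _ acyc])
 have "{(n, n'). n : instance_nodes G & n' : set (succs G n)} = (SIGMA n:instance_nodes G. set (succs G n))" by auto
 thus "finite {(n, n'). n : instance_nodes G & n' : set (succs G n)}" by (simp add: instance_nodes_def)
qed

lemma instance_node:
 assumes "n < length G" "rule_of G n = R_Instance \<mu>"
 obtains n' where "n' < length G" "succs G n = [n']" "instance_of \<mu> (astate_of G n) (astate_of G n')"
proof -
 have "EX n'<length G. succs G n = [n'] & instance_of \<mu> (astate_of G n) (astate_of G n')"
  using structured_Instance[OF st assms] by (rule conjunct2)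
 thus thesis by (elim exE conjE) (rule that)
qed

lemma is_ren_unique: "is_ren G n ts ==> is_ren G n ts' ==> ts = ts'"
proof (induction arbitrary: ts' rule: is_ren.induct)
 case (1 n)
 from 1(2,1) show ?case by (cases rule: is_ren.cases) (auto simp: suc_nodes_def)
next
 case (2 n \<mu> ts)
 from 2(5) show ?case
 proof (cases rule: is_ren.cases)
  case 1
  thus ?thesis using 2(2) by (simp add: suc_nodes_def)
 next
  case (2 \<mu>' ts'')
  hence "\<mu>' = \<mu>" using \<open>rule_of G n = R_Instance \<mu>\<close> by simp
  thus ?thesis using 2 \<open>!!ts'. is_ren G (succs G n ! 0) ts' ==> ts = ts'\<close> by blast
 next
  case 3
  thus ?thesis using 2(2) by (simp add: instance_nodes_def)
 qed
next
 case (3 n)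
 from 3(4) show ?case
 proof (cases rule: is_ren.cases)
  case 1
  thus ?thesis using 3(2) by simp
 next
  case (2 \<mu>' ts'')
  thus ?thesis using 3(1,3) by (simp add: instance_nodes_def)
 next
  case 3
  thus ?thesis by simp
 qed
qed

lemma is_ren_exists: "n < length G ==> EX ts. is_ren G n ts"
proof (induction n rule: wf_induct_rule[OF wf_instances])
 case (1 n)
 consider "n : suc_nodes G" | \<mu> where "rule_of G n = R_Instance \<mu>" | "n ~: suc_nodes G" "n ~: instance_nodes G"
  by (auto simp: instance_nodes_def)
 thus ?case
 proof cases
  case 1
  thus ?thesis by (blast intro: is_ren.intros)
 next
  case 2
  then obtain n' where n': "n' < length G" "succs G n = [n']" using instance_node[OF 1(2)] by metis
  have "n : instance_nodes G" using 1(2) 2 by (auto simp: instance_nodes_def)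
  then obtain ts where "is_ren G n' ts" using 1(1)[of n'] n' by auto
  thus ?thesis using is_ren.intros(2)[OF 1(2) 2] n' by (metis nth_Cons_0)
 next
  case 3
  thus ?thesis using is_ren.intros(3)[OF 1(2)] by blast
 qed
qed

lemma Ren_eqI: "is_ren G n ts ==> Ren G n = ts" unfolding Ren_def by (rule the_equality) (auto intro: is_ren_unique)

lemma is_ren_Ren: "n < length G ==> is_ren G n (Ren G n)" using is_ren_exists Ren_eqI by metis

lemma Ren_suc: "n : suc_nodes G ==> Ren G n = []" by (rule Ren_eqI) (rule is_ren.intros)

lemma Ren_instance:
 assumes "n < length G" "rule_of G n = R_Instance \<mu>" "succs G n = [n']" "n' < length G"
 shows "Ren G n = map (subst_trm (emb_subst \<mu>)) (Ren G n')"
 by (rule Ren_eqI, rule is_ren.intros(2)[OF assms(1,2)]) (simp add: assms(3) is_ren_Ren[OF assms(4)])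

lemma Ren_other:
 "n < length G ==> n ~: suc_nodes G ==> n ~: instance_nodes G ==> Ren G n = [Fun (Pred n) (map Var (state_var_list (S n)))]"
 by (rule Ren_eqI) (rule is_ren.intros)

lemma Ren_atom:
 assumes "n < length G" "n ~: suc_nodes G"
 shows "EX f us. Ren G n = [Fun f us] & vars_trm (Fun f us) <= vars_state (S n)" using assms
proof (induction n rule: wf_induct_rule[OF wf_instances])
 case (1 n)
 show ?case
 proof (cases "n : instance_nodes G")
  case True
  then obtain \<mu> where mu: "rule_of G n = R_Instance \<mu>" by (auto simp: instance_nodes_def)
  obtain n' where n': "n' < length G" "succs G n = [n']" "instance_of \<mu> (astate_of G n) (astate_of G n')"
   by (rule instance_node[OF 1(2) mu])
  have "n' ~: suc_nodes G" using rwd True n'(2) by (auto simp: renaming_well_defined_def)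
  then obtain f us where f: "Ren G n' = [Fun f us]" "vars_trm (Fun f us) <= vars_state (S n')" using 1(1)[of n'] n' True by auto
  have "S n = S n' $s \<mu>" using n'(3) by (cases "astate_of G n"; cases "astate_of G n'"; auto)
  hence "vars_state (S n) = (UN x:vars_state (S n'). vars_trm (\<mu> x))" by (simp add: vars_state_subst)
  moreover have "vars_trm (Fun f us $ emb_subst \<mu>) = (UN x:vars_trm (Fun f us). vars_trm (\<mu> x))" by (simp add: vars_trm_subst)
  ultimately have "vars_trm (Fun f us $ emb_subst \<mu>) <= vars_state (S n)" using f(2) by blast
  thus ?thesis using Ren_instance[OF 1(2) mu n'(2,1)] f(1) by simp
 next
  case False
  thus ?thesis using Ren_other[OF 1(2,3)] by (auto simp: vars_state_def)
 qed
qed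

definition atom :: "nat => 'f gsym trm" where
 "atom n = hd (Ren G n)"

lemma atom:
 assumes "n < length G" "n ~: suc_nodes G"
 shows "Ren G n = [atom n]" "vars_trm (atom n) <= vars_state (S n)" "EX f us. atom n = Fun f us"
proof -
 obtain f us where f: "Ren G n = [Fun f us]" "vars_trm (Fun f us) <= vars_state (S n)" using Ren_atom[OF assms] by blast
 have "atom n = Fun f us" by (simp only: atom_def f(1) list.sel)
 thus "Ren G n = [atom n]" "vars_trm (atom n) <= vars_state (S n)" "EX f us. atom n = Fun f us" using f by auto
qed

lemma atom_instance:
 assumes "n < length G" "rule_of G n = R_Instance \<mu>" "succs G n = [n']" "n' < length G" "n' ~: suc_nodes G"
 shows "atom n = atom n' $ emb_subst \<mu>"
proof -
 have "Ren G n = [atom n' $ emb_subst \<mu>]" using Ren_instance[OF assms(1-4)] atom(1)[OF assms(4,5)] by simp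
 thus ?thesis by (simp only: atom_def[of n] list.sel)
qed

definition start :: "nat => bool" where
 "start n \<longleftrightarrow> n = 0 \<or> n : first_succs G"

lemma expand_at: "expanded G n ==> expand P gnd (W n) (M n) (astate_of G n) (rule_of G n) (map (astate_of G) (succs G n))"
 using structured_expanded(1)[OF st] .

lemma succ_at: "expanded G n ==> n' : set (succs G n) ==> n < n' & n' < length G & W n Un rule_vars (rule_of G n) <= W n'"
 using structured_expanded(3)[OF st] by blast

lemma vars_state_W: "expanded G n ==> vars_state (S n) <= W n" using structured_expanded(4)[OF st, of n] by (cases "astate_of G n") auto

lemma vars_state_abstract: "n < length G ==> vars_state (S n) <= abstract" using sane by (simp add: sane_def)

lemma split_at:
 assumes "n : split_nodes G"
 obtains l Q where "S n = [Goal (l # Q)]" "S (succs G n ! 0) = [Goal [l]]" "length (succs G n) = 2" "expanded G n"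
proof -
 obtain \<mu> where mu: "n < length G" "rule_of G n = R_Split \<mu>" using assms by (auto simp: split_nodes_def)
 hence ex: "expanded G n" by (auto simp: expanded_def instance_nodes_def)
 have "EX l Q. S n = [Goal (l # Q)] & fst (map (astate_of G) (succs G n) ! 0) = [Goal [l]] & length (map (astate_of G) (succs G n)) = 2"
  using expand_at[OF ex] unfolding mu(2) by (cases rule: expand.cases) auto
 then obtain l Q where "S n = [Goal (l # Q)]" "fst (map (astate_of G) (succs G n) ! 0) = [Goal [l]]" "length (succs G n) = 2" by auto
 thus thesis using that ex by simp
qed

lemma suc_state:
 assumes "n : suc_nodes G"
 shows "EX S'. S n = Goal [] # S'"
proof -
 have n: "n < length G" "rule_of G n = R_Suc" using assms by (auto simp: suc_nodes_def)
 hence "expanded G n" by (auto simp: expanded_def instance_nodes_def)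
 from expand_at[OF this] show ?thesis unfolding n(2) by (cases rule: expand.cases) auto
qed

lemma start_node:
 assumes "start n"
 shows "n < length G" "n ~: suc_nodes G"
proof -
 have "n < length G & n ~: suc_nodes G"
 proof (cases "n = 0")
  case True
  thus ?thesis using root suc_state[of n] by auto
 next
  case False
  then obtain k where k: "n = succs G k ! 0" "k : instance_nodes G \<or> k : split_nodes G"
   using assms by (auto simp: start_def first_succs_def)
  from k(2) show ?thesis
  proof
   assume i: "k : instance_nodes G"
   then obtain \<mu> where "k < length G" "rule_of G k = R_Instance \<mu>" by (auto simp: instance_nodes_def)
   then obtain n' where "n' < length G" "succs G k = [n']" by (rule instance_node)
   thus ?thesis using k(1) rwd i by (auto simp: renaming_well_defined_def)
  next
   assume "k : split_nodes G"
   then obtain l Q where l: "S n = [Goal [l]]" "length (succs G k) = 2" "expanded G k" using k(1) by (metis split_at)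
   hence "n : set (succs G k)" using k(1) by simp
   thus ?thesis using succ_at[OF l(3)] suc_state[of n] l(1) by auto
  qed
 qed
 thus "n < length G" "n ~: suc_nodes G" by blast+
qed

text \<open>A clause path under construction: nothing is required of its last node, and it may
  consist of its start only.\<close>

definition run :: "nat list => bool" where
 "run \<pi> \<longleftrightarrow> \<pi> ~= [] & start (hd \<pi>) & (ALL n:set \<pi>. n < length G) &
   (ALL j. Suc j < length \<pi> --> \<pi> ! Suc j : set (succs G (\<pi> ! j))) &
   (ALL j. Suc j < length \<pi> --> \<pi> ! j ~: instance_nodes G) &
   (ALL j. 0 < j & Suc j < length \<pi> --> \<pi> ! j ~: first_succs G)"

lemma run_single: "start n ==> run [n]" using start_node[of n] by (simp add: run_def)

lemma run_snoc:
 assumes "run \<pi>" "last \<pi> ~: instance_nodes G" "length \<pi> = 1 \<or> last \<pi> ~: first_succs G"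
  "n' : set (succs G (last \<pi>))" "n' < length G"
 shows "run (\<pi> @ [n'])"
proof -
 have ne: "\<pi> ~= []" and last: "last \<pi> = \<pi> ! (length \<pi> - 1)" using assms(1) by (auto simp: run_def last_conv_nth)
 have nth: "(\<pi> @ [n']) ! j = \<pi> ! j" if "j < length \<pi>" for j using that by (simp add: nth_append)
 have e: "Suc j < length (\<pi> @ [n']) ==> Suc j < length \<pi> \<or> j = length \<pi> - 1" for j using ne by auto
 have 1: "(\<pi> @ [n']) ! Suc j : set (succs G ((\<pi> @ [n']) ! j))" if "Suc j < length (\<pi> @ [n'])" for j using e[OF that]
 proof
  assume "Suc j < length \<pi>"
  thus ?thesis using assms(1) nth by (simp add: run_def)
 next
  assume j: "j = length \<pi> - 1"
  hence "Suc j = length \<pi>" using ne by simp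
  thus ?thesis using j assms(4) last ne by (simp add: nth_append)
 qed
 have 2: "(\<pi> @ [n']) ! j ~: instance_nodes G" if "Suc j < length (\<pi> @ [n'])" for j
  using e[OF that] assms(1,2) nth[of j] last ne by (auto simp: run_def)
 have 3: "(\<pi> @ [n']) ! j ~: first_succs G" if "0 < j" "Suc j < length (\<pi> @ [n'])" for j
  using e[OF that(2)] that(1) assms(1,3) nth[of j] last ne by (auto simp: run_def)
 show ?thesis using assms(1,5) ne 1 2 3 unfolding run_def by auto
qed

lemma run_clause_path:
 "run \<pi> ==> 1 < length \<pi> ==> last \<pi> : suc_nodes G Un instance_nodes G Un first_succs G ==> clause_path G \<pi>"
 unfolding run_def clause_path_def start_def by blast

lemma run_expanded:
 assumes "run \<pi>" "Suc j < length \<pi>"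
 shows "expanded G (\<pi> ! j)"
proof -
 have "\<pi> ! Suc j : set (succs G (\<pi> ! j))" "\<pi> ! j ~: instance_nodes G" "\<pi> ! j < length G" using assms by (auto simp: run_def)
 thus ?thesis using structured_Open[OF st, of "\<pi> ! j"] by (auto simp: expanded_def)
qed

lemma edge_vars:
 assumes "expanded G n" "n' : set (succs G n)" "\<sigma> : edge_substs G n n'" "z : W n Int abstract"
 shows "vars_trm (\<sigma> z) <= W n' Int abstract"
proof -
 have abs: "vars_trm (\<sigma> z) <= abstract"
 proof (cases "rule_of G n")
  case (R_Eval \<tau>)
  have "vars_trm (\<tau> z) <= abstract" using expand_at[OF assms(1)] assms(4) unfolding R_Eval by (cases rule: expand.cases) auto
  thus ?thesis using assms(3,4) by (auto simp: edge_substs_def R_Eval restrict_subst_def split: if_splits)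
 next
  case (R_Split \<mu>)
  have "vars_trm (\<mu> z) <= abstract" using expand_at[OF assms(1)] unfolding R_Split
  proof (cases rule: expand.cases)
   case (Split_rule \<G> l Q U)
   hence "\<mu> z = Var z \<or> (EX y:abstract - W n. \<mu> z = Var y)" using assms(4) by blast
   thus ?thesis using assms(4) by auto
  qed
  thus ?thesis using assms(3,4) by (auto simp: edge_substs_def R_Split split: if_splits)
 qed (use assms(3,4) in \<open>auto simp: edge_substs_def\<close>)
 have W: "W n Un rule_vars (rule_of G n) <= W n'" using succ_at[OF assms(1,2)] by blast
 have r: "vars_trm (\<tau> z) <= {z} Un (subst_dom \<tau> Un range_vars \<tau>)" for \<tau> :: "'f subst"
  by (cases "\<tau> z = Var z") (auto simp: range_vars_def subst_range_def subst_dom_def)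
 have "\<sigma> z = Var z \<or> (EX \<tau>. \<sigma> z = \<tau> z & rule_vars (rule_of G n) = subst_dom \<tau> Un range_vars \<tau>)"
  using assms(3) by (cases "rule_of G n") (auto simp: edge_substs_def restrict_subst_def split: if_splits)
 hence "vars_trm (\<sigma> z) <= W n'" using W r assms(4) by fastforce
 thus ?thesis using abs by blast
qed

text \<open>Variables present at the start are sent to variables known at the end of the path, which
  is the domain on which the next edge factors through the valuations.\<close>

lemma path_vars:
 assumes "\<pi> ~= []" "ALL j. Suc j < length \<pi> --> expanded G (\<pi> ! j) & \<pi> ! Suc j : set (succs G (\<pi> ! j))" "x : W (hd \<pi>) Int abstract"
 shows "vars_trm (rev_path_subst G m (rev \<pi>) x) <= W (last \<pi>) Int abstract" using assms
proof (induction \<pi> arbitrary: m rule: rev_induct)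
 case (snoc n' \<pi>)
 show ?case
 proof (cases "\<pi> = []")
  case True
  thus ?thesis using snoc.prems(3) by simp
 next
  case False
  let ?n = "last \<pi>"
  have last: "?n = \<pi> ! (length \<pi> - 1)" using False by (simp add: last_conv_nth)
  have "Suc (length \<pi> - 1) < length (\<pi> @ [n'])" using False by simp
  hence ex: "expanded G ?n" "n' : set (succs G ?n)"
   using snoc.prems(2)[rule_format, of "length \<pi> - 1"] False last by (auto simp: nth_append)
  have pre: "ALL j. Suc j < length \<pi> --> expanded G (\<pi> ! j) & \<pi> ! Suc j : set (succs G (\<pi> ! j))"
  proof (intro allI impI)
   fix j assume j: "Suc j < length \<pi>"
   thus "expanded G (\<pi> ! j) & \<pi> ! Suc j : set (succs G (\<pi> ! j))" using snoc.prems(2)[rule_format, of j] by (simp add: nth_append)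
  qed
  obtain ns where ns: "rev \<pi> = ?n # ns" using False by (metis append_butlast_last_id rev_eq_Cons_iff rev_rev_ident)
  obtain \<sigma> m' where e: "\<sigma> : edge_substs G ?n n'" "rev_path_subst G m (n' # ?n # ns) = subst_comp (rev_path_subst G m' (?n # ns)) \<sigma>"
   using rev_path_edge by meson
  have "vars_trm (rev_path_subst G m' (rev \<pi>) x) <= W ?n Int abstract" using snoc.IH[OF False pre] snoc.prems(3) False by simp
  moreover have "rev_path_subst G m (rev (\<pi> @ [n'])) x = rev_path_subst G m' (rev \<pi>) x $ \<sigma>"
   unfolding rev_append ns using e(2) by (simp add: subst_comp_def)
  moreover have "vars_trm (rev_path_subst G m' (rev \<pi>) x $ \<sigma>) <= W n' Int abstract"
   unfolding vars_trm_subst by (rule UN_least, rule edge_vars[OF ex e(1)]) (rule subsetD[OF calculation(1)])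
  ultimately show ?thesis by simp
 qed
qed simp

text \<open>A path is traversed with valuations \<open>vs\<close> at its start and \<open>v\<close> at its end. The mark \<open>m\<close> is
  arbitrary, because the substitutions along the edges are compatible with the valuations whether or
  not they are restricted to the ground variables.\<close>

definition covers :: "'f subst set => nat list => 'f subst => 'f subst => bool" where
 "covers D \<pi> vs v \<longleftrightarrow>
   (ALL m. EX \<delta>:D. ALL x:vars_state (S (hd \<pi>)). rev_path_subst G m (rev \<pi>) x $ v = vs x $ \<delta>) &
   (ALL m i. Suc i < length \<pi> & \<pi> ! i : split_nodes G & \<pi> ! Suc i = succs G (\<pi> ! i) ! 1 -->
    tree PG (atom (succs G (\<pi> ! i) ! 0) $ emb_subst (%x. rev_path_subst G m (rev (drop i \<pi>)) x $ v)))"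

lemma covers_single: "Var : D ==> covers D [n] v v" by (auto simp: covers_def intro!: bexI[of _ Var])

lemma split_left:
 assumes "n : split_nodes G"
 shows "start (succs G n ! 0)" "vars_trm (atom (succs G n ! 0)) <= vars_state (S n)" "succs G n ! 0 : set (succs G n)"
proof -
 show s: "start (succs G n ! 0)" using assms by (auto simp: start_def first_succs_def)
 obtain l Q where l: "S n = [Goal (l # Q)]" "S (succs G n ! 0) = [Goal [l]]" "length (succs G n) = 2" by (rule split_at[OF assms])
 thus "vars_trm (atom (succs G n ! 0)) <= vars_state (S n)" "succs G n ! 0 : set (succs G n)" using atom(2)[OF start_node[OF s]] by auto
qed

text \<open>All suffixes of the path receive the same last factor, so one factorization serves the
  head and every intermediate goal; derivable goals stay derivable under the additional
  instantiation. Only the right edge of a \<open>Split\<close> node adds a new goal.\<close>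

lemma covers_snoc:
 assumes run: "run \<pi>" "run (\<pi> @ [n'])" and cov: "covers D \<pi> vs v"
  and D: "!!\<delta> \<delta>'. \<delta> : D ==> \<delta>' : D ==> (%x. \<delta> x $ \<delta>') : D"
  and edge: "!!\<sigma>. \<sigma> : edge_substs G (last \<pi>) n' ==> EX \<delta>:D. ALL z:W (last \<pi>) Int abstract. \<sigma> z $ v' = v z $ \<delta>"
  and split: "!!\<sigma>. last \<pi> : split_nodes G ==> n' = succs G (last \<pi>) ! 1 ==> \<sigma> : edge_substs G (last \<pi>) n' ==>
   tree PG (atom (succs G (last \<pi>) ! 0) $ emb_subst (%x. \<sigma> x $ v'))"
 shows "covers D (\<pi> @ [n']) vs v'"
proof -
 have ne: "\<pi> ~= []" using run(1) by (simp add: run_def)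
 let ?n = "last \<pi>"
 have lastn: "?n = \<pi> ! (length \<pi> - 1)" using ne by (simp add: last_conv_nth)
 have pe: "ALL j. Suc j < length \<pi> --> expanded G (\<pi> ! j) & \<pi> ! Suc j : set (succs G (\<pi> ! j))"
  using run(1) run_expanded by (auto simp: run_def)
 have exl: "expanded G ?n" using run_expanded[OF run(2), of "length \<pi> - 1"] ne lastn by (simp add: nth_append)
 have exn: "expanded G (\<pi> ! i)" if "i < length \<pi>" for i
  using that pe exl lastn by (cases "Suc i < length \<pi>") (auto simp: not_less le_Suc_eq dest!: le_antisym[of "length \<pi>" "Suc i"])
 \<comment> \<open>Needed for all suffixes, as an intermediate goal is instantiated by the path from
   its own \<open>Split\<close> node on.\<close>
 have step: "EX \<delta>:D. EX m'. ALL x:W (\<pi> ! i) Int abstract. rev_path_subst G m (n' # rev (drop i \<pi>)) x $ v' = rev_path_subst G m' (rev (drop i \<pi>)) x $ v $ \<delta>"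
  if i: "i < length \<pi>" for i m
 proof -
  have d: "drop i \<pi> ~= []" "last (drop i \<pi>) = ?n" "hd (drop i \<pi>) = \<pi> ! i" using i by (auto simp: hd_drop_conv_nth)
  obtain ns where ns: "rev (drop i \<pi>) = ?n # ns" using d by (metis append_butlast_last_id rev_eq_Cons_iff rev_rev_ident)
  obtain \<sigma> m' where e: "\<sigma> : edge_substs G ?n n'" "rev_path_subst G m (n' # ?n # ns) = subst_comp (rev_path_subst G m' (?n # ns)) \<sigma>"
   using rev_path_edge by meson
  obtain \<delta> where de: "\<delta> : D" "!!z. z : W ?n Int abstract ==> \<sigma> z $ v' = v z $ \<delta>" using edge[OF e(1)] by blast
  have "rev_path_subst G m (n' # rev (drop i \<pi>)) x $ v' = rev_path_subst G m' (rev (drop i \<pi>)) x $ v $ \<delta>" if x: "x : W (\<pi> ! i) Int abstract" for x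
  proof -
   have "ALL j. Suc j < length (drop i \<pi>) --> expanded G (drop i \<pi> ! j) & drop i \<pi> ! Suc j : set (succs G (drop i \<pi> ! j))"
    using pe i by (auto simp: add.commute)
   hence "vars_trm (rev_path_subst G m' (rev (drop i \<pi>)) x) <= W ?n Int abstract" using path_vars[OF d(1), of x m'] x d(2,3) by simp
   hence "rev_path_subst G m' (rev (drop i \<pi>)) x $ (%z. \<sigma> z $ v') = rev_path_subst G m' (rev (drop i \<pi>)) x $ (%z. v z $ \<delta>)"
    using de(2) by (intro subst_trm_cong) blast
   thus ?thesis unfolding ns e(2) subst_comp_def by (simp only: subst_trm_subst)
  qed
  thus ?thesis using de(1) by blast
 qed
 have 1: "EX \<delta>:D. ALL x:vars_state (S (hd (\<pi> @ [n']))). rev_path_subst G m (rev (\<pi> @ [n'])) x $ v' = vs x $ \<delta>" for m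
 proof -
  have h: "hd \<pi> = \<pi> ! 0" using ne by (simp add: hd_conv_nth)
  hence sub: "vars_state (S (hd \<pi>)) <= W (\<pi> ! 0) Int abstract" using vars_state_W exn[of 0] vars_state_abstract[of "\<pi> ! 0"] ne by (simp add: expanded_def)
  obtain \<delta> m' where d: "\<delta> : D" "!!x. x : W (\<pi> ! 0) Int abstract ==> rev_path_subst G m (n' # rev \<pi>) x $ v' = rev_path_subst G m' (rev \<pi>) x $ v $ \<delta>"
   using step[of 0 m] ne by (auto simp del: Int_iff)
  obtain \<delta>' where d': "\<delta>' : D" "!!x. x : vars_state (S (hd \<pi>)) ==> rev_path_subst G m' (rev \<pi>) x $ v = vs x $ \<delta>'"
   using cov unfolding covers_def by blast
  have "ALL x:vars_state (S (hd (\<pi> @ [n']))). rev_path_subst G m (rev (\<pi> @ [n'])) x $ v' = vs x $ (%x. \<delta>' x $ \<delta>)"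
  proof
   fix x assume "x : vars_state (S (hd (\<pi> @ [n'])))"
   hence x: "x : vars_state (S (hd \<pi>))" using ne by simp
   hence "x : W (\<pi> ! 0) Int abstract" using sub by blast
   thus "rev_path_subst G m (rev (\<pi> @ [n'])) x $ v' = vs x $ (%x. \<delta>' x $ \<delta>)"
    using d(2)[of x] d'(2)[OF x] by (simp add: subst_trm_subst)
  qed
  thus ?thesis using D[OF d'(1) d(1)] by (rule bexI)
 qed
 have 2: "tree PG (atom (succs G ((\<pi> @ [n']) ! i) ! 0) $ emb_subst (%x. rev_path_subst G m (rev (drop i (\<pi> @ [n']))) x $ v'))"
  if i: "Suc i < length (\<pi> @ [n'])" "(\<pi> @ [n']) ! i : split_nodes G" "(\<pi> @ [n']) ! Suc i = succs G ((\<pi> @ [n']) ! i) ! 1" for m i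
 proof (cases "Suc i < length \<pi>")
  case True
  hence il: "i < length \<pi>" and nth: "(\<pi> @ [n']) ! i = \<pi> ! i" "(\<pi> @ [n']) ! Suc i = \<pi> ! Suc i" by (auto simp: nth_append)
  obtain \<delta> m' where d: "!!x. x : W (\<pi> ! i) Int abstract ==>
    rev_path_subst G m (n' # rev (drop i \<pi>)) x $ v' = rev_path_subst G m' (rev (drop i \<pi>)) x $ v $ \<delta>" using step[OF il] by blast
  let ?B = "atom (succs G (\<pi> ! i) ! 0)"
  have "\<pi> ! i < length G" using exn[OF il] by (simp add: expanded_def)
  hence B: "vars_trm ?B <= W (\<pi> ! i) Int abstract"
   using split_left(2)[of "\<pi> ! i"] vars_state_W[OF exn[OF il]] vars_state_abstract[of "\<pi> ! i"] i(2) nth by auto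
  have "tree PG (?B $ emb_subst (%x. rev_path_subst G m' (rev (drop i \<pi>)) x $ v))" using cov True i nth unfolding covers_def by auto
  hence "tree PG (?B $ emb_subst (%x. rev_path_subst G m' (rev (drop i \<pi>)) x $ v) $ emb_subst \<delta>)" by (rule tree_inst)
  moreover have "?B $ emb_subst (%x. rev_path_subst G m' (rev (drop i \<pi>)) x $ v) $ emb_subst \<delta> =
    ?B $ emb_subst (%x. rev_path_subst G m (n' # rev (drop i \<pi>)) x $ v')"
   unfolding emb_subst_subst by (rule emb_subst_cong, rule d[symmetric]) (rule subsetD[OF B])
  ultimately show ?thesis using nth il by simp
 next
  case False
  hence ie: "i = length \<pi> - 1" "Suc i = length \<pi>" using i(1) by auto
  hence nth: "(\<pi> @ [n']) ! i = ?n" "(\<pi> @ [n']) ! Suc i = n'" using lastn ne by (auto simp: nth_append)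
  have dr: "drop i (\<pi> @ [n']) = [?n, n']" using ie ne by (metis append_butlast_last_id append_eq_conv_conj append_assoc append_Cons append_Nil length_butlast)
  obtain \<sigma> m' where e: "\<sigma> : edge_substs G ?n n'" "rev_path_subst G m (n' # ?n # []) = subst_comp (rev_path_subst G m' (?n # [])) \<sigma>"
   using rev_path_edge by meson
  have R: "rev_path_subst G m (rev (drop i (\<pi> @ [n']))) = \<sigma>" unfolding dr using e(2) by (simp add: subst_comp_def)
  show ?thesis unfolding R nth by (rule split[OF i(2)[unfolded nth] i(3)[unfolded nth] e(1)])
 qed
 show ?thesis unfolding covers_def by (intro conjI allI impI) (rule 1, elim conjE, rule 2)
qed

lemma intermediate_goals_mem:
 assumes "B : set (intermediate_goals G \<pi>)"
 shows "EX i. Suc i < length \<pi> & \<pi> ! i : split_nodes G & \<pi> ! Suc i = succs G (\<pi> ! i) ! 1 &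
  B = atom (succs G (\<pi> ! i) ! 0) $ path_subst G (drop i \<pi>)" using assms
proof (induction \<pi> rule: induct_list012)
 case (3 n n' ns)
 consider "B : set (intermediate_goals G (n' # ns))" | "n : split_nodes G" "n' = succs G n ! 1"
   "B : set (map (subst_trm (path_subst G (n # n' # ns))) (Ren G (succs G n ! 0)))" using 3(3) by (auto split: if_splits)
 thus ?case
 proof cases
  case 1
  then obtain i where "Suc i < length (n' # ns)" "(n' # ns) ! i : split_nodes G" "(n' # ns) ! Suc i = succs G ((n' # ns) ! i) ! 1"
   "B = atom (succs G ((n' # ns) ! i) ! 0) $ path_subst G (drop i (n' # ns))" using 3(2) by blast
  thus ?thesis by (intro exI[of _ "Suc i"]) simp
 next
  case 2
  hence "Ren G (succs G n ! 0) = [atom (succs G n ! 0)]" using atom(1) start_node split_left(1) by blast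
  thus ?thesis using 2 by (intro exI[of _ 0]) simp
 qed
qed simp_all

lemma PG_definite: "definite PG" unfolding definite_def PG P_G_def
proof (intro ballI, elim CollectE exE conjE, intro conjI ballI)
 fix c \<pi> assume c: "c = path_clause G \<pi>" and p: "clause_path G \<pi>"
 have s: "start (hd \<pi>)" using p by (auto simp: clause_path_def start_def)
 have at: "EX f us. atom n $ \<sigma> = Fun f us" if "start n \<or> (n < length G & n ~: suc_nodes G)" for n \<sigma>
  using that atom(3)[of n] start_node[of n] by fastforce
 show "EX f us. head c = Fun f us" using at[of "hd \<pi>"] s by (simp add: c path_clause_def atom_def)
 fix l assume "l : set (body c)"
 then obtain B where B: "l = Atom B" "B : set (intermediate_goals G \<pi>) \<or> B : set (Ren G (last \<pi>))" by (auto simp: c path_clause_def)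
 from B(2) show "EX f us. l = Atom (Fun f us)"
 proof
  assume "B : set (intermediate_goals G \<pi>)"
  thus ?thesis using intermediate_goals_mem at split_left(1) B(1) by metis
 next
  assume b: "B : set (Ren G (last \<pi>))"
  have "\<pi> ~= []" "ALL n:set \<pi>. n < length G" using p by (auto simp: clause_path_def)
  hence "last \<pi> < length G" by simp
  thus ?thesis using b atom[of "last \<pi>"] Ren_suc[of "last \<pi>"] B(1) by (cases "last \<pi> : suc_nodes G") auto
 qed
qed

lemma covers_clause:
 assumes run: "run \<pi>" "1 < length \<pi>" "last \<pi> : suc_nodes G Un instance_nodes G Un first_succs G" and cov: "covers D \<pi> vs v"
 obtains c \<delta> where "c : set PG" "\<delta> : D" "head c $ emb_subst v = atom (hd \<pi>) $ emb_subst vs $ emb_subst \<delta>"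
  "body c = map Atom (intermediate_goals G \<pi> @ Ren G (last \<pi>))"
  "!!B. B : set (intermediate_goals G \<pi>) ==> tree PG (B $ emb_subst v)"
proof -
 let ?c = "path_clause G \<pi>"
 have c: "?c : set PG" using run_clause_path[OF run] PG by (auto simp: P_G_def)
 obtain \<delta> where d: "\<delta> : D" "!!x. x : vars_state (S (hd \<pi>)) ==> rev_path_subst G \<infinity> (rev \<pi>) x $ v = vs x $ \<delta>"
  using cov unfolding covers_def by blast
 have s: "start (hd \<pi>)" using run(1) by (simp add: run_def)
 have "head ?c $ emb_subst v = atom (hd \<pi>) $ emb_subst (%x. rev_path_subst G \<infinity> (rev \<pi>) x $ v)"
  by (simp add: path_clause_def atom_def path_subst_def emb_subst_subst)
 also have "\<dots> = atom (hd \<pi>) $ emb_subst (%x. vs x $ \<delta>)"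
  using d(2) atom(2)[OF start_node[OF s]] by (intro emb_subst_cong) blast
 finally have h: "head ?c $ emb_subst v = atom (hd \<pi>) $ emb_subst vs $ emb_subst \<delta>" by (simp add: emb_subst_subst)
 have t: "tree PG (B $ emb_subst v)" if B: "B : set (intermediate_goals G \<pi>)" for B
 proof -
  obtain i where i: "Suc i < length \<pi>" "\<pi> ! i : split_nodes G" "\<pi> ! Suc i = succs G (\<pi> ! i) ! 1"
   "B = atom (succs G (\<pi> ! i) ! 0) $ path_subst G (drop i \<pi>)" using intermediate_goals_mem[OF B] by blast
  hence "tree PG (atom (succs G (\<pi> ! i) ! 0) $ emb_subst (%x. rev_path_subst G \<infinity> (rev (drop i \<pi>)) x $ v))"
   using cov unfolding covers_def by blast
  thus ?thesis by (simp add: i(4) path_subst_def emb_subst_subst)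
 qed
 show thesis by (rule that[OF c d(1) h _ t]) (simp_all add: path_clause_def)
qed

text \<open>The intermediate goals precede the final atom in the clause body and are derivable, so
  the final atom is called.\<close>

lemma covers_calls:
 assumes run: "run \<pi>" "1 < length \<pi>" "last \<pi> : instance_nodes G Un first_succs G" "last \<pi> ~: suc_nodes G" and cov: "covers D \<pi> vs v"
 shows "calls PG (atom (hd \<pi>) $ emb_subst vs) (atom (last \<pi>) $ emb_subst v)"
proof -
 have l: "last \<pi> : suc_nodes G Un instance_nodes G Un first_succs G" using run(3) by blast
 obtain c \<delta> where c: "c : set PG" "head c $ emb_subst v = atom (hd \<pi>) $ emb_subst vs $ emb_subst \<delta>"
  "body c = map Atom (intermediate_goals G \<pi> @ Ren G (last \<pi>))"
  "!!B. B : set (intermediate_goals G \<pi>) ==> tree PG (B $ emb_subst v)" by (rule covers_clause[OF run(1,2) l cov]) blast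
 have "last \<pi> < length G" using run(1) by (auto simp: run_def)
 hence "Ren G (last \<pi>) = [atom (last \<pi>)]" using atom(1) run(4) by blast
 hence "body c = map Atom (intermediate_goals G \<pi> @ atom (last \<pi>) # [])" using c(3) by simp
 thus ?thesis unfolding calls_def using c(1,4) c(2)[symmetric] by blast
qed

text \<open>The factor under which the last atom is derivable is applied to the whole clause
  instance; the intermediate goals tolerate this by closure under instantiation.\<close>

lemma covers_tree:
 assumes run: "run \<pi>" "1 < length \<pi>" "last \<pi> : suc_nodes G Un instance_nodes G Un first_succs G" and cov: "covers D \<pi> vs v"
  and D: "!!\<delta> \<delta>'. \<delta> : D ==> \<delta>' : D ==> (%x. \<delta> x $ \<delta>') : D"
  and t: "\<delta>' : D" "last \<pi> ~: suc_nodes G ==> tree PG (atom (last \<pi>) $ emb_subst v $ emb_subst \<delta>')"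
 shows "EX \<delta>:D. tree PG (atom (hd \<pi>) $ emb_subst vs $ emb_subst \<delta>)"
proof -
 obtain c \<delta> where c: "c : set PG" "\<delta> : D" "head c $ emb_subst v = atom (hd \<pi>) $ emb_subst vs $ emb_subst \<delta>"
  "body c = map Atom (intermediate_goals G \<pi> @ Ren G (last \<pi>))"
  "!!B. B : set (intermediate_goals G \<pi>) ==> tree PG (B $ emb_subst v)" by (rule covers_clause[OF run cov]) blast
 have "last \<pi> < length G" using run(1) by (auto simp: run_def)
 hence R: "set (Ren G (last \<pi>)) <= {atom (last \<pi>)}" "last \<pi> : suc_nodes G ==> Ren G (last \<pi>) = []"
  using atom(1)[of "last \<pi>"] Ren_suc[of "last \<pi>"] by (cases "last \<pi> : suc_nodes G"; simp)+
 have "tree PG (head c $ (%x. emb_subst v x $ emb_subst \<delta>'))"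
 proof (rule tree.intros[OF c(1)])
  fix B assume "Atom B : set (body c)"
  hence "B : set (intermediate_goals G \<pi>) \<or> B = atom (last \<pi>) & last \<pi> ~: suc_nodes G" using R by (auto simp: c(4))
  hence "tree PG (B $ emb_subst v $ emb_subst \<delta>')" using c(5) t(2) tree_inst by blast
  thus "tree PG (B $ (%x. emb_subst v x $ emb_subst \<delta>'))" by (simp only: subst_trm_subst)
 qed
 hence "tree PG (head c $ emb_subst v $ emb_subst \<delta>')" by (simp only: subst_trm_subst)
 hence "tree PG (atom (hd \<pi>) $ emb_subst vs $ emb_subst (%x. \<delta> x $ \<delta>'))"
  unfolding c(3) emb_subst_subst[where B = "atom (hd \<pi>) $ emb_subst vs"] .
 thus ?thesis using D[OF c(2) t(1)] by blast
qed

end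

section \<open>Following a computation through the graph\<close>

lemma marks_state_subst [simp]: "marks_state (S $s \<sigma>) = marks_state S"
proof (induction S)
 case (Cons g S)
 have "marks_sgoal (g $h \<sigma>) = marks_sgoal g" by (cases g) simp_all
 thus ?case using Cons by simp
qed simp

lemma subst_case_goals: "case_goals P p ts Q m $s \<sigma> = case_goals P p (map (subst_trm \<sigma>) ts) (Q $g \<sigma>) m"
 by (simp add: case_goals_def subst_state_def)

lemma length_subst_state [simp]: "length (S $s \<sigma>) = length S" by (simp add: subst_state_def)

lemma Scope_subst [simp]: "Scope m : set (S $s \<sigma>) \<longleftrightarrow> Scope m : set S"
proof (induction S)
 case (Cons g S)
 thus ?case by (cases g) auto
qed simp

section \<open>Valuations at single nodes\<close>

locale bounded_graph = graph P gnd G W M PG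
 for P :: "'f clause list" and gnd :: "'f groundness" and G :: "'f graph"
  and W :: "nat => var set" and M :: "nat => nat set" and PG :: "'f gsym clause list" +
 fixes K :: nat and N :: "var list"
 assumes K: "!!c. c : set P ==> max_arity (head c) <= K"
  and N: "N ~= []" "set N <= ordinary" "!!n. n < length G ==> kb_vars (U n) Int ordinary <= set N"
begin

lemma node_cases:
 assumes "expanded G n"
 obtains (Suc) S' n' where "rule_of G n = R_Suc" "S n = Goal [] # S'" "succs G n = [n']" "astate_of G n' = (S', snd (astate_of G n))"
 | (Fail) m S' n' where "rule_of G n = R_Fail" "S n = Scope m # S'" "succs G n = [n']" "astate_of G n' = (S', snd (astate_of G n))"
 | (Cut_scope) m Q S1 S2 n' where "rule_of G n = R_Cut" "S n = Goal (Cut m # Q) # S1 @ Scope m # S2" "Scope m ~: set S1"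
   "succs G n = [n']" "astate_of G n' = (Goal Q # Scope m # S2, snd (astate_of G n))"
 | (Cut_all) m Q S' n' where "rule_of G n = R_Cut" "S n = Goal (Cut m # Q) # S'" "Scope m ~: set S'"
   "succs G n = [n']" "astate_of G n' = ([Goal Q], snd (astate_of G n))"
 | (Case) m p ts Q S' n' where "rule_of G n = R_Case" "S n = Goal (Atom (Fun p ts) # Q) # S'" "m ~: marks_state (S n)"
   "succs G n = [n']" "astate_of G n' = (case_goals P p ts Q m @ S', snd (astate_of G n))"
 | (Backtrack) t Q c m S' n' where "rule_of G n = R_Backtrack" "S n = Labeled (Atom t # Q) c m # S'"
   "~ (EX \<gamma>. concretization \<gamma> (astate_of G n) & unifiable (t $ \<gamma>) (head c))"
   "succs G n = [n']" "astate_of G n' = (S', snd (astate_of G n))"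
 | (Eval) \<sigma> t Q c m S' n1 n2 where "rule_of G n = R_Eval \<sigma>" "S n = Labeled (Atom t # Q) c m # S'"
   "is_mgu \<sigma> t (head c)" "!!x. x : W n Un vars_clause c ==> vars_trm (\<sigma> x) <= abstract - W n"
   "succs G n = [n1, n2]" "n1 ~= n2"
   "astate_of G n1 = (Goal ((label_cuts m (body c) @ Q) $g \<sigma>) # S' $s (restrict_subst \<sigma> (Gr n)),
     abstract Int range_vars (restrict_subst \<sigma> (Gr n)), subst_pairs (restrict_subst \<sigma> (Gr n)) (U n))"
   "astate_of G n2 = (S', Gr n, insert (t, head c) (U n))"
 | (Parallel) S1 S2 n1 n2 where "rule_of G n = R_Parallel" "S n = S1 @ S2" "active_cuts S1 Int active_marks S2 = {}"
   "succs G n = [n1, n2]" "n1 ~= n2" "astate_of G n1 = (S1, snd (astate_of G n))" "astate_of G n2 = (S2, snd (astate_of G n))"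
 | (Split) \<mu> l Q n1 n2 where "rule_of G n = R_Split \<mu>" "S n = [Goal (l # Q)]"
   "!!x. x : Gr n ==> \<mu> x = Var x" "!!x. x : W n - Gr n ==> EX y:abstract - W n. \<mu> x = Var y" "inj_on \<mu> (W n)"
   "succs G n = [n1, n2]" "n1 ~= n2" "astate_of G n1 = ([Goal [l]], snd (astate_of G n))"
   "astate_of G n2 = ([Goal (Q $g \<mu>)], Gr n Un approx_gnd gnd (Gr n) l \<mu>, subst_pairs \<mu> (U n))"
proof -
 have dis: "distinct (succs G n)" using structured_expanded(2)[OF st assms] .
 have M: "marks_state (S n) <= M n" using structured_expanded(5)[OF st assms] .
 from expand_at[OF assms] show thesis
 proof (cases rule: expand.cases)
  case (Suc_rule S' KB)
  then obtain n' where "succs G n = [n']" "astate_of G n' = (S', KB)" by auto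
  with Suc_rule show ?thesis using that(1) by simp
 next
  case (Fail_rule m S' KB)
  then obtain n' where "succs G n = [n']" "astate_of G n' = (S', KB)" by auto
  with Fail_rule show ?thesis using that(2) by simp
 next
  case (Cut_scope_rule m S1 Q S2 KB)
  then obtain n' where "succs G n = [n']" "astate_of G n' = (Goal Q # Scope m # S2, KB)" by auto
  with Cut_scope_rule show ?thesis using that(3) by simp
 next
  case (Cut_all_rule m S1 Q KB)
  then obtain n' where "succs G n = [n']" "astate_of G n' = ([Goal Q], KB)" by auto
  with Cut_all_rule show ?thesis using that(4) by simp
 next
  case (Case_rule m p ts Q S' KB)
  then obtain n' where "succs G n = [n']" "astate_of G n' = (case_goals P p ts Q m @ S', KB)" by auto
  moreover have "m ~: marks_state (S n)" using M Case_rule(4) by blast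
  ultimately show ?thesis using that(5)[of p ts Q S' m n'] Case_rule by simp
 next
  case (Backtrack_rule t Q c m S' KB)
  then obtain n' where n': "succs G n = [n']" "astate_of G n' = (S', KB)" by auto
  show ?thesis by (rule that(6)[of t Q c m S' n']) (use Backtrack_rule n' in \<open>simp_all del: concretization.simps\<close>)
 next
  case (Eval_rule \<sigma> t c \<tau> \<G> Q m S' U')
  obtain n1 n2 where n: "succs G n = [n1, n2]"
    "astate_of G n1 = (Goal ((label_cuts m (body c) @ Q) $g \<sigma>) # S' $s \<tau>, abstract Int range_vars \<tau>, subst_pairs \<tau> U')"
    "astate_of G n2 = (S', \<G>, insert (t, head c) U')" using Eval_rule(3) by (auto simp del: subst_goal_simps)
  show ?thesis
   by (rule that(7)[of \<sigma> t Q c m S' n1 n2]) (use Eval_rule(1,2,4,5,6) n dis in \<open>simp_all del: subst_goal_simps\<close>)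
 next
  case (Parallel_rule S1 S2 KB)
  then obtain n1 n2 where n: "succs G n = [n1, n2]" "astate_of G n1 = (S1, KB)" "astate_of G n2 = (S2, KB)" by auto
  show ?thesis by (rule that(8)[of S1 S2 n1 n2]) (use Parallel_rule n dis in simp_all)
 next
  case (Split_rule \<G> \<mu> l Q U')
  obtain n1 n2 where n: "succs G n = [n1, n2]" "astate_of G n1 = ([Goal [l]], \<G>, U')"
   "astate_of G n2 = ([Goal (Q $g \<mu>)], \<G> Un approx_gnd gnd \<G> l \<mu>, subst_pairs \<mu> U')" using Split_rule(3) by auto
  show ?thesis by (rule that(9)[of \<mu> l Q n1 n2]) (use Split_rule(1,2,4,5,6) n dis in simp_all)
 qed
qed

text \<open>The extra instantiations tolerated along a path. They leave an atom at final values
  unchanged, so nothing is lost for answers.\<close>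

definition D :: "'f subst set" where
 "D = {\<delta>. ALL x:finals. \<delta> x = Var x}"

lemma D_Var: "Var : D" by (simp add: D_def)

lemma D_comp: "\<delta> : D ==> \<delta>' : D ==> (%x. \<delta> x $ \<delta>') : D" by (simp add: D_def)

definition edge_ok :: "nat => nat => 'f subst => 'f subst => bool" where
 "edge_ok n n' v v' \<longleftrightarrow> (ALL \<sigma>:edge_substs G n n'. EX \<delta>:D. ALL z:W n Int abstract. \<sigma> z $ v' = v z $ \<delta>)"

lemma edge_ok_id: "edge_substs G n n' = {Var} ==> edge_ok n n' v v" unfolding edge_ok_def by (auto intro!: bexI[OF _ D_Var])

text \<open>On the ground variables all three valuations coincide. This is why an
  \<open>Eval\<close> substitution restricted to them is compatible with each valuation.\<close>

definition kb_ok :: "nat => 'f subst => 'f subst => 'f subst => bool" where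
 "kb_ok n \<psi> v \<rho> \<longleftrightarrow> apart K N \<psi> (U n) & (ALL x:ordinary. \<psi> x = Var x) &
   (ALL x:Gr n. ground (\<psi> x) & v x = \<psi> x & \<rho> x = \<psi> x)"

lemma kb_ok_cong: "snd (astate_of G n') = snd (astate_of G n) ==> kb_ok n' = kb_ok n" by (intro ext) (simp add: kb_ok_def)

lemma label_clause:
 assumes "n < length G" "Labeled Q c m : set (S n)"
 shows "vars_clause c <= ordinary" "vars_trm (head c) <= ordinary" "max_arity (head c) <= K"
proof -
 have "c : labels (S n)" using assms(2) unfolding labels_def by blast
 hence "c : set P" using sane[OF assms(1)] by (auto simp: sane_def)
 thus "vars_clause c <= ordinary" "vars_trm (head c) <= ordinary" "max_arity (head c) <= K" using clauses K head_vars[of c] by blast+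
qed

text \<open>Evaluation: two valuations that together unify the selected atom with the head of the clause
  factor through the substitution of the \<open>Eval\<close> node. They are combined into one because clause
  variables are ordinary and the variables of states are abstract.\<close>

definition upd :: "nat => 'f subst => 'f subst => 'f subst" where
 "upd n f \<delta> x = (if x : abstract - W n then \<delta> x else f x)"

lemma upd_fresh: "vars_trm u <= abstract - W n ==> u $ upd n f \<delta> = u $ \<delta>" by (intro subst_trm_cong) (auto simp: upd_def)

lemma eval_factor:
 assumes "is_mgu \<sigma> t (head c)" "t $ f = head c $ b" "vars_trm t <= abstract" "vars_trm (head c) <= ordinary"
 obtains \<delta> where "!!x. x : abstract ==> \<sigma> x $ \<delta> = f x" "!!y. y : ordinary ==> \<sigma> y $ \<delta> = b y"
proof -
 let ?u = "%x. if x : abstract then f x else b x"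
 have "t $ ?u = t $ f" using assms(3) by (intro subst_trm_cong) auto
 moreover have "head c $ ?u = head c $ b" using assms(4) by (intro subst_trm_cong) (auto simp: not_abstract)
 ultimately have "t $ ?u = head c $ ?u" using assms(2) by simp
 then obtain \<delta> where "?u = subst_comp \<sigma> \<delta>" using assms(1) unfolding is_mgu_def by blast
 hence *: "\<sigma> x $ \<delta> = ?u x" for x by (simp add: subst_comp_def fun_eq_iff)
 show thesis by (rule that[of \<delta>]) (simp_all add: * not_abstract)
qed

context
 fixes n n1 \<sigma> t Q c m S'
 assumes n: "expanded G n" and Sn: "S n = Labeled (Atom t # Q) c m # S'"
  and fresh: "!!x. x : W n Un vars_clause c ==> vars_trm (\<sigma> x) <= abstract - W n"
  and a1: "astate_of G n1 = (Goal ((label_cuts m (body c) @ Q) $g \<sigma>) # S' $s (restrict_subst \<sigma> (Gr n)),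
     abstract Int range_vars (restrict_subst \<sigma> (Gr n)), subst_pairs (restrict_subst \<sigma> (Gr n)) (U n))"
begin

lemma nG: "n < length G" using n by (simp add: expanded_def)

lemma eval_vars: "vars_trm t <= W n Int abstract" "vars_goal Q <= W n Int abstract" "vars_state S' <= W n Int abstract"
 "Gr n <= W n Int abstract" "kb_vars (U n) <= W n" "vars_clause c <= ordinary"
proof -
 have W: "vars_astate (astate_of G n) <= W n" using structured_expanded(4)[OF st n] .
 show "vars_trm t <= W n Int abstract" "vars_goal Q <= W n Int abstract" "vars_state S' <= W n Int abstract"
  using vars_state_W[OF n] vars_state_abstract[OF nG] by (auto simp: Sn)
 have "Gr n <= W n" "kb_vars (U n) <= W n" using W by (cases "astate_of G n"; auto simp: kb_vars_def)+
 thus "Gr n <= W n Int abstract" "kb_vars (U n) <= W n" using sane[OF nG] by (auto simp: sane_def)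
 show "vars_clause c <= ordinary" using label_clause(1)[OF nG, of "Atom t # Q" c m] Sn by simp
qed

lemma eval_new_goal:
 assumes "!!x. x : abstract ==> \<sigma> x $ \<delta> = f0 x" "!!y. y : ordinary ==> \<sigma> y $ \<delta> = b y"
 shows "(label_cuts m (body c) @ Q) $g \<sigma> $g (upd n f \<delta>) = resolvent m c (Q $g f0) Var b"
proof -
 have "Q $g \<sigma> $g (upd n f \<delta>) = Q $g f0" unfolding subst_goal_subst subst_goal_eq_iff
 proof
  fix x assume "x : vars_goal Q"
  hence "x : W n" "x : abstract" using eval_vars by auto
  thus "\<sigma> x $ upd n f \<delta> = f0 x" using upd_fresh[OF fresh] assms(1) by simp
 qed
 moreover have "(body c $g \<sigma>) $g (upd n f \<delta>) = body c $g b" unfolding subst_goal_subst subst_goal_eq_iff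
 proof
  fix x assume "x : vars_goal (body c)"
  hence "x : vars_clause c" "x : ordinary" using eval_vars(6) body_vars[of c] by auto
  thus "\<sigma> x $ upd n f \<delta> = b x" using upd_fresh[OF fresh] assms(2) by simp
 qed
 ultimately show ?thesis by (simp add: resolvent_def subst_goal_label_cuts)
qed

lemma eval_edge:
 assumes "!!x. x : abstract ==> \<sigma> x $ \<delta> = f0 x" "z : W n Int abstract"
 shows "\<sigma> z $ upd n f \<delta> = f0 z"
proof -
 have "vars_trm (\<sigma> z) <= abstract - W n" by (rule fresh) (use assms(2) in blast)
 hence "\<sigma> z $ upd n f \<delta> = \<sigma> z $ \<delta>" by (rule upd_fresh)
 also have "\<dots> = f0 z" by (rule assms(1)) (use assms(2) in blast)
 finally show ?thesis .
qed

text \<open>The goals behind the evaluated one see only the restricted substitution, and on ground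
  variables the new valuation restores the old values. So the rest of the state keeps its
  meaning.\<close>

lemma eval_keep:
 assumes "!!z. z : Gr n ==> \<sigma> z $ \<delta> = f z" "z : W n"
 shows "restrict_subst \<sigma> (Gr n) z $ upd n f \<delta> = f z"
proof (cases "z : Gr n")
 case True
 thus ?thesis using assms upd_fresh[OF fresh] by (simp add: restrict_subst_def)
next
 case False
 thus ?thesis using assms(2) by (simp add: restrict_subst_def upd_def)
qed

lemma eval_keep_state:
 assumes "!!z. z : Gr n ==> \<sigma> z $ \<delta> = f z" "vars_state T <= W n"
 shows "(T $s (restrict_subst \<sigma> (Gr n))) $s (upd n f \<delta>) = T $s f" using assms(2)
proof (induction T)
 case (Cons g T)
 have "(g $h (restrict_subst \<sigma> (Gr n))) $h (upd n f \<delta>) = g $h f"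
  using Cons.prems eval_keep[OF assms(1)] by (cases g) (auto simp: subst_goal_subst subst_goal_eq_iff)
 thus ?case using Cons by simp
qed simp

lemma eval_ground_vars:
 assumes "x : Gr n1"
 obtains z where "z : Gr n" "x : vars_trm (\<sigma> z)" "x : abstract - W n"
proof -
 have "x : range_vars (restrict_subst \<sigma> (Gr n))" using assms by (simp add: a1)
 then obtain z where z: "restrict_subst \<sigma> (Gr n) z ~= Var z" "x : vars_trm (restrict_subst \<sigma> (Gr n) z)"
  by (auto simp: range_vars_def subst_range_def subst_dom_def)
 hence "z : Gr n" by (auto simp: restrict_subst_def split: if_splits)
 moreover from this have "x : vars_trm (\<sigma> z)" using z(2) by (simp add: restrict_subst_def)
 ultimately show thesis using that fresh[of z] eval_vars(4) by blast
qed

lemma eval_kb_ok: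
 assumes ok: "kb_ok n \<psi> v \<rho>"
  and p: "!!z. z : Gr n ==> \<sigma> z $ \<delta>\<psi> = \<psi> z" and v: "!!z. z : Gr n ==> \<sigma> z $ \<delta>v = v z" and r: "!!z. z : Gr n ==> \<sigma> z $ \<delta>\<rho> = \<rho> z"
 shows "kb_ok n1 (upd n \<psi> \<delta>\<psi>) (upd n v \<delta>v) (upd n \<rho> \<delta>\<rho>)" unfolding kb_ok_def
proof (intro conjI ballI)
 have ord: "\<psi> x = Var x" if "x : ordinary" for x using ok that by (simp add: kb_ok_def)
 show "upd n \<psi> \<delta>\<psi> x = Var x" if "x : ordinary" for x using ord[OF that] that by (simp add: upd_def not_abstract)
 show "apart K N (upd n \<psi> \<delta>\<psi>) (U n1)"
 proof (rule apart_subst[of K N \<psi> "U n" Var])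
  show "apart K N \<psi> (U n)" using ok by (simp add: kb_ok_def)
  fix s s' assume "(s, s') : U n1"
  then obtain q q' where q: "(q, q') : U n" "s = q $ restrict_subst \<sigma> (Gr n)" "s' = q' $ restrict_subst \<sigma> (Gr n)"
   by (auto simp: a1 subst_pairs_def)
  have "vars_trm q <= W n" "vars_trm q' <= W n" using q(1) eval_vars(5) by (auto simp: kb_vars_def)
  hence "s $ upd n \<psi> \<delta>\<psi> = q $ \<psi>" "s' $ upd n \<psi> \<delta>\<psi> = q' $ \<psi>"
   unfolding q(2,3) subst_trm_subst using eval_keep[OF p] by (auto intro!: subst_trm_cong)
  thus "EX q q'. (q, q') : U n & s $ upd n \<psi> \<delta>\<psi> = q $ \<psi> $ Var & s' $ upd n \<psi> \<delta>\<psi> = q' $ \<psi> $ Var"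
   using q(1) by auto
 qed simp
 fix x assume "x : Gr n1"
 then obtain z where z: "z : Gr n" "x : vars_trm (\<sigma> z)" "x : abstract - W n" by (rule eval_ground_vars)
 \<comment> \<open>Equal values of \<sigma> z force equal values of every variable in it, and
   groundness passes down in the same way.\<close>
 have g: "ground (\<psi> z)" "v z = \<psi> z" "\<rho> z = \<psi> z" using ok z(1) by (simp_all add: kb_ok_def)
 hence "\<delta>v x = \<delta>\<psi> x" "\<delta>\<rho> x = \<delta>\<psi> x"
  using p[OF z(1)] v[OF z(1)] r[OF z(1)] z(2) by (metis subst_trm_eqD)+
 moreover have "ground (\<delta>\<psi> x)"
 proof -
  have "vars_trm (\<sigma> z $ \<delta>\<psi>) = {}" using p[OF z(1)] g(1) by (simp add: ground_def)
  thus ?thesis using z(2) by (auto simp: ground_def vars_trm_subst)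
 qed
 ultimately show "ground (upd n \<psi> \<delta>\<psi> x)" "upd n v \<delta>v x = upd n \<psi> \<delta>\<psi> x" "upd n \<rho> \<delta>\<rho> x = upd n \<psi> \<delta>\<psi> x"
  using z(3) by (simp_all add: upd_def)
qed

end

text \<open>\<kappa> says which final values the hazards of the front have on the path.\<close>

definition kappa_ok :: "'f subst => bool" where
 "kappa_ok \<kappa> \<longleftrightarrow> (ALL x. x ~: hazards --> \<kappa> x = Var x) & (ALL x:hazards. vars_trm (\<kappa> x) <= finals)"

definition front :: "'f subst => 'f subst => 'f subst => 'f state => bool" where
 "front \<kappa> \<psi> v X \<longleftrightarrow> vars_state (X $s \<psi>) <= hazards Un locals &
   X $s v = X $s \<psi> $s \<kappa> & exh P (X $s \<psi>)"

text \<open>The state of node \<open>n\<close> is \<open>X @ T @ Y\<close>: the computation exhausts \<open>X\<close>, its interesting part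
  starts in \<open>T\<close>, and \<open>Y\<close> is never reached. The abstract variables have three values: \<open>\<psi>\<close> is the one in
  the computation, \<open>v\<close> the one in the instance of the clause of \<open>P_G\<close>, and \<open>\<rho>\<close> the one in a more
  general goal that \<open>\<psi>\<close> instantiates by one of its answers.\<close>

definition conf :: "('f state => 'f state => 'f state => bool) => nat => 'f subst => 'f subst => 'f subst => 'f subst =>
  'f state => 'f state => bool" where
 "conf R n \<kappa> \<psi> v \<rho> X T \<longleftrightarrow> n < length G & (EX Y. S n = X @ T @ Y) & T ~= [] & kappa_ok \<kappa> & kb_ok n \<psi> v \<rho> &
   front \<kappa> \<psi> v X & R (T $s \<psi>) (T $s v) (T $s \<rho>)"

lemma confI:
 assumes "n < length G" "S n = X @ T @ Y" "T ~= []" "kappa_ok \<kappa>" "kb_ok n \<psi> v \<rho>" "front \<kappa> \<psi> v X"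
  "R (T $s \<psi>) (T $s v) (T $s \<rho>)"
 shows "conf R n \<kappa> \<psi> v \<rho> X T" using assms unfolding conf_def by blast

definition step_ok :: "('f state => 'f state => 'f state => bool) => nat => 'f subst => bool" where
 "step_ok R n v \<longleftrightarrow> (EX n':set (succs G n). EX \<kappa> \<psi> v' \<rho> X T. conf R n' \<kappa> \<psi> v' \<rho> X T & edge_ok n n' v v')"

lemma step_okI: "n' : set (succs G n) ==> conf R n' \<kappa> \<psi> v' \<rho> X T ==> edge_ok n n' v v' ==> step_ok R n v"
 unfolding step_ok_def by blast

lemma front_Nil: "front \<kappa> \<psi> v []" by (simp add: front_def exh_Nil)

lemma step_same:
 assumes "expanded G n" "n' : set (succs G n)" "edge_substs G n n' = {Var}" "kb_ok n' = kb_ok n" "S n' = X @ T @ Y" "T ~= []"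
  "kappa_ok \<kappa>" "kb_ok n \<psi> v \<rho>" "front \<kappa> \<psi> v X" "R (T $s \<psi>) (T $s v) (T $s \<rho>)"
 shows "step_ok R n v"
proof (rule step_okI[OF assms(2)])
 show "conf R n' \<kappa> \<psi> v \<rho> X T" unfolding conf_def using assms succ_at[OF assms(1,2)] by auto
 show "edge_ok n n' v v" by (rule edge_ok_id[OF assms(3)])
qed

text \<open>A match yields a concretization that contradicts the side condition of
  \<open>Backtrack\<close>; such nodes therefore discard only what the computation discards as
  well.\<close>

lemma no_backtrack:
 assumes "n < length G" "kb_ok n \<psi> v \<rho>" "S n = Labeled (Atom t # Q) c m # S'"
  and "vars_trm (t $ \<psi>) <= locals & matchable (t $ \<psi>) c \<or> vars_trm (t $ \<psi>) <= finals & (EX \<beta>. t $ \<psi> = head c $ \<beta>)"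
 shows "EX \<gamma>. concretization \<gamma> (astate_of G n) & unifiable (t $ \<gamma>) (head c)"
proof -
 have h: "vars_trm (head c) <= ordinary" using label_clause(2)[OF assms(1), of "Atom t # Q" c m] assms(3) by simp
 have t: "vars_trm t <= abstract" using vars_state_abstract[OF assms(1)] by (simp add: assms(3))
 obtain \<alpha> \<beta> where ab: "vars_trm (t $ \<psi>) <= locals & t $ \<psi> $ \<alpha> = head c $ \<beta> \<or> vars_trm (t $ \<psi>) <= finals & t $ \<psi> = head c $ \<beta>"
  using assms(4) unfolding matchable_def by blast
 have k: "apart K N \<psi> (U n)" "ALL x:ordinary. \<psi> x = Var x" "ALL x:Gr n. ground (\<psi> x)" using assms(2) by (simp_all add: kb_ok_def)
 have g: "Gr n <= abstract" using sane[OF assms(1)] by (simp add: sane_def)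
 have u: "(UN (s, s'):U n. vars_trm s Un vars_trm s') Int ordinary <= set N" using N(3)[OF assms(1)] by (simp add: kb_vars_def)
 have "EX \<gamma>. concretization \<gamma> (S n, (Gr n, U n)) & unifiable (t $ \<gamma>) (head c)"
  by (rule concretization_exists[OF k g N(1,2) u t ab h])
 thus ?thesis by (simp only: prod.collapse)
qed

lemma eval_right:
 assumes "n < length G" "kb_ok n \<psi> v \<rho>" "S n = Labeled (Atom t # Q) c m # S'" "astate_of G n2 = (S', Gr n, insert (t, head c) (U n))"
  and "hazardous (t $ \<psi>) \<or> ~ matchable (t $ \<psi>) c \<or> vars_trm (t $ \<psi>) <= finals & ~ (EX \<beta>. t $ \<psi> = head c $ \<beta>)"
 shows "kb_ok n2 \<psi> v \<rho>"
proof -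
 have h: "vars_trm (head c) <= ordinary" "max_arity (head c) <= K"
  using label_clause(2,3)[OF assms(1), of "Atom t # Q" c m] assms(3) by simp_all
 have k: "apart K N \<psi> (U n)" "ALL x:ordinary. \<psi> x = Var x" using assms(2) by (simp_all add: kb_ok_def)
 have "apart K N \<psi> (insert (t, head c) (U n))"
  by (rule apart_no_match[OF k h N(1)]) (use assms(5) in \<open>simp add: matchable_def\<close>)
 thus ?thesis using assms(2) by (simp add: kb_ok_def assms(4))
qed

text \<open>Choosing the mgu among the locals fixes hazards and finals, which makes the step commute
  with \<kappa>.\<close>

lemma local_mgu:
 assumes "~ hazardous t" "vars_trm t <= hazards Un locals" "matchable t c"
 obtains \<alpha> \<beta> where "two_mgu (vars_trm t Un vars_goal Q) t c \<alpha> \<beta>" "!!x. x ~: locals ==> \<alpha> x = Var x"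
  "!!x. x : locals ==> vars_trm (\<alpha> x) <= locals" "!!y. vars_trm (\<beta> y) <= locals"
proof -
 have t: "vars_trm t <= locals" using assms(1,2) by (auto simp: hazardous_def)
 have fin: "finite (vars_trm t Un vars_goal Q)" by (simp add: vars_trm_def del: set_var_list)
 have dis: "locals Int hazards = {}" using codes_disjoint(2) by blast
 note ex = two_mgu_exists[OF inj_on_id assms(3,1) fin infinite_locals dis t]
 obtain \<alpha> where "EX \<beta>. two_mgu (vars_trm t Un vars_goal Q) t c \<alpha> \<beta> &
  two_mgu (vars_trm t Un vars_goal Q) (map_trm id t) (map_clause id c) (%x. map_trm id (\<alpha> x)) (%x. map_trm id (\<beta> x)) &
  (ALL x. x ~: vars_trm t --> \<alpha> x = Var x) & (ALL x:locals. vars_trm (\<alpha> x) <= locals) & (ALL y. vars_trm (\<beta> y) <= locals)"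
  by (rule exE[OF ex])
 then obtain \<beta> where *: "two_mgu (vars_trm t Un vars_goal Q) t c \<alpha> \<beta> &
  two_mgu (vars_trm t Un vars_goal Q) (map_trm id t) (map_clause id c) (%x. map_trm id (\<alpha> x)) (%x. map_trm id (\<beta> x)) &
  (ALL x. x ~: vars_trm t --> \<alpha> x = Var x) & (ALL x:locals. vars_trm (\<alpha> x) <= locals) & (ALL y. vars_trm (\<beta> y) <= locals)"
  by (rule exE)
 note a = conjunct2[OF conjunct2[OF *]]
 show thesis
 proof (rule that[OF conjunct1[OF *]])
  show "\<alpha> x = Var x" if "x ~: locals" for x by (rule mp[OF spec[OF conjunct1[OF a]]]) (rule contra_subsetD[OF t that])
  show "vars_trm (\<alpha> x) <= locals" if "x : locals" for x by (rule bspec[OF conjunct1[OF conjunct2[OF a]] that])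
  show "vars_trm (\<beta> x) <= locals" for x by (rule spec[OF conjunct2[OF conjunct2[OF a]]])
 qed
qed

lemma edge_other: "expanded G n ==> ALL \<sigma>. rule_of G n ~= R_Eval \<sigma> ==> ALL \<mu>. rule_of G n ~= R_Split \<mu> ==> edge_substs G n n' = {Var}"
 by (cases "rule_of G n") (auto simp: edge_substs_def)

lemma edge_eval:
 assumes "rule_of G n = R_Eval \<sigma>" "succs G n = [n1, n2]" "n1 ~= n2"
 shows "edge_substs G n n1 = {\<sigma>, restrict_subst \<sigma> (Gr n)}" "edge_substs G n n2 = {Var}"
 using assms(2,3) by (simp_all add: edge_substs_def assms(1))

text \<open>\<kappa> sends hazards to finals and \<alpha> sends locals to locals; neither produces
  variables that the other one moves.\<close>

lemma kappa_commute:
 assumes "kappa_ok \<kappa>" "!!x. x ~: locals ==> \<alpha> x = Var x" "!!x. x : locals ==> vars_trm (\<alpha> x) <= locals"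
  "vars_trm u <= hazards Un locals"
 shows "u $ \<kappa> $ \<alpha> = u $ \<alpha> $ \<kappa>" unfolding subst_trm_subst
proof (rule subst_trm_cong)
 fix x assume "x : vars_trm u"
 then consider "x : hazards" | "x : locals" using assms(4) by blast
 thus "\<kappa> x $ \<alpha> = \<alpha> x $ \<kappa>"
 proof cases
  case 1
  hence "\<alpha> x = Var x" using assms(2) codes_disjoint(2) by blast
  moreover have "\<kappa> x $ \<alpha> = \<kappa> x"
   using assms(1,2) 1 codes_disjoint(3) unfolding kappa_ok_def by (intro subst_trm_ident) blast
  ultimately show ?thesis by simp
 next
  case 2
  hence "\<kappa> x = Var x" using assms(1) codes_disjoint(2) unfolding kappa_ok_def by blast
  moreover have "\<alpha> x $ \<kappa> = \<alpha> x"
   using assms(1,3) 2 codes_disjoint(2) unfolding kappa_ok_def by (intro subst_trm_ident) blast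
  ultimately show ?thesis by simp
 qed
qed

lemma kappa_locals: "kappa_ok \<kappa> ==> vars_trm u <= locals ==> u $ \<kappa> = u"
 using codes_disjoint(2) unfolding kappa_ok_def by (intro subst_trm_ident) blast

text \<open>A hazard-free atom of locals has the same value at \<psi> and \<open>v\<close>, so one
  mgu \<alpha> serves both. Along the edge \<open>v\<close> is multiplied by \<alpha>, which belongs
  to \<open>D\<close> because it moves only locals.\<close>

lemma front_eval:
 assumes n: "expanded G n" and Sn: "S n = Labeled (Atom t # Q) c m # S'"
  and ev: "rule_of G n = R_Eval \<sigma>" "is_mgu \<sigma> t (head c)" "!!x. x : W n Un vars_clause c ==> vars_trm (\<sigma> x) <= abstract - W n"
   "succs G n = [n1, n2]" "n1 ~= n2"
  and a1: "astate_of G n1 = (Goal ((label_cuts m (body c) @ Q) $g \<sigma>) # S' $s (restrict_subst \<sigma> (Gr n)),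
     abstract Int range_vars (restrict_subst \<sigma> (Gr n)), subst_pairs (restrict_subst \<sigma> (Gr n)) (U n))"
  and ok: "kappa_ok \<kappa>" "kb_ok n \<psi> v \<rho>"
  and fr: "vars_trm (t $ \<psi>) Un vars_goal (Q $g \<psi>) <= hazards Un locals" "t $ v = t $ \<psi> $ \<kappa>"
   "Q $g v = Q $g \<psi> $g \<kappa>"
  and hz: "~ hazardous (t $ \<psi>)"
  and mgu: "two_mgu (vars_trm (t $ \<psi>) Un vars_goal (Q $g \<psi>)) (t $ \<psi>) c \<alpha> \<beta>"
   "!!x. x ~: locals ==> \<alpha> x = Var x" "!!x. x : locals ==> vars_trm (\<alpha> x) <= locals" "!!y. vars_trm (\<beta> y) <= locals"
 obtains \<psi>' v' \<rho>' ng where "S n1 = Goal ng # S' $s (restrict_subst \<sigma> (Gr n))"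
  "ng $g \<psi>' = resolvent m c (Q $g \<psi>) \<alpha> \<beta>" "ng $g v' = ng $g \<psi>' $g \<kappa>"
  "vars_goal (ng $g \<psi>') <= hazards Un locals" "kb_ok n1 \<psi>' v' \<rho>'" "edge_ok n n1 v v'"
  "!!Z. vars_state Z <= W n ==> (Z $s (restrict_subst \<sigma> (Gr n))) $s \<psi>' = Z $s \<psi> &
   (Z $s (restrict_subst \<sigma> (Gr n))) $s v' = Z $s v &
   (Z $s (restrict_subst \<sigma> (Gr n))) $s \<rho>' = Z $s \<rho>"
proof -
 have nG: "n < length G" using n by (simp add: expanded_def)
 note vars = eval_vars[OF n Sn ev(3) a1]
 have ht: "vars_trm (head c) <= ordinary" using label_clause(2)[OF nG, of "Atom t # Q" c m] Sn by simp
 have ta: "vars_trm t <= abstract" using vars(1) by blast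
 have tl: "vars_trm (t $ \<psi>) <= locals" using fr(1) hz by (auto simp: hazardous_def)
 have tv: "t $ v = t $ \<psi>" using fr(2) kappa_locals[OF ok(1) tl] by simp
 have e1: "t $ (%x. \<psi> x $ \<alpha>) = head c $ \<beta>" using two_mguD(1)[OF mgu(1)] by (simp add: subst_trm_subst)
 have e2: "t $ (%x. v x $ \<alpha>) = head c $ \<beta>" using two_mguD(1)[OF mgu(1)] tv by (simp only: subst_trm_subst[symmetric])
 obtain dp where dp: "!!x. x : abstract ==> \<sigma> x $ dp = \<psi> x $ \<alpha>" "!!y. y : ordinary ==> \<sigma> y $ dp = \<beta> y"
  using eval_factor[OF ev(2) e1 ta ht] by blast
 obtain dv where dv: "!!x. x : abstract ==> \<sigma> x $ dv = v x $ \<alpha>" "!!y. y : ordinary ==> \<sigma> y $ dv = \<beta> y"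
  using eval_factor[OF ev(2) e2 ta ht] by blast
 let ?\<psi> = "upd n \<psi> dp" and ?v = "upd n v dv" and ?\<rho> = "upd n \<rho> dp"
 let ?ng = "(label_cuts m (body c) @ Q) $g \<sigma>"
 have gr: "ground (\<psi> z)" "v z = \<psi> z" "\<rho> z = \<psi> z" "z : abstract" if "z : Gr n" for z
  using that ok(2) vars(4) by (auto simp: kb_ok_def)
 have g: "\<sigma> z $ dp = \<psi> z" "\<sigma> z $ dv = v z" "\<sigma> z $ dp = \<rho> z" if "z : Gr n" for z
  using gr[OF that] dp(1)[of z] dv(1)[of z] by (simp_all add: ground_subst_id)
 have png: "?ng $g ?\<psi> = resolvent m c (Q $g \<psi>) \<alpha> \<beta>"
  using eval_new_goal[OF n Sn ev(3) a1 dp] by (simp add: resolvent_def subst_goal_subst del: subst_goal_simps)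
 have vng: "?ng $g ?v = resolvent m c (Q $g v) \<alpha> \<beta>"
  using eval_new_goal[OF n Sn ev(3) a1 dv] by (simp add: resolvent_def subst_goal_subst del: subst_goal_simps)
 have bk: "B $g \<beta> $g \<kappa> = B $g \<beta>" for B :: "(unit, 'f) lit list"
  unfolding subst_goal_subst subst_goal_eq_iff using kappa_locals[OF ok(1) mgu(4)] by blast
 have ak: "Q $g \<psi> $g \<alpha> $g \<kappa> = Q $g v $g \<alpha>"
 proof -
  have "\<psi> x $ \<kappa> $ \<alpha> = \<psi> x $ \<alpha> $ \<kappa>" if "x : vars_goal Q" for x
   using that fr(1) by (intro kappa_commute[OF ok(1) mgu(2,3)]) (auto simp: vars_goal_subst)
  thus ?thesis unfolding fr(3) subst_goal_subst subst_goal_eq_iff by (simp add: subst_trm_subst[symmetric])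
 qed
 have 1: "S n1 = Goal ?ng # S' $s (restrict_subst \<sigma> (Gr n))" by (simp only: a1 fst_conv)
 have 2: "?ng $g ?v = ?ng $g ?\<psi> $g \<kappa>" unfolding png vng using bk ak by (simp add: resolvent_def subst_goal_label_cuts)
 have 3: "vars_goal (?ng $g ?\<psi>) <= hazards Un locals"
 proof -
  have "vars_trm (\<alpha> x) <= hazards Un locals" if "x : hazards Un locals" for x
   using that mgu(2,3)[of x] by (cases "x : locals") auto
  moreover have "vars_goal (Q $g \<psi>) <= hazards Un locals" using fr(1) by simp
  ultimately have "vars_goal (Q $g \<psi> $g \<alpha>) <= hazards Un locals"
   unfolding vars_goal_subst[of \<alpha>] by (intro UN_least) blast
  moreover have "vars_goal (body c $g \<beta>) <= locals" using mgu(4) by (auto simp: vars_goal_subst)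
  ultimately show ?thesis unfolding png resolvent_def by auto
 qed
 have 4: "kb_ok n1 ?\<psi> ?v ?\<rho>" by (rule eval_kb_ok[OF n Sn ev(3) a1 ok(2)]) (use g in blast)+
 have 5: "edge_ok n n1 v ?v" unfolding edge_ok_def edge_eval(1)[OF ev(1,4,5)]
 proof (intro ballI, elim insertE emptyE)
  fix \<tau> assume t: "\<tau> = \<sigma>"
  have "\<alpha> : D" using mgu(2) codes_disjoint(3) by (auto simp: D_def)
  moreover have "\<sigma> z $ ?v = v z $ \<alpha>" if "z : W n Int abstract" for z by (rule eval_edge[OF n Sn ev(3) a1 dv(1) that])
  ultimately show "EX \<delta>:D. ALL z:W n Int abstract. \<tau> z $ ?v = v z $ \<delta>" unfolding t by blast
 next
  fix \<tau> assume t: "\<tau> = restrict_subst \<sigma> (Gr n)"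
  have "restrict_subst \<sigma> (Gr n) z $ ?v = v z $ Var" if "z : W n Int abstract" for z
   using eval_keep[OF n Sn ev(3) a1 g(2), of z] that by simp
  thus "EX \<delta>:D. ALL z:W n Int abstract. \<tau> z $ ?v = v z $ \<delta>" unfolding t using D_Var by blast
 qed
 have 6: "(Z $s (restrict_subst \<sigma> (Gr n))) $s ?\<psi> = Z $s \<psi> &
   (Z $s (restrict_subst \<sigma> (Gr n))) $s ?v = Z $s v &
   (Z $s (restrict_subst \<sigma> (Gr n))) $s ?\<rho> = Z $s \<rho>" if "vars_state Z <= W n" for Z
  using eval_keep_state[OF n Sn ev(3) a1 g(1) that] eval_keep_state[OF n Sn ev(3) a1 g(2) that]
   eval_keep_state[OF n Sn ev(3) a1 g(3) that] by blast
 show thesis by (rule that[OF 1 png 2 3 4 5 6])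
qed

lemma front_Cons:
 "front \<kappa> \<psi> v (e # X) ==> set (sgoal_var_list (e $h \<psi>)) <= hazards Un locals & vars_state (X $s \<psi>) <= hazards Un locals &
   e $h v = e $h \<psi> $h \<kappa> & X $s v = X $s \<psi> $s \<kappa> &
   exh P (e $h \<psi> # X $s \<psi>)" by (simp add: front_def)

lemma frontI:
 "vars_state (X $s \<psi>) <= hazards Un locals ==> X $s v = X $s \<psi> $s \<kappa> ==>
  exh P (X $s \<psi>) ==> front \<kappa> \<psi> v X" by (simp add: front_def)

text \<open>Each rule performs the step that the exhausted front performs anyway. A cut in the front
  has its marker there, since exhaustion involves local steps only; in particular
  \<open>Cut_all\<close> is impossible.\<close>

lemma front_step:
 assumes n: "expanded G n" and np: "rule_of G n ~= R_Parallel" and cf: "conf R n \<kappa> \<psi> v \<rho> (e # X1) T"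
 shows "step_ok R n v"
proof -
 obtain Y where SY: "S n = e # X1 @ T @ Y" using cf by (auto simp: conf_def)
 have nG: "n < length G" and T: "T ~= []" and ok: "kappa_ok \<kappa>" "kb_ok n \<psi> v \<rho>" and fr: "front \<kappa> \<psi> v (e # X1)"
  and R: "R (T $s \<psi>) (T $s v) (T $s \<rho>)" using cf by (simp_all add: conf_def)
 note f = front_Cons[OF fr]
 have exh: "exh P (e $h \<psi> # X1 $s \<psi>)" using f by (elim conjE)
 have tail: "front \<kappa> \<psi> v X1" if "rstep P (e $h \<psi> # X1 $s \<psi>) (X1 $s \<psi>)" "local (e $h \<psi> # X1 $s \<psi>)"
  by (rule frontI) (use f exh_lstep[OF exh lstepI[OF that]] in simp_all)
 have same: "step_ok R n v" if "succs G n = [n']" "edge_substs G n n' = {Var}" "snd (astate_of G n') = snd (astate_of G n)"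
   "S n' = X @ T @ Y'" "front \<kappa> \<psi> v X" for n' X Y'
  by (rule step_same[where R = R, OF n _ that(2) kb_ok_cong[OF that(3)] that(4) T ok that(5) R]) (simp add: that(1))
 from n show ?thesis
 proof (cases rule: node_cases)
  case (Suc S' n')
  hence e: "e = Goal []" "S' = X1 @ T @ Y" using SY by auto
  have "front \<kappa> \<psi> v X1" by (rule tail) (simp_all add: e r_suc)
  thus ?thesis by (intro same[of n' X1 Y]) (use Suc e edge_other[OF n] in simp_all)
 next
  case (Fail m S' n')
  hence e: "e = Scope m" "S' = X1 @ T @ Y" using SY by auto
  have "front \<kappa> \<psi> v X1" by (rule tail) (simp_all add: e r_fail)
  thus ?thesis by (intro same[of n' X1 Y]) (use Fail e edge_other[OF n] in simp_all)
 next
  case (Cut_scope m Q S1 S2 n')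
  hence e: "e = Goal (Cut m # Q)" "X1 @ T @ Y = S1 @ Scope m # S2" using SY by auto
  obtain X' where "lstep P (e $h \<psi> # X1 $s \<psi>) X'" using exh_progress[OF exh] by blast
  hence "Scope m : set X1" by (simp add: lstep_def e)
  then obtain XA XB where X1: "X1 = XA @ Scope m # XB" "Scope m ~: set XA" by (meson split_list_first)
  \<comment> \<open>Both decompositions split at the first occurrence of the marker, so the
    remainders coincide.\<close>
  have "Scope m # XB @ T @ Y = Scope m # S2"
   using Scope_split[OF X1(2), of "XB @ T @ Y"] Scope_split[OF Cut_scope(3), of S2] e(2) X1(1) by simp
  hence S2: "S2 = XB @ T @ Y" by simp
  have dw: "dropWhile (%g. g ~= Scope m) (X1 $s \<psi>) = Scope m # XB $s \<psi>"
   using Scope_split[of m "XA $s \<psi>" "XB $s \<psi>"] X1(2) by (simp add: X1(1))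
  have "rstep P (e $h \<psi> # X1 $s \<psi>) (Goal (Q $g \<psi>) # Scope m # XB $s \<psi>)"
   using r_cut[of P m "Q $g \<psi>" "X1 $s \<psi>"] by (simp add: e dw)
  moreover have "local (e $h \<psi> # X1 $s \<psi>)" using X1(1) by (simp add: e)
  ultimately have "exh P (Goal (Q $g \<psi>) # Scope m # XB $s \<psi>)" by (rule exh_lstep[OF exh lstepI])
  hence "front \<kappa> \<psi> v (Goal Q # Scope m # XB)" by (intro frontI) (use f in \<open>simp_all add: e X1(1)\<close>)
  thus ?thesis by (intro same[of n' "Goal Q # Scope m # XB" Y]) (use Cut_scope S2 edge_other[OF n] in simp_all)
 next
  case (Cut_all m Q S' n')
  hence e: "e = Goal (Cut m # Q)" "S' = X1 @ T @ Y" using SY by auto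
  obtain X' where "lstep P (e $h \<psi> # X1 $s \<psi>) X'" using exh_progress[OF exh] by blast
  hence "Scope m : set X1" by (simp add: lstep_def e)
  thus ?thesis using Cut_all(3) e(2) by simp
 next
  case (Case m p ts Q S' n')
  hence e: "e = Goal (Atom (Fun p ts) # Q)" "S' = X1 @ T @ Y" using SY by auto
  have "m ~: marks_state ((e # X1) $s \<psi>)" unfolding marks_state_subst using Case(3) SY by simp
  hence "rstep P (e $h \<psi> # X1 $s \<psi>) ((case_goals P p ts Q m @ X1) $s \<psi>)"
   using r_case[of m p "map (subst_trm \<psi>) ts" "Q $g \<psi>" "X1 $s \<psi>" P] by (simp add: e subst_case_goals)
  moreover have "local (e $h \<psi> # X1 $s \<psi>)" by (simp add: e)
  ultimately have ex: "exh P ((case_goals P p ts Q m @ X1) $s \<psi>)" by (rule exh_lstep[OF exh lstepI])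
  have "front \<kappa> \<psi> v (case_goals P p ts Q m @ X1)"
  proof (rule frontI[OF _ _ ex])
   show "vars_state ((case_goals P p ts Q m @ X1) $s \<psi>) <= hazards Un locals"
    using f vars_case_goals[of P p "map (subst_trm \<psi>) ts" "Q $g \<psi>" m] by (auto simp: e subst_case_goals)
   show "(case_goals P p ts Q m @ X1) $s v = (case_goals P p ts Q m @ X1) $s \<psi> $s \<kappa>"
   proof -
    have "map (subst_trm v) ts = map (subst_trm \<kappa>) (map (subst_trm \<psi>) ts)" "Q $g v = Q $g \<psi> $g \<kappa>"
     "X1 $s v = X1 $s \<psi> $s \<kappa>" using f by (simp_all add: e)
    thus ?thesis by (simp only: subst_state_simps subst_case_goals)
   qed
  qed
  thus ?thesis by (intro same[of n' "case_goals P p ts Q m @ X1" Y]) (use Case e edge_other[OF n] in simp_all)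
 next
  case (Backtrack t Q c m S' n')
  hence e: "e = Labeled (Atom t # Q) c m" "S' = X1 @ T @ Y" using SY by auto
  have "hazardous (t $ \<psi>) \<or> ~ matchable (t $ \<psi>) c"
  proof (rule ccontr)
   assume a: "~ ?thesis"
   hence "vars_trm (t $ \<psi>) <= locals" using f by (auto simp: e hazardous_def)
   hence "EX \<gamma>. concretization \<gamma> (astate_of G n) & unifiable (t $ \<gamma>) (head c)"
    using a no_backtrack[OF nG ok(2) Backtrack(2)] by blast
   thus False using Backtrack(3) by blast
  qed
  hence "front \<kappa> \<psi> v X1" by (intro tail) (simp_all add: e r_drop)
  thus ?thesis by (intro same[of n' X1 Y]) (use Backtrack(1,2,4,5) e edge_other[OF n] in simp_all)
 next
  case (Eval \<sigma> t Q c m S' n1 n2)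
  hence e: "e = Labeled (Atom t # Q) c m" "S' = X1 @ T @ Y" using SY by auto
  have vt: "vars_trm (t $ \<psi>) Un vars_goal (Q $g \<psi>) <= hazards Un locals" using f by (auto simp: e)
  show ?thesis
  proof (cases "hazardous (t $ \<psi>) \<or> ~ matchable (t $ \<psi>) c")
   case True
   hence "front \<kappa> \<psi> v X1" by (intro tail) (simp_all add: e r_drop)
   moreover have "kb_ok n2 \<psi> v \<rho>" by (rule eval_right[OF nG ok(2) Eval(2,8)]) (use True in blast)
   ultimately have "conf R n2 \<kappa> \<psi> v \<rho> X1 T" unfolding conf_def using succ_at[OF n, of n2] Eval(5,8) e T ok(1) R by auto
   thus ?thesis by (intro step_okI[of n2]) (use Eval(5) edge_ok_id[OF edge_eval(2)[OF Eval(1,5,6)]] in simp_all)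
  next
   case False
   hence hz: "~ hazardous (t $ \<psi>)" and ma: "matchable (t $ \<psi>) c" by blast+
   have vt1: "vars_trm (t $ \<psi>) <= hazards Un locals" using vt by blast
   obtain \<alpha> \<beta> where mgu: "two_mgu (vars_trm (t $ \<psi>) Un vars_goal (Q $g \<psi>)) (t $ \<psi>) c \<alpha> \<beta>"
     "!!x. x ~: locals ==> \<alpha> x = Var x" "!!x. x : locals ==> vars_trm (\<alpha> x) <= locals" "!!y. vars_trm (\<beta> y) <= locals"
    by (rule local_mgu[OF hz vt1 ma, of "Q $g \<psi>"]) (rule that)
   let ?r = "restrict_subst \<sigma> (Gr n)"
   have X1: "X1 $s v = X1 $s \<psi> $s \<kappa>" "vars_state (X1 $s \<psi>) <= hazards Un locals" using f by blast+
   have tv: "t $ v = t $ \<psi> $ \<kappa>" "Q $g v = Q $g \<psi> $g \<kappa>" using f by (simp_all add: e)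
   have "rstep P (e $h \<psi> # X1 $s \<psi>) (Goal (resolvent m c (Q $g \<psi>) \<alpha> \<beta>) # X1 $s \<psi>)"
    using r_res[OF hz mgu(1)] by (simp add: e)
   moreover have "local (e $h \<psi> # X1 $s \<psi>)" by (simp add: e)
   ultimately have ex: "exh P (Goal (resolvent m c (Q $g \<psi>) \<alpha> \<beta>) # X1 $s \<psi>)" by (rule exh_lstep[OF exh lstepI])
   obtain \<psi>' v' \<rho>' ng where new: "S n1 = Goal ng # S' $s ?r"
    "ng $g \<psi>' = resolvent m c (Q $g \<psi>) \<alpha> \<beta>" "ng $g v' = ng $g \<psi>' $g \<kappa>"
    "vars_goal (ng $g \<psi>') <= hazards Un locals" "kb_ok n1 \<psi>' v' \<rho>'" "edge_ok n n1 v v'"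
    "!!Z. vars_state Z <= W n ==> Z $s ?r $s \<psi>' = Z $s \<psi> &
     Z $s ?r $s v' = Z $s v & Z $s ?r $s \<rho>' = Z $s \<rho>"
    by (rule front_eval[OF n Eval(2) Eval(1,3,4,5,6,7) ok vt tv hz mgu]) (rule that | assumption)+
   have sub: "vars_state X1 <= W n" "vars_state T <= W n" using vars_state_W[OF n] by (auto simp: SY)
   have fr': "front \<kappa> \<psi>' v' (Goal ng # X1 $s ?r)" by (rule frontI) (use new X1 ex new(7)[OF sub(1)] in simp_all)
   have "conf R n1 \<kappa> \<psi>' v' \<rho>' (Goal ng # X1 $s ?r) (T $s ?r)"
   proof (rule confI[OF _ _ _ ok(1) new(5) fr'])
    show "n1 < length G" using succ_at[OF n, of n1] Eval(5) by simp
    show "S n1 = (Goal ng # X1 $s ?r) @ T $s ?r @ Y $s ?r" using new(1) by (simp add: e(2))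
    show "T $s ?r ~= []" using T by (simp add: subst_state_def)
    show "R (T $s ?r $s \<psi>') (T $s ?r $s v') (T $s ?r $s \<rho>')" using R new(7)[OF sub(2)] by simp
   qed
   thus ?thesis by (intro step_okI[of n1]) (use Eval(5) new(6) in simp_all)
  qed
 next
  case (Parallel S1 S2 n1 n2)
  thus ?thesis using np by simp
 next
  case (Split \<mu> l Q n1 n2)
  thus ?thesis using SY T by simp
 qed
qed

end

text \<open>There are two kinds of interesting parts: for \<open>RA\<close> a goal with an infinite computation, for \<open>RB\<close> a
  goal with an answer, to which the clauses before the successful one do not contribute.\<close>

definition RA :: "'f clause list => 'f state => 'f state => 'f state => bool" where
 "RA P T\<psi> Tv T\<rho> \<longleftrightarrow> (EX g. T\<psi> = [g] & Tv = [g] & set (sgoal_var_list g) <= locals & ~ fin P [g])"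

text \<open>The two forms before and after a case analysis: a goal with an answer, or the
  alternatives up to the answering one, each both at the values when called and at the answer
  values.\<close>

definition good :: "'f clause list => 'f state => 'f state => bool" where
 "good P T\<rho> T\<psi> \<longleftrightarrow> (EX Q\<rho> \<delta>. T\<rho> = [Goal Q\<rho>] & T\<psi> = [Goal (Q\<rho> $g \<delta>)] & ans P Q\<rho> \<delta>) \<or>
   (EX t\<rho> Q\<rho> cs c m \<alpha> \<beta> \<delta>. T\<rho> = map (%c. Labeled (Atom t\<rho> # Q\<rho>) c m) (cs @ [c]) &
    T\<psi> = map (%c. Labeled (Atom (t\<rho> $ \<alpha> $ \<delta>) # Q\<rho> $g \<alpha> $g \<delta>) c m) (cs @ [c]) & ~ hazardous t\<rho> &
    (ALL c':set cs. sibling_exh P t\<rho> Q\<rho> m c') & two_mgu (vars_trm t\<rho> Un vars_goal Q\<rho>) t\<rho> c \<alpha> \<beta> &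
    ans P (resolvent m c Q\<rho> \<alpha> \<beta>) \<delta>)"

definition RB :: "'f clause list => 'f state => 'f state => 'f state => bool" where
 "RB P T\<psi> Tv T\<rho> \<longleftrightarrow> Tv = T\<psi> & vars_state T\<psi> <= finals & good P T\<rho> T\<psi>"

lemma good_suffix:
 fixes P :: "'f clause list"
 assumes "good P (C @ C') (A @ A')" "A' ~= []" "length A = length C"
 shows "good P C' A'" using assms(1)[unfolded good_def]
proof (elim disjE exE conjE)
 fix Q\<rho> \<delta> assume "C @ C' = [Goal Q\<rho>]" "A @ A' = [Goal (Q\<rho> $g \<delta>)]" "ans P Q\<rho> \<delta>"
 moreover from this have "A = []" using assms(2) by (cases A) auto
 ultimately show ?thesis using assms(3) unfolding good_def by auto
next
 fix t\<rho> :: "'f trm" and Q\<rho> cs c m \<alpha> \<beta> \<delta>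
 let ?L = "%c. Labeled (Atom t\<rho> # Q\<rho>) c m" and ?F = "%c. Labeled (Atom (t\<rho> $ \<alpha> $ \<delta>) # Q\<rho> $g \<alpha> $g \<delta>) c m"
 assume C: "C @ C' = map ?L (cs @ [c])" and A: "A @ A' = map ?F (cs @ [c])"
  and h: "~ hazardous t\<rho>" "ALL c':set cs. sibling_exh P t\<rho> Q\<rho> m c'"
   "two_mgu (vars_trm t\<rho> Un vars_goal Q\<rho>) t\<rho> c \<alpha> \<beta>" "ans P (resolvent m c Q\<rho> \<alpha> \<beta>) \<delta>"
 have "length A + length A' = length cs + 1" using arg_cong[OF A, of length] by simp
 hence k: "length A <= length cs" using assms(2) by (cases A') auto
 have C': "C' = map ?L (drop (length A) cs @ [c])" using arg_cong[OF C, of "drop (length A)"] k assms(3) by (simp add: drop_map)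
 have A': "A' = map ?F (drop (length A) cs @ [c])" using arg_cong[OF A, of "drop (length A)"] k by (simp add: drop_map)
 have "ALL c':set (drop (length A) cs). sibling_exh P t\<rho> Q\<rho> m c'" using h(2) by (meson in_set_dropD)
 thus ?thesis unfolding good_def using C' A' h(1,3,4) by blast
qed

lemma good_long:
 assumes "good P T\<rho> T\<psi>" "1 < length T\<rho>"
 shows "EX t\<rho> Q\<rho> cs c m \<alpha> \<delta>. T\<rho> = map (%c. Labeled (Atom t\<rho> # Q\<rho>) c m) (cs @ [c]) &
    T\<psi> = map (%c. Labeled (Atom (t\<rho> $ \<alpha> $ \<delta>) # Q\<rho> $g \<alpha> $g \<delta>) c m) (cs @ [c]) & ~ hazardous t\<rho> &
    (ALL c':set cs. sibling_exh P t\<rho> Q\<rho> m c')" using assms(1)[unfolded good_def]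
proof
 assume "EX Q\<rho> \<delta>. T\<rho> = [Goal Q\<rho>] & T\<psi> = [Goal (Q\<rho> $g \<delta>)] & ans P Q\<rho> \<delta>"
 hence "length T\<rho> = 1" by (elim exE conjE) simp
 thus ?thesis using assms(2) by simp
qed blast

lemma good_labeled:
 assumes "good P [Labeled (Atom t # Q) c m] [Labeled (Atom t' # Q') c m]"
 shows "EX \<alpha> \<beta> \<delta>. ~ hazardous t & t' = t $ \<alpha> $ \<delta> & Q' = Q $g \<alpha> $g \<delta> &
   two_mgu (vars_trm t Un vars_goal Q) t c \<alpha> \<beta> & ans P (resolvent m c Q \<alpha> \<beta>) \<delta>"
 using assms[unfolded good_def]
proof (elim disjE exE conjE)
 fix t\<rho> Q\<rho> cs c0 m0 \<alpha> \<beta> \<delta>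
 assume a: "[Labeled (Atom t # Q) c m] = map (%c. Labeled (Atom t\<rho> # Q\<rho>) c m0) (cs @ [c0])"
  "[Labeled (Atom t' # Q') c m] = map (%c. Labeled (Atom (t\<rho> $ \<alpha> $ \<delta>) # Q\<rho> $g \<alpha> $g \<delta>) c m0) (cs @ [c0])"
  "~ hazardous t\<rho>" "two_mgu (vars_trm t\<rho> Un vars_goal Q\<rho>) t\<rho> c0 \<alpha> \<beta>" "ans P (resolvent m0 c0 Q\<rho> \<alpha> \<beta>) \<delta>"
 have "cs = []" using arg_cong[OF a(1), of length] by simp
 hence "t\<rho> = t" "Q\<rho> = Q" "c0 = c" "m0 = m" "t' = t\<rho> $ \<alpha> $ \<delta>" "Q' = Q\<rho> $g \<alpha> $g \<delta>" using a(1,2) by simp_all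
 thus ?thesis using a(3-5) by blast
qed simp

lemma subst_state_ident: "(!!x. x : vars_state Z ==> \<sigma> x = Var x) ==> Z $s \<sigma> = Z"
proof (induction Z)
 case (Cons g Z)
 have "g $h \<sigma> = g" using Cons.prems by (cases g) (auto intro!: subst_goal_ident)
 thus ?case using Cons by simp
qed simp

lemma active_cuts_subst [simp]: "active_cuts (S $s \<sigma>) = active_cuts S"
proof (induction S)
 case (Cons g S)
 have "cuts_sgoal (g $h \<sigma>) = cuts_sgoal g" by (cases g) simp_all
 thus ?case using Cons by simp
qed simp

lemma scopes_subst [simp]: "scopes (S $s \<sigma>) = scopes S" by (simp add: scopes_def)

text \<open>Reconciles the side condition of \<open>Parallel\<close> with that on exhausted
  suffixes: a marker at the beginning of the right part is exempt in both.\<close>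

lemma scopes_active_marks: "Z ~= [] ==> scopes (tl us) <= active_marks (us @ Z)"
proof
 fix m assume Z: "Z ~= []" "m : scopes (tl us)"
 then obtain e us' where us: "us = e # us'" by (cases us) (auto simp: scopes_def)
 hence "Scope m : set us'" using Z(2) by (simp add: scopes_def)
 then obtain p q where "us' = p @ Scope m # q" by (meson split_list)
 hence "us @ Z = (e # p) @ Scope m # (q @ Z)" using us by simp
 thus "m : active_marks (us @ Z)" unfolding active_marks_def using Z(1) by blast
qed

text \<open>Each variable gets a hazard of its own, so that \<kappa> can assign values to the
  hazards independently.\<close>

definition hz :: "var => var" where
 "hz x = AVar (3 * code x)"

lemma hz_inj: "inj hz" by (rule injI) (simp add: hz_def code_inj)

lemma hz_hazard: "hz x : hazards" by (simp add: hz_def hazards_def)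

definition unhz :: "var => var" where
 "unhz = inv_into UNIV hz"

lemma unhz_hz [simp]: "unhz (hz x) = x" unfolding unhz_def using hz_inj by (rule inv_into_f_f) simp

text \<open>Variables that an answer leaves open become one arbitrary final. This is allowed because
  instances of answers count as answers.\<close>

definition to_finals :: "'f subst" where
 "to_finals x = (if x : finals then Var x else Var (AVar 1))"

lemma to_finals_vars: "vars_trm (u $ to_finals) <= finals"
proof -
 have "AVar 1 : finals" unfolding finals_def by (rule range_eqI[of _ _ 0]) simp
 thus ?thesis by (auto simp: vars_trm_subst to_finals_def split: if_splits)
qed

lemma to_finals_id: "vars_trm u <= finals ==> u $ to_finals = u" by (rule subst_trm_ident) (auto simp: to_finals_def)

lemma to_finals_goal: "vars_goal Q <= finals ==> Q $g to_finals = Q" by (rule subst_goal_ident) (auto simp: to_finals_def)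

lemma ans_CutD: "ans P (Cut m # Q) \<delta> ==> ans P Q \<delta>" by (erule ans.cases) auto

lemma mem_range_vars: "x : vars_trm (\<sigma> z) ==> \<sigma> z ~= Var z ==> x : range_vars \<sigma>"
 by (auto simp: range_vars_def subst_range_def subst_dom_def)

section \<open>Steps at \<open>Parallel\<close> nodes, of infinite goals and of answered
  goals\<close>

context bounded_graph
begin

text \<open>The division of the state lies within the front, within the interesting part, or behind
  it. In the first two cases the right successor is entered with what is left of the front or of the
  alternatives; in the last case the left one.\<close>

lemma parallel_step:
 assumes n: "expanded G n" and pr: "rule_of G n = R_Parallel" and cf: "conf R n \<kappa> \<psi> v \<rho> X T"
  and closed: "!!A A' B B' C C'. R (A @ A') (B @ B') (C @ C') ==> A' ~= [] ==> length A = length B ==> length A = length C ==> R A' B' C'"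
 shows "step_ok R n v"
proof -
 obtain Y where SY: "S n = X @ T @ Y" using cf by (auto simp: conf_def)
 have T: "T ~= []" and ok: "kappa_ok \<kappa>" "kb_ok n \<psi> v \<rho>" and fr: "front \<kappa> \<psi> v X"
  and R: "R (T $s \<psi>) (T $s v) (T $s \<rho>)" using cf by (simp_all add: conf_def)
 from n show ?thesis
 proof (cases rule: node_cases)
  case (Parallel S1 S2 n1 n2)
  have e: "edge_substs G n n' = {Var}" for n' by (rule edge_other[OF n]) (simp_all add: pr)
  have same: "step_ok R n v" if "n' = n1 \<or> n' = n2" "S n' = X' @ T' @ Y'" "T' ~= []" "front \<kappa> \<psi> v X'"
    "R (T' $s \<psi>) (T' $s v) (T' $s \<rho>)" for n' X' T' Y'
   by (rule step_same[where R = R, OF n _ e kb_ok_cong that(2,3) ok that(4,5)]) (use that(1) Parallel(4,6,7) in auto)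
  have "X @ (T @ Y) = S1 @ S2" using SY Parallel(2) by simp
  then obtain us where us: "X = S1 @ us & us @ T @ Y = S2 \<or> X @ us = S1 & T @ Y = us @ S2" by (auto simp: append_eq_append_conv2)
  thus ?thesis
  proof (elim disjE conjE)
   assume a: "X = S1 @ us" "us @ T @ Y = S2"
   have f: "vars_state (us $s \<psi>) <= hazards Un locals" "exh P (S1 $s \<psi> @ us $s \<psi>)"
    "S1 $s v @ us $s v = S1 $s \<psi> $s \<kappa> @ us $s \<psi> $s \<kappa>" using fr by (simp_all add: front_def a)
   have "scopes (tl us) <= active_marks S2" using scopes_active_marks[of "T @ Y" us] T a(2) by simp
   hence "active_cuts S1 Int scopes (tl us) = {}" using Parallel(3) by blast
   moreover have "tl (us $s \<psi>) = tl us $s \<psi>" by (cases us) simp_all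
   ultimately have "exh P (us $s \<psi>)" by (intro exh_suffix[OF f(2)]) simp
   hence "front \<kappa> \<psi> v us" by (intro frontI) (use f in simp_all)
   thus ?thesis by (intro same[of n2 us T Y]) (use a T R Parallel(7) in simp_all)
  next
   assume a: "X @ us = S1" "T @ Y = us @ S2"
   then obtain ws where ws: "T = us @ ws & ws @ Y = S2 \<or> T @ ws = us & Y = ws @ S2" by (auto simp: append_eq_append_conv2)
   show ?thesis
   proof (cases "T @ [] = us \<or> (EX ws. T @ ws = us)")
    case True
    then obtain ws where "us = T @ ws" by auto
    thus ?thesis by (intro same[of n1 X T ws]) (use a T R fr Parallel(6) in simp_all)
   next
    case False
    hence w: "T = us @ ws" "ws @ Y = S2" "ws ~= []" using ws by auto
    have "R (ws $s \<psi>) (ws $s v) (ws $s \<rho>)"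
     by (rule closed[of "us $s \<psi>" _ "us $s v" _ "us $s \<rho>"]) (use R w(1,3) in \<open>auto simp: subst_state_def\<close>)
    thus ?thesis by (intro same[of n2 "[]" ws Y]) (use w front_Nil Parallel(7) in simp_all)
   qed
  qed
 qed (use pr in simp_all)
qed

lemma RA_closed: "RA P (A @ A') (B @ B') (C @ C') ==> A' ~= [] ==> length A = length B ==> length A = length C ==> RA P A' B' C'"
 unfolding RA_def by (cases A) auto

lemma RB_closed: "RB P (A @ A') (B @ B') (C @ C') ==> A' ~= [] ==> length A = length B ==> length A = length C ==> RB P A' B' C'"
 unfolding RB_def using good_suffix[of P C C' A A'] by auto

lemma kappa_locals_state: "kappa_ok \<kappa> ==> vars_state Z <= locals ==> Z $s \<kappa> = Z"
 using codes_disjoint(2) unfolding kappa_ok_def by (intro subst_state_ident) blast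

text \<open>With an empty front the goal itself is infinite. A \<open>Case\<close> node selects the
  responsible alternative, and the exhausted ones before it become the new front.\<close>

lemma step_A:
 assumes n: "expanded G n" and np: "rule_of G n ~= R_Parallel" "!!\<mu>. rule_of G n ~= R_Split \<mu>" and cf: "conf (RA P) n \<kappa> \<psi> v \<rho> [] T"
 shows "step_ok (RA P) n v"
proof -
 obtain Y where SY: "S n = T @ Y" using cf by (auto simp: conf_def)
 have nG: "n < length G" and ok: "kappa_ok \<kappa>" "kb_ok n \<psi> v \<rho>" and R: "RA P (T $s \<psi>) (T $s v) (T $s \<rho>)"
  using cf by (simp_all add: conf_def)
 obtain g where T: "T = [g]" using R by (cases T) (auto simp: RA_def subst_state_def)
 have g: "g $h v = g $h \<psi>" "set (sgoal_var_list (g $h \<psi>)) <= locals" "~ fin P [g $h \<psi>]" using R by (auto simp: RA_def T)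
 have same: "step_ok (RA P) n v" if "succs G n = [n']" "edge_substs G n n' = {Var}" "snd (astate_of G n') = snd (astate_of G n)"
   "S n' = X @ [g'] @ Y'" "front \<kappa> \<psi> v X" "RA P [g' $h \<psi>] [g' $h v] [g' $h \<rho>]" for n' X g' Y'
  by (rule step_same[where R = "RA P", OF n _ that(2) kb_ok_cong[OF that(3)] that(4) _ ok that(5)]) (use that(1,6) in simp_all)
 from n show ?thesis
 proof (cases rule: node_cases)
  case (Suc S' n')
  thus ?thesis using SY T g(3) by simp
 next
  case (Fail m S' n')
  thus ?thesis using SY T g(3) by simp
 next
  case (Cut_scope m Q S1 S2 n')
  hence e: "g = Goal (Cut m # Q)" using SY T by simp
  have "RA P [Goal Q $h \<psi>] [Goal Q $h v] [Goal Q $h \<rho>]" using g not_fin_Cut[of P m "Q $g \<psi>"] by (simp add: RA_def e)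
  thus ?thesis by (intro same[of n' "[]" "Goal Q" "Scope m # S2"]) (use Cut_scope edge_other[OF n] front_Nil in simp_all)
 next
  case (Cut_all m Q S' n')
  hence e: "g = Goal (Cut m # Q)" using SY T by simp
  have "RA P [Goal Q $h \<psi>] [Goal Q $h v] [Goal Q $h \<rho>]" using g not_fin_Cut[of P m "Q $g \<psi>"] by (simp add: RA_def e)
  thus ?thesis by (intro same[of n' "[]" "Goal Q" "[]"]) (use Cut_all edge_other[OF n] front_Nil in simp_all)
 next
  case (Case m p ts Q S' n')
  hence e: "g = Goal (Atom (Fun p ts) # Q)" "S' = Y" using SY T by simp_all
  have m: "m ~: marks_goal (Q $g \<psi>)" using Case(2,3) by simp
  let ?ts = "map (subst_trm \<psi>) ts" and ?L = "%c. Labeled (Atom (Fun p ts) # Q) c m"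
  have nf: "~ fin P [Goal (Atom (Fun p ?ts) # Q $g \<psi>)]" using g(3) by (simp add: e)
  obtain cs1 c cs2 where cs: "slice P p (length ?ts) = cs1 @ c # cs2"
   "exh P (map (%c. Labeled (Atom (Fun p ?ts) # Q $g \<psi>) c m) cs1)" "~ fin P [Labeled (Atom (Fun p ?ts) # Q $g \<psi>) c m]"
   by (rule not_fin_case[OF nf m]) (rule that)
  have eq: "map (subst_trm v) ts = ?ts" "Q $g v = Q $g \<psi>" using g(1) by (simp_all add: e)
  have L: "map ?L cs $s \<psi> = map (%c. Labeled (Atom (Fun p ?ts) # Q $g \<psi>) c m) cs"
   "map ?L cs $s v = map (%c. Labeled (Atom (Fun p ?ts) # Q $g \<psi>) c m) cs" for cs using eq by (simp_all add: subst_state_def)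
  have vl: "vars_state (map ?L cs $s \<psi>) <= locals" for cs using g(2) by (induction cs) (auto simp: e)
  have "front \<kappa> \<psi> v (map ?L cs1)"
   by (rule frontI) (use vl[of cs1] L[of cs1] cs(2) kappa_locals_state[OF ok(1) vl[of cs1]] in auto)
  moreover have "RA P [?L c $h \<psi>] [?L c $h v] [?L c $h \<rho>]" using g cs(3) L[of "[c]"] by (simp add: RA_def e)
  ultimately show ?thesis by (intro same[of n' "map ?L cs1" "?L c" "map ?L cs2 @ Scope m # Y"])
    (use Case e cs(1) edge_other[OF n] in \<open>simp_all add: case_goals_def\<close>)
 next
  case (Backtrack t Q c m S' n')
  hence e: "g = Labeled (Atom t # Q) c m" using SY T by simp
  have nf: "~ fin P [Labeled (Atom (t $ \<psi>) # Q $g \<psi>) c m]" using g(3) by (simp add: e)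
  hence "matchable (t $ \<psi>) c" by (rule not_fin_Labeled) simp
  hence "EX \<gamma>. concretization \<gamma> (astate_of G n) & unifiable (t $ \<gamma>) (head c)"
   using no_backtrack[OF nG ok(2) Backtrack(2)] g(2) by (simp add: e)
  thus ?thesis using Backtrack(3) by blast
 next
  case (Eval \<sigma> t Q c m S' n1 n2)
  hence e: "g = Labeled (Atom t # Q) c m" "S' = Y" using SY T by simp_all
  have nf: "~ fin P [Labeled (Atom (t $ \<psi>) # Q $g \<psi>) c m]" using g(3) by (simp add: e)
  have hz: "~ hazardous (t $ \<psi>)" and ma: "matchable (t $ \<psi>) c" by (rule not_fin_Labeled[OF nf]; simp)+
  have res: "~ fin P [Goal (resolvent m c (Q $g \<psi>) \<alpha> \<beta>)]"
   if "two_mgu (vars_trm (t $ \<psi>) Un vars_goal (Q $g \<psi>)) (t $ \<psi>) c \<alpha> \<beta>" for \<alpha> \<beta>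
   by (rule not_fin_Labeled[OF nf]) (use that in auto)
  have vl: "vars_trm (t $ \<psi>) <= locals" "vars_goal (Q $g \<psi>) <= locals" using g(2) by (auto simp: e)
  hence vt1: "vars_trm (t $ \<psi>) <= hazards Un locals" and vt: "vars_trm (t $ \<psi>) Un vars_goal (Q $g \<psi>) <= hazards Un locals" by auto
  obtain \<alpha> \<beta> where mgu: "two_mgu (vars_trm (t $ \<psi>) Un vars_goal (Q $g \<psi>)) (t $ \<psi>) c \<alpha> \<beta>"
    "!!x. x ~: locals ==> \<alpha> x = Var x" "!!x. x : locals ==> vars_trm (\<alpha> x) <= locals" "!!y. vars_trm (\<beta> y) <= locals"
   by (rule local_mgu[OF hz vt1 ma, of "Q $g \<psi>"]) (rule that)
  let ?r = "restrict_subst \<sigma> (Gr n)"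
  have kQ: "Q $g \<psi> $g \<kappa> = Q $g \<psi>"
   using vl(2) ok(1) codes_disjoint(2) unfolding kappa_ok_def by (intro subst_goal_ident) blast
  have tv: "t $ v = t $ \<psi> $ \<kappa>" "Q $g v = Q $g \<psi> $g \<kappa>"
   using g(1) kappa_locals[OF ok(1) vl(1)] kQ by (simp_all add: e)
  obtain \<psi>' v' \<rho>' ng where new: "S n1 = Goal ng # S' $s ?r"
   "ng $g \<psi>' = resolvent m c (Q $g \<psi>) \<alpha> \<beta>" "ng $g v' = ng $g \<psi>' $g \<kappa>"
   "vars_goal (ng $g \<psi>') <= hazards Un locals" "kb_ok n1 \<psi>' v' \<rho>'" "edge_ok n n1 v v'"
   by (rule front_eval[OF n Eval(2) Eval(1,3,4,5,6,7) ok vt tv hz mgu]) (rule that | assumption)+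
  have vr: "vars_goal (resolvent m c (Q $g \<psi>) \<alpha> \<beta>) <= locals"
  proof -
   have "vars_goal (Q $g \<psi> $g \<alpha>) <= locals"
    unfolding vars_goal_subst[of \<alpha>] using vl(2) mgu(3) by (intro UN_least) blast
   moreover have "vars_goal (body c $g \<beta>) <= locals" using mgu(4) by (auto simp: vars_goal_subst)
   ultimately show ?thesis unfolding resolvent_def by simp
  qed
  have "ng $g \<psi>' $g \<kappa> = ng $g \<psi>'"
   unfolding new(2) using vr ok(1) codes_disjoint(2) unfolding kappa_ok_def by (intro subst_goal_ident) blast
  hence "RA P ([Goal ng] $s \<psi>') ([Goal ng] $s v') ([Goal ng] $s \<rho>')" using vr res[OF mgu(1)] new(2,3) by (simp add: RA_def)
  moreover have "n1 < length G" using succ_at[OF n, of n1] Eval(5) by simp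
  ultimately have "conf (RA P) n1 \<kappa> \<psi>' v' \<rho>' [] [Goal ng]"
   by (intro confI[where Y = "S' $s ?r"]) (use new ok(1) front_Nil in simp_all)
  thus ?thesis by (intro step_okI[of n1]) (use Eval(5) new(6) in simp_all)
 next
  case (Parallel S1 S2 n1 n2)
  thus ?thesis using np by simp
 next
  case (Split \<mu> l Q n1 n2)
  thus ?thesis using np by simp
 qed
qed

lemma edge_ok_keep:
 assumes "rule_of G n = R_Eval \<sigma>" "succs G n = [n1, n2]" "n1 ~= n2"
  and "!!z. z : W n Int abstract ==> \<sigma> z $ v' = v z" "!!z. z : W n Int abstract ==> restrict_subst \<sigma> (Gr n) z $ v' = v z"
 shows "edge_ok n n1 v v'" unfolding edge_ok_def edge_eval(1)[OF assms(1-3)]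
proof (intro ballI, elim insertE emptyE)
 fix \<tau> assume "\<tau> = \<sigma>"
 thus "EX \<delta>:D. ALL z:W n Int abstract. \<tau> z $ v' = v z $ \<delta>" using assms(4) by (intro bexI[OF _ D_Var] ballI) (simp only: subst_trm_Var)
next
 fix \<tau> assume "\<tau> = restrict_subst \<sigma> (Gr n)"
 thus "EX \<delta>:D. ALL z:W n Int abstract. \<tau> z $ v' = v z $ \<delta>" using assms(5) by (intro bexI[OF _ D_Var] ballI) (simp only: subst_trm_Var)
qed

text \<open>In the answering alternative \<psi> and \<open>v\<close> follow the \<open>Eval\<close>
  edge at answer values, while \<rho> follows it at the mgu. Since the final values are fixed from
  the beginning, the edge needs no further instantiation.\<close>

lemma step_B:
 assumes n: "expanded G n" and np: "rule_of G n ~= R_Parallel" "!!\<mu>. rule_of G n ~= R_Split \<mu>" "rule_of G n ~= R_Suc"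
  and cf: "conf (RB P) n \<kappa> \<psi> v \<rho> [] [g]"
 shows "step_ok (RB P) n v"
proof -
 obtain Y where SY: "S n = g # Y" using cf by (auto simp: conf_def)
 have nG: "n < length G" and ok: "kappa_ok \<kappa>" "kb_ok n \<psi> v \<rho>" and R: "RB P [g $h \<psi>] [g $h v] [g $h \<rho>]"
  using cf by (simp_all add: conf_def)
 have g: "g $h v = g $h \<psi>" "set (sgoal_var_list (g $h \<psi>)) <= finals" "good P [g $h \<rho>] [g $h \<psi>]"
  using R by (auto simp: RB_def)
 have same: "step_ok (RB P) n v" if "succs G n = [n']" "edge_substs G n n' = {Var}" "snd (astate_of G n') = snd (astate_of G n)"
   "S n' = T @ Y'" "T ~= []" "RB P (T $s \<psi>) (T $s v) (T $s \<rho>)" for n' T Y'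
  by (rule step_same[where R = "RB P" and X = "[]", OF n _ that(2) kb_ok_cong[OF that(3)] _ that(5) ok front_Nil that(6)]) (use that(1,4) in simp_all)
 have cut: "RB P ([Goal Q] $s \<psi>) ([Goal Q] $s v) ([Goal Q] $s \<rho>)" if e: "g = Goal (Cut m # Q)" for m Q
 proof -
  obtain \<delta> where "Q $g \<psi> = Q $g \<rho> $g \<delta>" "ans P (Cut m # Q $g \<rho>) \<delta>"
   using g(3) by (auto simp: good_def e map_eq_Cons_conv)
  moreover from this(2) have "ans P (Q $g \<rho>) \<delta>" by (rule ans_CutD)
  ultimately have "good P [Goal (Q $g \<rho>)] [Goal (Q $g \<psi>)]" unfolding good_def by blast
  thus ?thesis using g by (simp add: RB_def e)
 qed
 have lab: "EX \<alpha> \<beta> \<delta>. ~ hazardous (t $ \<rho>) & t $ \<psi> = t $ \<rho> $ \<alpha> $ \<delta> & Q $g \<psi> = Q $g \<rho> $g \<alpha> $g \<delta> &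
   two_mgu (vars_trm (t $ \<rho>) Un vars_goal (Q $g \<rho>)) (t $ \<rho>) c \<alpha> \<beta> & ans P (resolvent m c (Q $g \<rho>) \<alpha> \<beta>) \<delta>"
  if e: "g = Labeled (Atom t # Q) c m" for t Q c m by (rule good_labeled) (use g(3) e in simp)
 from n show ?thesis
 proof (cases rule: node_cases)
  case (Suc S' n')
  thus ?thesis using np by simp
 next
  case (Fail m S' n')
  thus ?thesis using SY g(3) by (auto simp: good_def map_eq_Cons_conv)
 next
  case (Cut_scope m Q S1 S2 n')
  hence e: "g = Goal (Cut m # Q)" using SY by simp
  show ?thesis by (intro same[of n' "[Goal Q]" "Scope m # S2"]) (use cut[OF e] Cut_scope edge_other[OF n] in simp_all)
 next
  case (Cut_all m Q S' n')
  hence e: "g = Goal (Cut m # Q)" using SY by simp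
  show ?thesis by (intro same[of n' "[Goal Q]" "[]"]) (use cut[OF e] Cut_all edge_other[OF n] in simp_all)
 next
  case (Case m p ts Q S' n')
  hence e: "g = Goal (Atom (Fun p ts) # Q)" "S' = Y" using SY by simp_all
  have m: "m ~: marks_goal (Q $g \<rho>)" using Case(2,3) by simp
  let ?t = "Fun p ts" let ?L = "%c. Labeled (Atom ?t # Q) c m"
  obtain \<delta> where d: "?t $ \<psi> = ?t $ \<rho> $ \<delta>" "Q $g \<psi> = Q $g \<rho> $g \<delta>" "ans P (Atom (?t $ \<rho>) # Q $g \<rho>) \<delta>"
   using g(3) by (auto simp: good_def e map_eq_Cons_conv simp del: subst_trm.simps(2))
  obtain p' ts' cs1 c cs2 \<alpha> \<beta> \<delta>' where a: "?t $ \<rho> = Fun p' ts'" "slice P p' (length ts') = cs1 @ c # cs2"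
   "~ hazardous (?t $ \<rho>)" "!!c'. c' : set cs1 ==> sibling_exh P (?t $ \<rho>) (Q $g \<rho>) m c'"
   "two_mgu (vars_trm (?t $ \<rho>) Un vars_goal (Q $g \<rho>)) (?t $ \<rho>) c \<alpha> \<beta>" "ans P (resolvent m c (Q $g \<rho>) \<alpha> \<beta>) \<delta>'"
   "!!x. x : vars_trm (?t $ \<rho>) Un vars_goal (Q $g \<rho>) ==> \<delta> x = \<alpha> x $ \<delta>'"
   by (rule ans_AtomE[OF d(3) m]) (rule that | assumption)+
  have tp: "?t $ \<psi> = ?t $ \<rho> $ \<alpha> $ \<delta>'"
   unfolding d(1) subst_trm_subst[where t = "?t $ \<rho>"] using a(7) by (intro subst_trm_cong) blast
  have Qp: "Q $g \<psi> = Q $g \<rho> $g \<alpha> $g \<delta>'"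
   unfolding d(2) subst_goal_subst[where Q = "Q $g \<rho>"] subst_goal_eq_iff using a(7) by blast
  have sl: "slice P p (length ts) = cs1 @ c # cs2" using a(1,2) by auto
  \<comment> \<open>The siblings before the answering clause stay in the interesting part: at the
    final values it must be decided for each of them separately which successor of its
    \<open>Eval\<close> node applies.\<close>
  let ?T = "map ?L (cs1 @ [c])"
  have "good P (?T $s \<rho>) (?T $s \<psi>)" unfolding good_def
  proof (intro disjI2 exI conjI)
   show "?T $s \<rho> = map (%c. Labeled (Atom (?t $ \<rho>) # Q $g \<rho>) c m) (cs1 @ [c])" by (simp add: subst_state_def)
   show "?T $s \<psi> = map (%c. Labeled (Atom (?t $ \<rho> $ \<alpha> $ \<delta>') # Q $g \<rho> $g \<alpha> $g \<delta>') c m) (cs1 @ [c])"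
    unfolding tp[symmetric] Qp[symmetric] by (simp add: subst_state_def)
   show "ALL c':set cs1. sibling_exh P (?t $ \<rho>) (Q $g \<rho>) m c'" using a(4) by blast
  qed (rule a)+
  moreover have "map ?L cs $s v = map ?L cs $s \<psi>" for cs using g(1) by (auto simp: subst_state_def e)
  moreover have "vars_state (map ?L cs $s \<psi>) <= finals" for cs using g(2) by (induction cs) (auto simp: e)
  ultimately have "RB P (?T $s \<psi>) (?T $s v) (?T $s \<rho>)" by (simp only: RB_def simp_thms)
  thus ?thesis
   by (intro same[of n' ?T "map ?L cs2 @ Scope m # Y"]) (use Case e sl edge_other[OF n] in \<open>simp_all add: case_goals_def\<close>)
 next
  case (Backtrack t Q c m S' n')
  hence e: "g = Labeled (Atom t # Q) c m" using SY by simp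
  obtain \<alpha> \<beta> \<delta> where l: "t $ \<psi> = t $ \<rho> $ \<alpha> $ \<delta>" "two_mgu (vars_trm (t $ \<rho>) Un vars_goal (Q $g \<rho>)) (t $ \<rho>) c \<alpha> \<beta>"
   using lab[OF e] by blast
  have "t $ \<psi> = head c $ \<beta> $ \<delta>" using l(1) two_mguD(1)[OF l(2)] by simp
  hence "t $ \<psi> = head c $ (%y. \<beta> y $ \<delta>)" by (simp add: subst_trm_subst)
  hence "EX \<gamma>. concretization \<gamma> (astate_of G n) & unifiable (t $ \<gamma>) (head c)"
   using no_backtrack[OF nG ok(2) Backtrack(2)] g(2) by (auto simp: e)
  thus ?thesis using Backtrack(3) by blast
 next
  case (Eval \<sigma> t Q c m S' n1 n2)
  hence e: "g = Labeled (Atom t # Q) c m" "S' = Y" using SY by simp_all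
  obtain \<alpha> \<beta> \<delta>0 where l: "~ hazardous (t $ \<rho>)" "t $ \<psi> = t $ \<rho> $ \<alpha> $ \<delta>0" "Q $g \<psi> = Q $g \<rho> $g \<alpha> $g \<delta>0"
   "two_mgu (vars_trm (t $ \<rho>) Un vars_goal (Q $g \<rho>)) (t $ \<rho>) c \<alpha> \<beta>" "ans P (resolvent m c (Q $g \<rho>) \<alpha> \<beta>) \<delta>0"
   using lab[OF e(1)] by blast
  define \<delta> where "\<delta> = (%x. \<delta>0 x $ to_finals)"
  have vf: "vars_trm (t $ \<psi>) <= finals" "vars_goal (Q $g \<psi>) <= finals" using g(2) by (auto simp: e)
  have tp: "t $ \<psi> = t $ \<rho> $ \<alpha> $ \<delta>"
   using to_finals_id[OF vf(1)] l(2) unfolding \<delta>_def by (metis subst_trm_subst)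
  have Qp: "Q $g \<psi> = Q $g \<rho> $g \<alpha> $g \<delta>"
   using to_finals_goal[OF vf(2)] l(3) unfolding \<delta>_def by (metis subst_goal_subst)
  have an: "ans P (resolvent m c (Q $g \<rho>) \<alpha> \<beta>) \<delta>" unfolding \<delta>_def by (rule ans_inst[OF l(5)])
  have dfin: "vars_trm (\<delta> x) <= finals" for x unfolding \<delta>_def by (rule to_finals_vars)
  note vars = eval_vars[OF n Eval(2,4,7)]
  have ht: "vars_trm (head c) <= ordinary" using label_clause(2)[OF nG, of "Atom t # Q" c m] Eval(2) by simp
  have ta: "vars_trm t <= abstract" using vars(1) by blast
  let ?b = "%y. \<beta> y $ \<delta>" and ?r = "restrict_subst \<sigma> (Gr n)"
  have "t $ \<psi> = head c $ \<beta> $ \<delta>" using tp two_mguD(1)[OF l(4)] by simp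
  hence tb: "t $ \<psi> = head c $ ?b" by (simp add: subst_trm_subst)
  have tv: "t $ v = head c $ ?b" using tb g(1) by (simp add: e)
  have tr: "t $ (%x. \<rho> x $ \<alpha>) = head c $ \<beta>" using two_mguD(1)[OF l(4)] by (simp add: subst_trm_subst)
  obtain dp where dp: "!!x. x : abstract ==> \<sigma> x $ dp = \<psi> x" "!!y. y : ordinary ==> \<sigma> y $ dp = ?b y"
   using eval_factor[OF Eval(3) tb ta ht] by blast
  obtain dv where dv: "!!x. x : abstract ==> \<sigma> x $ dv = v x" "!!y. y : ordinary ==> \<sigma> y $ dv = ?b y"
   using eval_factor[OF Eval(3) tv ta ht] by blast
  obtain dr where dr: "!!x. x : abstract ==> \<sigma> x $ dr = \<rho> x $ \<alpha>" "!!y. y : ordinary ==> \<sigma> y $ dr = \<beta> y"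
   using eval_factor[OF Eval(3) tr ta ht] by blast
  let ?\<psi> = "upd n \<psi> dp" and ?v = "upd n v dv" and ?\<rho> = "upd n \<rho> dr"
  let ?ng = "(label_cuts m (body c) @ Q) $g \<sigma>"
  have gr: "ground (\<psi> z)" "v z = \<psi> z" "\<rho> z = \<psi> z" "z : abstract" if "z : Gr n" for z
   using that ok(2) vars(4) by (auto simp: kb_ok_def)
  have gg: "\<sigma> z $ dp = \<psi> z" "\<sigma> z $ dv = v z" "\<sigma> z $ dr = \<rho> z" if "z : Gr n" for z
   using gr[OF that] dp(1)[of z] dv(1)[of z] dr(1)[of z] by (simp_all add: ground_subst_id)
  have png: "?ng $g ?\<psi> = resolvent m c (Q $g \<psi>) Var ?b" by (rule eval_new_goal[OF n Eval(2,4,7) dp])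
  have vng: "?ng $g ?v = resolvent m c (Q $g v) Var ?b" by (rule eval_new_goal[OF n Eval(2,4,7) dv])
  have rng: "?ng $g ?\<rho> = resolvent m c (Q $g \<rho>) \<alpha> \<beta>"
   using eval_new_goal[OF n Eval(2,4,7) dr] by (simp add: resolvent_def subst_goal_subst del: subst_goal_simps)
  have pr: "?ng $g ?\<psi> = resolvent m c (Q $g \<rho>) \<alpha> \<beta> $g \<delta>"
   unfolding png Qp by (simp add: resolvent_def subst_goal_label_cuts subst_goal_subst)
  have "good P [Goal (?ng $g ?\<rho>)] [Goal (?ng $g ?\<psi>)]" unfolding good_def rng pr using an by blast
  moreover have "?ng $g ?v = ?ng $g ?\<psi>" unfolding png vng using g(1) by (simp add: e)
  moreover have "vars_goal (?ng $g ?\<psi>) <= finals" unfolding pr vars_goal_subst[of \<delta>] using dfin by blast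
  ultimately have RB: "RB P ([Goal ?ng] $s ?\<psi>) ([Goal ?ng] $s ?v) ([Goal ?ng] $s ?\<rho>)"
   by (simp add: RB_def del: subst_goal_simps)
  have kb: "kb_ok n1 ?\<psi> ?v ?\<rho>" by (rule eval_kb_ok[OF n Eval(2,4,7) ok(2)]) (use gg in blast)+
  have "conf (RB P) n1 \<kappa> ?\<psi> ?v ?\<rho> [] [Goal ?ng]"
  proof (rule confI[where R = "RB P", OF _ _ _ ok(1) kb front_Nil RB])
   show "n1 < length G" using succ_at[OF n, of n1] Eval(5) by simp
   show "S n1 = [] @ [Goal ?ng] @ S' $s ?r" by (simp only: Eval(7) fst_conv append.simps)
  qed simp
  moreover have "edge_ok n n1 v ?v"
   by (rule edge_ok_keep[OF Eval(1,5,6)]) (use eval_edge[OF n Eval(2,4,7) dv(1)] eval_keep[OF n Eval(2,4,7) gg(2)] in blast)+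
  ultimately show ?thesis by (intro step_okI[of n1]) (use Eval(5) in simp_all)
 next
  case (Parallel S1 S2 n1 n2)
  thus ?thesis using np by simp
 next
  case (Split \<mu> l Q n1 n2)
  thus ?thesis using np by simp
 qed
qed

text \<open>A sibling is exhausted for the general goal at \<rho>, but its head may match the final
  values, and then its \<open>Eval\<close> node cannot be left to the right. The path enters the
  body: \<open>v\<close> takes the values that match the head, and in \<psi> the fresh variables
  that are not ground become hazards. This body is exhausted because it arises from the one at
  \<rho> by skipping. It becomes the front, behind which the remaining alternatives follow
  unchanged.\<close>

lemma step_sibling:
 assumes n: "expanded G n" and np: "rule_of G n ~= R_Parallel" and cf: "conf (RB P) n \<kappa> \<psi> v \<rho> [] (g # T2)" and T2: "T2 ~= []"
 shows "step_ok (RB P) n v"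
proof -
 obtain Y where SY: "S n = g # T2 @ Y" using cf by (auto simp: conf_def)
 have nG: "n < length G" and ok: "kappa_ok \<kappa>" "kb_ok n \<psi> v \<rho>" and
  R: "RB P (g $h \<psi> # T2 $s \<psi>) (g $h v # T2 $s v) (g $h \<rho> # T2 $s \<rho>)" using cf by (simp_all add: conf_def)
 have R2: "RB P (T2 $s \<psi>) (T2 $s v) (T2 $s \<rho>)"
  by (rule RB_closed[of "[g $h \<psi>]" _ "[g $h v]" _ "[g $h \<rho>]"]) (use R T2 in \<open>auto simp: subst_state_def\<close>)
 have "good P (g $h \<rho> # T2 $s \<rho>) (g $h \<psi> # T2 $s \<psi>)" using R by (simp add: RB_def)
 then obtain t\<rho> Q\<rho> cs c0 m \<alpha>0 \<delta>0 where gd: "g $h \<rho> # T2 $s \<rho> = map (%c. Labeled (Atom t\<rho> # Q\<rho>) c m) (cs @ [c0])"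
  "g $h \<psi> # T2 $s \<psi> = map (%c. Labeled (Atom (t\<rho> $ \<alpha>0 $ \<delta>0) # Q\<rho> $g \<alpha>0 $g \<delta>0) c m) (cs @ [c0])"
  "~ hazardous t\<rho>" "ALL c':set cs. sibling_exh P t\<rho> Q\<rho> m c'"
 proof -
  have "1 < length (g $h \<rho> # T2 $s \<rho>)" using T2 by simp
  from good_long[OF \<open>good P _ _\<close> this] show thesis by (elim exE conjE) (rule that)
 qed
 obtain c cs' where cs: "cs = c # cs'" using gd(1) T2 by (cases cs) (auto simp: subst_state_def)
 have g\<rho>: "g $h \<rho> = Labeled (Atom t\<rho> # Q\<rho>) c m" and
  g\<psi>: "g $h \<psi> = Labeled (Atom (t\<rho> $ \<alpha>0 $ \<delta>0) # Q\<rho> $g \<alpha>0 $g \<delta>0) c m" using gd(1,2) cs by simp_all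
 obtain t Q where e: "g = Labeled (Atom t # Q) c m"
 proof -
  obtain Q' where "g = Labeled Q' c m" "Q' $g \<rho> = Atom t\<rho> # Q\<rho>" using g\<rho> by (cases g) auto
  moreover from this obtain l Q where "Q' = l # Q" "subst_lit \<rho> l = Atom t\<rho>" by (cases Q') auto
  moreover from this obtain t where "l = Atom t" by (cases l) auto
  ultimately show thesis using that by blast
 qed
 have tr: "t\<rho> = t $ \<rho>" "Q\<rho> = Q $g \<rho>" using g\<rho> by (simp_all add: e)
 have tp: "t $ \<psi> = t $ \<rho> $ \<alpha>0 $ \<delta>0" using g\<psi> by (simp add: e tr)
 have sib: "sibling_exh P (t $ \<rho>) (Q $g \<rho>) m c" and hz\<rho>: "~ hazardous (t $ \<rho>)" using gd(3,4) cs tr by simp_all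
 have vv: "t $ v = t $ \<psi>" "Q $g v = Q $g \<psi>" using R by (simp_all add: RB_def e)
 have vf: "vars_trm (t $ \<psi>) <= finals" "vars_goal (Q $g \<psi>) <= finals" using R by (simp_all add: RB_def e)
 from n show ?thesis
 proof (cases rule: node_cases)
  case (Backtrack t' Q' c' m' S' n')
  thus ?thesis by (intro step_same[where R = "RB P" and X = "[]" and Y = Y and n' = n', OF n _ _ kb_ok_cong _ T2 ok front_Nil R2])
    (use SY edge_other[OF n] in simp_all)
 next
  case (Eval \<sigma> t' Q' c' m' S' n1 n2)
  have eqs: "t' = t" "Q' = Q" "c' = c" "m' = m" "S' = T2 @ Y" using Eval(2) SY e by simp_all
  note E = Eval[unfolded eqs(1-4)]
  show ?thesis
  proof (cases "EX \<beta>. t $ \<psi> = head c $ \<beta>")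
   case False
   have "kb_ok n2 \<psi> v \<rho>" by (rule eval_right[OF nG ok(2) E(2,8)]) (use False vf in blast)
   hence "conf (RB P) n2 \<kappa> \<psi> v \<rho> [] T2"
    by (intro confI[where Y = Y]) (use succ_at[OF n, of n2] E(5,8) eqs(5) T2 ok(1) front_Nil R2 in simp_all)
   thus ?thesis by (intro step_okI[of n2]) (use E(5) edge_ok_id[OF edge_eval(2)[OF E(1,5,6)]] in simp_all)
  next
   case True
   then obtain \<beta>f where bf: "t $ \<psi> = head c $ \<beta>f" by blast
   let ?b = "%y. \<beta>f y $ to_finals" and ?r = "restrict_subst \<sigma> (Gr n)"
   have tb: "t $ v = head c $ ?b" using to_finals_id[OF vf(1)] bf vv(1) by (metis subst_trm_subst)
   have "t $ \<rho> $ (%x. \<alpha>0 x $ \<delta>0) = head c $ \<beta>f" using tp bf by (simp add: subst_trm_subst)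
   hence ma: "matchable (t $ \<rho>) c" unfolding matchable_def by blast
   have fv: "finite (vars_trm (t $ \<rho>) Un vars_goal (Q $g \<rho>))" by (simp add: vars_trm_def del: set_var_list)
   obtain \<alpha> \<beta> where mgu: "two_mgu (vars_trm (t $ \<rho>) Un vars_goal (Q $g \<rho>)) (t $ \<rho>) c \<alpha> \<beta>"
    by (rule two_mgu_ex[OF ma hz\<rho> fv])
   have exr: "exh P [Goal (resolvent m c (Q $g \<rho>) \<alpha> \<beta>)]" using sib mgu unfolding sibling_exh_def by blast
   note vars = eval_vars[OF n E(2,4,7)]
   have ht: "vars_trm (head c) <= ordinary" using label_clause(2)[OF nG, of "Atom t # Q" c m] E(2) by simp
   have ta: "vars_trm t <= abstract" using vars(1) by blast
   have tr': "t $ (%x. \<rho> x $ \<alpha>) = head c $ \<beta>" using two_mguD(1)[OF mgu] by (simp add: subst_trm_subst)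
   obtain dv where dv: "!!x. x : abstract ==> \<sigma> x $ dv = v x" "!!y. y : ordinary ==> \<sigma> y $ dv = ?b y"
    using eval_factor[OF E(3) tb ta ht] by blast
   obtain dr where dr: "!!x. x : abstract ==> \<sigma> x $ dr = \<rho> x $ \<alpha>" "!!y. y : ordinary ==> \<sigma> y $ dr = \<beta> y"
    using eval_factor[OF E(3) tr' ta ht] by blast
   define dx where "dx = (%x. if x : Gr n1 then dv x else Var (hz x))"
   \<comment> \<open>The remaining alternatives see only ground fresh variables, so \<rho> may take
     the values of \<open>dv\<close> on them.\<close>
   let ?\<psi> = "upd n \<psi> dx" and ?v = "upd n v dv" and ?\<rho> = "upd n \<rho> dv"
   let ?ng = "(label_cuts m (body c) @ Q) $g \<sigma>"
   have gr: "ground (\<psi> z)" "v z = \<psi> z" "\<rho> z = \<psi> z" "z : abstract" "z : W n" if "z : Gr n" for z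
    using that ok(2) vars(4) by (auto simp: kb_ok_def)
   have g2: "\<sigma> z $ dv = v z" if "z : Gr n" for z using dv(1)[OF gr(4)[OF that]] .
   have g3: "\<sigma> z $ dv = \<rho> z" if "z : Gr n" for z using g2[OF that] gr[OF that] by simp
   have g1: "\<sigma> z $ dx = \<psi> z" if z: "z : Gr n" for z
   proof -
    have fr: "vars_trm (\<sigma> z) <= abstract - W n" by (rule E(4)) (use gr(5)[OF z] in blast)
    hence ne: "\<sigma> z ~= Var z" using gr(5)[OF z] by auto
    have "x : Gr n1" if "x : vars_trm (\<sigma> z)" for x
    proof -
     have "?r z = \<sigma> z" using z by (simp add: restrict_subst_def)
     hence "x : range_vars ?r" using that ne by (intro mem_range_vars[of x ?r z]) simp_all
     thus ?thesis using that fr by (auto simp: E(7))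
    qed
    hence "\<sigma> z $ dx = \<sigma> z $ dv" by (intro subst_trm_cong) (simp add: dx_def)
    thus ?thesis using g2[OF z] gr(2)[OF z] by simp
   qed
   have dvg: "ground (dv x)" "dr x = dv x" if xg: "x : Gr n1" for x
   proof -
    obtain z where z: "z : Gr n" "x : vars_trm (\<sigma> z)" by (rule eval_ground_vars[OF n E(2,4,7) xg])
    have "vars_trm (\<sigma> z $ dv) = {}" using g2[OF z(1)] gr[OF z(1)] by (simp add: ground_def)
    thus "ground (dv x)" using z(2) by (auto simp: ground_def vars_trm_subst)
    have "\<sigma> z $ dr = \<sigma> z $ dv" using dr(1)[OF gr(4)[OF z(1)]] g2[OF z(1)] gr[OF z(1)] by (simp add: ground_subst_id)
    thus "dr x = dv x" using z(2) by (rule subst_trm_eqD)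
   qed
   have ngf: "x : abstract - W n" if xn: "x : vars_goal ?ng" for x
   proof -
    have "vars_goal ?ng = (UN y:vars_goal (body c) Un vars_goal Q. vars_trm (\<sigma> y))" by (simp only: vars_goal_subst goal_var_list_simps goal_var_list_label_cuts set_append)
    then obtain y where y: "y : vars_goal (body c) Un vars_goal Q" "x : vars_trm (\<sigma> y)" using xn by blast
    hence "y : W n Un vars_clause c" using body_vars[of c] vars(2) by blast
    thus ?thesis using E(4) y(2) by blast
   qed
   have on: "?ng $g (upd n f d) = ?ng $g d" for f d unfolding subst_goal_eq_iff using ngf by (simp add: upd_def)
   have vng: "?ng $g dv = resolvent m c (Q $g v) Var ?b" using eval_new_goal[OF n E(2,4,7) dv, of v] unfolding on .
   have rng: "?ng $g dr = resolvent m c (Q $g \<rho>) \<alpha> \<beta>"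
    using eval_new_goal[OF n E(2,4,7) dr, of \<rho>] unfolding on by (simp add: resolvent_def subst_goal_subst del: subst_goal_simps)
   have vfin: "vars_trm (dv x) <= finals" if "x : vars_goal ?ng" for x
   proof -
    have "vars_goal (body c $g ?b) <= finals" unfolding vars_goal_subst using to_finals_vars by (intro UN_least)
    hence "vars_goal (?ng $g dv) <= finals" unfolding vng using vf(2) vv(2) by (simp add: resolvent_def)
    thus ?thesis using that by (auto simp only: vars_goal_subst[of dv])
   qed
   \<comment> \<open>The default \<open>AVar 1\<close> covers hazards whose variable has no final
     value; those of the new goal never need it.\<close>
   define \<kappa>' where "\<kappa>' = (%h. if h : hazards then (if vars_trm (dv (unhz h)) <= finals then dv (unhz h) else Var (AVar 1)) else Var h)"
   have "AVar 1 : finals" unfolding finals_def by (rule range_eqI[of _ _ 0]) simp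
   hence k: "kappa_ok \<kappa>'" by (auto simp: kappa_ok_def \<kappa>'_def)
   have kv: "dx x $ \<kappa>' = dv x" if "x : vars_goal ?ng" for x
   proof (cases "x : Gr n1")
    case True
    thus ?thesis using dvg(1) by (simp add: dx_def ground_subst_id)
   next
    case False
    thus ?thesis using vfin[OF that] by (simp add: dx_def \<kappa>'_def hz_hazard)
   qed
   have kng: "?ng $g dv = ?ng $g dx $g \<kappa>'" unfolding subst_goal_subst[where \<sigma> = dx] subst_goal_eq_iff using kv by simp
   \<comment> \<open>Replacing hazards by their values at the mgu exhibits the exhausted resolvent
     as the real goal for skipping.\<close>
   let ?a = "%h. if h : hazards then dr (unhz h) else Var h"
   have "dx x $ ?a = dr x" for x using dvg[of x] by (cases "x : Gr n1") (simp_all add: dx_def ground_subst_id hz_hazard)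
   hence real: "?ng $g dr = ?ng $g dx $g ?a" unfolding subst_goal_subst[where \<sigma> = dx] subst_goal_eq_iff by simp
   have "skip_goal {} (?ng $g dr) (?ng $g dx)" unfolding skip_goal_def
   proof (intro conjI exI[of _ ?a] exI[of _ "[]"])
    show "?ng $g dr = ?ng $g dx $g ?a @ []" using real by simp
   qed simp_all
   hence sk: "list_all2 (skip_sgoal (scopes [Goal (?ng $g dx)])) [Goal (?ng $g dr)] [Goal (?ng $g dx)]" by (simp del: subst_goal_simps)
   have "exh P ([] @ [Goal (?ng $g dr)])" using exr unfolding rng by simp
   hence ex: "exh P [Goal (?ng $g dx)]" by (rule exh_skip[OF _ _ sk]) simp
   have vh: "vars_goal (?ng $g dx) <= hazards Un locals" unfolding vars_goal_subst[of dx]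
   proof (rule UN_least)
    fix x show "vars_trm (dx x) <= hazards Un locals" using dvg(1)[of x] by (cases "x : Gr n1") (auto simp: dx_def ground_def hz_hazard)
   qed
   have fr: "front \<kappa>' ?\<psi> ?v [Goal ?ng]"
    by (rule frontI) (use ex vh kng in \<open>simp_all add: on del: subst_goal_simps\<close>)
   have kb: "kb_ok n1 ?\<psi> ?v ?\<rho>" by (rule eval_kb_ok[OF n E(2,4,7) ok(2)]) (use g1 g2 g3 in blast)+
   have sub: "vars_state T2 <= W n" using vars_state_W[OF n] by (auto simp: SY)
   have RB: "RB P (T2 $s ?r $s ?\<psi>) (T2 $s ?r $s ?v) (T2 $s ?r $s ?\<rho>)"
   proof -
    have "T2 $s ?r $s ?\<psi> = T2 $s \<psi>" by (rule eval_keep_state[OF n E(2,4,7) g1 sub])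
    moreover have "T2 $s ?r $s ?v = T2 $s v" by (rule eval_keep_state[OF n E(2,4,7) g2 sub])
    moreover have "T2 $s ?r $s ?\<rho> = T2 $s \<rho>" by (rule eval_keep_state[OF n E(2,4,7) g3 sub])
    ultimately show ?thesis using R2 by simp
   qed
   have "conf (RB P) n1 \<kappa>' ?\<psi> ?v ?\<rho> [Goal ?ng] (T2 $s ?r)"
   proof (rule confI[where R = "RB P", OF _ _ _ k kb fr RB])
    show "n1 < length G" using succ_at[OF n, of n1] E(5) by simp
    show "S n1 = [Goal ?ng] @ T2 $s ?r @ Y $s ?r" by (simp only: E(7) fst_conv append.simps eqs(5) subst_state_simps)
    show "T2 $s ?r ~= []" using T2 by (simp add: subst_state_def)
   qed
   moreover have "edge_ok n n1 v ?v"
    by (rule edge_ok_keep[OF E(1,5,6)]) (use eval_edge[OF n E(2,4,7) dv(1)] eval_keep[OF n E(2,4,7) g2] in blast)+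
   ultimately show ?thesis by (intro step_okI[of n1]) (use E(5) in simp_all)
  qed
 qed (use SY e np T2 in simp_all)
qed

end

text \<open>An answer of a conjunction consists of an answer of the first part and one of the
  instantiated rest. Exhausted siblings are transferred from \<open>A @ Q\<close> to
  \<open>A\<close> by regarding \<open>Q\<close> as a skipped tail.\<close>

lemma ans_prefix: "ans P R \<delta> ==> R = A @ Q ==> ans P A \<delta>"
 and ans_split: "ans P R \<delta> ==> R = A @ Q ==> EX \<delta>1 \<delta>2. ans P A \<delta>1 & ans P (Q $g \<delta>1) \<delta>2 & (ALL x:vars_goal Q. \<delta> x = \<delta>1 x $ \<delta>2)"
proof -
 have sib: "sibling_exh P t A m c" if s: "sibling_exh P t (A @ Q) m c" and hz: "~ hazardous t" for t m c and A Q :: "'a goal"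
  unfolding sibling_exh_def
 proof (intro allI impI, elim conjE)
  fix V \<alpha> \<beta> assume mg: "two_mgu V t c \<alpha> \<beta>" and V: "vars_trm t Un vars_goal A <= V"
  let ?V = "vars_trm t Un vars_goal (A @ Q)"
  have fv: "finite ?V" by (simp add: vars_trm_def del: set_var_list)
  obtain \<alpha>2 \<beta>2 where mg2: "two_mgu ?V t c \<alpha>2 \<beta>2" by (rule two_mgu_ex[OF two_mgu_matchable[OF mg] hz fv])
  have "exh P [Goal (resolvent m c (A @ Q) \<alpha>2 \<beta>2)]" using s mg2 unfolding sibling_exh_def by blast
  hence ex: "exh P ([] @ [Goal (resolvent m c A \<alpha>2 \<beta>2 @ Q $g \<alpha>2)])" by (simp add: resolvent_append)
  have "skip_goal {} (resolvent m c A \<alpha>2 \<beta>2 @ Q $g \<alpha>2) (resolvent m c A \<alpha>2 \<beta>2)" unfolding skip_goal_def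
  proof (intro conjI exI[of _ Var] exI[of _ "Q $g \<alpha>2"])
   show "resolvent m c A \<alpha>2 \<beta>2 @ Q $g \<alpha>2 = resolvent m c A \<alpha>2 \<beta>2 $g Var @ Q $g \<alpha>2" by simp
  qed simp_all
  hence "list_all2 (skip_sgoal (scopes [Goal (resolvent m c A \<alpha>2 \<beta>2)])) [Goal (resolvent m c A \<alpha>2 \<beta>2 @ Q $g \<alpha>2)] [Goal (resolvent m c A \<alpha>2 \<beta>2)]"
   by simp
  hence "exh P [Goal (resolvent m c A \<alpha>2 \<beta>2)]" by (rule exh_skip[OF ex, rotated]) simp
  moreover have "variant (Goal (resolvent m c A \<alpha>2 \<beta>2)) (Goal (resolvent m c A \<alpha> \<beta>))"
   by (rule variant_resolvent[OF mg2 mg, of Var Var]) (use V in auto)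
  ultimately show "exh P [Goal (resolvent m c A \<alpha> \<beta>)]" using exh_sim variants_sim by (metis list.rel_inject(2) list_all2_Nil)
 qed
 show "ans P R \<delta> ==> R = A @ Q ==> ans P A \<delta>"
 proof (induction arbitrary: A Q rule: ans.induct)
  case (ans_Nil \<delta>)
  thus ?case by (simp add: ans.ans_Nil)
 next
  case (ans_Cut R \<delta> m)
  show ?case
  proof (cases A)
   case Nil
   thus ?thesis by (simp add: ans.ans_Nil)
  next
   case (Cons l A')
   hence "l = Cut m" "R = A' @ Q" using ans_Cut.prems by auto
   thus ?thesis using ans_Cut.IH Cons by (simp add: ans.ans_Cut)
  qed
 next
  case (ans_Atom p ts cs1 c cs2 m R \<alpha> \<beta> \<delta>' \<delta>)
  show ?case
  proof (cases A)
   case Nil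
   thus ?thesis by (simp add: ans.ans_Nil)
  next
   case (Cons l A')
   hence l: "l = Atom (Fun p ts)" "R = A' @ Q" using ans_Atom.prems by auto
   have "ans P (resolvent m c A' \<alpha> \<beta>) \<delta>'" by (rule ans_Atom.IH) (simp add: l resolvent_append)
   moreover have "two_mgu (vars_trm (Fun p ts) Un vars_goal A') (Fun p ts) c \<alpha> \<beta>"
    by (rule two_mgu_subset[OF ans_Atom.hyps(5)]) (auto simp: l)
   moreover have "sibling_exh P (Fun p ts) A' m c'" if "c' : set cs1" for c'
    by (rule sib[OF ans_Atom.hyps(4)[OF that, unfolded l(2)] ans_Atom.hyps(3)])
   ultimately show ?thesis unfolding Cons l(1)
    by (intro ans.ans_Atom[OF ans_Atom.hyps(1) _ ans_Atom.hyps(3)]) (use ans_Atom.hyps(2,7) l(2) in auto)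
  qed
 qed
 show "ans P R \<delta> ==> R = A @ Q ==> EX \<delta>1 \<delta>2. ans P A \<delta>1 & ans P (Q $g \<delta>1) \<delta>2 & (ALL x:vars_goal Q. \<delta> x = \<delta>1 x $ \<delta>2)"
 proof (induction arbitrary: A Q rule: ans.induct)
  case (ans_Nil \<delta>)
  thus ?case by (simp add: ans.ans_Nil)
 next
  case (ans_Cut R \<delta> m)
  show ?case
  proof (cases A)
   case Nil
   have "ans P Q \<delta>" using ans.ans_Cut[OF ans_Cut.hyps, of m] ans_Cut.prems Nil by simp
   thus ?thesis unfolding Nil by (intro exI[of _ Var] exI[of _ \<delta>]) (simp add: ans.ans_Nil)
  next
   case (Cons l A')
   hence l: "l = Cut m" "R = A' @ Q" using ans_Cut.prems by auto
   obtain \<delta>1 \<delta>2 where d: "ans P A' \<delta>1" "ans P (Q $g \<delta>1) \<delta>2" "ALL x:vars_goal Q. \<delta> x = \<delta>1 x $ \<delta>2"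
    using ans_Cut.IH[OF l(2)] by blast
   have "ans P A \<delta>1" unfolding Cons l(1) by (rule ans.ans_Cut[OF d(1)])
   thus ?thesis using d(2,3) by blast
  qed
 next
  case (ans_Atom p ts cs1 c cs2 m R \<alpha> \<beta> \<delta>' \<delta>)
  show ?case
  proof (cases A)
   case Nil
   have "ans P (Atom (Fun p ts) # R) \<delta>" by (rule ans.ans_Atom[OF ans_Atom.hyps])
   hence "ans P Q \<delta>" using ans_Atom.prems Nil by simp
   thus ?thesis unfolding Nil by (intro exI[of _ Var] exI[of _ \<delta>]) (simp add: ans.ans_Nil)
  next
   case (Cons l A')
   hence l: "l = Atom (Fun p ts)" "R = A' @ Q" using ans_Atom.prems by auto
   have re: "resolvent m c R \<alpha> \<beta> = resolvent m c A' \<alpha> \<beta> @ Q $g \<alpha>" by (simp add: l resolvent_append)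
   obtain \<delta>1 \<delta>2 where d: "ans P (resolvent m c A' \<alpha> \<beta>) \<delta>1" "ans P (Q $g \<alpha> $g \<delta>1) \<delta>2"
     "ALL x:vars_goal (Q $g \<alpha>). \<delta>' x = \<delta>1 x $ \<delta>2" using ans_Atom.IH[OF re] by blast
   let ?\<delta>1 = "%x. \<alpha> x $ \<delta>1"
   have mg: "two_mgu (vars_trm (Fun p ts) Un vars_goal A') (Fun p ts) c \<alpha> \<beta>"
    by (rule two_mgu_subset[OF ans_Atom.hyps(5)]) (auto simp: l)
   have sb: "sibling_exh P (Fun p ts) A' m c'" if "c' : set cs1" for c'
    by (rule sib[OF ans_Atom.hyps(4)[OF that, unfolded l(2)] ans_Atom.hyps(3)])
   have "m ~: marks_goal A'" using ans_Atom.hyps(2) l(2) by simp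
   hence "ans P A ?\<delta>1" unfolding Cons l(1) by (rule ans.ans_Atom[OF ans_Atom.hyps(1) _ ans_Atom.hyps(3) sb mg d(1) refl])
   moreover have "ans P (Q $g ?\<delta>1) \<delta>2" using d(2) by (simp add: subst_goal_subst)
   moreover have "\<delta> x = ?\<delta>1 x $ \<delta>2" if x: "x : vars_goal Q" for x
   proof -
    have "\<delta> x = \<alpha> x $ \<delta>'" by (rule ans_Atom.hyps(7)) (use x l(2) in simp)
    also have "\<dots> = \<alpha> x $ (%x. \<delta>1 x $ \<delta>2)" using d(3) x by (intro subst_trm_cong) (auto simp: vars_goal_subst)
    finally show ?thesis by (simp only: subst_trm_subst)
   qed
   ultimately show ?thesis by blast
  qed
 qed
qed

text \<open>Enumerations of finals and of locals, used as targets of renamings.\<close>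

definition KF :: "nat => var" where "KF i = AVar (3 * i + 1)"
definition KL :: "nat => var" where "KL i = AVar (3 * i + 2)"

lemma ans_not_hazardous: "ans P (Atom t # Q) \<delta> ==> ~ hazardous t" by (erule ans.cases) auto

section \<open>\<open>Instance\<close> and \<open>Split\<close> nodes\<close>

context bounded_graph
begin

text \<open>Ordinary variables in the pairs may be renamed by the \<open>Instance\<close>
  substitution. The inverse renaming \<open>r\<close> makes \<psi> the identity on them again; it is
  harmless for non-unifiability and does not affect the front and the interesting part, whose values
  contain no ordinary variables.\<close>

lemma instance_conf:
 assumes n: "n < length G" and ru: "rule_of G n = R_Instance \<mu>" and cf: "conf R n \<kappa> \<psi> v \<rho> X T"
  and R: "!!A B C. R A B C ==> vars_state A Int ordinary = {}"
  and n': "n' < length G" "instance_of \<mu> (astate_of G n) (astate_of G n')"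
 shows "EX \<psi>' \<rho>' X' T'. conf R n' \<kappa> \<psi>' (%z. \<mu> z $ v) \<rho>' X' T'"
proof -
 have i: "S n = S n' $s \<mu>" "!!x. x : ordinary ==> EX y:ordinary. \<mu> x = Var y" "inj_on \<mu> ordinary" "Gr n' <= abstract"
  "!!x. x : Gr n' ==> vars_trm (\<mu> x) <= Gr n" "subst_pairs \<mu> (U n') <= U n"
  using n'(2) by (cases "astate_of G n"; cases "astate_of G n'"; auto)+
 obtain Y where SY: "S n = X @ T @ Y" and T: "T ~= []" and ok: "kappa_ok \<kappa>" "kb_ok n \<psi> v \<rho>" and fr: "front \<kappa> \<psi> v X"
  and RT: "R (T $s \<psi>) (T $s v) (T $s \<rho>)" using cf by (auto simp: conf_def)
 have "map (subst_sgoal \<mu>) (S n') = X @ T @ Y" using i(1) SY by (simp add: subst_state_def)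
 then obtain X' V where V: "S n' = X' @ V" "X = map (subst_sgoal \<mu>) X'" "T @ Y = map (subst_sgoal \<mu>) V"
  by (auto simp: map_eq_append_conv)
 obtain T' Y' where V2: "V = T' @ Y'" "T = map (subst_sgoal \<mu>) T'" using V(3)[symmetric] by (auto simp: map_eq_append_conv)
 have S': "S n' = X' @ T' @ Y'" "X = X' $s \<mu>" "T = T' $s \<mu>" using V V2 by (simp_all add: subst_state_def)
 define r :: "'f subst" where "r y = (if EX x:ordinary. \<mu> x = Var y then Var (SOME x. x : ordinary & \<mu> x = Var y) else Var y)" for y
 have r1: "r y = Var x" if "x : ordinary" "\<mu> x = Var y" for x y
 proof -
  have "(SOME x. x : ordinary & \<mu> x = Var y) = x"
  proof (rule some_equality)
   show "x : ordinary & \<mu> x = Var y" using that by simp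
   fix x' assume "x' : ordinary & \<mu> x' = Var y"
   thus "x' = x" using inj_onD[OF i(3), of x' x] that by simp
  qed
  moreover have "EX x:ordinary. \<mu> x = Var y" using that by blast
  ultimately show ?thesis by (simp add: r_def)
 qed
 have r2: "r y = Var y" if "y ~: ordinary" for y
 proof -
  have "~ (EX x:ordinary. \<mu> x = Var y)" using that i(2) by fastforce
  thus ?thesis by (simp add: r_def)
 qed
 have r3: "EX x:ordinary. r y = Var x" if "y : ordinary" for y
 proof (cases "EX x:ordinary. \<mu> x = Var y")
  case True
  thus ?thesis using r1 by blast
 next
  case False
  thus ?thesis using that by (auto simp: r_def)
 qed
 have rh: "harmless r" unfolding harmless_def using r2 r3 codes_disjoint(4,5) by blast
 let ?\<psi> = "%z. \<mu> z $ \<psi> $ r" and ?v = "%z. \<mu> z $ v" and ?\<rho> = "%z. \<mu> z $ \<rho>"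
 have st: "Z $s \<sigma> $s \<tau> = Z $s (%x. \<sigma> x $ \<tau>)" for \<sigma> \<tau> :: "'f subst" and Z
  by (simp add: subst_state_def subst_sgoal_subst)
 have rid: "Z $s ?\<psi> = Z $s \<mu> $s \<psi>" if "vars_state (Z $s \<mu> $s \<psi>) Int ordinary = {}" for Z
 proof -
  have "Z $s ?\<psi> = Z $s \<mu> $s \<psi> $s r" by (simp add: st subst_trm_subst)
  also have "\<dots> = Z $s \<mu> $s \<psi>" using that r2 by (intro subst_state_ident) blast
  finally show ?thesis .
 qed
 have pX: "X' $s ?\<psi> = X $s \<psi>" using rid[of X'] fr codes_disjoint(4,6) unfolding front_def S'(2) by blast
 have pT: "T' $s ?\<psi> = T $s \<psi>" using rid[of T'] R[OF RT] unfolding S'(3) by blast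
 have gnd: "\<mu> x $ \<psi> = \<mu> x $ v" "\<mu> x $ \<rho> = \<mu> x $ \<psi>" "ground (\<mu> x $ \<psi>)" if "x : Gr n'" for x
 proof -
  have k: "!!y. y : vars_trm (\<mu> x) ==> ground (\<psi> y) & v y = \<psi> y & \<rho> y = \<psi> y" using i(5)[OF that] ok(2) unfolding kb_ok_def by blast
  thus "\<mu> x $ \<psi> = \<mu> x $ v" "\<mu> x $ \<rho> = \<mu> x $ \<psi>" by (auto intro!: subst_trm_cong)
  show "ground (\<mu> x $ \<psi>)" using k by (auto simp: ground_def vars_trm_subst)
 qed
 have pord: "ALL x:ordinary. \<psi> x = Var x" using ok(2) by (simp add: kb_ok_def)
 have "kb_ok n' ?\<psi> ?v ?\<rho>" unfolding kb_ok_def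
 proof (intro conjI ballI)
  show "apart K N ?\<psi> (U n')"
  proof (rule apart_subst[OF _ rh])
   show "apart K N \<psi> (U n)" using ok(2) by (simp add: kb_ok_def)
   fix s s' assume "(s, s') : U n'"
   hence "(s $ \<mu>, s' $ \<mu>) : U n" using i(6) by (force simp: subst_pairs_def)
   thus "EX q q'. (q, q') : U n & s $ ?\<psi> = q $ \<psi> $ r & s' $ ?\<psi> = q' $ \<psi> $ r"
    by (intro exI[of _ "s $ \<mu>"] exI[of _ "s' $ \<mu>"]) (simp add: subst_trm_subst)
  qed
  show "?\<psi> x = Var x" if "x : ordinary" for x
  proof -
   obtain y where y: "y : ordinary" "\<mu> x = Var y" using i(2)[OF \<open>x : ordinary\<close>] by blast
   thus ?thesis using pord r1[OF \<open>x : ordinary\<close> y(2)] by simp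
  qed
  fix x assume "x : Gr n'"
  thus "ground (?\<psi> x)" "?v x = ?\<psi> x" "?\<rho> x = ?\<psi> x" using gnd[of x] by (simp_all add: ground_subst_id)
 qed
 moreover have "front \<kappa> ?\<psi> ?v X'" unfolding front_def pX using fr by (simp add: front_def S'(2) st)
 moreover have "R (T' $s ?\<psi>) (T' $s ?v) (T' $s ?\<rho>)" unfolding pT using RT by (simp add: S'(3) st)
 moreover have "T' ~= []" using T S'(3) by auto
 ultimately have "conf R n' \<kappa> ?\<psi> ?v ?\<rho> X' T'" using confI[OF n'(1) S'(1) _ ok(1)] by blast
 thus ?thesis by blast
qed

text \<open>The valuation behind a \<open>Split\<close> edge: \<mu> renames a variable
  \<open>z\<close> whose value may change by an answer to a fresh one, which takes the new value
  \<open>g z\<close>; all others keep \<open>f\<close>. Injectivity of \<mu> makes the choice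
  unique.\<close>

definition spl :: "nat => 'f subst => 'f subst => 'f subst => 'f subst" where
 "spl n \<mu> f g y = (if y : abstract - W n & (EX z:W n. \<mu> z = Var y) then g (SOME z. z : W n & \<mu> z = Var y) else f y)"

context
 fixes n \<mu> l Q n1 n2
 assumes n: "expanded G n" and ru: "rule_of G n = R_Split \<mu>" and Sn: "S n = [Goal (l # Q)]"
  and mu: "!!x. x : Gr n ==> \<mu> x = Var x" "!!x. x : W n - Gr n ==> EX y:abstract - W n. \<mu> x = Var y" "inj_on \<mu> (W n)"
  and ss: "succs G n = [n1, n2]" "n1 ~= n2" "astate_of G n1 = ([Goal [l]], snd (astate_of G n))"
   "astate_of G n2 = ([Goal (Q $g \<mu>)], Gr n Un approx_gnd gnd (Gr n) l \<mu>, subst_pairs \<mu> (U n))"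
begin

lemma split_W: "Gr n <= W n" "kb_vars (U n) <= W n" "set (lit_var_list l) <= W n" "vars_goal Q <= W n" "n < length G"
proof -
 have W: "vars_astate (astate_of G n) <= W n" using structured_expanded(4)[OF st n] .
 show "Gr n <= W n" "kb_vars (U n) <= W n" using W by (cases "astate_of G n"; auto simp: kb_vars_def)+
 show "set (lit_var_list l) <= W n" "vars_goal Q <= W n" using vars_state_W[OF n] by (simp_all add: Sn)
 show "n < length G" using n by (simp add: expanded_def)
qed

lemma spl_fresh:
 assumes "z : W n" "\<mu> z = Var y" "y : abstract - W n"
 shows "spl n \<mu> f g y = g z"
proof -
 have "(SOME z. z : W n & \<mu> z = Var y) = z"
 proof (rule some_equality)
  show "z : W n & \<mu> z = Var y" using assms by simp
  fix z' assume "z' : W n & \<mu> z' = Var y"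
  thus "z' = z" using inj_onD[OF mu(3), of z' z] assms by simp
 qed
 moreover have "EX z:W n. \<mu> z = Var y" using assms by blast
 ultimately show ?thesis using assms(3) by (simp add: spl_def)
qed

lemma spl_mu:
 assumes "z : W n" "!!z. z : Gr n ==> f z = g z"
 shows "\<mu> z $ spl n \<mu> f g = g z"
proof (cases "z : Gr n")
 case True
 thus ?thesis using mu(1) assms by (simp add: spl_def)
next
 case False
 then obtain y where "y : abstract - W n" "\<mu> z = Var y" using mu(2) assms(1) by blast
 thus ?thesis using spl_fresh[OF assms(1)] by simp
qed

lemma spl_goal:
 assumes "!!z. z : Gr n ==> f z = g z"
 shows "Q $g \<mu> $g (spl n \<mu> f g) = Q $g g" unfolding subst_goal_subst subst_goal_eq_iff
proof
 fix x assume "x : vars_goal Q"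
 hence "x : W n" by (rule subsetD[OF split_W(4)])
 thus "\<mu> x $ spl n \<mu> f g = g x" using assms by (rule spl_mu)
qed

lemma split_edges: "edge_substs G n n1 = {Var}" "edge_substs G n n2 = {\<mu>}" using ss(1,2) by (simp_all add: edge_substs_def ru)

text \<open>The variables added to the ground ones come from argument positions that the groundness
  analysis promises to be ground after an answer. The last premise is the place where this promise
  enters.\<close>

lemma split_kb:
 assumes ok: "kb_ok n \<psi> v \<rho>" and th: "harmless \<theta>"
  and gr: "!!z. z : Gr n ==> gv z = \<psi> z & g\<rho> z = \<psi> z"
  and ap: "!!p ts j z. l = Atom (Fun p ts) ==> j : gnd p (length ts) {i. i < length ts & vars_trm (ts ! i) <= Gr n} ==> j < length ts ==>
   z : vars_trm (ts ! j) ==> ground (\<psi> z $ \<theta>) & gv z = \<psi> z $ \<theta> & g\<rho> z = \<psi> z $ \<theta>"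
 shows "kb_ok n2 (spl n \<mu> \<psi> (%z. \<psi> z $ \<theta>)) (spl n \<mu> v gv) (spl n \<mu> \<rho> g\<rho>)" unfolding kb_ok_def
proof (intro conjI ballI)
 have k: "\<psi> z = \<psi> z $ \<theta>" "v z = gv z" "\<rho> z = g\<rho> z" "ground (\<psi> z)" if "z : Gr n" for z
  using ok gr[OF that] that by (auto simp: kb_ok_def ground_subst_id)
 let ?\<psi> = "spl n \<mu> \<psi> (%z. \<psi> z $ \<theta>)"
 show "apart K N ?\<psi> (U n2)"
 proof (rule apart_subst[OF _ th])
  show "apart K N \<psi> (U n)" using ok by (simp add: kb_ok_def)
  fix s s' assume "(s, s') : U n2"
  then obtain q q' where q: "(q, q') : U n" "s = q $ \<mu>" "s' = q' $ \<mu>" by (auto simp: ss(4) subst_pairs_def)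
  have "vars_trm q <= W n" "vars_trm q' <= W n" using q(1) split_W(2) by (auto simp: kb_vars_def)
  hence "s $ ?\<psi> = q $ \<psi> $ \<theta>" "s' $ ?\<psi> = q' $ \<psi> $ \<theta>"
   unfolding q(2,3) subst_trm_subst using spl_mu[OF _ k(1)] by (auto intro!: subst_trm_cong simp: subset_iff)
  thus "EX q q'. (q, q') : U n & s $ ?\<psi> = q $ \<psi> $ \<theta> & s' $ ?\<psi> = q' $ \<psi> $ \<theta>" using q(1) by blast
 qed
 show "?\<psi> x = Var x" if "x : ordinary" for x using that ok by (simp add: spl_def kb_ok_def not_abstract)
 fix x assume "x : Gr n2"
 then consider "x : Gr n" | "x : approx_gnd gnd (Gr n) l \<mu>" by (auto simp: ss(4))
 hence "(x : W n & x : Gr n) \<or> (EX z:W n. \<mu> z = Var x & x : abstract - W n & ground (\<psi> z $ \<theta>) & gv z = \<psi> z $ \<theta> & g\<rho> z = \<psi> z $ \<theta>)"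
 proof cases
  case 1
  thus ?thesis using split_W(1) by blast
 next
  case 2
  obtain p ts where l: "l = Atom (Fun p ts)" using 2 by (cases "(gnd, Gr n, l, \<mu>)" rule: approx_gnd.cases) auto
  obtain j where j: "j : gnd p (length ts) {i. i < length ts & vars_trm (ts ! i) <= Gr n}" "j < length ts" "x : vars_trm (ts ! j $ \<mu>)"
   using 2 unfolding l by auto
  then obtain z where z: "z : vars_trm (ts ! j)" "x : vars_trm (\<mu> z)" by (auto simp: vars_trm_subst)
  have zW: "z : W n" using split_W(3) z(1) j(2) nth_mem by (fastforce simp: l)
  show ?thesis
  proof (cases "z : Gr n")
   case True
   thus ?thesis using mu(1)[OF True] z(2) zW by simp
  next
   case False
   then obtain y where "y : abstract - W n" "\<mu> z = Var y" using mu(2) zW by blast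
   thus ?thesis using z(2) ap[OF l j(1,2) z(1)] zW by auto
  qed
 qed
 thus "ground (?\<psi> x)" "spl n \<mu> v gv x = ?\<psi> x" "spl n \<mu> \<rho> g\<rho> x = ?\<psi> x"
 proof (atomize (full), elim disjE bexE conjE)
  assume "x : W n" "x : Gr n"
  thus "ground (?\<psi> x) & spl n \<mu> v gv x = ?\<psi> x & spl n \<mu> \<rho> g\<rho> x = ?\<psi> x" using ok by (simp add: spl_def kb_ok_def)
 next
  fix z assume "z : W n" "\<mu> z = Var x" "x : abstract - W n" "ground (\<psi> z $ \<theta>)" "gv z = \<psi> z $ \<theta>" "g\<rho> z = \<psi> z $ \<theta>"
  thus "ground (?\<psi> x) & spl n \<mu> v gv x = ?\<psi> x & spl n \<mu> \<rho> g\<rho> x = ?\<psi> x" by (simp add: spl_fresh)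
 qed
qed

lemma split_edge_ok:
 assumes "\<delta> : D" "!!z. z : Gr n ==> v z = gv z" "!!z. z : W n ==> gv z = v z $ \<delta>"
 shows "edge_ok n n2 v (spl n \<mu> v gv)" unfolding edge_ok_def split_edges(2)
proof (intro ballI bexI[OF _ assms(1)], elim singletonE)
 fix z \<sigma> assume z: "z : W n Int abstract" and s: "\<sigma> = \<mu>"
 have "\<mu> z $ spl n \<mu> v gv = gv z" by (rule spl_mu) (use z assms(2) in auto)
 thus "\<sigma> z $ spl n \<mu> v gv = v z $ \<delta>" using assms(3) z s by simp
qed

lemma split_left_atom: "n1 : set (succs G n)" "n1 = succs G n ! 0" "start n1" "vars_trm (atom n1) <= set (lit_var_list l)" "n1 < length G"
proof -
 show "n1 : set (succs G n)" and h: "n1 = succs G n ! 0" using ss(1) by simp_all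
 have "n : split_nodes G" using ru split_W(5) by (auto simp: split_nodes_def)
 thus s: "start n1" using split_left(1) h by simp
 show "n1 < length G" using start_node[OF s] by blast
 show "vars_trm (atom n1) <= set (lit_var_list l)" using atom(2)[OF start_node[OF s]] by (simp add: ss(3))
qed

lemma atom_D:
 assumes "set (lit_var_list (subst_lit v l)) <= finals" "\<delta> : D"
 shows "atom n1 $ emb_subst v $ emb_subst \<delta> = atom n1 $ emb_subst v" unfolding emb_subst_subst
proof (rule emb_subst_cong)
 fix x assume "x : vars_trm (atom n1)"
 hence "vars_trm (v x) <= finals" using assms(1) split_left_atom(4) by (auto simp: lit_vars_subst)
 thus "v x $ \<delta> = v x" using assms(2) by (intro subst_trm_ident) (auto simp: D_def)
qed

text \<open>The left child is entered with the whole answer \<delta>, since its atom is wanted at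
  final values. The right child continues at \<delta>1, the answer of \<open>l\<close> alone, and
  \<delta>2 answers the rest.\<close>

lemma split_B:
 assumes cf: "conf (RB P) n \<kappa> \<psi> v \<rho> X T"
  and left: "!!\<rho>' T'. conf (RB P) n1 \<kappa> \<psi> v \<rho>' [] T' ==> edge_ok n n1 v v ==> EX \<delta>:D. tree PG (atom n1 $ emb_subst v $ emb_subst \<delta>)"
 shows "EX \<psi>' v' \<rho>' T'. conf (RB P) n2 \<kappa> \<psi>' v' \<rho>' [] T' & edge_ok n n2 v v' & tree PG (atom n1 $ emb_subst (%x. \<mu> x $ v'))"
proof -
 obtain Y where SY: "S n = X @ T @ Y" and T: "T ~= []" and ok: "kappa_ok \<kappa>" "kb_ok n \<psi> v \<rho>"
  and RT: "RB P (T $s \<psi>) (T $s v) (T $s \<rho>)" using cf by (auto simp: conf_def)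
 have T1: "T = [Goal (l # Q)]" using SY Sn T by (cases X; cases T) auto
 have v: "subst_lit v l = subst_lit \<psi> l" "Q $g v = Q $g \<psi>" using RT by (simp_all add: RB_def T1)
 have vf: "set (lit_var_list (subst_lit \<psi> l)) <= finals" "vars_goal (Q $g \<psi>) <= finals" using RT by (simp_all add: RB_def T1)
 have "good P [Goal (subst_lit \<rho> l # Q $g \<rho>)] [Goal (subst_lit \<psi> l # Q $g \<psi>)]" using RT by (simp add: RB_def T1)
 then obtain \<delta> where d: "ans P (subst_lit \<rho> l # Q $g \<rho>) \<delta>" "subst_lit \<psi> l = subst_lit \<delta> (subst_lit \<rho> l)"
   "Q $g \<psi> = Q $g \<rho> $g \<delta>" by (auto simp: good_def map_eq_Cons_conv)
 have pre: "ans P [subst_lit \<rho> l] \<delta>" by (rule ans_prefix[OF d(1), of "[subst_lit \<rho> l]" "Q $g \<rho>"]) simp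
 obtain \<delta>1 \<delta>2 where d12: "ans P [subst_lit \<rho> l] \<delta>1" "ans P (Q $g \<rho> $g \<delta>1) \<delta>2"
   "ALL x:vars_goal (Q $g \<rho>). \<delta> x = \<delta>1 x $ \<delta>2"
  using ans_split[OF d(1), of "[subst_lit \<rho> l]" "Q $g \<rho>"] by auto
 have pl: "\<psi> z = \<rho> z $ \<delta>" "v z = \<psi> z" if "z : set (lit_var_list l)" for z
  using d(2) v(1) that by (auto simp: subst_lit_subst subst_lit_eq_iff)
 have pQ: "\<psi> z = \<rho> z $ \<delta>1 $ \<delta>2" if z: "z : vars_goal Q" for z
 proof -
  have "\<psi> z = \<rho> z $ \<delta>" using d(3) z by (auto simp: subst_goal_subst subst_goal_eq_iff)
  also have "\<dots> = \<rho> z $ (%x. \<delta>1 x $ \<delta>2)" using d12(3) z by (intro subst_trm_cong) (auto simp: vars_goal_subst)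
  finally show ?thesis by (simp only: subst_trm_subst)
 qed
 have gg: "ground (\<psi> z)" "v z = \<psi> z" "\<rho> z = \<psi> z" if "z : Gr n" for z using that ok(2) by (simp_all add: kb_ok_def)
 have "conf (RB P) n1 \<kappa> \<psi> v \<rho> [] [Goal [l]]"
 proof (rule confI[where R = "RB P" and Y = "[]", OF split_left_atom(5) _ _ ok(1) _ front_Nil])
  show "kb_ok n1 \<psi> v \<rho>" using ok(2) kb_ok_cong[of n1 n] by (simp add: ss(3))
  have "good P [Goal [subst_lit \<rho> l]] [Goal [subst_lit \<psi> l]]" unfolding good_def using pre d(2) by auto
  thus "RB P ([Goal [l]] $s \<psi>) ([Goal [l]] $s v) ([Goal [l]] $s \<rho>)" using v vf by (simp add: RB_def)
 qed (simp_all add: ss(3))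
 then obtain \<delta>L where "\<delta>L : D" "tree PG (atom n1 $ emb_subst v $ emb_subst \<delta>L)" using left edge_ok_id[OF split_edges(1)] by blast
 hence tr: "tree PG (atom n1 $ emb_subst v)" using atom_D[of v \<delta>L] vf(1) v(1) by simp
 \<comment> \<open>Variables outside \<open>Q\<close> take their value at \<psi>, so that those
   which become ground agree with it.\<close>
 define g\<rho> where "g\<rho> = (%z. if z : vars_goal Q then \<rho> z $ \<delta>1 else \<psi> z)"
 let ?\<psi> = "spl n \<mu> \<psi> \<psi>" and ?v = "spl n \<mu> v v" and ?\<rho> = "spl n \<mu> \<rho> g\<rho>"
 have gr\<rho>: "\<rho> z = g\<rho> z" if "z : Gr n" for z using gg[OF that] by (simp add: g\<rho>_def ground_subst_id)
 have "kb_ok n2 ?\<psi> ?v ?\<rho>"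
 proof (rule split_kb[OF ok(2) harmless_Var, unfolded subst_trm_Var])
  show "v z = \<psi> z & g\<rho> z = \<psi> z" if "z : Gr n" for z using gg[OF that] gr\<rho>[OF that] by simp
  fix p ts j z assume l: "l = Atom (Fun p ts)" and j: "j : gnd p (length ts) {i. i < length ts & vars_trm (ts ! i) <= Gr n}" "j < length ts"
   and z: "z : vars_trm (ts ! j)"
  let ?ts = "map (subst_trm \<rho>) ts" and ?I = "{i. i < length ts & vars_trm (ts ! i) <= Gr n}"
  have a: "ans P [Atom (Fun p ?ts)] \<delta>" "ans P [Atom (Fun p ?ts)] \<delta>1" using pre d12(1) by (simp_all add: l)
  have nh: "~ hazardous (Fun p ?ts)" by (rule ans_not_hazardous[OF a(1)])
  have I: "ALL i:?I. i < length ?ts & ground (?ts ! i)" using gg by (auto simp: ground_def vars_trm_subst)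
  have j': "j : gnd p (length ?ts) ?I" "j < length ?ts" using j by simp_all
  have "ground (?ts ! j $ \<delta>)" "ground (?ts ! j $ \<delta>1)" using answer_ground[OF ga a(1) nh I j'] answer_ground[OF ga a(2) nh I j'] by blast+
  hence g: "ground (\<rho> z $ \<delta>)" "ground (\<rho> z $ \<delta>1)" using z j(2) by (auto simp: ground_def vars_trm_subst)
  have zl: "z : set (lit_var_list l)" using z j(2) nth_mem by (fastforce simp: l)
  have "g\<rho> z = \<psi> z" using pQ g(2) by (simp add: g\<rho>_def ground_subst_id)
  thus "ground (\<psi> z) & v z = \<psi> z & g\<rho> z = \<psi> z" using pl[OF zl] g(1) by simp
 qed
 moreover have "RB P ([Goal (Q $g \<mu>)] $s ?\<psi>) ([Goal (Q $g \<mu>)] $s ?v) ([Goal (Q $g \<mu>)] $s ?\<rho>)"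
 proof -
  have e: "Q $g \<mu> $g ?\<psi> = Q $g \<psi>" "Q $g \<mu> $g ?v = Q $g v"
   "Q $g \<mu> $g ?\<rho> = Q $g g\<rho>" using spl_goal[of \<psi> \<psi>] spl_goal[of v v] spl_goal[of \<rho> g\<rho>] gr\<rho> by simp_all
  have r: "Q $g g\<rho> = Q $g \<rho> $g \<delta>1" unfolding subst_goal_subst subst_goal_eq_iff by (simp add: g\<rho>_def)
  have "Q $g \<psi> = Q $g \<rho> $g \<delta>1 $g \<delta>2"
   unfolding subst_goal_subst subst_goal_eq_iff using pQ by (simp add: subst_trm_subst)
  hence "good P [Goal (Q $g g\<rho>)] [Goal (Q $g \<psi>)]" unfolding good_def r using d12(2) by blast
  thus ?thesis using v vf by (simp add: RB_def e)
 qed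
 moreover have n2: "n2 < length G" using succ_at[OF n, of n2] ss(1) by simp
 ultimately have "conf (RB P) n2 \<kappa> ?\<psi> ?v ?\<rho> [] [Goal (Q $g \<mu>)]"
  by (intro confI[where Y = "[]"]) (use ok(1) front_Nil in \<open>simp_all add: ss(4)\<close>)
 moreover have "edge_ok n n2 v ?v" by (rule split_edge_ok[OF D_Var]) simp_all
 moreover have "atom n1 $ emb_subst (%x. \<mu> x $ ?v) = atom n1 $ emb_subst v"
  using spl_mu[of _ v v] split_left_atom(4) split_W(3) by (intro emb_subst_cong) auto
 ultimately show ?thesis using tr by metis
qed

text \<open>If \<open>l\<close> alone is finite, the computation of the rest is infinite after some
  answer of \<open>l\<close>. This answer is used twice: renamed to finals it shows that the left
  atom is derivable, renamed to locals it provides the values for the right child.\<close>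

lemma split_A:
 assumes cf: "conf (RA P) n \<kappa> \<psi> v \<rho> X T"
  and left: "!!\<psi>' v' \<rho>' T'. conf (RB P) n1 \<kappa> \<psi>' v' \<rho>' [] T' ==> edge_ok n n1 v v' ==> EX \<delta>:D. tree PG (atom n1 $ emb_subst v' $ emb_subst \<delta>)"
 shows "(EX \<psi>' v' \<rho>' T'. conf (RA P) n1 \<kappa> \<psi>' v' \<rho>' [] T' & edge_ok n n1 v v') \<or>
  (EX \<psi>' v' \<rho>' T'. conf (RA P) n2 \<kappa> \<psi>' v' \<rho>' [] T' & edge_ok n n2 v v' & tree PG (atom n1 $ emb_subst (%x. \<mu> x $ v')))"
proof -
 obtain Y where SY: "S n = X @ T @ Y" and T: "T ~= []" and ok: "kappa_ok \<kappa>" "kb_ok n \<psi> v \<rho>"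
  and RT: "RA P (T $s \<psi>) (T $s v) (T $s \<rho>)" using cf by (auto simp: conf_def)
 have T1: "T = [Goal (l # Q)]" using SY Sn T by (cases X; cases T) auto
 have v: "subst_lit v l = subst_lit \<psi> l" "Q $g v = Q $g \<psi>" using RT by (auto simp: RA_def T1)
 have vl: "set (lit_var_list (subst_lit \<psi> l)) <= locals" "vars_goal (Q $g \<psi>) <= locals" using RT by (auto simp: RA_def T1)
 have nf: "~ fin P [Goal ([subst_lit \<psi> l] @ Q $g \<psi>)]" using RT by (auto simp: RA_def T1)
 have kb1: "kb_ok n1 = kb_ok n" by (rule kb_ok_cong) (simp add: ss(3))
 have gg: "ground (\<psi> z)" "v z = \<psi> z" "\<rho> z = \<psi> z" if "z : Gr n" for z using that ok(2) by (simp_all add: kb_ok_def)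
 have vz: "v z = \<psi> z" if "z : set (lit_var_list l) Un vars_goal Q" for z
  using v that by (auto simp: subst_lit_eq_iff subst_goal_eq_iff)
 have lz: "vars_trm (\<psi> z) <= locals" if "z : set (lit_var_list l) Un vars_goal Q" for z
  using vl that by (auto simp: lit_vars_subst vars_goal_subst)
 show ?thesis
 proof (cases "fin P [Goal [subst_lit \<psi> l]]")
  case False
  have "RA P ([Goal [l]] $s \<psi>) ([Goal [l]] $s v) ([Goal [l]] $s \<rho>)" using False v vl by (simp add: RA_def)
  hence "conf (RA P) n1 \<kappa> \<psi> v \<rho> [] [Goal [l]]"
   by (intro confI[where Y = "[]"]) (use split_left_atom(5) ok front_Nil in \<open>simp_all add: ss(3) kb1\<close>)
  thus ?thesis using edge_ok_id[OF split_edges(1)] by blast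
 next
  case True
  obtain \<delta> where d: "admissible \<delta>" "ans P [subst_lit \<psi> l] \<delta>" "~ fin P [Goal (Q $g \<psi> $g \<delta>)]"
   using not_fin_append[OF True nf] by blast
  have KF: "inj KF" "range KF Int hazards = {}" and KL: "inj KL" "range KL Int hazards = {}"
   unfolding KF_def KL_def hazards_def by (auto intro!: injI) presburger+
  have dl: "vars_trm (\<delta> x) Int hazards = {}" if "x : locals" for x using d(1) that codes_disjoint(2) unfolding admissible_def by blast
  define tF where "tF = (%x. if x : locals then \<delta> x $ ren KF else Var x)"
  define tL where "tL = (%x. if x : locals then \<delta> x $ ren KL else Var x)"
  \<comment> \<open>Shifts the final \<open>AVar (3 * i + 1)\<close> to the local
    \<open>AVar (3 * i + 2)\<close>, which transports derivability of the left atom from the first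
    renaming to the second.\<close>
  define sw :: "'f subst" where "sw x = (case x of AVar k => if x : finals then Var (AVar (k + 1)) else Var x | _ => Var x)" for x
  have harm: "harmless tF" "harmless tL" unfolding harmless_def tF_def tL_def using codes_disjoint by auto
  have DF: "tF : D" "tL : D" unfolding D_def tF_def tL_def using codes_disjoint(3) by auto
  have swr: "ren KF x $ sw = (ren KL x :: 'f trm)" for x
   using codes_disjoint(1) by (cases x) (auto simp: ren_def sw_def KF_def KL_def finals_def hazards_def)
  have tFL: "tF x $ sw = tL x" if "x : locals" for x using that swr by (simp add: tF_def tL_def subst_trm_subst)
  have vF: "vars_trm (tF x) <= finals" "vars_trm (tL x) <= locals" if "x : locals" for x
  proof -
   have "vars_trm (ren KF y :: 'f trm) <= finals" "vars_trm (ren KL y :: 'f trm) <= locals" if "y : vars_trm (\<delta> x)" for y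
    using that dl[OF \<open>x : locals\<close>] by (auto simp: ren_def KF_def KL_def finals_def locals_def)
   thus "vars_trm (tF x) <= finals" "vars_trm (tL x) <= locals" using that unfolding tF_def tL_def by (simp_all add: vars_trm_subst) blast+
  qed
  have lF: "subst_lit tF (subst_lit \<psi> l) = subst_lit (%x. \<delta> x $ ren KF) (subst_lit \<psi> l)"
   unfolding subst_lit_eq_iff using vl(1) by (auto simp: tF_def)
  have QL: "Q $g \<psi> $g tL = Q $g \<psi> $g \<delta> $g (ren KL)"
   unfolding subst_goal_subst[where Q = "Q $g \<psi>"] subst_goal_eq_iff using vl(2) by (auto simp: tL_def)
  let ?\<psi>F = "%z. \<psi> z $ tF" and ?vF = "%z. v z $ tF"
  have pF: "subst_lit ?\<psi>F l = subst_lit tF (subst_lit \<psi> l)" "subst_lit ?vF l = subst_lit tF (subst_lit \<psi> l)"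
   using v(1) by (simp_all add: subst_lit_subst[symmetric])
  have fF: "set (lit_var_list (subst_lit tF (subst_lit \<psi> l))) <= finals"
   unfolding lit_vars_subst[where l = "subst_lit \<psi> l"] using vF(1) vl(1) by blast
  have "kb_ok n1 ?\<psi>F ?vF \<psi>" unfolding kb1 kb_ok_def
  proof (intro conjI ballI)
   show "apart K N ?\<psi>F (U n)"
   proof (rule apart_subst[OF _ harm(1)])
    show "apart K N \<psi> (U n)" using ok(2) by (simp add: kb_ok_def)
    fix s s' assume "(s, s') : U n"
    thus "EX q q'. (q, q') : U n & s $ ?\<psi>F = q $ \<psi> $ tF & s' $ ?\<psi>F = q' $ \<psi> $ tF"
     by (intro exI[of _ s] exI[of _ s']) (simp add: subst_trm_subst)
   qed
   show "?\<psi>F x = Var x" if "x : ordinary" for x using that ok(2) codes_disjoint(6) by (auto simp: kb_ok_def tF_def)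
   show "ground (?\<psi>F x)" "?vF x = ?\<psi>F x" "\<psi> x = ?\<psi>F x" if "x : Gr n" for x using gg[OF that] by (simp_all add: ground_subst_id)
  qed
  moreover have "RB P ([Goal [l]] $s ?\<psi>F) ([Goal [l]] $s ?vF) ([Goal [l]] $s \<psi>)"
  proof -
   have "good P [Goal [subst_lit \<psi> l]] [Goal [subst_lit tF (subst_lit \<psi> l)]]"
    unfolding good_def lF using ans_inst[OF d(2), of "ren KF"] by auto
   thus ?thesis using fF by (simp add: RB_def pF)
  qed
  ultimately have "conf (RB P) n1 \<kappa> ?\<psi>F ?vF \<psi> [] [Goal [l]]"
   by (intro confI[where Y = "[]"]) (use split_left_atom(5) ok(1) front_Nil in \<open>simp_all add: ss(3)\<close>)
  moreover have "edge_ok n n1 v ?vF" unfolding edge_ok_def split_edges(1) using DF(1) by auto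
  ultimately obtain \<delta>L where "\<delta>L : D" "tree PG (atom n1 $ emb_subst ?vF $ emb_subst \<delta>L)" using left by blast
  hence "tree PG (atom n1 $ emb_subst ?vF)" using atom_D[of ?vF \<delta>L] fF pF(2) by simp
  hence trs: "tree PG (atom n1 $ emb_subst ?vF $ emb_subst sw)" by (rule tree_inst)
  let ?gp = "%z. \<psi> z $ tL" and ?gv = "%z. v z $ tL"
  let ?\<psi> = "spl n \<mu> \<psi> ?gp" and ?v = "spl n \<mu> v ?gv" and ?\<rho> = "spl n \<mu> \<rho> ?gp"
  have gr: "\<psi> z = ?gp z" "v z = ?gv z" "\<rho> z = ?gp z" if "z : Gr n" for z using gg[OF that] by (simp_all add: ground_subst_id)
  have "kb_ok n2 ?\<psi> ?v ?\<rho>"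
  proof (rule split_kb[OF ok(2) harm(2)])
   show "?gv z = \<psi> z & ?gp z = \<psi> z" if "z : Gr n" for z using gr[OF that] gg[OF that] by simp
   fix p ts j z assume l: "l = Atom (Fun p ts)" and j: "j : gnd p (length ts) {i. i < length ts & vars_trm (ts ! i) <= Gr n}" "j < length ts"
    and z: "z : vars_trm (ts ! j)"
   let ?ts = "map (subst_trm \<psi>) ts" and ?I = "{i. i < length ts & vars_trm (ts ! i) <= Gr n}"
   have a: "ans P [Atom (Fun p ?ts)] \<delta>" using d(2) by (simp add: l)
   have nh: "~ hazardous (Fun p ?ts)" by (rule ans_not_hazardous[OF a])
   have I: "ALL i:?I. i < length ?ts & ground (?ts ! i)" using gg by (auto simp: ground_def vars_trm_subst)
   have j': "j : gnd p (length ?ts) ?I" "j < length ?ts" using j by simp_all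
   have "ground (?ts ! j $ \<delta>)" by (rule answer_ground[OF ga a nh I j'])
   hence g: "ground (\<psi> z $ \<delta>)" using z j(2) by (auto simp: ground_def vars_trm_subst)
   have zl: "z : set (lit_var_list l)" using z j(2) nth_mem by (fastforce simp: l)
   have "\<psi> z $ tL = \<psi> z $ \<delta> $ ren KL" unfolding subst_trm_subst[where t = "\<psi> z"] using lz[of z] zl by (intro subst_trm_cong) (auto simp: tL_def)
   thus "ground (\<psi> z $ tL) & ?gv z = \<psi> z $ tL & ?gp z = \<psi> z $ tL" using g vz[of z] zl by (simp add: ground_subst_id)
  qed
  moreover have "RA P ([Goal (Q $g \<mu>)] $s ?\<psi>) ([Goal (Q $g \<mu>)] $s ?v) ([Goal (Q $g \<mu>)] $s ?\<rho>)"
  proof -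
   have e: "Q $g \<mu> $g ?\<psi> = Q $g ?gp" "Q $g \<mu> $g ?v = Q $g ?gv" using spl_goal[OF gr(1)] spl_goal[OF gr(2)] by simp_all
   have e2: "Q $g ?gp = Q $g \<psi> $g tL" "Q $g ?gv = Q $g \<psi> $g tL" using v(2) by (simp_all add: subst_goal_subst[symmetric])
   have "vars_goal (Q $g \<psi> $g tL) <= locals" unfolding vars_goal_subst[where Q = "Q $g \<psi>"] using vF(2) vl(2) by blast
   moreover have "~ fin P [Goal (Q $g \<psi> $g tL)]"
   proof
    let ?g = "Goal (Q $g \<psi> $g \<delta>)"
    assume "fin P [Goal (Q $g \<psi> $g tL)]"
    hence "fin P [?g $h (ren KL)]" unfolding QL by simp
    moreover have "sim [?g] [?g $h (ren KL)]" by (rule variants_sim) (simp add: variant_ren[OF KL] del: subst_sgoal.simps)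
    ultimately show False using d(3) fin_sim sim_sym by blast
   qed
   ultimately show ?thesis by (simp add: RA_def e e2)
  qed
  moreover have n2: "n2 < length G" using succ_at[OF n, of n2] ss(1) by simp
  ultimately have "conf (RA P) n2 \<kappa> ?\<psi> ?v ?\<rho> [] [Goal (Q $g \<mu>)]"
   by (intro confI[where Y = "[]"]) (use ok(1) front_Nil in \<open>simp_all add: ss(4)\<close>)
  moreover have "edge_ok n n2 v ?v" by (rule split_edge_ok[OF DF(2) gr(2)]) simp_all
  moreover have "atom n1 $ emb_subst (%x. \<mu> x $ ?v) = atom n1 $ emb_subst ?vF $ emb_subst sw" unfolding emb_subst_subst
  proof (rule emb_subst_cong)
   fix x assume "x : vars_trm (atom n1)"
   hence x: "x : set (lit_var_list l)" "x : W n" using split_left_atom(4) split_W(3) by auto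
   have "\<mu> x $ ?v = \<psi> x $ tL" using spl_mu[OF x(2) gr(2)] vz[of x] x(1) by simp
   also have "\<dots> = \<psi> x $ (%x. tF x $ sw)" using lz[of x] x(1) tFL by (intro subst_trm_cong) auto
   also have "\<dots> = v x $ tF $ sw" using vz[of x] x(1) by (simp add: subst_trm_subst)
   finally show "\<mu> x $ ?v = v x $ tF $ sw" .
  qed
  ultimately show ?thesis using trs by metis
 qed
qed

end

end

section \<open>The main induction\<close>

context bounded_graph
begin

text \<open>Successors of expanded nodes have larger indices, so the way to the next call is bounded
  by the size of the graph; only \<open>Instance\<close> edges can lead back. What happens at calls,
  at solved goals and at \<open>Split\<close> nodes differs for the two kinds of computations and is
  left as a premise.\<close>

lemma segment:
 assumes "run \<pi>" "covers D \<pi> vs v" "conf R (last \<pi>) \<kappa> \<psi> v \<rho> X T" "length \<pi> = 1 ==> last \<pi> ~: instance_nodes G"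
  and call: "!!\<pi> v \<kappa> \<psi> \<rho> X T. run \<pi> ==> hd \<pi> = s ==> covers D \<pi> vs v ==> 1 < length \<pi> ==>
   last \<pi> : instance_nodes G Un first_succs G ==> last \<pi> ~: suc_nodes G ==> conf R (last \<pi>) \<kappa> \<psi> v \<rho> X T ==> C"
  and stop: "!!\<pi> v \<kappa> \<psi> \<rho> T. run \<pi> ==> hd \<pi> = s ==> covers D \<pi> vs v ==> 1 < length \<pi> ==>
   last \<pi> : suc_nodes G ==> conf R (last \<pi>) \<kappa> \<psi> v \<rho> [] T ==> C"
  and split: "!!\<pi> v \<kappa> \<psi> \<rho> X T. run \<pi> ==> hd \<pi> = s ==> covers D \<pi> vs v ==> conf R (last \<pi>) \<kappa> \<psi> v \<rho> X T ==>
   last \<pi> : split_nodes G ==> last \<pi> ~: instance_nodes G ==> length \<pi> = 1 \<or> last \<pi> ~: first_succs G ==>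
   C \<or> (EX n' \<kappa> \<psi> v' \<rho> X T. n' : set (succs G (last \<pi>)) & covers D (\<pi> @ [n']) vs v' & conf R n' \<kappa> \<psi> v' \<rho> X T)"
  and step: "!!n \<kappa> \<psi> v \<rho> X T. conf R n \<kappa> \<psi> v \<rho> X T ==> expanded G n ==> n ~: split_nodes G ==>
   ~ (X = [] & n : suc_nodes G) ==> step_ok R n v"
  and s: "hd \<pi> = s"
 shows C using assms(1-4) s
proof (induction "length G - last \<pi>" arbitrary: \<pi> v \<kappa> \<psi> \<rho> X T rule: less_induct)
 case less
 let ?n = "last \<pi>"
 have nG: "?n < length G" and ne: "S ?n ~= []" using less.prems(3) by (auto simp: conf_def)
 have len: "length \<pi> = 1 \<or> 1 < length \<pi>" using less.prems(1) by (cases \<pi>) (auto simp: run_def)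
 show C
 proof (cases "1 < length \<pi> & ?n : instance_nodes G Un first_succs G")
  case True
  moreover have "?n ~: suc_nodes G"
  proof (cases "?n : first_succs G")
   case True
   thus ?thesis using start_node(2)[of ?n] by (simp add: start_def)
  next
   case False
   hence "?n : instance_nodes G" using True by blast
   thus ?thesis by (auto simp: instance_nodes_def suc_nodes_def)
  qed
  ultimately show ?thesis using call[OF less.prems(1,5,2) _ _ _ less.prems(3)] by blast
 next
  case False
  hence ni: "?n ~: instance_nodes G" and nf: "length \<pi> = 1 \<or> ?n ~: first_succs G" using less.prems(4) len by auto
  have ex: "expanded G ?n" using nG ni leaves[OF nG] ne by (auto simp: expanded_def)
  have go: C if e: "n' : set (succs G ?n)" "covers D (\<pi> @ [n']) vs v'" "conf R n' \<kappa>' \<psi>' v' \<rho>' X' T'" for n' v' \<kappa>' \<psi>' \<rho>' X' T'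
  proof (rule less.hyps[of "\<pi> @ [n']"])
   have n': "?n < n'" "n' < length G" using succ_at[OF ex e(1)] by simp_all
   thus "length G - last (\<pi> @ [n']) < length G - ?n" by simp
   show "run (\<pi> @ [n'])" by (rule run_snoc[OF less.prems(1) ni nf e(1) n'(2)])
   show "covers D (\<pi> @ [n']) vs v'" by (rule e(2))
   show "conf R (last (\<pi> @ [n'])) \<kappa>' \<psi>' v' \<rho>' X' T'" using e(3) by simp
   show "last (\<pi> @ [n']) ~: instance_nodes G" if "length (\<pi> @ [n']) = 1" using that less.prems(1) by (simp add: run_def)
   show "hd (\<pi> @ [n']) = s" using less.prems(1,5) by (simp add: run_def)
  qed
  show ?thesis
  proof (cases "?n : split_nodes G")
   case True
   show ?thesis using split[OF less.prems(1,5,2,3) True ni nf] go by blast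
  next
   case nsp: False
   show ?thesis
   proof (cases "X = [] & ?n : suc_nodes G")
    case True
    have "start (hd \<pi>)" using less.prems(1) by (simp add: run_def)
    hence "length \<pi> ~= 1" using True start_node(2)[of "hd \<pi>"] by (cases \<pi>) auto
    thus ?thesis using stop[OF less.prems(1,5,2)] len True less.prems(3) by blast
   next
    case False
    obtain n' \<kappa>' \<psi>' v' \<rho>' X' T' where n': "n' : set (succs G ?n)" "conf R n' \<kappa>' \<psi>' v' \<rho>' X' T'" "edge_ok ?n n' v v'"
     using step[OF less.prems(3) ex nsp False] unfolding step_ok_def by blast
    have n2: "n' < length G" using succ_at[OF ex n'(1)] by simp
    have "covers D (\<pi> @ [n']) vs v'"
    proof (rule covers_snoc[OF less.prems(1) run_snoc[OF less.prems(1) ni nf n'(1) n2] less.prems(2) D_comp])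
     show "EX \<delta>:D. ALL z:W ?n Int abstract. \<sigma> z $ v' = v z $ \<delta>" if "\<sigma> : edge_substs G ?n n'" for \<sigma>
      using n'(3) that unfolding edge_ok_def by blast
    qed (use nsp in simp_all)
    thus ?thesis using go[OF n'(1) _ n'(2)] by blast
   qed
  qed
 qed
qed

lemma RA_step:
 assumes cf: "conf (RA P) n \<kappa> \<psi> v \<rho> X T" and n: "expanded G n" "n ~: split_nodes G"
 shows "step_ok (RA P) n v"
proof -
 have ns: "rule_of G n ~= R_Split \<mu>" for \<mu> using n by (auto simp: split_nodes_def expanded_def)
 show ?thesis
 proof (cases "rule_of G n = R_Parallel")
  case True
  show ?thesis by (rule parallel_step[OF n(1) True cf]) (rule RA_closed)
 next
  case False
  show ?thesis
  proof (cases X)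
   case Nil
   show ?thesis by (rule step_A[OF n(1) False ns]) (use cf Nil in simp)
  next
   case (Cons e X1)
   show ?thesis by (rule front_step[OF n(1) False]) (use cf Cons in simp)
  qed
 qed
qed

lemma RB_step:
 assumes cf: "conf (RB P) n \<kappa> \<psi> v \<rho> X T" and n: "expanded G n" "n ~: split_nodes G" and nsuc: "~ (X = [] & n : suc_nodes G)"
 shows "step_ok (RB P) n v"
proof -
 have ns: "rule_of G n ~= R_Split \<mu>" for \<mu> using n by (auto simp: split_nodes_def expanded_def)
 show ?thesis
 proof (cases "rule_of G n = R_Parallel")
  case True
  show ?thesis by (rule parallel_step[OF n(1) True cf]) (rule RB_closed)
 next
  case False
  show ?thesis
  proof (cases X)
   case Nil
   have T: "T ~= []" using cf by (simp add: conf_def)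
   then obtain g T2 where T2: "T = g # T2" by (cases T) auto
   have sn: "rule_of G n ~= R_Suc" using nsuc Nil n(1) by (auto simp: suc_nodes_def expanded_def)
   show ?thesis
   proof (cases "T2 = []")
    case True
    show ?thesis by (rule step_B[OF n(1) False ns sn]) (use cf Nil T2 True in simp)
   next
    case f: False
    show ?thesis by (rule step_sibling[OF n(1) False _ f]) (use cf Nil T2 in simp)
   qed
  next
   case (Cons e X1)
   show ?thesis by (rule front_step[OF n(1) False]) (use cf Cons in simp)
  qed
 qed
qed

lemma split_covers:
 assumes "run \<pi>" "last \<pi> ~: instance_nodes G" "length \<pi> = 1 \<or> last \<pi> ~: first_succs G" "n' : set (succs G (last \<pi>))" "n' < length G"
  and "covers D \<pi> vs v" "edge_ok (last \<pi>) n' v v'"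
  and "!!\<sigma>. n' = succs G (last \<pi>) ! 1 ==> \<sigma> : edge_substs G (last \<pi>) n' ==> tree PG (atom (succs G (last \<pi>) ! 0) $ emb_subst (%x. \<sigma> x $ v'))"
 shows "run (\<pi> @ [n'])" "covers D (\<pi> @ [n']) vs v'"
proof -
 show r: "run (\<pi> @ [n'])" by (rule run_snoc[OF assms(1-5)])
 show "covers D (\<pi> @ [n']) vs v'"
  by (rule covers_snoc[OF assms(1) r assms(6) D_comp]) (use assms(7,8) in \<open>unfold edge_ok_def, blast+\<close>)
qed

text \<open>The factor \<delta> accounts for the bindings of locals made while passing through
  fronts.\<close>

definition claim_B :: "'f gsym trm => bool" where
 "claim_B A \<longleftrightarrow> (ALL n \<kappa> \<psi> v \<rho> X T. (start n \<or> n : instance_nodes G) & conf (RB P) n \<kappa> \<psi> v \<rho> X T & A = atom n $ emb_subst v -->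
   (EX \<delta>:D. tree PG (A $ emb_subst \<delta>)))"

definition claim_A :: "'f gsym trm => bool" where
 "claim_A A \<longleftrightarrow> (ALL n \<kappa> \<psi> v \<rho> X T. (start n \<or> n : instance_nodes G) & conf (RA P) n \<kappa> \<psi> v \<rho> X T & A = atom n $ emb_subst v --> False)"

text \<open>Chains of \<open>Instance\<close> edges do not change the atom, so they are followed in an inner induction.\<close>

lemma through_instances:
 assumes conf: "conf R n \<kappa> \<psi> v \<rho> X T" and n: "start n \<or> n : instance_nodes G"
  and R: "!!A B C. R A B C ==> vars_state A Int ordinary = {}"
  and base: "!!n \<psi> v \<rho> X T. start n ==> n ~: instance_nodes G ==> conf R n \<kappa> \<psi> v \<rho> X T ==> atom n $ emb_subst v = A ==> C"
  and A: "atom n $ emb_subst v = A"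
 shows C using conf n A
proof (induction n arbitrary: \<psi> v \<rho> X T rule: wf_induct_rule[OF wf_instances])
 case (1 n)
 show ?case
 proof (cases "n : instance_nodes G")
  case True
  then obtain \<mu> where mu: "n < length G" "rule_of G n = R_Instance \<mu>" by (auto simp: instance_nodes_def)
  obtain n' where n': "n' < length G" "succs G n = [n']" "instance_of \<mu> (astate_of G n) (astate_of G n')"
   by (rule instance_node[OF mu])
  have ex: "EX \<psi>' \<rho>' X' T'. conf R n' \<kappa> \<psi>' (%z. \<mu> z $ v) \<rho>' X' T'"
   by (rule instance_conf[OF mu 1(2) _ n'(1,3)]) (rule R)
  obtain \<psi>' \<rho>' X' T' where cf: "conf R n' \<kappa> \<psi>' (%z. \<mu> z $ v) \<rho>' X' T'" using ex by blast
  have s: "start n'" using True n'(2) unfolding start_def first_succs_def by (force intro: image_eqI[of _ _ n])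
  have an: "atom n = atom n' $ emb_subst \<mu>" by (rule atom_instance[OF mu n'(2,1) start_node(2)[OF s]])
  have a: "atom n' $ emb_subst (%z. \<mu> z $ v) = A" using 1(4)[unfolded an emb_subst_subst] .
  show ?thesis by (rule 1(1)[OF _ cf _ a]) (use True n'(2) s in simp_all)
 next
  case False
  hence "start n" using 1(3) by blast
  thus ?thesis by (rule base[OF _ False 1(2,4)])
 qed
qed

lemma RA_no_ordinary: "RA P A B C ==> vars_state A Int ordinary = {}" using codes_disjoint(6) by (auto simp: RA_def)

lemma RB_no_ordinary: "RB P A B C ==> vars_state A Int ordinary = {}" using codes_disjoint(5) by (auto simp: RB_def)

lemma split_node:
 assumes "n : split_nodes G"
 obtains \<mu> l Q n1 n2 where "expanded G n" "rule_of G n = R_Split \<mu>" "S n = [Goal (l # Q)]"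
   "!!x. x : Gr n ==> \<mu> x = Var x" "!!x. x : W n - Gr n ==> EX y:abstract - W n. \<mu> x = Var y" "inj_on \<mu> (W n)"
   "succs G n = [n1, n2]" "n1 ~= n2" "astate_of G n1 = ([Goal [l]], snd (astate_of G n))"
   "astate_of G n2 = ([Goal (Q $g \<mu>)], Gr n Un approx_gnd gnd (Gr n) l \<mu>, subst_pairs \<mu> (U n))"
proof -
 obtain \<nu> where n: "n < length G" "rule_of G n = R_Split \<nu>" using assms by (auto simp: split_nodes_def)
 hence ex: "expanded G n" by (auto simp: expanded_def instance_nodes_def)
 from ex show thesis
 proof (cases rule: node_cases)
  case (Split \<mu> l Q n1 n2)
  show ?thesis by (rule that[OF ex Split])
 qed (use n(2) in simp_all)
qed

text \<open>A left child of a \<open>Split\<close> node is called by the path leading to it, so the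
  induction hypothesis derives its atom before the right child is entered. At the end of the path
  the last atom is derived likewise, or is absent at a \<open>Suc\<close> node; then the head is
  derivable too.\<close>

lemma main_B:
 assumes IH: "!!B. calls PG A B ==> claim_B B"
 shows "claim_B A" unfolding claim_B_def
proof (intro allI impI, elim conjE)
 fix n \<kappa> \<psi> v \<rho> X T assume n: "start n \<or> n : instance_nodes G" and cf: "conf (RB P) n \<kappa> \<psi> v \<rho> X T" and A: "A = atom n $ emb_subst v"
 have callee: "EX \<delta>:D. tree PG (atom (last \<pi>) $ emb_subst v $ emb_subst \<delta>)"
  if "run \<pi>" "covers D \<pi> vs v" "1 < length \<pi>" "last \<pi> : instance_nodes G Un first_succs G" "last \<pi> ~: suc_nodes G"
   "conf (RB P) (last \<pi>) \<kappa> \<psi> v \<rho> X T" "atom (hd \<pi>) $ emb_subst vs = A" for \<pi> vs v \<kappa> \<psi> \<rho> X T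
 proof -
  have "calls PG A (atom (last \<pi>) $ emb_subst v)" using covers_calls[OF that(1,3,4,5,2)] that(7) by simp
  hence "claim_B (atom (last \<pi>) $ emb_subst v)" by (rule IH)
  thus ?thesis using that(4,6) unfolding claim_B_def start_def by blast
 qed
 show "EX \<delta>:D. tree PG (A $ emb_subst \<delta>)"
 proof (rule through_instances[OF cf n RB_no_ordinary _ A[symmetric]])
  fix n \<psi> v \<rho> X T assume s: "start n" "n ~: instance_nodes G" and cf: "conf (RB P) n \<kappa> \<psi> v \<rho> X T" and a: "atom n $ emb_subst v = A"
  show "EX \<delta>:D. tree PG (A $ emb_subst \<delta>)"
  proof (rule segment[where R = "RB P" and \<pi> = "[n]" and s = n and vs = v])
   show "run [n]" by (rule run_single[OF s(1)])
   show "covers D [n] v v" by (rule covers_single[OF D_Var])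
   show "conf (RB P) (last [n]) \<kappa> \<psi> v \<rho> X T" using cf by simp
   show "step_ok (RB P) n v" if "conf (RB P) n \<kappa> \<psi> v \<rho> X T" "expanded G n" "n ~: split_nodes G" "~ (X = [] & n : suc_nodes G)"
    for n \<kappa> \<psi> v \<rho> X T by (rule RB_step[OF that])
   show "hd [n] = n" by simp
   show "last [n] ~: instance_nodes G" using s(2) by simp
  next
   fix \<pi> w \<kappa> \<psi> \<rho> X T
   assume p: "run \<pi>" "hd \<pi> = n" "covers D \<pi> v w" "1 < length \<pi>" "last \<pi> : instance_nodes G Un first_succs G" "last \<pi> ~: suc_nodes G"
    "conf (RB P) (last \<pi>) \<kappa> \<psi> w \<rho> X T"
   obtain \<delta> where d: "\<delta> : D" "tree PG (atom (last \<pi>) $ emb_subst w $ emb_subst \<delta>)" using callee[OF p(1,3,4,5,6,7)] a p(2) by blast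
   have "EX \<delta>:D. tree PG (atom (hd \<pi>) $ emb_subst v $ emb_subst \<delta>)"
    by (rule covers_tree[OF p(1,4) _ p(3) D_comp d(1)]) (use p(5) d(2) in auto)
   thus "EX \<delta>:D. tree PG (A $ emb_subst \<delta>)" using a p(2) by simp
  next
   fix \<pi> w \<kappa> \<psi> \<rho> T
   assume p: "run \<pi>" "hd \<pi> = n" "covers D \<pi> v w" "1 < length \<pi>" "last \<pi> : suc_nodes G" "conf (RB P) (last \<pi>) \<kappa> \<psi> w \<rho> [] T"
   have "EX \<delta>:D. tree PG (atom (hd \<pi>) $ emb_subst v $ emb_subst \<delta>)"
    by (rule covers_tree[OF p(1,4) _ p(3) D_comp D_Var]) (use p(5) in auto)
   thus "EX \<delta>:D. tree PG (A $ emb_subst \<delta>)" using a p(2) by simp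
  next
   fix \<pi> w \<kappa> \<psi> \<rho> X T
   assume p: "run \<pi>" "hd \<pi> = n" "covers D \<pi> v w" "conf (RB P) (last \<pi>) \<kappa> \<psi> w \<rho> X T" "last \<pi> : split_nodes G"
    "last \<pi> ~: instance_nodes G" "length \<pi> = 1 \<or> last \<pi> ~: first_succs G"
   let ?k = "last \<pi>"
   obtain \<mu> l Q n1 n2 where sp: "expanded G ?k" "rule_of G ?k = R_Split \<mu>" "S ?k = [Goal (l # Q)]"
    "!!x. x : Gr ?k ==> \<mu> x = Var x" "!!x. x : W ?k - Gr ?k ==> EX y:abstract - W ?k. \<mu> x = Var y" "inj_on \<mu> (W ?k)"
    "succs G ?k = [n1, n2]" "n1 ~= n2" "astate_of G n1 = ([Goal [l]], snd (astate_of G ?k))"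
    "astate_of G n2 = ([Goal (Q $g \<mu>)], Gr ?k Un approx_gnd gnd (Gr ?k) l \<mu>, subst_pairs \<mu> (U ?k))"
    by (rule split_node[OF p(5)]) (rule that | assumption)+
   have nn: "n1 : set (succs G ?k)" "n2 : set (succs G ?k)" using sp(7) by simp_all
   have lt: "n1 < length G" "n2 < length G" using succ_at[OF sp(1)] nn by blast+
   have n01: "succs G ?k ! 0 = n1" "succs G ?k ! 1 = n2" using sp(7) by simp_all
   have s1: "start n1" by (rule split_left_atom(3)[OF sp])
   have left: "EX \<delta>:D. tree PG (atom n1 $ emb_subst w $ emb_subst \<delta>)"
    if c: "conf (RB P) n1 \<kappa> \<psi> w \<rho>' [] T'" "edge_ok ?k n1 w w" for \<rho>' T'
   proof -
    have r: "run (\<pi> @ [n1])" "covers D (\<pi> @ [n1]) v w"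
     by (rule split_covers[OF p(1,6,7) nn(1) lt(1) p(3) c(2)], use n01 sp(8) in simp)+
    have f: "n1 : first_succs G" using p(5) n01(1) unfolding first_succs_def by (force intro: image_eqI[of _ _ ?k])
    have ne: "\<pi> ~= []" using p(1) by (simp add: run_def)
    have "EX \<delta>:D. tree PG (atom (last (\<pi> @ [n1])) $ emb_subst w $ emb_subst \<delta>)"
     by (rule callee[OF r]) (use ne f c(1) start_node(2)[OF s1] p(2) a in simp_all)
    thus ?thesis by simp
   qed
   have ex: "EX \<psi>' v' \<rho>' T'. conf (RB P) n2 \<kappa> \<psi>' v' \<rho>' [] T' & edge_ok ?k n2 w v' & tree PG (atom n1 $ emb_subst (%x. \<mu> x $ v'))"
    by (rule split_B[OF sp p(4)]) (assumption | rule left)+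
   obtain \<psi>' v' \<rho>' T' where q: "conf (RB P) n2 \<kappa> \<psi>' v' \<rho>' [] T'" "edge_ok ?k n2 w v'" "tree PG (atom n1 $ emb_subst (%x. \<mu> x $ v'))"
    using ex by blast
   have "covers D (\<pi> @ [n2]) v v'"
    by (rule split_covers(2)[OF p(1,6,7) nn(2) lt(2) p(3) q(2)]) (use n01 q(3) split_edges(2)[OF sp] in simp)
   thus "(EX \<delta>:D. tree PG (A $ emb_subst \<delta>)) \<or> (EX n' \<kappa> \<psi> v' \<rho> X T. n' : set (succs G ?k) & covers D (\<pi> @ [n']) v v' & conf (RB P) n' \<kappa> \<psi> v' \<rho> X T)"
    using q(1) nn(2) by blast
  qed
 qed
qed

text \<open>An infinite computation leads to a call that is infinite again, which the induction
  hypothesis excludes. It cannot end at a \<open>Suc\<close> node with empty front, because the goal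
  in question would be solved and hence finite. Derivability of left atoms comes from the other
  claim.\<close>

lemma main_A:
 assumes IHB: "!!B. calls PG A B ==> claim_B B" and IHA: "!!B. calls PG A B ==> claim_A B"
 shows "claim_A A" unfolding claim_A_def
proof (intro allI impI, elim conjE)
 fix n \<kappa> \<psi> v \<rho> X T assume n: "start n \<or> n : instance_nodes G" and cf: "conf (RA P) n \<kappa> \<psi> v \<rho> X T" and A: "A = atom n $ emb_subst v"
 show False
 proof (rule through_instances[OF cf n RA_no_ordinary _ A[symmetric]])
  fix n \<psi> v \<rho> X T assume s: "start n" "n ~: instance_nodes G" and cf: "conf (RA P) n \<kappa> \<psi> v \<rho> X T" and a: "atom n $ emb_subst v = A"
  show False
  proof (rule segment[where R = "RA P" and \<pi> = "[n]" and s = n and vs = v])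
   show "run [n]" by (rule run_single[OF s(1)])
   show "covers D [n] v v" by (rule covers_single[OF D_Var])
   show "conf (RA P) (last [n]) \<kappa> \<psi> v \<rho> X T" using cf by simp
   show "step_ok (RA P) n v" if "conf (RA P) n \<kappa> \<psi> v \<rho> X T" "expanded G n" "n ~: split_nodes G" "~ (X = [] & n : suc_nodes G)"
    for n \<kappa> \<psi> v \<rho> X T by (rule RA_step[OF that(1-3)])
   show "hd [n] = n" by simp
   show "last [n] ~: instance_nodes G" using s(2) by simp
  next
   fix \<pi> w \<kappa> \<psi> \<rho> X T
   assume p: "run \<pi>" "hd \<pi> = n" "covers D \<pi> v w" "1 < length \<pi>" "last \<pi> : instance_nodes G Un first_succs G" "last \<pi> ~: suc_nodes G"
    "conf (RA P) (last \<pi>) \<kappa> \<psi> w \<rho> X T"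
   have "calls PG A (atom (last \<pi>) $ emb_subst w)" using covers_calls[OF p(1,4,5,6,3)] p(2) a by simp
   hence "claim_A (atom (last \<pi>) $ emb_subst w)" by (rule IHA)
   thus False using p(5,7) unfolding claim_A_def start_def by blast
  next
   fix \<pi> w \<kappa> \<psi> \<rho> T
   assume p: "run \<pi>" "last \<pi> : suc_nodes G" "conf (RA P) (last \<pi>) \<kappa> \<psi> w \<rho> [] T"
   obtain S' where "S (last \<pi>) = Goal [] # S'" using suc_state[OF p(2)] by blast
   thus False using p(3) by (cases T) (auto simp: conf_def RA_def)
  next
   fix \<pi> w \<kappa> \<psi> \<rho> X T
   assume p: "run \<pi>" "hd \<pi> = n" "covers D \<pi> v w" "conf (RA P) (last \<pi>) \<kappa> \<psi> w \<rho> X T" "last \<pi> : split_nodes G"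
    "last \<pi> ~: instance_nodes G" "length \<pi> = 1 \<or> last \<pi> ~: first_succs G"
   let ?k = "last \<pi>"
   obtain \<mu> l Q n1 n2 where sp: "expanded G ?k" "rule_of G ?k = R_Split \<mu>" "S ?k = [Goal (l # Q)]"
    "!!x. x : Gr ?k ==> \<mu> x = Var x" "!!x. x : W ?k - Gr ?k ==> EX y:abstract - W ?k. \<mu> x = Var y" "inj_on \<mu> (W ?k)"
    "succs G ?k = [n1, n2]" "n1 ~= n2" "astate_of G n1 = ([Goal [l]], snd (astate_of G ?k))"
    "astate_of G n2 = ([Goal (Q $g \<mu>)], Gr ?k Un approx_gnd gnd (Gr ?k) l \<mu>, subst_pairs \<mu> (U ?k))"
    by (rule split_node[OF p(5)]) (rule that | assumption)+
   have nn: "n1 : set (succs G ?k)" "n2 : set (succs G ?k)" using sp(7) by simp_all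
   have lt: "n1 < length G" "n2 < length G" using succ_at[OF sp(1)] nn by blast+
   have n01: "succs G ?k ! 0 = n1" "succs G ?k ! 1 = n2" using sp(7) by simp_all
   have s1: "start n1" by (rule split_left_atom(3)[OF sp])
   have f: "n1 : first_succs G" using p(5) n01(1) unfolding first_succs_def by (force intro: image_eqI[of _ _ ?k])
   have r: "run (\<pi> @ [n1])" "covers D (\<pi> @ [n1]) v v'" if "edge_ok ?k n1 w v'" for v'
    by (rule split_covers[OF p(1,6,7) nn(1) lt(1) p(3) that], use n01 sp(8) in simp)+
   have left: "EX \<delta>:D. tree PG (atom n1 $ emb_subst v' $ emb_subst \<delta>)"
    if c: "conf (RB P) n1 \<kappa> \<psi>' v' \<rho>' [] T'" "edge_ok ?k n1 w v'" for \<psi>' v' \<rho>' T'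
   proof -
    have ne: "\<pi> ~= []" using p(1) by (simp add: run_def)
    have "calls PG (atom (hd (\<pi> @ [n1])) $ emb_subst v) (atom (last (\<pi> @ [n1])) $ emb_subst v')"
     by (rule covers_calls[OF r(1)[OF c(2)] _ _ _ r(2)[OF c(2)]]) (use ne f start_node(2)[OF s1] in simp_all)
    hence "calls PG A (atom n1 $ emb_subst v')" using ne p(2) a by simp
    hence "claim_B (atom n1 $ emb_subst v')" by (rule IHB)
    thus ?thesis using s1 c(1) unfolding claim_B_def by blast
   qed
   have cov2: "covers D (\<pi> @ [n2]) v v'" if "edge_ok ?k n2 w v'" "tree PG (atom n1 $ emb_subst (%x. \<mu> x $ v'))" for v'
    by (rule split_covers(2)[OF p(1,6,7) nn(2) lt(2) p(3) that(1)]) (use n01 that(2) split_edges(2)[OF sp] in simp)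
   have ex: "(EX \<psi>' v' \<rho>' T'. conf (RA P) n1 \<kappa> \<psi>' v' \<rho>' [] T' & edge_ok ?k n1 w v') \<or>
    (EX \<psi>' v' \<rho>' T'. conf (RA P) n2 \<kappa> \<psi>' v' \<rho>' [] T' & edge_ok ?k n2 w v' & tree PG (atom n1 $ emb_subst (%x. \<mu> x $ v')))"
    by (rule split_A[OF sp p(4)]) (assumption | rule left)+
   thus "False \<or> (EX n' \<kappa> \<psi> v' \<rho> X T. n' : set (succs G ?k) & covers D (\<pi> @ [n']) v v' & conf (RA P) n' \<kappa> \<psi> v' \<rho> X T)"
    using r(2) cov2 nn by blast
  qed
 qed
qed

theorem accessible_claims: "accessible PG A ==> claim_B A & claim_A A"
proof (induction rule: accessible_induct)
 case (step A)
 thus ?case using main_B[of A] main_A[of A] by blast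
qed

lemma root_terminates:
 assumes r0: "astate_of G 0 = ([Goal [Atom (Fun p (map Var Ts))]], ({Ts ! i | i. i : I}, {}))"
  and Ts: "set Ts <= abstract" "distinct Ts" "I <= {..<length Ts}"
  and ts: "ts : ground_args (length Ts) I" and q: "query_terminates PG (Fun (Pred 0) (map (map_trm Orig) ts))"
 shows "query_terminates P (Fun p ts)"
proof (rule ccontr)
 have len: "length ts = length Ts" and ord: "!!t. t : set ts ==> vars_trm t <= ordinary" and gr: "!!i. i : I ==> ground (ts ! i)"
  using ts by (auto simp: ground_args_def)
 assume "~ query_terminates P (Fun p ts)"
 hence "~ terminates P [Goal [Atom (Fun p ts)]]" by (simp add: query_terminates_def)
 moreover have "vars_state [Goal [Atom (Fun p ts)]] <= ordinary" using ord by auto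
 ultimately have nf: "~ fin P [Goal [Atom (Fun p ts)]]" using terminates_iff_fin by blast
 have KL: "inj KL" "range KL Int hazards = {}" unfolding KL_def hazards_def by (auto intro!: injI) presburger+
 \<comment> \<open>A goal with an infinite computation is followed with locals, so the ordinary
   variables of the query are renamed first.\<close>
 define ts' where "ts' = map (subst_trm (ren KL)) ts"
 have nf': "~ fin P [Goal [Atom (Fun p ts')]]"
 proof
  let ?g = "Goal [Atom (Fun p ts)]"
  assume "fin P [Goal [Atom (Fun p ts')]]"
  hence "fin P [?g $h (ren KL)]" by (simp add: ts'_def)
  moreover have "sim [?g] [?g $h (ren KL)]" by (rule variants_sim) (simp add: variant_ren[OF KL] del: subst_sgoal.simps)
  ultimately show False using nf fin_sim sim_sym by blast
 qed
 have loc: "vars_trm (t $ ren KL) <= locals" if "t : set ts" for t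
  using ord[OF that] ordinary_not_hazard by (auto simp: vars_trm_subst ren_def KL_def locals_def)
 define \<psi> :: "'f subst" where "\<psi> x = (case map_of (zip Ts ts') x of Some t => t | None => Var x)" for x
 have l': "length ts' = length Ts" by (simp add: ts'_def len)
 have \<psi>i: "\<psi> (Ts ! i) = ts' ! i" if "i < length Ts" for i
  using map_of_zip_nth[OF l'[symmetric] Ts(2), of i] that by (simp add: \<psi>_def l')
 have \<psi>Ts: "map \<psi> Ts = ts'" by (rule nth_equalityI) (simp_all add: l' \<psi>i)
 have \<psi>o: "\<psi> x = Var x" if "x ~: set Ts" for x using that map_of_zip_is_None[OF l'[symmetric], of x] by (simp add: \<psi>_def)
 \<comment> \<open>There is no front yet, so any final serves as the value of the hazards.\<close>
 have kap: "kappa_ok (%x. if x : hazards then Var (AVar 1) else Var x)"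
 proof -
  have "AVar 1 : finals" unfolding finals_def by (rule range_eqI[of _ _ 0]) simp
  thus ?thesis by (simp add: kappa_ok_def)
 qed
 have kb: "kb_ok 0 \<psi> \<psi> \<psi>" unfolding kb_ok_def
 proof (intro conjI ballI)
  show "apart K N \<psi> (U 0)" by (simp add: r0 apart_def)
  show "\<psi> x = Var x" if "x : ordinary" for x using \<psi>o[of x] that Ts(1) not_abstract by blast
  fix x assume "x : Gr 0"
  then obtain i where i: "x = Ts ! i" "i : I" "i < length Ts" using Ts(3) by (auto simp: r0)
  thus "ground (\<psi> x)" using \<psi>i[of i] gr[of i] by (simp add: ts'_def len ground_subst_id)
 qed simp_all
 have RA: "RA P ([Goal [Atom (Fun p (map Var Ts))]] $s \<psi>) ([Goal [Atom (Fun p (map Var Ts))]] $s \<psi>) ([Goal [Atom (Fun p (map Var Ts))]] $s \<psi>)"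
 proof -
  have "[Goal [Atom (Fun p (map Var Ts))]] $s \<psi> = [Goal [Atom (Fun p ts')]]" using \<psi>Ts by (simp add: comp_def)
  moreover have "set (sgoal_var_list (Goal [Atom (Fun p ts')])) <= locals" using loc by (auto simp: ts'_def)
  ultimately show ?thesis using nf' by (simp add: RA_def)
 qed
 have c0: "conf (RA P) 0 (%x. if x : hazards then Var (AVar 1) else Var x) \<psi> \<psi> \<psi> [] [Goal [Atom (Fun p (map Var Ts))]]"
  by (rule confI[where R = "RA P" and Y = "[]", OF root(1) _ _ kap kb front_Nil RA]) (simp_all add: assms(1))
 have s0: "start 0" by (simp add: start_def)
 have i0: "0 ~: instance_nodes G" using rwd by (simp add: renaming_well_defined_def)
 have vl: "state_var_list (S 0) = Ts"
 proof -
  have "concat (map var_list (map Var Ts :: 'f trm list)) = Ts" by (induction Ts) simp_all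
  thus ?thesis using Ts(2) by (simp add: r0 state_var_list_def comp_def distinct_remdups_id)
 qed
 have "atom 0 = Fun (Pred 0) (map Var Ts)" using Ren_other[OF start_node[OF s0] i0] atom(1)[OF start_node[OF s0]] vl by simp
 hence "atom 0 $ emb_subst \<psi> = Fun (Pred 0) (map (map_trm Orig) ts')" using \<psi>Ts[symmetric] by (simp add: comp_def)
 also have "\<dots> = Fun (Pred 0) (map (map_trm Orig) ts) $ emb_subst (ren KL)"
  by (simp add: ts'_def map_trm_subst emb_subst_def comp_def)
 finally have a0: "atom 0 $ emb_subst \<psi> = Fun (Pred 0) (map (map_trm Orig) ts) $ emb_subst (ren KL)" .
 have "vars_trm (Fun (Pred 0) (map (map_trm Orig) ts)) <= ordinary" using ord by auto
 hence "accessible PG (Fun (Pred 0) (map (map_trm Orig) ts))" by (rule accessible_query[OF PG_definite q])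
 \<comment> \<open>Accessibility is closed under instantiation and hence survives the renaming of
   the query to locals.\<close>
 hence "accessible PG (atom 0 $ emb_subst \<psi>)" unfolding a0 by (rule accessible_inst)
 thus False using accessible_claims c0 s0 unfolding claim_A_def by blast
qed

end

theorem theorem3:
  fixes P :: "'f clause list"
    and gnd :: "'f groundness"
    and G :: "'f graph"
    and PG :: "'f gsym clause list"
    and p :: 'f
    and Ts :: "var list"
    and I :: "nat set"
  assumes "\<forall>c\<in>set P. vars_clause c \<subseteq> ordinary"
    and "groundness_analysis P gnd"
    and "termination_graph P gnd G"
    and "proper G"
    and "set Ts \<subseteq> abstract" and "distinct Ts" and "I \<subseteq> {..<length Ts}"
    and "astate_of G 0 = ([Goal [Atom (Fun p (map Var Ts))]], ({Ts ! i | i. i \<in> I}, {}))"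
    and "renaming_well_defined G"
    and "set PG = P_G G"
    and "\<forall>q\<in>Q_G (length Ts) I. query_terminates PG q"
  shows "(\<forall>S\<in>concretizations (astate_of G 0). terminates P S) \<and>
         (\<forall>ts\<in>ground_args (length Ts) I. query_terminates P (Fun p ts))"
proof -
 have built: "built P gnd G" and acyc: "acyclic {(n, n'). n : instance_nodes G & n' : set (succs G n)}"
  using assms(3) by (simp_all add: termination_graph_def)
 obtain W M where st: "structured P gnd G W M" using built_structured[OF built] by blast
 have s0: "sane P (astate_of G 0)" using assms(5,7) nth_mem by (fastforce simp: assms(8) sane_def kb_vars_def)
 have sane: "sane P (astate_of G n)" if "n < length G" for n by (rule built_sane[OF built s0 that])
 have len0: "0 < length G" using built by (induction rule: built.induct) auto
 have leaves: "fst (astate_of G n) = []" if "n < length G" "rule_of G n = Open" for n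
 proof -
  have "n : leaf_nodes G" using structured_Open[OF st that] that(1) by (simp add: leaf_nodes_def)
  thus ?thesis using assms(3,4) unfolding termination_graph_def proper_def by blast
 qed
 \<comment> \<open>Any common bound on the arities in the heads is suitable; the sum is one.\<close>
 define K where "K = sum_list (map (%c. max_arity (head c)) P)"
 have K: "max_arity (head c) <= K" if "c : set P" for c unfolding K_def by (rule member_le_sum_list) (use that in auto)
 have fin: "finite (\<Union>n<length G. kb_vars (snd (snd (astate_of G n))) Int ordinary)"
  by (rule finite_UN_I) (use sane in \<open>simp_all add: sane_def\<close>)
 obtain N' where N': "set N' = (\<Union>n<length G. kb_vars (snd (snd (astate_of G n))) Int ordinary)" by (rule exE[OF finite_list[OF fin]]) (rule that)
 have graph: "graph P gnd G W M PG"
 proof (rule graph.intro)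
  show "vars_clause c <= ordinary" if "c : set P" for c using assms(1) that by (rule bspec)
  show "EX t. fst (astate_of G 0) = [Goal [Atom t]]" unfolding assms(8) fst_conv by (intro exI) (rule refl)
 qed (rule assms(2,9,10) st acyc len0 | rule sane leaves, assumption+)+
 \<comment> \<open>\<open>NVar 0\<close> ensures that the list has a head, which the values of
   hazards are padded with.\<close>
 have bounded: "bounded_graph P gnd G W M PG K (NVar 0 # N')"
 proof (rule bounded_graph.intro[OF graph], rule bounded_graph_axioms.intro)
  show "max_arity (head c) <= K" if "c : set P" for c using that by (rule K)
  show "NVar 0 # N' ~= []" by simp
  show "set (NVar 0 # N') <= ordinary" unfolding list.set N' by (auto simp: ordinary_def)
  show "kb_vars (snd (snd (astate_of G n))) Int ordinary <= set (NVar 0 # N')" if "n < length G" for n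
   unfolding list.set N' using that by blast
 qed
 have query: "query_terminates P (Fun p ts)" if "ts : ground_args (length Ts) I" for ts
 proof (rule bounded_graph.root_terminates[OF bounded assms(8,5,6,7) that])
  show "query_terminates PG (Fun (Pred 0) (map (map_trm Orig) ts))" using assms(11) that unfolding Q_G_def by blast
 qed
 have "terminates P S'" if conc: "S' : concretizations (astate_of G 0)" for S'
 proof -
  obtain \<gamma> where g: "S' = fst (astate_of G 0) $s \<gamma>" "concretization \<gamma> (astate_of G 0)"
   using conc by (auto simp: concretizations_def)
  have dom: "subst_dom \<gamma> = abstract" "range_vars \<gamma> <= ordinary" "range_vars (restrict_subst \<gamma> {Ts ! i | i. i : I}) = {}"
   using g(2) by (simp_all add: assms(8))
  \<comment> \<open>The domain of a concretization is exactly the set of abstract variables, so each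
    argument is really replaced and its value belongs to the range.\<close>
  have ne: "\<gamma> x ~= Var x" if "x : set Ts" for x using that assms(5) dom(1) by (auto simp: subst_dom_def)
  have "map \<gamma> Ts : ground_args (length Ts) I" unfolding ground_args_def
  proof (intro CollectI conjI ballI)
   show "vars_trm t <= ordinary" if t: "t : set (map \<gamma> Ts)" for t

   proof -
    obtain x where x: "x : set Ts" "t = \<gamma> x" using t by auto
    show ?thesis using mem_range_vars[of _ \<gamma> x, OF _ ne[OF x(1)]] dom(2) unfolding x(2) by blast
   qed
   fix i assume i: "i : I"
   hence iT: "i < length Ts" using assms(7) by blast
   let ?r = "restrict_subst \<gamma> {Ts ! i | i. i : I}"
   have "?r (Ts ! i) = \<gamma> (Ts ! i)" using i by (auto simp: restrict_subst_def)
   moreover have "\<gamma> (Ts ! i) ~= Var (Ts ! i)" using ne nth_mem[OF iT] by blast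
   ultimately have "vars_trm (\<gamma> (Ts ! i)) = {}" using mem_range_vars[of _ ?r "Ts ! i"] dom(3) by auto
   thus "ground (map \<gamma> Ts ! i)" using iT by (simp add: ground_def)
  qed simp
  hence "query_terminates P (Fun p (map \<gamma> Ts))" by (rule query)
  moreover have "S' = [Goal [Atom (Fun p (map \<gamma> Ts))]]" by (simp add: g(1) assms(8) comp_def)
  ultimately show ?thesis by (simp add: query_terminates_def)
 qed
 thus ?thesis using query by blast
qed

end
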